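(* Let $d\ge 6$. Suppose $X_1,\dots,X_n$ are i.i.d. from $\mathbb P$, where $\mathbb P$ is the uniform distribution on the unit sphere $\mathbb S^{d-1}\subset\mathbb R^d$, or any distribution with a density $g$ on the sphere such that $g(x)\ge c_1$ for all $x\in\mathbb S^{d-1}$, where $c_1>0$ is a constant. There exist positive constants $C_d,\gamma_d$ depending only on $d$ such that, for $n\ge 2$, the least squares estimator $\hat K_n$ (computed over all compact convex subsets of $\mathbb R^d$) satisfies $$\sup_{K^*\in\mathcal C(1)}\mathbb E_{K^*}\|h_{\hat K_n}-h_{K^*}\|_{\mathbb P}^2\ \ge\ C_d\,n^{-2/(d-1)}\log(n)^{-\gamma_d},$$ where $\mathcal C(1)$ is the set of all compact convex sets contained in the unit Euclidean ball of $\mathbb R^d$.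
   Context: For a compact convex set $K\subset\mathbb R^d$, its support function is $h_K:\mathbb S^{d-1}\to\mathbb R$, $h_K(u)=\max_{x\in K}\langle x,u\rangle$. One observes $(X_i,Y_i)$, $i=1,\dots,n$, with $Y_i=h_{K^*}(X_i)+\xi_i$, where $\xi_1,\dots,\xi_n$ are i.i.d. $N(0,1)$ and $K^*$ is an unknown compact convex set. Let $\mathcal C$ be the class of all compact convex sets in $\mathbb R^d$. The least squares estimator is $\hat K_n\in\operatorname{argmin}_{K\in\mathcal C}\sum_{i=1}^n(Y_i-h_K(X_i))^2$; it is not restricted to $\mathcal C(1)$. $\|g\|_{\mathbb P}^2=\int g^2\,d\mathbb P$, and $\mathbb E_{K^*}$ is expectation when the true set is $K^*$. The constant $c_1$ is an absolute constant, not depending on $d$. *)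

theory Defs
  imports "HOL-Probability.Probability"
begin

section \<open>Convex bodies and support functions\<close>

text \<open>The empty set is excluded: its support function, a maximum over the set, is undefined.\<close>

definition convex_bodies :: "'a::euclidean_space set set" where
  "convex_bodies = {K. K \<noteq> {} \<and> compact K \<and> convex K}"

definition unit_convex_bodies :: "'a::euclidean_space set set" where
  "unit_convex_bodies = {K \<in> convex_bodies. K \<subseteq> cball 0 1}"

text \<open>On \<^const>\<open>convex_bodies\<close> the supremum is a maximum, see \<open>support_fun_max\<close> below.\<close>

definition support_fun :: "'a::euclidean_space set \<Rightarrow> 'a \<Rightarrow> real" where
  "support_fun K u = (SUP x\<in>K. x \<bullet> u)"

lemma support_fun_max:
  assumes "K \<in> convex_bodies"
  shows "\<exists>x\<in>K. support_fun K u = x \<bullet> u \<and> (\<forall>y\<in>K. y \<bullet> u \<le> x \<bullet> u)"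
proof -
  have "continuous_on K (\<lambda>x. x \<bullet> u)" by (intro continuous_intros)
  then obtain x where x: "x \<in> K" "\<forall>y\<in>K. y \<bullet> u \<le> x \<bullet> u"
    using continuous_attains_sup[of K "\<lambda>x. x \<bullet> u"] assms by (auto simp: convex_bodies_def)
  then have "support_fun K u = x \<bullet> u"
    unfolding support_fun_def by (intro cSup_eq_maximum) auto
  with x show ?thesis by blast
qed


section \<open>Distributions on the sphere\<close>

text \<open>
  The law of \<open>U / norm U\<close> for \<open>U\<close> uniform on the unit ball, as a Borel measure on the ambient
  space. The lemmas below show that it is a probability measure, concentrated on the sphere and
  invariant under orthogonal transformations; there is only one such measure.
\<close>

definition sphere_uniform :: "'a::euclidean_space measure" where
  "sphere_uniform = distr (uniform_measure lborel (ball 0 1)) borel sgn"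

lemma emeasure_unit_ball:
  "emeasure lborel (ball (0::'a::euclidean_space) 1) \<noteq> 0"
  "emeasure lborel (ball (0::'a::euclidean_space) 1) \<noteq> \<infinity>"
proof -
  have "measure lborel (ball (0::'a) 1) > 0" by (rule content_ball_pos) simp
  then show "emeasure lborel (ball (0::'a) 1) \<noteq> 0" by (auto simp: measure_def)
  show "emeasure lborel (ball (0::'a) 1) \<noteq> \<infinity>"
    using emeasure_lborel_ball_finite[of "0::'a" 1] by auto
qed

lemma prob_space_sphere_uniform: "prob_space (sphere_uniform :: 'a::euclidean_space measure)"
  unfolding sphere_uniform_def
  by (intro prob_space.prob_space_distr prob_space_uniform_measure emeasure_unit_ball) simp

lemma AE_sphere_uniform: "AE x in (sphere_uniform :: 'a::euclidean_space measure). x \<in> sphere 0 1"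
proof -
  have "AE x in lborel. x \<in> ball 0 1 \<longrightarrow> sgn x \<in> sphere (0::'a) 1"
    using AE_lborel_singleton[of "0::'a"] by eventually_elim (auto simp: norm_sgn)
  then have "AE x in uniform_measure lborel (ball 0 1). sgn x \<in> sphere (0::'a) 1"
    by (intro AE_uniform_measureI) auto
  then show ?thesis
    unfolding sphere_uniform_def by (subst AE_distr_iff) auto
qed

lemma distr_lborel_orthogonal:
  fixes f :: "'a::euclidean_space \<Rightarrow> 'a"
  assumes f: "orthogonal_transformation f"
  shows "distr lborel borel f = (lborel :: 'a measure)"
proof -
  let ?L = "lborel :: 'a measure"
  have lin: "linear f" using f by (rule orthogonal_transformation_linear)
  have f_meas [measurable]: "f \<in> borel_measurable borel"
    using lin by (intro borel_measurable_continuous_onI linear_continuous_on)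
      (simp add: linear_conv_bounded_linear)
  define M where "M = distr ?L borel f"
  have sM [simp, measurable_cong]: "sets M = sets borel" by (simp add: M_def)
  define B where "B = ball (0::'a) 1"
  have B_meas [measurable]: "B \<in> sets borel" by (simp add: B_def)
  have norm_f: "norm (f x) = norm x" for x
    using f by (simp add: orthogonal_transformation_norm)
  have surj: "\<exists>y. f y = x" for x
    using orthogonal_transformation_surj[OF f] by (metis surjD)
  have trans: "(\<integral>\<^sup>+x. h (c + x) \<partial>?L) = (\<integral>\<^sup>+x. h x \<partial>?L)"
    if [measurable]: "h \<in> borel_measurable borel" for h :: "'a \<Rightarrow> ennreal" and c
    using that by (subst (2) lborel_distr_plus[of c, symmetric]) (simp add: nn_integral_distr)
  have Mint: "(\<integral>\<^sup>+x. h x \<partial>M) = (\<integral>\<^sup>+x. h (f x) \<partial>?L)"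
    if "h \<in> borel_measurable borel" for h :: "'a \<Rightarrow> ennreal"
    using that by (simp add: M_def nn_integral_distr)
  have Mtrans: "(\<integral>\<^sup>+x. h (c + x) \<partial>M) = (\<integral>\<^sup>+x. h x \<partial>M)"
    if [measurable]: "h \<in> borel_measurable borel" for h :: "'a \<Rightarrow> ennreal" and c
  proof -
    obtain b where b: "f b = c" using surj by blast
    have "(\<integral>\<^sup>+x. h (c + x) \<partial>M) = (\<integral>\<^sup>+x. h (f (b + x)) \<partial>?L)"
      by (subst Mint) (simp_all add: linear_add[OF lin] b)
    also have "\<dots> = (\<integral>\<^sup>+x. h (f x) \<partial>?L)" by (rule trans) simp
    finally show ?thesis by (simp add: Mint)
  qed
  have MB: "emeasure M B = emeasure ?L B"
  proof -
    have "f -` B \<inter> space ?L = B" by (auto simp: B_def norm_f)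
    then show ?thesis by (simp add: M_def emeasure_distr)
  qed
  have "sigma_finite_measure M"
  proof (rule sigma_finite_measure.intro, rule exI[of _ "range (\<lambda>n::nat. ball (0::'a) n)"], intro conjI)
    show "countable (range (\<lambda>n::nat. ball (0::'a) n))" by simp
    show "range (\<lambda>n::nat. ball (0::'a) n) \<subseteq> sets M" by auto
    show "\<Union> (range (\<lambda>n::nat. ball (0::'a) n)) = space M"
      by (auto simp: M_def reals_Archimedean2)
    show "\<forall>a\<in>range (\<lambda>n::nat. ball (0::'a) n). emeasure M a \<noteq> \<infinity>"
    proof safe
      fix n :: nat
      assume "emeasure M (ball 0 (real n)) = \<infinity>"
      moreover have "f -` ball 0 (real n) \<inter> space ?L = ball 0 (real n)" by (auto simp: norm_f)
      ultimately show False
        using emeasure_lborel_ball_finite[of "0::'a" "real n"] by (simp add: M_def emeasure_distr)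
    qed
  qed
  then interpret M: sigma_finite_measure M .
  interpret P: pair_sigma_finite M ?L ..
  have eq: "emeasure M A = emeasure ?L A" if A [measurable]: "A \<in> sets borel" for A
  proof -
    have "emeasure M A * emeasure ?L B
        = (\<integral>\<^sup>+y. indicator B y * (\<integral>\<^sup>+x. indicator A x \<partial>M) \<partial>?L)"
      by (simp add: nn_integral_multc mult.commute)
    also have "\<dots> = (\<integral>\<^sup>+y. indicator B y * (\<integral>\<^sup>+x. indicator A (y + x) \<partial>M) \<partial>?L)"
      by (subst Mtrans) simp_all
    also have "\<dots> = (\<integral>\<^sup>+y. (\<integral>\<^sup>+x. indicator B y * indicator A (y + x) \<partial>M) \<partial>?L)"
      by (simp add: nn_integral_cmult)
    also have "\<dots> = (\<integral>\<^sup>+x. (\<integral>\<^sup>+y. indicator B y * indicator A (y + x) \<partial>?L) \<partial>M)"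
      by (rule P.Fubini') measurable
    also have "\<dots> = (\<integral>\<^sup>+x. (\<integral>\<^sup>+y. indicator B (y - x) * indicator A y \<partial>?L) \<partial>M)"
    proof (rule nn_integral_cong)
      fix x
      show "(\<integral>\<^sup>+y. indicator B y * indicator A (y + x) \<partial>?L)
          = (\<integral>\<^sup>+y. indicator B (y - x) * indicator A y \<partial>?L)"
        using trans[of "\<lambda>y. indicator B (y - x) * indicator A y" x] by (simp add: add.commute)
    qed
    also have "\<dots> = (\<integral>\<^sup>+y. (\<integral>\<^sup>+x. indicator B (y - x) * indicator A y \<partial>M) \<partial>?L)"
      by (rule P.Fubini'[where f = "\<lambda>x y. indicator B (y - x) * indicator A y", symmetric]) measurable
    also have "\<dots> = (\<integral>\<^sup>+y. (\<integral>\<^sup>+x. indicator B (- y + x) \<partial>M) * indicator A y \<partial>?L)"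
    proof (rule nn_integral_cong)
      fix y
      have "(indicator B (y - x) :: ennreal) = indicator B (- y + x)" for x
        by (auto simp: indicator_def B_def norm_minus_commute)
      then show "(\<integral>\<^sup>+x. indicator B (y - x) * indicator A y \<partial>M)
          = (\<integral>\<^sup>+x. indicator B (- y + x) \<partial>M) * indicator A y"
        by (simp add: nn_integral_multc)
    qed
    also have "\<dots> = (\<integral>\<^sup>+y. emeasure M B * indicator A y \<partial>?L)"
      by (subst Mtrans) simp_all
    also have "\<dots> = emeasure ?L A * emeasure ?L B"
      unfolding MB by (subst nn_integral_cmult) (simp_all add: mult.commute)
    finally show ?thesis
      using emeasure_unit_ball[where 'a='a] by (auto simp: B_def mult.commute[where b = "emeasure lborel (ball (0::'a) 1)"] ennreal_mult_cancel_left)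
  qed
  show ?thesis
    unfolding M_def[symmetric] by (rule measure_eqI) (simp_all add: eq)
qed

lemma sphere_uniform_orthogonal:
  fixes f :: "'a::euclidean_space \<Rightarrow> 'a"
  assumes f: "orthogonal_transformation f"
  shows "distr sphere_uniform borel f = sphere_uniform"
proof -
  have lin: "linear f" using f by (rule orthogonal_transformation_linear)
  have f_meas [measurable]: "f \<in> borel_measurable borel"
    using lin by (intro borel_measurable_continuous_onI linear_continuous_on)
      (simp add: linear_conv_bounded_linear)
  have norm_f: "norm (f x) = norm x" for x
    using f by (simp add: orthogonal_transformation_norm)
  have sgn_f: "f (sgn x) = sgn (f x)" for x
    by (simp add: sgn_div_norm linear_scale[OF lin] norm_f)
  have U: "distr (uniform_measure lborel (ball 0 1)) borel f = uniform_measure lborel (ball (0::'a) 1)"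
  proof (rule measure_eqI)
    fix A assume "A \<in> sets (distr (uniform_measure lborel (ball 0 1)) borel f)"
    then have A [measurable]: "A \<in> sets borel" by simp
    have fA [measurable]: "f -` A \<in> sets borel"
      using measurable_sets[OF f_meas A] by simp
    have "ball 0 1 \<inter> f -` A = f -` (ball 0 1 \<inter> A) \<inter> space lborel" by (auto simp: norm_f)
    then have "emeasure lborel (ball 0 1 \<inter> f -` A) = emeasure (distr lborel borel f) (ball 0 1 \<inter> A)"
      by (simp add: emeasure_distr)
    then have "emeasure lborel (ball 0 1 \<inter> f -` A) = emeasure lborel (ball 0 1 \<inter> A)"
      by (simp add: distr_lborel_orthogonal[OF f])
    then show "emeasure (distr (uniform_measure lborel (ball 0 1)) borel f) A
        = emeasure (uniform_measure lborel (ball 0 1)) A"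
      by (simp add: emeasure_distr)
  qed simp
  have "distr sphere_uniform borel f
      = distr (distr (uniform_measure lborel (ball (0::'a) 1)) borel f) borel sgn"
    unfolding sphere_uniform_def by (simp add: distr_distr comp_def sgn_f)
  then show ?thesis
    by (simp add: U sphere_uniform_def)
qed

text \<open>Densities are taken with respect to the normalised surface measure.\<close>

definition admissible_design :: "real \<Rightarrow> 'a::euclidean_space measure \<Rightarrow> bool" where
  "admissible_design c P \<longleftrightarrow> P = sphere_uniform \<or>
     (\<exists>g. g \<in> borel_measurable borel \<and> (\<forall>x\<in>sphere 0 1. c \<le> g x) \<and>
          P = density sphere_uniform (\<lambda>x. ennreal (g x)) \<and> prob_space P)"


section \<open>Regression model, least squares estimators and risk\<close>

text \<open>
  Law of one observation \<open>(X, Y)\<close> with \<open>Y = support_fun K X + \<xi>\<close>, where \<open>X\<close> has law \<open>P\<close> and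
  \<open>\<xi>\<close> is standard normal and independent of \<open>X\<close>.
\<close>

definition observation_law :: "'a::euclidean_space measure \<Rightarrow> 'a set \<Rightarrow> ('a \<times> real) measure" where
  "observation_law P K =
     distr (P \<Otimes>\<^sub>M density lborel std_normal_density) (borel \<Otimes>\<^sub>M borel)
       (\<lambda>(x, \<xi>). (x, support_fun K x + \<xi>))"

definition sample_law :: "'a::euclidean_space measure \<Rightarrow> nat \<Rightarrow> 'a set \<Rightarrow> (nat \<Rightarrow> 'a \<times> real) measure" where
  "sample_law P n K = (\<Pi>\<^sub>M i\<in>{..<n}. observation_law P K)"

text \<open>
  An estimator maps data \<open>\<omega>\<close>, with \<open>\<omega> i = (X\<^sub>i, Y\<^sub>i)\<close>, to a set. As the minimiser is not
  unique, an arbitrary selection is allowed, subject to measurability of the random convex body.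
\<close>

definition least_squares_estimator ::
    "nat \<Rightarrow> ((nat \<Rightarrow> 'a::euclidean_space \<times> real) \<Rightarrow> 'a set) \<Rightarrow> bool" where
  "least_squares_estimator n Khat \<longleftrightarrow>
     (\<forall>\<omega> \<in> {..<n} \<rightarrow>\<^sub>E sphere 0 1 \<times> UNIV.
        is_arg_min (\<lambda>K. \<Sum>i<n. (snd (\<omega> i) - support_fun K (fst (\<omega> i)))\<^sup>2)
          (\<lambda>K. K \<in> convex_bodies) (Khat \<omega>)) \<and>
     (\<forall>u \<in> sphere 0 1.
        (\<lambda>\<omega>. support_fun (Khat \<omega>) u) \<in> borel_measurable (\<Pi>\<^sub>M i\<in>{..<n}. borel \<Otimes>\<^sub>M borel))"

lemma support_fun_measurable:
  fixes K :: "'a::euclidean_space set"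
  assumes "K \<in> convex_bodies"
  shows "support_fun K \<in> borel_measurable borel"
proof -
  obtain B where B: "norm x \<le> B" if "x \<in> K" for x
    using assms compact_imp_bounded[of K] unfolding bounded_iff convex_bodies_def by auto
  have le: "support_fun K u \<le> support_fun K v + B * norm (u - v)" for u v
  proof -
    obtain x where x: "x \<in> K" "support_fun K u = x \<bullet> u" using support_fun_max[OF assms] by blast
    have "x \<bullet> v \<le> support_fun K v" using support_fun_max[OF assms, of v] x(1) by auto
    moreover have "x \<bullet> (u - v) \<le> B * norm (u - v)"
      by (meson B x(1) norm_cauchy_schwarz mult_right_mono norm_ge_zero order_trans)
    ultimately show ?thesis by (simp add: x inner_diff_right)
  qed
  have "B \<ge> 0"
    using B support_fun_max[OF assms, of 0] order_trans[OF norm_ge_zero] by blast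
  moreover have "dist (support_fun K u) (support_fun K v) \<le> B * dist u v" for u v
    using le[of u v] le[of v u] by (simp add: dist_norm norm_minus_commute abs_le_iff)
  ultimately have "B-lipschitz_on UNIV (support_fun K)" by (intro lipschitz_onI) auto
  then show ?thesis
    by (intro borel_measurable_continuous_onI lipschitz_on_continuous_on)
qed

lemma prob_space_sample_law:
  assumes "prob_space P" "sets P = sets borel" "K \<in> convex_bodies"
  shows "prob_space (sample_law P n K)"
proof -
  note [measurable_cong] = assms(2)
  note [measurable] = support_fun_measurable[OF assms(3)]
  interpret P: prob_space P by fact
  interpret N: prob_space "density lborel std_normal_density" by (rule prob_space_normal_density) simp
  interpret PN: pair_prob_space P "density lborel std_normal_density" ..
  have "prob_space (observation_law P K)"
    unfolding observation_law_def by (rule PN.prob_space_distr) measurable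
  then show ?thesis
    unfolding sample_law_def by (intro prob_space_PiM)
qed

definition L2_norm_sq :: "'a measure \<Rightarrow> ('a \<Rightarrow> real) \<Rightarrow> real" where
  "L2_norm_sq P g = (\<integral>u. (g u)\<^sup>2 \<partial>P)"

text \<open>The expected loss may be infinite, hence it is a nonnegative extended real.\<close>

definition risk ::
    "'a::euclidean_space measure \<Rightarrow> nat \<Rightarrow> ((nat \<Rightarrow> 'a \<times> real) \<Rightarrow> 'a set) \<Rightarrow> 'a set \<Rightarrow> ennreal" where
  "risk P n Khat K =
     (\<integral>\<^sup>+\<omega>. ennreal (L2_norm_sq P (\<lambda>u. support_fun (Khat \<omega>) u - support_fun K u))
        \<partial>sample_law P n K)"

end

theory Submission
  imports Defs "HOL-Real_Asymp.Real_Asymp"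
begin

text \<open>
  Write \<open>m\<close> for the dimension of the sphere and let \<open>n\<close> be of the order of \<open>2 ^ (k * m)\<close>. The true body
  \<open>K\<close> is a polytope between the unit ball and the ball of radius \<open>1 - 2 / 4 ^ J\<close>, where \<open>J\<close> is close
  to \<open>k / 2\<close>. It has far fewer than \<open>n\<close> facets, yet it is so close to the ball that the competitor
  obtained from the ball by adding a spike over each of about \<open>2 ^ (k * m)\<close> disjoint caps where the
  noise is favourable improves the least squares criterion by a multiple of \<open>n / 4 ^ k\<close>.

  On the other hand the support function of \<open>K\<close> is linear on dyadic boxes that are only
  polylogarithmically smaller than \<open>2 ^ (- J)\<close>, up to a layer of small probability. There
  \<open>support_fun G - support_fun K\<close> is convex, its supremum is controlled by its
  \<open>L\<^sup>2\<close> norm, and Bronshtein's entropy bound with chaining controls its correlation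
  with the noise. For \<open>m \<ge> 5\<close> this makes the correlation negligible against \<open>n / 4 ^ k\<close>
  if \<open>G\<close> is within squared distance \<open>4 ^ (- k)\<close> of \<open>K\<close>, up to logarithms. So the minimiser
  is not that close.
\<close>

section \<open>Support functions and their energy\<close>

text \<open>The gain of the competitor is of order n / 4^k. Its own squared distance from K costs
  about n / 16^J, which forces 2 J to be k plus a constant; K then has about 2^(J m), roughly sqrt
  n, linear pieces. On a box of side l the convex functions have size l^2, and their noise sum over
  N points is of order l^2 N^(1 - 2 / m), since for m > 4 the entropy 2^(s m) at accuracy 4^(-s)
  makes the finest chaining level dominate. Summation over the l^(-m) boxes of this side brings in
  l^(-2), so every scale contributes n^(1 - 2 / m) = n / 4^k, exactly the order of the gain. Powers
  of n alone thus decide nothing and the comparison is won by logarithmic factors: few boxes carry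
  much energy, the layer where K is not linear has small mass, and elsewhere the difference is
  smaller still. The noise bound loses k^2, each of these savings is made at least k^3, and this
  sets all exponents. Two obstacles shape the details: the estimator has no a priori bound, so its
  size is read off from its energy; and P has no upper density bound, so the layer and the usable
  spikes are found by averaging.\<close>

lemma support_fun_ge:
  assumes "K \<in> convex_bodies" "p \<in> K"
  shows "p \<bullet> y \<le> support_fun K y"
  using support_fun_max[OF assms(1), of y] assms(2) by auto

lemma support_fun_touch:
  assumes "K \<in> convex_bodies"
  shows "\<exists>p\<in>K. support_fun K x = p \<bullet> x \<and> (\<forall>y. p \<bullet> y \<le> support_fun K y)"
  using support_fun_max[OF assms, of x] support_fun_ge[OF assms] by blast

lemma support_fun_scale:
  assumes "K \<in> convex_bodies" "0 \<le> c"
  shows "support_fun K (c *\<^sub>R x) = c * support_fun K x"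
proof -
  obtain p where p: "p \<in> K" "support_fun K x = p \<bullet> x" "\<forall>y\<in>K. y \<bullet> x \<le> p \<bullet> x"
    using support_fun_max[OF assms(1)] by blast
  have "support_fun K (c *\<^sub>R x) = p \<bullet> (c *\<^sub>R x)"
    unfolding support_fun_def using p(1,3) assms(2)
    by (intro cSup_eq_maximum) (auto intro: mult_left_mono)
  with p show ?thesis by simp
qed

lemma convex_hull_convex_bodies:
  "compact S \<Longrightarrow> S \<noteq> {} \<Longrightarrow> convex hull S \<in> convex_bodies"
  by (simp add: convex_bodies_def compact_convex_hull)

lemma support_fun_convex_hull:
  assumes "s \<in> S" "s \<bullet> u = a" "\<And>s. s \<in> S \<Longrightarrow> s \<bullet> u \<le> a"
  shows "support_fun (convex hull S) u = a"
proof -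
  have "convex hull S \<subseteq> {x. u \<bullet> x \<le> a}"
    using assms(3) by (intro hull_minimal convex_halfspace_le) (auto simp: inner_commute)
  then show ?thesis
    unfolding support_fun_def using assms(1,2)
    by (intro cSup_eq_maximum) (auto simp: inner_commute intro!: rev_image_eqI[of s] hull_inc)
qed

lemma measure_lborel_reflect:
  fixes a :: "'a::euclidean_space"
  assumes [measurable]: "A \<in> sets borel"
  shows "measure lborel ((\<lambda>x. a - x) -` A) = measure lborel A"
proof -
  have o: "orthogonal_transformation (uminus :: 'a \<Rightarrow> 'a)"
    by (simp add: orthogonal_transformation_def linear_uminus)
  have "distr lborel borel (\<lambda>x. a - x) = distr (distr lborel borel uminus) borel ((+) a)"
    by (subst distr_distr) (auto simp: comp_def)
  also have "\<dots> = (lborel :: 'a measure)"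
    by (simp add: distr_lborel_orthogonal[OF o] lborel_distr_plus)
  finally have "measure (distr lborel borel (\<lambda>x. a - x)) A = measure lborel A" by simp
  then show ?thesis by (subst (asm) measure_distr) auto
qed

text \<open>Reflection in the centre swaps the half balls of \<open>q\<close> and
  \<open>- q\<close>, which together cover the ball. A convex function with subgradient
  \<open>q\<close> at \<open>x\<close> is at least its value at \<open>x\<close> on this half ball,
  so a large value at a point spreads to a set of comparable volume.\<close>

lemma half_ball_measure:
  fixes x q :: "'a::euclidean_space"
  shows "measure lborel (ball x r) \<le> 2 * measure lborel (ball x r \<inter> {y. 0 \<le> q \<bullet> (y - x)})"
proof -
  let ?H = "ball x r \<inter> {y. 0 \<le> q \<bullet> (y - x)}"
  have Hm [measurable]: "?H \<in> sets borel" by measurable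
  let ?R = "(\<lambda>y. 2 *\<^sub>R x - y) -` ?H"
  have Rf: "(\<lambda>y. 2 *\<^sub>R x - y) \<in> borel_measurable borel" by measurable
  have Rm: "?R \<in> sets borel" using measurable_sets[OF Rf Hm] by simp
  have fb: "emeasure lborel (ball x r) < \<infinity>"
    using emeasure_lborel_ball_finite by auto
  have RB: "?R \<subseteq> ball x r" by (auto simp: dist_norm algebra_simps scaleR_2 norm_minus_commute[of x])
  have "ball x r \<subseteq> ?H \<union> ?R"
  proof
    fix y assume y: "y \<in> ball x r"
    have e: "2 *\<^sub>R x - y - x = x - y" "x - (2 *\<^sub>R x - y) = y - x" by (simp_all add: scaleR_2)
    have "q \<bullet> (x - y) = - (q \<bullet> (y - x))" by (simp add: inner_diff_right)
    moreover have "norm (y - x) < r" using y by (simp add: dist_norm norm_minus_commute)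
    ultimately show "y \<in> ?H \<union> ?R" using y by (auto simp: e dist_norm)
  qed
  then have "ball x r = ?H \<union> ?R" using RB by auto
  then have "measure lborel (ball x r) = measure lborel (?H \<union> ?R)" by simp
  also have "\<dots> \<le> measure lborel ?H + measure lborel ?R"
    using Hm Rm by (intro measure_Un_le) auto
  also have "measure lborel ?R = measure lborel ?H"
    by (rule measure_lborel_reflect) simp
  finally show ?thesis by simp
qed

text \<open>The energy is collected on the unit ball, where it is dominated by the squared norm on the sphere.\<close>

definition energy :: "('a::euclidean_space \<Rightarrow> real) \<Rightarrow> 'a measure" where
  "energy f = density lborel (\<lambda>x. ennreal ((f x)\<^sup>2 * indicator (ball 0 1) x))"

lemma sets_energy [simp, measurable_cong]: "sets (energy f) = sets borel"
  by (simp add: energy_def)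

lemma space_energy [simp]: "space (energy f) = UNIV"
  by (simp add: energy_def)

text \<open>Chebyshev's inequality, in the form that converts pointwise lower bounds into
  energy.\<close>

lemma energy_ge:
  fixes f :: "'a::euclidean_space \<Rightarrow> real"
  assumes fin: "finite_measure (energy f)" and [measurable]: "f \<in> borel_measurable borel"
    and A [measurable]: "A \<in> sets borel" and AB: "A \<subseteq> ball 0 1"
    and s: "0 \<le> s" "\<And>x. x \<in> A \<Longrightarrow> s \<le> \<bar>f x\<bar>"
  shows "s\<^sup>2 * measure lborel A \<le> measure (energy f) A"
proof -
  interpret finite_measure "energy f" by fact
  have [measurable]: "ball (0::'a) 1 \<in> sets borel" by simp
  have fA: "emeasure lborel A \<noteq> \<infinity>"
    using emeasure_mono[OF AB, of lborel] emeasure_lborel_ball_finite[of "0::'a" 1] by auto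
  have "ennreal (s\<^sup>2 * measure lborel A) = ennreal (s\<^sup>2) * emeasure lborel A"
    using fA by (simp add: ennreal_mult emeasure_eq_ennreal_measure)
  also have "\<dots> = (\<integral>\<^sup>+x. ennreal (s\<^sup>2) * indicator A x \<partial>lborel)"
    by (simp add: nn_integral_cmult)
  also have "\<dots> \<le> (\<integral>\<^sup>+x. ennreal ((f x)\<^sup>2 * indicator (ball 0 1) x) * indicator A x \<partial>lborel)"
  proof (rule nn_integral_mono)
    fix x
    show "ennreal (s\<^sup>2) * indicator A x \<le> ennreal ((f x)\<^sup>2 * indicator (ball 0 1) x) * indicator A x"
    proof (cases "x \<in> A")
      case True
      then have "s\<^sup>2 \<le> (f x)\<^sup>2"
        using s power_mono[of s "\<bar>f x\<bar>" 2] by auto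
      with True AB show ?thesis by (auto simp: indicator_def intro!: ennreal_leI)
    qed auto
  qed
  also have "\<dots> = emeasure (energy f) A"
    unfolding energy_def by (subst emeasure_density) simp_all
  finally show ?thesis by (simp add: emeasure_eq_measure)
qed

lemma measure_lborel_ball_mult:
  fixes x :: "'a::euclidean_space"
  assumes "0 \<le> r"
  shows "measure lborel (ball x r) = unit_ball_vol (real DIM('a)) * r ^ DIM('a)"
  using content_ball[of r x] assms by (simp add: measure_completion)

text \<open>The premise \<open>touch\<close> is convexity of \<open>u\<close>, stated through
  supporting affine functions. A large positive value spreads to a half ball by
  \<open>half_ball_measure\<close>. A very negative value at the centre spreads to the points near
  it, because \<open>u\<close> is already bounded above at their mirror images. In both cases the
  energy of \<open>f\<close> would be too large.\<close>

lemma touching_ball_bound: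
  fixes u f :: "'a::euclidean_space \<Rightarrow> real"
  assumes fin: "finite_measure (energy f)" and fm: "f \<in> borel_measurable borel"
    and touch: "\<And>x. \<exists>q. \<forall>y. u x + q \<bullet> (y - x) \<le> u y"
    and r: "0 < r" and B: "ball x0 (2 * r) \<subseteq> ball 0 1" and tau: "0 \<le> \<tau>"
    and sandwich: "\<And>x. x \<in> ball x0 (2 * r) \<Longrightarrow> f x \<le> u x" "\<And>x. x \<in> ball x0 (2 * r) \<Longrightarrow> u x - \<tau> \<le> f x"
  shows "\<bar>u x0\<bar> \<le> \<tau> + 4 * 2 ^ DIM('a) *
    sqrt (measure (energy f) (ball x0 (2 * r)) / (unit_ball_vol (real DIM('a)) * r ^ DIM('a)))"
proof -
  interpret finite_measure "energy f" by fact
  let ?D = "DIM('a)"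
  define v where "v = unit_ball_vol (real ?D) * r ^ ?D"
  define I where "I = measure (energy f) (ball x0 (2 * r))"
  have v0: "v > 0" using r by (simp add: v_def)
  have I0: "I \<ge> 0" by (simp add: I_def)
  define U where "U = \<tau> + sqrt (2 * I / v)"
  have U0: "U \<ge> 0" using tau I0 v0 by (simp add: U_def)
  have up: "u x1 \<le> U" if x1: "x1 \<in> ball x0 r" for x1
  proof (cases "u x1 \<le> \<tau>")
    case True
    have "0 \<le> sqrt (2 * I / v)" using v0 I0 by simp
    then show ?thesis using True unfolding U_def by linarith
  next
    case False
    obtain q where q: "\<And>y. u x1 + q \<bullet> (y - x1) \<le> u y" using touch by blast
    let ?H = "ball x1 r \<inter> {y. 0 \<le> q \<bullet> (y - x1)}"
    have HB: "?H \<subseteq> ball x0 (2 * r)"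
    proof
      fix y assume "y \<in> ?H"
      then show "y \<in> ball x0 (2 * r)" using x1 dist_triangle[of x0 y x1] by (auto simp: dist_commute)
    qed
    have Hm: "?H \<in> sets borel" by measurable
    have "(u x1 - \<tau>)\<^sup>2 * measure lborel ?H \<le> measure (energy f) ?H"
    proof (rule energy_ge[OF fin fm Hm])
      fix y assume y: "y \<in> ?H"
      have "u x1 \<le> u y" using q[of y] y by auto
      moreover have "u y - \<tau> \<le> f y" using HB y sandwich(2) by blast
      ultimately show "u x1 - \<tau> \<le> \<bar>f y\<bar>" by linarith
    qed (use HB B False in auto)
    also have "\<dots> \<le> I" unfolding I_def using HB by (intro finite_measure_mono) auto
    finally have 1: "(u x1 - \<tau>)\<^sup>2 * measure lborel ?H \<le> I" .
    have "v \<le> 2 * measure lborel ?H"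
      using half_ball_measure[of x1 r q] measure_lborel_ball_mult[of r x1] r by (simp add: v_def)
    then have "(u x1 - \<tau>)\<^sup>2 * v \<le> (u x1 - \<tau>)\<^sup>2 * (2 * measure lborel ?H)"
      by (intro mult_left_mono) auto
    then have "(u x1 - \<tau>)\<^sup>2 \<le> 2 * I / v" using 1 v0 by (simp add: field_simps)
    then have "u x1 - \<tau> \<le> sqrt (2 * I / v)" by (rule real_le_rsqrt)
    then show ?thesis by (simp add: U_def)
  qed
  have low: "- u x0 \<le> U + 2 * sqrt (2 ^ ?D * I / v)"
  proof (cases "- u x0 \<le> U")
    case True
    have "0 \<le> sqrt (2 ^ ?D * I / v)" using v0 I0 by simp
    with True show ?thesis by linarith
  next
    case False
    let ?s = "(- u x0 - U) / 2"
    have HB: "ball x0 (r / 2) \<subseteq> ball x0 (2 * r)" using r by (intro subset_ball) auto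
    have "?s\<^sup>2 * measure lborel (ball x0 (r / 2)) \<le> measure (energy f) (ball x0 (r / 2))"
    proof (rule energy_ge[OF fin fm])
      fix y assume y: "y \<in> ball x0 (r / 2)"
      obtain q where q: "\<And>z. u y + q \<bullet> (z - y) \<le> u z" using touch by blast
      \<comment> \<open>The mirror image of \<open>x0\<close> in \<open>y\<close>. The supporting
        affine function at \<open>y\<close> gives 2 u(y) \<le> u(x0) + u(z), so \<open>u y\<close>
        is at most the mean of \<open>u x0\<close> and \<open>U\<close>.\<close>
      let ?z = "2 *\<^sub>R y - x0"
      have "dist x0 ?z = norm (2 *\<^sub>R (x0 - y))" by (simp add: dist_norm algebra_simps scaleR_2)
      then have "?z \<in> ball x0 r" using y by (simp add: dist_norm)
      then have "u ?z \<le> U" by (rule up)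
      moreover have "q \<bullet> (?z - y) = - (q \<bullet> (x0 - y))"
        by (simp add: inner_diff_right scaleR_2 inner_add_right)
      then have "2 * u y \<le> u x0 + u ?z" using q[of x0] q[of ?z] by linarith
      moreover have "f y \<le> u y" using y HB sandwich(1) by blast
      ultimately have "?s \<le> - f y" by (simp add: field_simps)
      then show "?s \<le> \<bar>f y\<bar>" by linarith
    qed (use HB B False in auto)
    also have "\<dots> \<le> I" unfolding I_def using HB by (intro finite_measure_mono) auto
    also have "measure lborel (ball x0 (r / 2)) = v / 2 ^ ?D"
      using measure_lborel_ball_mult[of "r / 2" x0] r by (simp add: v_def power_divide)
    finally have "?s\<^sup>2 \<le> 2 ^ ?D * I / v" using v0 by (simp add: field_simps)
    then have "?s \<le> sqrt (2 ^ ?D * I / v)" by (rule real_le_rsqrt)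
    then show ?thesis by (simp add: field_simps)
  qed
  define w where "w = sqrt (I / v)"
  have w0: "w \<ge> 0" using I0 v0 by (simp add: w_def)
  have s2: "sqrt (2 * I / v) \<le> 2 * w"
  proof -
    have "sqrt (2 * I / v) = sqrt 2 * w" unfolding w_def by (simp add: real_sqrt_mult real_sqrt_divide)
    also have "\<dots> \<le> 2 * w" using w0 sqrt2_less_2 by (intro mult_right_mono) auto
    finally show ?thesis .
  qed
  have sD: "sqrt (2 ^ ?D * I / v) \<le> 2 ^ ?D * w"
  proof -
    have "sqrt (2 ^ ?D * I / v) = sqrt (2 ^ ?D) * w" unfolding w_def by (simp add: real_sqrt_mult real_sqrt_divide)
    also have "sqrt (2 ^ ?D) \<le> (2 ^ ?D :: real)"
      by (rule real_le_lsqrt) (auto simp: power2_eq_square)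
    then have "sqrt (2 ^ ?D) * w \<le> 2 ^ ?D * w" using w0 by (intro mult_right_mono) auto
    finally show ?thesis .
  qed
  have "(1::real) * w \<le> 2 ^ ?D * w" using w0 by (intro mult_right_mono) auto
  moreover have "u x0 \<le> U" using up[of x0] r by simp
  ultimately have "\<bar>u x0\<bar> \<le> \<tau> + 4 * (2 ^ ?D * w)"
    using low s2 sD w0 unfolding U_def by linarith
  then show ?thesis by (simp add: w_def I_def v_def)
qed

text \<open>In the chart x / |x_j| of the cube facet containing \<open>c\<close> this is the box of
  radius \<open>r\<close> about \<open>c\<close>, extended to a cone and cut off at the unit ball.
  It does not refer to \<open>face\<close>, so an enlarged box may reach beyond the points labelled
  with its facet.\<close>

definition chart_cone :: "'d::finite \<Rightarrow> real ^ 'd \<Rightarrow> real \<Rightarrow> (real ^ 'd) set" where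
  "chart_cone j c r = {x \<in> ball 0 1. 0 < x $ j * c $ j \<and> (\<forall>i. \<bar>x $ i / \<bar>x $ j\<bar> - c $ i\<bar> \<le> r)}"

lemma measurable_vec_nth' [measurable]: "(\<lambda>x. x $ i) \<in> borel_measurable (borel :: (real ^ 'd) measure)"
  by (intro borel_measurable_continuous_onI continuous_intros)

lemma chart_cone_measurable [measurable]: "chart_cone j c r \<in> sets borel"
proof -
  have "chart_cone j c r = ball 0 1 \<inter> {x. 0 < x $ j * c $ j} \<inter> (\<Inter>i. {x. \<bar>x $ i / \<bar>x $ j\<bar> - c $ i\<bar> \<le> r})"
    by (auto simp: chart_cone_def)
  moreover have "{x. \<bar>x $ i / \<bar>x $ j\<bar> - c $ i\<bar> \<le> r} \<in> sets borel" for i by measurable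
  moreover have "{x. 0 < x $ j * c $ j} \<in> sets borel" by measurable
  ultimately show ?thesis by auto
qed

text \<open>The chart is Lipschitz away from the origin. A displacement by 2 r changes the j-th
  coordinate by at most half of \<open>lam\<close>, by \<open>4 * r \<le> lam\<close>, and the chart
  coordinates by at most 10 r / (lam / 2) \<le> l. This uses up the margin between 2 l and 3
  l.\<close>

lemma ball_subset_chart_cone:
  fixes y c :: "real ^ 'd"
  assumes c: "\<bar>c $ j\<bar> = 1" and yj: "y $ j = c $ j" and yi: "\<And>i. \<bar>y $ i - c $ i\<bar> \<le> 2 * l" "\<And>i. \<bar>y $ i\<bar> \<le> 4"
    and lam: "0 < lam" "4 * r \<le> lam" "20 * r \<le> lam * l" and x: "x \<in> ball (lam *\<^sub>R y) (2 * r)" and x1: "x \<in> ball 0 1"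
  shows "x \<in> chart_cone j c (3 * l)"
proof -
  have d: "\<bar>x $ i - lam * y $ i\<bar> \<le> 2 * r" for i
    using component_le_norm_cart[of "x - lam *\<^sub>R y" i] x by (simp add: dist_norm norm_minus_commute)
  have "x $ j * c $ j = lam * (c $ j * c $ j) + (x $ j - lam * y $ j) * c $ j"
    by (simp add: yj algebra_simps)
  moreover have cc: "c $ j * c $ j = 1" using c by (metis abs_mult_self_eq mult_1)
  moreover have "\<bar>(x $ j - lam * y $ j) * c $ j\<bar> \<le> 2 * r" using d[of j] c by (simp add: abs_mult)
  ultimately have xc: "\<bar>x $ j * c $ j - lam\<bar> \<le> 2 * r" by auto
  then have xj: "\<bar>x $ j\<bar> = x $ j * c $ j" "lam / 2 \<le> x $ j * c $ j"
    using lam c by (auto simp: abs_if split: if_splits)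
  have "\<bar>x $ i / \<bar>x $ j\<bar> - c $ i\<bar> \<le> 3 * l" for i
  proof -
    define t where "t = \<bar>x $ j\<bar>"
    have t: "lam / 2 \<le> t" "\<bar>t - lam\<bar> \<le> 2 * r" using xj xc by (auto simp: t_def)
    then have t0: "0 < t" using lam by auto
    have "\<bar>(lam - t) * y $ i\<bar> \<le> (2 * r) * 4"
      unfolding abs_mult using t(2) yi(2)[of i] by (intro mult_mono) auto
    moreover have "x $ i - t * y $ i = (x $ i - lam * y $ i) + (lam - t) * y $ i" by (simp add: algebra_simps)
    ultimately have "\<bar>x $ i - t * y $ i\<bar> \<le> 10 * r" using d[of i] by linarith
    also have "\<dots> \<le> t * l"
    proof -
      have "0 \<le> l" using yi(1)[of j] yj by simp
      then have "lam / 2 * l \<le> t * l" using t by (intro mult_right_mono)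
      then show ?thesis using lam by simp
    qed
    finally have "\<bar>x $ i / t - y $ i\<bar> \<le> l" using t0 by (simp add: abs_le_iff field_simps)
    then show ?thesis using yi(1)[of i] unfolding t_def by linarith
  qed
  moreover have "0 < x $ j * c $ j" using xj lam by linarith
  ultimately show ?thesis using x1 by (simp add: chart_cone_def)
qed

text \<open>In \<open>box_bound\<close> the factor \<open>16 * D\<close> is the inverse of the scale
  \<open>lam0\<close> at which the ray is entered, and \<open>1 / (320 * D)\<close> is the ball
  radius in units of \<open>l\<close>.\<close>

definition box_const :: "nat \<Rightarrow> real" where
  "box_const D = 16 * D * (1 + sqrt (4 * 4 ^ D / (unit_ball_vol D * (1 / (320 * real D)) ^ D)))"

lemma box_const_pos: "D > 0 \<Longrightarrow> box_const D > 0"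
  unfolding box_const_def by (intro mult_pos_pos add_pos_nonneg) auto

text \<open>Homogeneity improves the volume l^D of \<open>touching_ball_bound\<close> to l^(D - 1):
  a large value at \<open>y\<close> recurs along the ray through \<open>y\<close>, on which about 4
  / l disjoint balls of radius proportional to \<open>l\<close> fit into the cone, and each of them
  carries the energy of a single ball.\<close>

lemma box_bound:
  fixes u f :: "real ^ 'd \<Rightarrow> real" and y c :: "real ^ 'd"
  assumes fin: "finite_measure (energy f)" and fm: "f \<in> borel_measurable borel"
    and touch: "\<And>x. \<exists>q. \<forall>y. u x + q \<bullet> (y - x) \<le> u y"
    and hom: "\<And>a x. 0 \<le> a \<Longrightarrow> u (a *\<^sub>R x) = a * u x"
    and c: "\<bar>c $ j\<bar> = 1" "\<And>i. \<bar>c $ i\<bar> \<le> 2" and l: "0 < l" "l \<le> 1" and tau: "0 \<le> \<tau>"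
    and sandwich: "\<And>x. x \<in> chart_cone j c (3 * l) \<Longrightarrow> f x \<le> u x \<and> u x - \<tau> \<le> f x"
    and y: "y $ j = c $ j" "\<And>i. \<bar>y $ i - c $ i\<bar> \<le> 2 * l"
  shows "\<bar>u y\<bar> \<le> box_const CARD('d) * (\<tau> + sqrt (measure (energy f) (chart_cone j c (3 * l)) / l ^ (CARD('d) - 1)))"
proof -
  interpret finite_measure "energy f" by fact
  let ?D = "CARD('d)"
  have D0: "?D > 0" by simp
  \<comment> \<open>Since \<open>norm y \<le> 4 * D\<close> and all factors \<open>lam q\<close>
    stay below 2 \<open>lam0\<close>, the centres remain in the ball of radius 1 / 2.\<close>
  define lam0 where "lam0 = 1 / (16 * real ?D)"
  define r where "r = lam0 * l / 20"
  define N where "N = nat \<lfloor>5 / l\<rfloor>"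
  define lam where "lam q = lam0 + 4 * r * real q" for q
  define W where "W = chart_cone j c (3 * l)"
  define M where "M = measure (energy f) W"
  define v where "v = unit_ball_vol (real ?D)"
  have v0: "v > 0" by (simp add: v_def)
  have lam0: "lam0 > 0" "lam0 \<le> 1 / 16" using D0 by (auto simp: lam0_def field_simps)
  have r0: "r > 0" using lam0 l by (simp add: r_def)
  have rl: "20 * r = lam0 * l" by (simp add: r_def)
  have ll: "lam0 * l \<le> lam0 * 1" using l lam0 by (intro mult_left_mono) auto
  have r_le: "20 * r \<le> lam0" using rl ll by simp
  have l5: "5 \<le> 5 / l" using l by (simp add: field_simps)
  have N_ge: "4 / l \<le> real N"
  proof -
    have "5 / l - 1 \<le> real N" using l5 unfolding N_def by linarith
    moreover have "1 \<le> 1 / l" using l by simp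
    ultimately show ?thesis by (simp add: field_simps)
  qed
  have N_le: "real N \<le> 5 / l" using l5 unfolding N_def by linarith
  have lam_le: "lam q \<le> 2 * lam0" if "q < N" for q
  proof -
    have "4 * r * real q \<le> 4 * r * (5 / l)" using that N_le r0 by (intro mult_left_mono) auto
    also have "\<dots> = lam0" using l rl by (simp add: field_simps)
    finally show ?thesis by (simp add: lam_def)
  qed
  have lam_ge: "lam0 \<le> lam q" for q using r0 by (simp add: lam_def)
  have y4: "\<bar>y $ i\<bar> \<le> 4" for i using y(2)[of i] c(2)[of i] l by linarith
  have ny: "norm y \<le> 4 * ?D"
  proof -
    have "norm y \<le> (\<Sum>i\<in>UNIV. \<bar>y $ i\<bar>)" by (rule norm_le_l1_cart)
    also have "\<dots> \<le> (\<Sum>i\<in>(UNIV::'d set). 4)" by (intro sum_mono y4)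
    finally show ?thesis by simp
  qed
  have ny1: "1 \<le> norm y" using component_le_norm_cart[of y j] y(1) c(1) by simp
  have B1: "ball (lam q *\<^sub>R y) (2 * r) \<subseteq> ball 0 1" if q: "q < N" for q
  proof
    fix x assume x: "x \<in> ball (lam q *\<^sub>R y) (2 * r)"
    have "norm (lam q *\<^sub>R y) \<le> (2 * lam0) * (4 * ?D)"
      using lam_le[OF q] lam_ge[of q] lam0 ny by (simp only: norm_scaleR, intro mult_mono) auto
    also have "\<dots> = 1 / 2" using D0 by (simp add: lam0_def)
    finally have "norm x < 1 / 2 + 2 * r"
      using x norm_triangle_sub[of x "lam q *\<^sub>R y"] by (simp add: dist_norm norm_minus_commute)
    then show "x \<in> ball 0 1" using r_le lam0 by simp
  qed
  have BW: "ball (lam q *\<^sub>R y) (2 * r) \<subseteq> W" if q: "q < N" for q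
  proof
    fix x assume x: "x \<in> ball (lam q *\<^sub>R y) (2 * r)"
    have "lam0 * l \<le> lam q * l" using lam_ge[of q] l by (intro mult_right_mono) auto
    then show "x \<in> W" unfolding W_def
      using ball_subset_chart_cone[OF c(1) y y4 _ _ _ x] B1[OF q] x lam_ge[of q] lam0 r_le rl by auto
  qed
  define Iq where "Iq q = measure (energy f) (ball (lam q *\<^sub>R y) (2 * r))" for q
  have disj: "disjoint_family_on (\<lambda>q. ball (lam q *\<^sub>R y) (2 * r)) {..<N}"
  proof (clarsimp simp: disjoint_family_on_def)
    fix p q assume pq: "p < N" "q < N" "p \<noteq> q"
    have "4 * r * 1 \<le> 4 * r * \<bar>real p - real q\<bar>"
      using r0 pq by (intro mult_left_mono) auto
    also have "\<dots> = \<bar>lam p - lam q\<bar>" using r0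
      by (simp add: lam_def abs_mult flip: right_diff_distrib)
    also have "\<dots> * 1 \<le> \<bar>lam p - lam q\<bar> * norm y" using ny1 by (intro mult_left_mono) auto
    also have "\<dots> = dist (lam p *\<^sub>R y) (lam q *\<^sub>R y)" by (simp add: dist_norm flip: scaleR_left_diff_distrib)
    finally show "ball (lam p *\<^sub>R y) (2 * r) \<inter> ball (lam q *\<^sub>R y) (2 * r) = {}"
      by (intro disjoint_ballI) simp
  qed
  have sumI: "(\<Sum>q<N. Iq q) \<le> M"
  proof -
    have "(\<Sum>q<N. Iq q) = measure (energy f) (\<Union>q<N. ball (lam q *\<^sub>R y) (2 * r))"
      unfolding Iq_def using disj by (intro finite_measure_finite_Union[symmetric]) auto
    also have "\<dots> \<le> M" unfolding M_def using BW by (intro finite_measure_mono) (auto simp: W_def)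
    finally show ?thesis .
  qed
  define w where "w = sqrt (M / l ^ (?D - 1))"
  define Q where "Q = 4 * 4 ^ ?D / (v * (1 / (320 * real ?D)) ^ ?D)"
  have M0: "M \<ge> 0" by (simp add: M_def)
  have w0: "w \<ge> 0" using M0 l by (simp add: w_def)
  have Q0: "Q \<ge> 0" using v0 by (simp add: Q_def)
  have main: "lam0 * \<bar>u y\<bar> - \<tau> \<le> sqrt Q * w"
  proof (cases "lam0 * \<bar>u y\<bar> - \<tau> \<le> 0")
    case True
    have "0 \<le> sqrt Q * w" using Q0 w0 by simp
    with True show ?thesis by linarith
  next
    case False
    define s where "s = lam0 * \<bar>u y\<bar> - \<tau>"
    have s0: "s > 0" using False by (simp add: s_def)
    have each: "s\<^sup>2 * (v * r ^ ?D) \<le> 16 * 4 ^ ?D * Iq q" if q: "q < N" for q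
    proof -
      have "\<bar>u (lam q *\<^sub>R y)\<bar> \<le> \<tau> + 4 * 2 ^ DIM(real ^ 'd) *
          sqrt (measure (energy f) (ball (lam q *\<^sub>R y) (2 * r)) / (unit_ball_vol (real DIM(real ^ 'd)) * r ^ DIM(real ^ 'd)))"
        using BW[OF q] sandwich by (intro touching_ball_bound[OF fin fm touch r0 B1[OF q] tau]) (auto simp: W_def)
      then have "\<bar>u (lam q *\<^sub>R y)\<bar> \<le> \<tau> + 4 * 2 ^ ?D * sqrt (Iq q / (v * r ^ ?D))"
        by (simp add: Iq_def v_def)
      moreover have "u (lam q *\<^sub>R y) = lam q * u y" using lam_ge[of q] lam0 by (intro hom) auto
      moreover have "lam0 * \<bar>u y\<bar> \<le> lam q * \<bar>u y\<bar>" using lam_ge[of q] by (intro mult_right_mono) auto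
      moreover have "\<bar>lam q * u y\<bar> = lam q * \<bar>u y\<bar>" using lam_ge[of q] lam0 by (simp add: abs_mult)
      ultimately have "s \<le> 4 * 2 ^ ?D * sqrt (Iq q / (v * r ^ ?D))" unfolding s_def by linarith
      then have "s\<^sup>2 \<le> (4 * 2 ^ ?D * sqrt (Iq q / (v * r ^ ?D)))\<^sup>2" using s0 by (intro power_mono) auto
      also have "\<dots> = 16 * 4 ^ ?D * (Iq q / (v * r ^ ?D))"
      proof -
        have "(2 ^ ?D)\<^sup>2 = (4 ^ ?D :: real)" by (simp add: power2_eq_square flip: power_mult_distrib)
        then show ?thesis using v0 r0 by (simp add: power_mult_distrib Iq_def)
      qed
      finally show ?thesis using v0 r0 by (simp add: field_simps)
    qed
    have "real N * (s\<^sup>2 * (v * r ^ ?D)) = (\<Sum>q<N. s\<^sup>2 * (v * r ^ ?D))" by simp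
    also have "\<dots> \<le> (\<Sum>q<N. 16 * 4 ^ ?D * Iq q)" by (intro sum_mono each) auto
    also have "\<dots> = 16 * 4 ^ ?D * (\<Sum>q<N. Iq q)" by (simp add: sum_distrib_left)
    also have "\<dots> \<le> 16 * 4 ^ ?D * M" using sumI by (intro mult_left_mono) auto
    finally have 1: "real N * (s\<^sup>2 * (v * r ^ ?D)) \<le> 16 * 4 ^ ?D * M" .
    have "4 / l * (s\<^sup>2 * (v * r ^ ?D)) \<le> real N * (s\<^sup>2 * (v * r ^ ?D))"
      using N_ge v0 r0 by (intro mult_right_mono) auto
    with 1 have 2: "4 / l * (s\<^sup>2 * (v * r ^ ?D)) \<le> 16 * 4 ^ ?D * M" by linarith
    have rr: "r = (1 / (320 * real ?D)) * l" by (simp add: r_def lam0_def)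
    have "r ^ ?D = (1 / (320 * real ?D)) ^ ?D * l ^ ?D" by (simp only: rr power_mult_distrib)
    moreover have "l ^ ?D = l * l ^ (?D - 1)" using D0 by (metis power_eq_if neq0_conv)
    ultimately have 3: "4 * (s\<^sup>2 * (v * ((1 / (320 * real ?D)) ^ ?D * l ^ (?D - 1)))) \<le> 16 * 4 ^ ?D * M"
      using 2 l by (simp add: mult_ac)
    define z where "z = v * (1 / (320 * real ?D)) ^ ?D"
    define p where "p = l ^ (?D - 1)"
    have "z > 0" "p > 0" using v0 l D0 by (auto simp: z_def p_def)
    moreover have "4 * (s\<^sup>2 * (z * p)) \<le> 16 * 4 ^ ?D * M"
      using 3 unfolding z_def p_def by (simp only: mult.assoc)
    ultimately have "s\<^sup>2 \<le> (4 * 4 ^ ?D / z) * (M / p)" by (simp add: field_simps)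
    then have "s\<^sup>2 \<le> Q * (M / l ^ (?D - 1))" unfolding Q_def z_def p_def .
    then have "s \<le> sqrt (Q * (M / l ^ (?D - 1)))" by (rule real_le_rsqrt)
    then show ?thesis by (simp only: s_def w_def real_sqrt_mult)
  qed
  have "lam0 * \<bar>u y\<bar> \<le> \<tau> + sqrt Q * w" using main by simp
  also have "\<dots> \<le> (1 + sqrt Q) * (\<tau> + w)" using tau w0 Q0 by (simp add: algebra_simps)
  finally have "\<bar>u y\<bar> \<le> 16 * ?D * ((1 + sqrt Q) * (\<tau> + w))" using D0 by (simp add: lam0_def field_simps)
  then show ?thesis by (simp add: box_const_def Q_def w_def M_def W_def v_def)
qed

section \<open>Dyadic boxes on the sphere\<close>

lemma infnorm_attained: "\<exists>i. \<bar>x $ i\<bar> = infnorm (x :: real ^ 'd::finite)"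
proof -
  have "infnorm x = Max (range (\<lambda>i. \<bar>x $ i\<bar>))"
    unfolding infnorm_cart by (subst cSup_eq_Max) (auto simp: full_SetCompr_eq)
  also have "\<dots> \<in> range (\<lambda>i. \<bar>x $ i\<bar>)" by (intro Max_in) auto
  finally show ?thesis by auto
qed

text \<open>Ties between coordinates are broken by \<open>to_nat\<close>, so every point has exactly
  one face and the level sets are Borel.\<close>

definition face :: "real ^ 'd::finite \<Rightarrow> 'd" where
  "face x = arg_min to_nat (\<lambda>i. \<bar>x $ i\<bar> = infnorm x)"

definition nu :: "real ^ 'd::finite \<Rightarrow> real ^ 'd" where
  "nu x = inverse (infnorm x) *\<^sub>R x"

text \<open>Centre of the dyadic box of side \<open>2\<^sup>-\<^sup>k\<close> containing the projection of \<open>x\<close> to the surface of the cube.\<close>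

definition cen :: "nat \<Rightarrow> real ^ 'd::finite \<Rightarrow> real ^ 'd" where
  "cen k x = (\<chi> i. if i = face x then sgn (x $ i) else (of_int \<lfloor>2 ^ k * nu x $ i\<rfloor> + 1 / 2) / 2 ^ k)"

definition lab :: "nat \<Rightarrow> real ^ 'd::finite \<Rightarrow> 'd \<times> (real ^ 'd)" where
  "lab k x = (face x, cen k x)"

definition labs :: "nat \<Rightarrow> ('d::finite \<times> (real ^ 'd)) set" where
  "labs k = lab k ` (- {0})"

lemma abs_face: "\<bar>x $ face x\<bar> = infnorm x"
  unfolding face_def using infnorm_attained[of x] by (metis (mono_tags, lifting) arg_min_nat_lemma)

lemma infnorm_pos: "x \<noteq> 0 \<Longrightarrow> 0 < infnorm x"
  using infnorm_pos_lt by blast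

lemma scale_nu: "x = infnorm x *\<^sub>R nu x"
  using infnorm_pos[of x] by (cases "x = 0") (auto simp: nu_def infnorm_0)

lemma abs_nu_le: "\<bar>nu x $ i\<bar> \<le> 1"
  using component_le_infnorm_cart[of x i] infnorm_pos[of x]
  by (cases "x = 0") (auto simp: nu_def abs_mult field_simps)

lemma nu_face: "x \<noteq> 0 \<Longrightarrow> nu x $ face x = sgn (x $ face x)"
  using abs_face[of x] infnorm_pos[of x] by (auto simp: nu_def sgn_if abs_if field_simps split: if_splits)

lemma infnorm_unit:
  assumes "norm (x :: real ^ 'd) = 1"
  shows "infnorm x \<le> 1" "1 / CARD('d) \<le> infnorm x"
proof -
  show "infnorm x \<le> 1" using infnorm_le_norm[of x] assms by simp
  have "norm x \<le> (\<Sum>i\<in>UNIV. \<bar>x $ i\<bar>)" by (rule norm_le_l1_cart)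
  also have "\<dots> \<le> (\<Sum>i\<in>(UNIV::'d set). infnorm x)" by (intro sum_mono component_le_infnorm_cart)
  finally show "1 / CARD('d) \<le> infnorm x" using assms by (simp add: field_simps)
qed

lemma cen_face: "cen k x $ face x = sgn (x $ face x)"
  by (simp add: cen_def)

lemma abs_cen_face: "x \<noteq> 0 \<Longrightarrow> \<bar>cen k x $ face x\<bar> = 1"
  using abs_face[of x] infnorm_pos[of x] by (auto simp: cen_face sgn_if)

lemma nu_cen_face: "x \<noteq> 0 \<Longrightarrow> nu x $ face x = cen k x $ face x"
  by (simp add: cen_face nu_face)

lemma nu_cen:
  assumes "x \<noteq> 0"
  shows "\<bar>nu x $ i - cen k x $ i\<bar> \<le> 1 / 2 / 2 ^ k"
proof (cases "i = face x")
  case False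
  have "\<bar>2 ^ k * nu x $ i - (of_int \<lfloor>2 ^ k * nu x $ i\<rfloor> + 1 / 2)\<bar> \<le> 1 / 2" by linarith
  then have "\<bar>2 ^ k * (nu x $ i - cen k x $ i)\<bar> \<le> 1 / 2"
    using False by (simp add: cen_def right_diff_distrib)
  moreover define t where "t = \<bar>nu x $ i - cen k x $ i\<bar>"
  ultimately have "2 ^ k * t \<le> 1 / 2" by (simp add: abs_mult)
  then show ?thesis by (simp add: t_def[symmetric] field_simps)
qed (use nu_cen_face[OF assms, of k] in auto)

lemma two_power_le: "k \<le> k' \<Longrightarrow> 1 / 2 ^ k' \<le> (1 / 2 ^ k :: real)"
  by (intro divide_left_mono power_increasing) auto

text \<open>The bound is 2 and not 1 because the half-open boxes stick out of the cube: a coordinate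
  equal to 1 is given the centre 1 + 2^(-k) / 2.\<close>

lemma abs_cen_le:
  assumes "x \<noteq> 0" shows "\<bar>cen k x $ i\<bar> \<le> 2"
proof -
  have "1 / 2 / 2 ^ k \<le> (1 / 2 :: real)" by (simp add: field_simps)
  then show ?thesis using nu_cen[OF assms, of i k] abs_nu_le[of x i] by linarith
qed

lemma cen_cen:
  assumes "x \<noteq> 0"
  shows "\<bar>cen k x $ i - cen k' x $ i\<bar> \<le> 1 / 2 / 2 ^ k + 1 / 2 / 2 ^ k'"
  using nu_cen[OF assms, of i k] nu_cen[OF assms, of i k'] by linarith

lemma floor_double:
  fixes a b :: real
  assumes "\<lfloor>2 * a\<rfloor> = \<lfloor>2 * b\<rfloor>"
  shows "\<lfloor>a\<rfloor> = \<lfloor>b\<rfloor>"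
proof -
  have "\<lfloor>2 * t\<rfloor> = 2 * \<lfloor>t\<rfloor> \<or> \<lfloor>2 * t\<rfloor> = 2 * \<lfloor>t\<rfloor> + 1" for t :: real by linarith
  from this[of a] this[of b] show ?thesis using assms by presburger
qed

text \<open>The boxes are nested because the floor of 2 a determines the floor of a.\<close>

lemma lab_coarsen:
  assumes "lab k x = lab k y" "k' \<le> k"
  shows "lab k' x = lab k' y"
  using assms(2,1)
proof (induction rule: inc_induct)
  case (step n)
  then have e: "lab (Suc n) x = lab (Suc n) y" by simp
  then have f: "face x = face y" by (simp add: lab_def)
  have "cen n x $ i = cen n y $ i" for i
  proof (cases "i = face x")
    case True
    then show ?thesis using e f by (simp add: lab_def vec_eq_iff cen_def) metis
  next
    case False
    have "cen (Suc n) x $ i = cen (Suc n) y $ i" using e by (simp add: lab_def)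
    then have "\<lfloor>2 * (2 ^ n * nu x $ i)\<rfloor> = \<lfloor>2 * (2 ^ n * nu y $ i)\<rfloor>"
      using False f by (simp add: cen_def mult_ac)
    from floor_double[OF this] show ?thesis using False f by (simp add: cen_def)
  qed
  then show ?case using f by (simp add: lab_def vec_eq_iff)
qed

text \<open>Integer coordinates for the centres, so that labels can be counted as points of a finite
  product.\<close>

definition mk_cen :: "nat \<Rightarrow> 'd::finite \<Rightarrow> real \<Rightarrow> ('d \<Rightarrow> int) \<Rightarrow> real ^ 'd" where
  "mk_cen k j s \<kappa> = (\<chi> i. if i = j then s else (of_int (\<kappa> i) + 1 / 2) / 2 ^ k)"

lemma labs_obtain:
  assumes "(j, c) \<in> labs k"
  obtains s \<kappa> where "c = mk_cen k j s \<kappa>" "s \<in> {-1, 1}" "\<kappa> j = 0" "\<And>i. \<kappa> i \<in> {- (2 ^ k) .. 2 ^ k}"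
proof -
  obtain x where x: "x \<noteq> 0" "face x = j" "cen k x = c" using assms by (auto simp: labs_def lab_def)
  define \<kappa> where "\<kappa> i = (if i = j then 0 else \<lfloor>2 ^ k * nu x $ i\<rfloor>)" for i
  have "\<kappa> i \<in> {- (2 ^ k) .. 2 ^ k}" for i
  proof -
    have "\<bar>2 ^ k * nu x $ i\<bar> \<le> 2 ^ k" using abs_nu_le[of x i] by (simp add: abs_mult)
    then have "of_int (- (2 ^ k)) \<le> 2 ^ k * nu x $ i" "2 ^ k * nu x $ i < of_int (2 ^ k + 1)" by auto
    then have "- (2 ^ k) \<le> \<lfloor>2 ^ k * nu x $ i\<rfloor>" "\<lfloor>2 ^ k * nu x $ i\<rfloor> < 2 ^ k + 1"
      by (simp_all only: le_floor_iff floor_less_iff)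
    then show ?thesis by (auto simp: \<kappa>_def)
  qed
  moreover have "c = mk_cen k j (sgn (x $ j)) \<kappa>"
    unfolding x(3)[symmetric] x(2)[symmetric] by (auto simp: mk_cen_def cen_def \<kappa>_def x(2) vec_eq_iff)
  moreover have "sgn (x $ j) \<in> {-1, 1}"
    using abs_cen_face[OF x(1), of k] x(2) by (auto simp: cen_face sgn_if split: if_splits)
  ultimately show ?thesis using that by (simp add: \<kappa>_def)
qed

text \<open>The index of the facet coordinate is pinned to 0 and only D - 1 indices vary. Hence the
  exponent is the dimension of the sphere.\<close>

lemma card_labs:
  "finite (labs k :: ('d::finite \<times> (real ^ 'd)) set)"
  "real (card (labs k :: ('d::finite \<times> (real ^ 'd)) set)) \<le> 2 * CARD('d) * 3 ^ CARD('d) * (2 ^ k) ^ (CARD('d) - 1)"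
proof -
  define K where "K j = PiE (UNIV :: 'd set) (\<lambda>i. if i = j then {0} else {- (2 ^ k) .. 2 ^ k :: int})" for j
  define F where "F = (\<lambda>(j, s, \<kappa>). (j, mk_cen k j s \<kappa>) :: 'd \<times> (real ^ 'd))"
  define D where "D = Sigma (UNIV :: 'd set) (\<lambda>j. {-1, 1 :: real} \<times> K j)"
  have finK: "finite (K j)" for j unfolding K_def by (intro finite_PiE) auto
  have finD: "finite D" unfolding D_def using finK by auto
  have sub: "labs k \<subseteq> F ` D"
  proof
    fix B :: "'d \<times> (real ^ 'd)" assume "B \<in> labs k"
    then obtain j c where B: "B = (j, c)" "(j, c) \<in> labs k" by (cases B) auto
    then obtain s \<kappa> where sk: "c = mk_cen k j s \<kappa>" "s \<in> {-1, 1}" "\<kappa> j = 0" "\<And>i. \<kappa> i \<in> {- (2 ^ k) .. 2 ^ k}"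
      by (meson labs_obtain)
    then have "\<kappa> \<in> K j" by (auto simp: K_def PiE_def)
    then show "B \<in> F ` D" using B sk by (auto simp: F_def D_def intro!: rev_image_eqI[of "(j, s, \<kappa>)"])
  qed
  then show fin: "finite (labs k :: ('d \<times> (real ^ 'd)) set)" using finD finite_subset by blast
  have cK: "card (K j) = (2 * 2 ^ k + 1) ^ (CARD('d) - 1)" for j
  proof -
    have "card (K j) = (\<Prod>i\<in>UNIV. card (if i = j then {0} else {- (2 ^ k) .. 2 ^ k :: int}))"
      unfolding K_def by (rule card_PiE) simp
    also have "\<dots> = (\<Prod>i\<in>UNIV - {j}. 2 * 2 ^ k + 1)"
      by (subst prod.remove[of _ j]) (auto intro!: prod.cong simp: nat_add_distrib nat_mult_distrib nat_power_eq)
    finally show ?thesis by simp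
  qed
  have "card (labs k :: ('d \<times> (real ^ 'd)) set) \<le> card D" using sub finD by (meson card_image_le card_mono finite_imageI le_trans)
  also have "card D = CARD('d) * (2 * (2 * 2 ^ k + 1) ^ (CARD('d) - 1))"
    unfolding D_def by (subst card_SigmaI) (auto simp: finK cK card_cartesian_product)
  finally have "real (card (labs k :: ('d \<times> (real ^ 'd)) set)) \<le> real (CARD('d) * (2 * (2 * 2 ^ k + 1) ^ (CARD('d) - 1)))"
    by (simp only: of_nat_le_iff)
  also have "\<dots> = 2 * CARD('d) * (2 * 2 ^ k + 1 :: real) ^ (CARD('d) - 1)" by (simp add: add.commute)
  also have "\<dots> \<le> real (2 * CARD('d)) * (3 ^ CARD('d) * (2 ^ k) ^ (CARD('d) - 1) :: real)"
  proof (rule mult_left_mono)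
    have "(2 * 2 ^ k + 1 :: real) ^ (CARD('d) - 1) \<le> (3 * 2 ^ k) ^ (CARD('d) - 1)"
      by (intro power_mono) auto
    also have "\<dots> \<le> 3 ^ CARD('d) * (2 ^ k) ^ (CARD('d) - 1)"
      unfolding power_mult_distrib by (intro mult_right_mono power_increasing) auto
    finally show "(2 * 2 ^ k + 1 :: real) ^ (CARD('d) - 1) \<le> 3 ^ CARD('d) * (2 ^ k) ^ (CARD('d) - 1)" .
  qed auto
  finally show "real (card (labs k :: ('d \<times> (real ^ 'd)) set)) \<le> 2 * CARD('d) * 3 ^ CARD('d) * (2 ^ k) ^ (CARD('d) - 1)"
    by (simp add: mult.assoc)
qed

lemma card_int_near:
  fixes a A :: real
  assumes "0 \<le> A"
  shows "finite {m::int. \<bar>a - of_int m\<bar> \<le> A}" "real (card {m::int. \<bar>a - of_int m\<bar> \<le> A}) \<le> 2 * A + 1"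
proof -
  have e: "{m::int. \<bar>a - of_int m\<bar> \<le> A} = {\<lceil>a - A\<rceil> .. \<lfloor>a + A\<rfloor>}"
    by (auto simp: ceiling_le_iff le_floor_iff abs_le_iff algebra_simps)
  show "finite {m::int. \<bar>a - of_int m\<bar> \<le> A}" unfolding e by simp
  have "of_int (\<lfloor>a + A\<rfloor> - \<lceil>a - A\<rceil> + 1) \<le> 2 * A + 1" by linarith
  then show "real (card {m::int. \<bar>a - of_int m\<bar> \<le> A}) \<le> 2 * A + 1" unfolding e using assms by simp
qed

text \<open>The sign of the facet is determined by \<open>x\<close>, and every other index is an
  integer within \<open>A\<close> of a number read off from \<open>x\<close>. So enlarged boxes
  overlap a bounded number of times, uniformly in the level.\<close>

lemma card_labs_near:
  fixes x :: "real ^ 'd::finite" and A :: real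
  assumes A: "0 \<le> A"
  shows "real (card {B \<in> labs k. 0 < x $ fst B * snd B $ fst B \<and> (\<forall>i. \<bar>x $ i / \<bar>x $ fst B\<bar> - snd B $ i\<bar> \<le> A / 2 ^ k)})
    \<le> CARD('d) * (2 * A + 1) ^ CARD('d)"
proof -
  define I where "I j i = (if i = j then {0} else {m::int. \<bar>(2 ^ k * (x $ i / \<bar>x $ j\<bar>) - 1 / 2) - of_int m\<bar> \<le> A})" for i j
  define D where "D = Sigma (UNIV :: 'd set) (\<lambda>j. PiE (UNIV :: 'd set) (I j))"
  define F where "F = (\<lambda>(j, \<kappa>). (j, mk_cen k j (sgn (x $ j)) \<kappa>) :: 'd \<times> (real ^ 'd))"
  have finI: "finite (I j i)" for i j using card_int_near(1)[OF A] by (simp add: I_def)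
  have finK: "finite (PiE (UNIV :: 'd set) (I j))" for j using finI by (intro finite_PiE) auto
  have finD: "finite D" unfolding D_def using finK by auto
  let ?N = "{B \<in> labs k. 0 < x $ fst B * snd B $ fst B \<and> (\<forall>i. \<bar>x $ i / \<bar>x $ fst B\<bar> - snd B $ i\<bar> \<le> A / 2 ^ k)}"
  have "?N \<subseteq> F ` D"
  proof
    fix B assume "B \<in> ?N"
    then obtain j c where B: "B = (j, c)" "(j, c) \<in> labs k" "0 < x $ j * c $ j"
      "\<And>i. \<bar>x $ i / \<bar>x $ j\<bar> - c $ i\<bar> \<le> A / 2 ^ k" by (cases B) auto
    obtain s \<kappa> where sk: "c = mk_cen k j s \<kappa>" "s \<in> {-1, 1}" "\<kappa> j = 0"
      using B(2) by (meson labs_obtain)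
    have s: "s = sgn (x $ j)" using B(3) sk(1,2) by (auto simp: mk_cen_def zero_less_mult_iff)
    have "\<kappa> i \<in> I j i" for i
    proof (cases "i = j")
      case False
      have "\<bar>x $ i / \<bar>x $ j\<bar> - (of_int (\<kappa> i) + 1 / 2) / 2 ^ k\<bar> \<le> A / 2 ^ k"
        using B(4)[of i] False sk(1) by (simp add: mk_cen_def)
      then have "2 ^ k * \<bar>x $ i / \<bar>x $ j\<bar> - (of_int (\<kappa> i) + 1 / 2) / 2 ^ k\<bar> \<le> A" by (simp add: field_simps)
      moreover have "2 ^ k * \<bar>x $ i / \<bar>x $ j\<bar> - (of_int (\<kappa> i) + 1 / 2) / 2 ^ k\<bar>
          = \<bar>2 ^ k * (x $ i / \<bar>x $ j\<bar> - (of_int (\<kappa> i) + 1 / 2) / 2 ^ k)\<bar>" by (simp add: abs_mult)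
      moreover have "2 ^ k * (x $ i / \<bar>x $ j\<bar> - (of_int (\<kappa> i) + 1 / 2) / 2 ^ k)
          = 2 ^ k * (x $ i / \<bar>x $ j\<bar>) - 1 / 2 - of_int (\<kappa> i)" by (simp add: right_diff_distrib)
      ultimately have "\<bar>(2 ^ k * (x $ i / \<bar>x $ j\<bar>) - 1 / 2) - of_int (\<kappa> i)\<bar> \<le> A" by metis
      then show ?thesis using False by (simp add: I_def)
    qed (use sk in \<open>simp add: I_def\<close>)
    then have "(j, \<kappa>) \<in> D" by (auto simp: D_def PiE_def)
    then show "B \<in> F ` D" using B sk s by (auto simp: F_def intro!: rev_image_eqI[of "(j, \<kappa>)"])
  qed
  then have "card ?N \<le> card D" using finD by (meson card_image_le card_mono finite_imageI le_trans)
  also have "card D = (\<Sum>j\<in>UNIV. \<Prod>i\<in>UNIV. card (I j i))"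
    unfolding D_def using finK by (subst card_SigmaI) (auto simp: card_PiE)
  finally have "real (card ?N) \<le> (\<Sum>j\<in>UNIV. \<Prod>i\<in>UNIV. real (card (I j i)))"
    by (simp flip: of_nat_prod of_nat_sum)
  also have "\<dots> \<le> (\<Sum>j\<in>(UNIV::'d set). \<Prod>i\<in>(UNIV::'d set). (2 * A + 1))"
    using card_int_near(2)[OF A] A by (intro sum_mono prod_mono) (auto simp: I_def)
  finally show ?thesis by simp
qed

text \<open>The number of cones containing a point is integrated against the energy;
  \<open>card_labs_near\<close> with A = 3 bounds it by D 7^D.\<close>

lemma sum_energy_labs:
  fixes f :: "real ^ 'd::finite \<Rightarrow> real"
  assumes fin: "finite_measure (energy f)" and S: "S \<subseteq> labs k"
  shows "(\<Sum>(j, c)\<in>S. measure (energy f) (chart_cone j c (3 / 2 ^ k))) \<le> CARD('d) * 7 ^ CARD('d) * measure (energy f) UNIV"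
proof -
  interpret finite_measure "energy f" by fact
  let ?W = "\<lambda>B. chart_cone (fst B) (snd B) (3 / 2 ^ k)"
  have finS: "finite S" using S card_labs(1) finite_subset by blast
  have int: "integrable (energy f) (indicator (?W B) :: _ \<Rightarrow> real)" for B
    by (intro integrable_real_indicator) (auto simp: emeasure_eq_measure)
  have "(\<Sum>(j, c)\<in>S. measure (energy f) (chart_cone j c (3 / 2 ^ k))) = (\<Sum>B\<in>S. \<integral>x. indicator (?W B) x \<partial>energy f)"
    by (intro sum.cong) (auto simp: case_prod_beta)
  also have "\<dots> = (\<integral>x. (\<Sum>B\<in>S. indicator (?W B) x) \<partial>energy f)"
    by (rule Bochner_Integration.integral_sum[symmetric]) (rule int)
  also have "\<dots> \<le> (\<integral>x. CARD('d) * 7 ^ CARD('d) \<partial>energy f)"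
  proof (rule integral_mono)
    show "integrable (energy f) (\<lambda>x. \<Sum>B\<in>S. indicator (?W B) x :: real)" using int by auto
    fix x :: "real ^ 'd"
    have "(\<Sum>B\<in>S. indicator (?W B) x :: real) = real (card {B \<in> S. x \<in> ?W B})"
      using finS by (simp add: indicator_def sum.If_cases Int_def)
    also have "card {B \<in> S. x \<in> ?W B} \<le>
        card {B \<in> labs k. 0 < x $ fst B * snd B $ fst B \<and> (\<forall>i. \<bar>x $ i / \<bar>x $ fst B\<bar> - snd B $ i\<bar> \<le> 3 / 2 ^ k)}"
      using S card_labs(1)[of k] by (intro card_mono) (auto simp: chart_cone_def)
    finally have "(\<Sum>B\<in>S. indicator (?W B) x :: real) \<le>
        real (card {B \<in> labs k. 0 < x $ fst B * snd B $ fst B \<and> (\<forall>i. \<bar>x $ i / \<bar>x $ fst B\<bar> - snd B $ i\<bar> \<le> 3 / 2 ^ k)})" by simp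
    also have "\<dots> \<le> CARD('d) * 7 ^ CARD('d)" using card_labs_near[of 3 k x] by simp
    finally show "(\<Sum>B\<in>S. indicator (?W B) x :: real) \<le> CARD('d) * 7 ^ CARD('d)" .
  qed auto
  finally show ?thesis by (simp add: mult_ac)
qed

section \<open>Measurability of the labelling\<close>

lemma face_eq_iff:
  "face x = j \<longleftrightarrow> \<bar>x $ j\<bar> = infnorm x \<and> (\<forall>i. \<bar>x $ i\<bar> = infnorm x \<longrightarrow> to_nat j \<le> to_nat i)"
proof
  assume "face x = j"
  then show "\<bar>x $ j\<bar> = infnorm x \<and> (\<forall>i. \<bar>x $ i\<bar> = infnorm x \<longrightarrow> to_nat j \<le> to_nat i)"
    using abs_face[of x] by (auto simp: face_def intro: arg_min_nat_le)
next
  assume j: "\<bar>x $ j\<bar> = infnorm x \<and> (\<forall>i. \<bar>x $ i\<bar> = infnorm x \<longrightarrow> to_nat j \<le> to_nat i)"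
  then have "to_nat j \<le> to_nat (face x)" using abs_face by blast
  moreover have "to_nat (face x) \<le> to_nat j" unfolding face_def using j by (intro arg_min_nat_le) auto
  ultimately show "face x = j" by simp
qed

lemma infnorm_measurable [measurable]: "infnorm \<in> borel_measurable (borel :: (real ^ 'd) measure)"
  by (intro borel_measurable_continuous_onI continuous_on_infnorm continuous_on_id)

lemma face_measurable [measurable]: "{x :: real ^ 'd. face x = j} \<in> sets borel"
proof -
  have "{x :: real ^ 'd. face x = j} = {x. \<bar>x $ j\<bar> = infnorm x} \<inter> (\<Inter>i\<in>{i. to_nat i < to_nat j}. {x. \<bar>x $ i\<bar> \<noteq> infnorm x})"
    by (auto simp: face_eq_iff not_le)
  moreover have "{x :: real ^ 'd. \<bar>x $ j\<bar> = infnorm x} \<in> sets borel" by measurable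
  moreover have "{x :: real ^ 'd. \<bar>x $ i\<bar> \<noteq> infnorm x} \<in> sets borel" for i by measurable
  ultimately show ?thesis
    by (cases "{i :: 'd. to_nat i < to_nat j} = {}") (auto simp: finite_imp_closed)
qed

lemma nu_measurable [measurable]: "nu \<in> borel_measurable (borel :: (real ^ 'd) measure)"
  unfolding nu_def by measurable

lemma lab_measurable: "{x :: real ^ 'd. lab k x = B} \<in> sets borel"
proof -
  obtain j c where B: "B = (j, c)" by (cases B)
  have "{x :: real ^ 'd. lab k x = B} = {x. face x = j} \<inter>
      (\<Inter>i. {x. (if i = j then sgn (x $ i) else (of_int \<lfloor>2 ^ k * nu x $ i\<rfloor> + 1 / 2) / 2 ^ k) = c $ i})"
    by (auto simp: B lab_def cen_def vec_eq_iff)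
  moreover have "{x :: real ^ 'd. (if i = j then sgn (x $ i) else (of_int \<lfloor>2 ^ k * nu x $ i\<rfloor> + 1 / 2) / 2 ^ k) = c $ i} \<in> sets borel" for i
    by (cases "i = j"; simp; measurable)
  ultimately show ?thesis by auto
qed

section \<open>Entropy of convex functions\<close>

definition cube :: "'d::finite \<Rightarrow> (real ^ 'd) set" where
  "cube j = {z. z $ j = 0 \<and> (\<forall>i. \<bar>z $ i\<bar> \<le> 1 / 2)}"

definition touches :: "'d::finite \<Rightarrow> (real ^ 'd \<Rightarrow> real) \<Rightarrow> real ^ 'd \<Rightarrow> real ^ 'd \<Rightarrow> bool" where
  "touches j u z w \<longleftrightarrow> w $ j = 0 \<and> (\<forall>i. \<bar>w $ i\<bar> \<le> 4) \<and> (\<forall>z'\<in>cube j. u z + w \<bullet> (z' - z) \<le> u z')"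

text \<open>Convexity is encoded by a bounded subgradient at every point. The bound 4 in
  \<open>touches\<close> is the largest slope of a convex function that is bounded by 1 on the cube
  of twice the side: over the extra distance 1 / 2 it can rise by at most 2.\<close>

definition cvx_class :: "'d::finite \<Rightarrow> (real ^ 'd \<Rightarrow> real) set" where
  "cvx_class j = {u. \<forall>z\<in>cube j. \<bar>u z\<bar> \<le> 1 \<and> (\<exists>w. touches j u z w)}"

lemma inner_vec_sum: "x \<bullet> y = (\<Sum>i\<in>UNIV. x $ i * y $ i)" for x y :: "real ^ 'd"
  by (simp add: inner_vec_def)

lemma mult_le_square_sum: "a * b \<le> (a + b)\<^sup>2 / (4::real)"
  using zero_le_power2[of "a - b"] by (simp add: power2_eq_square algebra_simps)

lemma floor_close: "\<lfloor>a :: real\<rfloor> = \<lfloor>b\<rfloor> \<Longrightarrow> \<bar>a - b\<bar> \<le> 1"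
  by linarith

text \<open>
  Two touching pairs \<open>(z, w)\<close> and \<open>(z', w')\<close> with \<open>z + w\<close> close to \<open>z' + w'\<close> have nearly the same
  value at \<open>z\<close>, with an error quadratic in the distance. This gives the exponent of Bronshtein's
  entropy bound.
\<close>

lemma touches_close:
  fixes z w z' w' :: "real ^ 'd::finite" and e :: real
  assumes t: "touches j u z w" "touches j u z' w'" and z: "z \<in> cube j" "z' \<in> cube j"
    and e: "\<And>i. \<bar>(z $ i + w $ i) - (z' $ i + w' $ i)\<bar> \<le> e"
  shows "u z - (u z' + w' \<bullet> (z - z')) \<le> CARD('d) * e\<^sup>2 / 4"
proof -
  have "u z + w \<bullet> (z' - z) \<le> u z'" using t(1) z(2) by (simp add: touches_def)
  then have "u z - (u z' + w' \<bullet> (z - z')) \<le> (w - w') \<bullet> (z - z')"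
    by (simp add: inner_diff_left inner_diff_right)
  also have "\<dots> = (\<Sum>i\<in>UNIV. (w $ i - w' $ i) * (z $ i - z' $ i))" by (simp add: inner_vec_sum)
  also have "\<dots> \<le> (\<Sum>i\<in>(UNIV::'d set). e\<^sup>2 / 4)"
  proof (rule sum_mono)
    fix i
    have "(w $ i - w' $ i) * (z $ i - z' $ i) \<le> (w $ i - w' $ i + (z $ i - z' $ i))\<^sup>2 / 4"
      by (rule mult_le_square_sum)
    also have "(w $ i - w' $ i + (z $ i - z' $ i))\<^sup>2 \<le> e\<^sup>2"
      using e[of i] by (intro power2_le_iff_abs_le[THEN iffD2]) (auto simp: algebra_simps)
    finally show "(w $ i - w' $ i) * (z $ i - z' $ i) \<le> e\<^sup>2 / 4" by simp
  qed
  finally show ?thesis by simp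
qed

text \<open>Cells of mesh 1 / (D 2^s) for the sums z + w of a point and its subgradient, the Minty
  parametrisation of a monotone graph. The entries of z + w are at most 5 in absolute value and
  vanish in direction \<open>j\<close>.\<close>

definition net_cells :: "'d::finite \<Rightarrow> nat \<Rightarrow> ('d \<Rightarrow> int) set" where
  "net_cells j s = PiE UNIV (\<lambda>i. if i = j then {0} else {- (5 * int CARD('d) * 2 ^ s) .. 5 * int CARD('d) * 2 ^ s})"

text \<open>Supporting affine functions with intercept and slopes rounded to multiples of 1 / Q. For
  functions of \<open>cvx_class\<close> intercepts are bounded by 3 D and slopes by 4; this
  \<open>Q\<close> keeps the rounding error on the cube below half of 4^(-s).\<close>

definition net_affine :: "'d::finite itself \<Rightarrow> nat \<Rightarrow> (real \<times> (real ^ 'd)) set" where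
  "net_affine _ s = (let Q = 4 * int CARD('d) * 4 ^ s in
     (\<lambda>(a, w). (of_int a / of_int Q, \<chi> i. of_int (w i) / of_int Q)) `
       ({- (3 * int CARD('d) * Q) .. 3 * int CARD('d) * Q} \<times> PiE UNIV (\<lambda>i. {- (4 * Q) .. 4 * Q})))"

text \<open>One affine function per cell, combined by the maximum. There are of order 2^(s m) cells,
  with polynomially many choices in 4^s for each, so the log-cardinality is of order 2^(s m) (s + 1)
  at accuracy 4^(-s). This is Bronshtein's bound up to the factor s + 1.\<close>

definition bron_net :: "'d::finite \<Rightarrow> nat \<Rightarrow> (real ^ 'd \<Rightarrow> real) set" where
  "bron_net j s = (\<lambda>a z. Max ((\<lambda>\<kappa>. fst (a \<kappa>) + snd (a \<kappa>) \<bullet> z) ` net_cells j s)) `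
     (net_cells j s \<rightarrow>\<^sub>E net_affine TYPE('d) s)"

lemma net_cells:
  "finite (net_cells (j::'d::finite) s)" "net_cells j s \<noteq> {}"
  "real (card (net_cells j s)) \<le> (11 * CARD('d)) ^ CARD('d) * 2 ^ (s * (CARD('d) - 1))"
proof -
  show "finite (net_cells j s)" unfolding net_cells_def by (intro finite_PiE) auto
  show "net_cells j s \<noteq> {}" unfolding net_cells_def by (auto simp: PiE_eq_empty_iff split: if_splits)
  have "card (net_cells j s) = (\<Prod>i\<in>UNIV. card (if i = j then {0} else {- (5 * int CARD('d) * 2 ^ s) .. 5 * int CARD('d) * 2 ^ s}))"
    unfolding net_cells_def by (rule card_PiE) simp
  also have "\<dots> = (\<Prod>i\<in>UNIV - {j}. 10 * CARD('d) * 2 ^ s + 1)"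
    by (subst prod.remove[of _ j]) (auto intro!: prod.cong simp: nat_add_distrib nat_mult_distrib nat_power_eq mult.assoc)
  also have "\<dots> = (10 * CARD('d) * 2 ^ s + 1) ^ (CARD('d) - 1)" by simp
  finally have "real (card (net_cells j s)) = (10 * real CARD('d) * 2 ^ s + 1) ^ (CARD('d) - 1)" by (simp add: add.commute)
  also have "\<dots> \<le> (11 * real CARD('d) * 2 ^ s) ^ (CARD('d) - 1)"
  proof (intro power_mono)
    have "1 * 1 \<le> real CARD('d) * 2 ^ s" by (intro mult_mono) auto
    then show "10 * real CARD('d) * 2 ^ s + 1 \<le> 11 * real CARD('d) * 2 ^ s" by simp
  qed simp
  also have "\<dots> = (11 * real CARD('d)) ^ (CARD('d) - 1) * 2 ^ (s * (CARD('d) - 1))"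
    by (simp add: power_mult_distrib power_mult)
  also have "\<dots> \<le> (11 * real CARD('d)) ^ CARD('d) * 2 ^ (s * (CARD('d) - 1))"
  proof (intro mult_right_mono power_increasing)
    have "1 \<le> real CARD('d)" by (simp add: Suc_leI)
    then show "1 \<le> 11 * real CARD('d)" by linarith
  qed auto
  finally show "real (card (net_cells j s)) \<le> (11 * CARD('d)) ^ CARD('d) * 2 ^ (s * (CARD('d) - 1))" by simp
qed

lemma net_affine:
  "finite (net_affine TYPE('d::finite) s)"
  "real (card (net_affine TYPE('d) s)) \<le> (36 * (real CARD('d))\<^sup>2 * 4 ^ s) ^ (CARD('d) + 1)"
proof -
  define Q where "Q = 4 * int CARD('d) * 4 ^ s"
  let ?X = "{- (3 * int CARD('d) * Q) .. 3 * int CARD('d) * Q} \<times> PiE (UNIV::'d set) (\<lambda>i. {- (4 * Q) .. 4 * Q})"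
  have fX: "finite ?X" by (intro finite_cartesian_product finite_PiE) auto
  then show "finite (net_affine TYPE('d) s)" by (simp add: net_affine_def Let_def Q_def)
  have "0 < Q" by (simp add: Q_def)
  then have Q0: "Q \<ge> 1" by simp
  have "card (net_affine TYPE('d) s) \<le> card ?X"
    using fX by (simp add: net_affine_def Let_def card_image_le flip: Q_def)
  also have "card ?X = nat (6 * int CARD('d) * Q + 1) * nat (8 * Q + 1) ^ CARD('d)"
    by (subst card_cartesian_product) (simp add: card_PiE mult_ac)
  finally have "real (card (net_affine TYPE('d) s)) \<le> real (nat (6 * int CARD('d) * Q + 1)) * real (nat (8 * Q + 1)) ^ CARD('d)"
    by (metis of_nat_le_iff of_nat_mult of_nat_power)
  also have "\<dots> \<le> (9 * real CARD('d) * Q) * (9 * real CARD('d) * Q) ^ CARD('d)"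
  proof (intro mult_mono power_mono)
    have d: "1 \<le> int CARD('d)" by (simp add: Suc_leI int_one_le_iff_zero_less)
    have "1 * 1 \<le> int CARD('d) * Q" using Q0 d by (intro mult_mono) auto
    then have "6 * (int CARD('d) * Q) + 1 \<le> 9 * (int CARD('d) * Q)" by linarith
    then have "6 * int CARD('d) * Q + 1 \<le> 9 * int CARD('d) * Q" by (simp only: mult.assoc)
    then have "real_of_int (6 * int CARD('d) * Q + 1) \<le> real_of_int (9 * int CARD('d) * Q)" by (simp only: of_int_le_iff)
    then show "real (nat (6 * int CARD('d) * Q + 1)) \<le> 9 * real CARD('d) * Q" using Q0 by simp
    have "1 * Q \<le> int CARD('d) * Q" using Q0 d by (intro mult_right_mono) auto
    then have "8 * Q + 1 \<le> 9 * int CARD('d) * Q" using Q0 by linarith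
    then have "real_of_int (8 * Q + 1) \<le> real_of_int (9 * int CARD('d) * Q)" by (simp only: of_int_le_iff)
    then show "real (nat (8 * Q + 1)) \<le> 9 * real CARD('d) * Q" using Q0 by simp
  qed (use Q0 in auto)
  also have "\<dots> = (36 * (real CARD('d))\<^sup>2 * 4 ^ s) ^ (CARD('d) + 1)"
    by (simp add: Q_def power2_eq_square mult_ac)
  finally show "real (card (net_affine TYPE('d) s)) \<le> (36 * (real CARD('d))\<^sup>2 * 4 ^ s) ^ (CARD('d) + 1)" .
qed

lemma bron_net_measurable: "v \<in> bron_net j s \<Longrightarrow> v \<in> borel_measurable borel"
  unfolding bron_net_def using net_cells(1,2)[of j s]
  by (auto intro!: borel_measurable_Max borel_measurable_add borel_measurable_inner)

lemma finite_bron_net: "finite (bron_net j s)"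
  unfolding bron_net_def using net_cells(1) net_affine(1) by (intro finite_imageI finite_PiE) auto

definition bron_const :: "nat \<Rightarrow> real" where
  "bron_const D = (11 * D) ^ D * ((D + 1) * (ln (36 * (real D)\<^sup>2) + 2))"

lemma card_bron_net:
  "ln (real (card (bron_net (j::'d::finite) s))) \<le> bron_const CARD('d) * 2 ^ (s * (CARD('d) - 1)) * (real s + 1)"
proof (cases "bron_net j s = {}")
  case True
  have "1 \<le> real CARD('d)" by (simp add: Suc_leI)
  then have "1 \<le> 36 * (real CARD('d))\<^sup>2" using one_le_power[of "real CARD('d)" 2] by linarith
  then show ?thesis using True by (simp add: bron_const_def)
next
  case False
  define T where "T = (36 * (real CARD('d))\<^sup>2 * 4 ^ s) ^ (CARD('d) + 1)"
  define N where "N = card (net_cells j s)"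
  have d: "1 \<le> real CARD('d)" by (simp add: Suc_leI)
  then have d36: "1 \<le> 36 * (real CARD('d))\<^sup>2" using one_le_power[of "real CARD('d)" 2] by linarith
  then have "1 * 1 \<le> 36 * (real CARD('d))\<^sup>2 * 4 ^ s" by (intro mult_mono) auto
  then have T1: "1 \<le> T" unfolding T_def by (intro one_le_power) simp
  have "card (bron_net j s) \<le> card (net_cells j s \<rightarrow>\<^sub>E net_affine TYPE('d) s)"
    unfolding bron_net_def using net_cells(1) net_affine(1) by (intro card_image_le finite_PiE) auto
  also have "\<dots> = card (net_affine TYPE('d) s) ^ N"
    unfolding N_def using net_cells(1)[of j s] by (simp add: card_PiE)
  finally have "real (card (bron_net j s)) \<le> real (card (net_affine TYPE('d) s)) ^ N"
    by (metis of_nat_le_iff of_nat_power)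
  also have "\<dots> \<le> T ^ N" using net_affine(2)[where 'd='d, of s] unfolding T_def by (intro power_mono) auto
  finally have "ln (real (card (bron_net j s))) \<le> ln (T ^ N)"
    using T1 False finite_bron_net[of j s] by (subst ln_le_cancel_iff) (auto simp: card_gt_0_iff)
  also have "\<dots> = N * ln T" using T1 by (simp add: ln_realpow)
  also have "ln T = (CARD('d) + 1) * (ln (36 * (real CARD('d))\<^sup>2) + s * ln 4)"
  proof -
    have "ln T = real (CARD('d) + 1) * ln (36 * (real CARD('d))\<^sup>2 * 4 ^ s)"
      unfolding T_def by (rule ln_realpow)
    also have "ln (36 * (real CARD('d))\<^sup>2 * 4 ^ s) = ln (36 * (real CARD('d))\<^sup>2) + s * ln 4"
      using d36 by (simp add: ln_mult ln_realpow)
    finally show ?thesis by simp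
  qed
  also have "\<dots> \<le> (CARD('d) + 1) * ((ln (36 * (real CARD('d))\<^sup>2) + 2) * (real s + 1))"
  proof (rule mult_left_mono)
    have "ln 4 = 2 * ln (2::real)" using ln_realpow[of "2::real" 2] by simp
    then have "ln 4 \<le> (2::real)" using ln_le_minus_one[of "2::real"] by simp
    then have "s * ln 4 \<le> s * (2::real)" by (intro mult_left_mono) auto
    then have gen: "L + s * ln 4 \<le> (L + 2) * (real s + 1)" if "0 \<le> L" for L :: real
    proof -
      have "0 \<le> L * real s" using that by simp
      moreover have "(L + 2) * (real s + 1) = L * real s + L + 2 * real s + 2" by (simp add: algebra_simps)
      ultimately show ?thesis using \<open>s * ln 4 \<le> s * (2::real)\<close> by linarith
    qed
    have "0 \<le> ln (36 * (real CARD('d))\<^sup>2)" using d36 by (rule ln_ge_zero)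
    then show "ln (36 * (real CARD('d))\<^sup>2) + s * ln 4 \<le> (ln (36 * (real CARD('d))\<^sup>2) + 2) * (real s + 1)" by (rule gen)
  qed simp
  then have "N * ((CARD('d) + 1) * (ln (36 * (real CARD('d))\<^sup>2) + s * ln 4)) \<le>
     ((11 * CARD('d)) ^ CARD('d) * 2 ^ (s * (CARD('d) - 1))) * ((CARD('d) + 1) * ((ln (36 * (real CARD('d))\<^sup>2) + 2) * (real s + 1)))"
    using net_cells(3)[of j s] d36 unfolding N_def by (intro mult_mono) auto
  finally show ?thesis by (simp add: bron_const_def mult_ac add_ac)
qed

lemma bron_net_approx:
  fixes j :: "'d::finite"
  assumes u: "u \<in> cvx_class j"
  shows "\<exists>v\<in>bron_net j s. \<forall>z\<in>cube j. \<bar>u z - v z\<bar> \<le> 1 / 4 ^ s"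
proof -
  define D where "D = CARD('d)"
  have D1: "1 \<le> real D" by (simp add: D_def Suc_leI)
  define Q where "Q = 4 * int D * 4 ^ s"
  have Q: "real_of_int Q = 4 * real D * 4 ^ s" by (simp add: Q_def)
  have Q0: "0 < real_of_int Q" using D1 by (simp add: Q)
  define cell where "cell z w = (\<lambda>i. \<lfloor>real D * 2 ^ s * (z $ i + w $ i)\<rfloor>)" for z w :: "real ^ 'd"
  define ok where "ok zw \<longleftrightarrow> fst zw \<in> cube j \<and> touches j u (fst zw) (snd zw)" for zw
  have "0 \<in> cube j" by (simp add: cube_def)
  then obtain w0 where w0: "ok (0, w0)" using u by (auto simp: cvx_class_def ok_def)
  \<comment> \<open>Empty cells receive the pair \<open>(0, w0)\<close>. Every touching pair yields
    an affine function below \<open>u\<close>, so this default cannot spoil the maximum.\<close>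
  define P where "P \<kappa> = (if \<exists>zw. ok zw \<and> cell (fst zw) (snd zw) = \<kappa> then SOME zw. ok zw \<and> cell (fst zw) (snd zw) = \<kappa> else (0, w0))" for \<kappa>
  have P_ok: "ok (P \<kappa>)" for \<kappa>
    unfolding P_def using w0 someI_ex[of "\<lambda>zw. ok zw \<and> cell (fst zw) (snd zw) = \<kappa>"] by auto
  have P_cell: "cell (fst (P (cell z w))) (snd (P (cell z w))) = cell z w" if "ok (z, w)" for z w
  proof -
    have ex: "\<exists>zw. ok zw \<and> cell (fst zw) (snd zw) = cell z w" using that by (intro exI[of _ "(z, w)"]) auto
    from someI_ex[OF ex] show ?thesis unfolding P_def using ex by simp
  qed
  define a where "a \<kappa> = u (fst (P \<kappa>)) - snd (P \<kappa>) \<bullet> fst (P \<kappa>)" for \<kappa>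
  define W where "W \<kappa> = snd (P \<kappa>)" for \<kappa>
  define r where "r \<kappa> = (of_int \<lfloor>a \<kappa> * Q\<rfloor> / of_int Q :: real, (\<chi> i. of_int \<lfloor>W \<kappa> $ i * Q\<rfloor> / of_int Q) :: real ^ 'd)" for \<kappa>
  have round: "\<bar>of_int \<lfloor>t * Q\<rfloor> / of_int Q - t\<bar> \<le> 1 / of_int Q" for t :: real
  proof -
    have "\<bar>of_int \<lfloor>t * Q\<rfloor> - t * Q\<bar> \<le> 1" by linarith
    then have "\<bar>(of_int \<lfloor>t * Q\<rfloor> - t * Q) / Q\<bar> \<le> 1 / Q"
      using Q0 by (simp only: abs_divide abs_of_pos) (intro divide_right_mono, auto)
    then show ?thesis using Q0 by (simp add: diff_divide_distrib)
  qed
  have cubeD: "z $ j = 0" "\<bar>z $ i\<bar> \<le> 1 / 2" if "z \<in> cube j" for z i using that by (auto simp: cube_def)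
  have W: "\<bar>W \<kappa> $ i\<bar> \<le> 4" "W \<kappa> $ j = 0" for \<kappa> i using P_ok[of \<kappa>] by (auto simp: W_def ok_def touches_def)
  have dot: "\<bar>w \<bullet> z\<bar> \<le> D * b" if "\<And>i. \<bar>w $ i\<bar> \<le> 2 * b" "z \<in> cube j" for w z :: "real ^ 'd" and b :: real
  proof -
    have b: "0 \<le> b" using order_trans[OF abs_ge_zero that(1)[of j]] by simp
    have "\<bar>w \<bullet> z\<bar> \<le> (\<Sum>i\<in>UNIV. \<bar>w $ i * z $ i\<bar>)" unfolding inner_vec_sum by (rule sum_abs)
    also have "\<dots> \<le> (\<Sum>i\<in>(UNIV::'d set). (2 * b) * (1 / 2))"
      unfolding abs_mult using that(1) cubeD(2)[OF that(2)] b by (intro sum_mono mult_mono) auto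
    finally show ?thesis by (simp add: D_def)
  qed
  have a_le: "\<bar>a \<kappa>\<bar> \<le> 3 * D" for \<kappa>
  proof -
    have "\<bar>u (fst (P \<kappa>))\<bar> \<le> 1" using u P_ok[of \<kappa>] by (auto simp: cvx_class_def ok_def)
    moreover have "\<bar>snd (P \<kappa>) \<bullet> fst (P \<kappa>)\<bar> \<le> real D * 2"
      using W(1)[of \<kappa>] P_ok[of \<kappa>] by (intro dot) (auto simp: W_def ok_def)
    ultimately show ?thesis using D1 unfolding a_def by linarith
  qed
  have floor_in: "\<lfloor>t * Q\<rfloor> \<in> {- (b * Q) .. b * Q}" if "\<bar>t\<bar> \<le> real_of_int b" for t :: real and b :: int
  proof -
    have "\<bar>t * Q\<bar> \<le> real_of_int b * Q" unfolding abs_mult using that Q0 by (intro mult_mono) auto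
    then have "- (real_of_int (b * Q)) \<le> t * Q" "t * Q \<le> real_of_int (b * Q)" by auto
    then have "real_of_int (- (b * Q)) \<le> t * Q" "real_of_int \<lfloor>t * Q\<rfloor> \<le> real_of_int (b * Q)" by linarith+
    then show ?thesis by (simp add: le_floor_iff del: of_int_mult of_int_minus)
  qed
  have rT: "r \<kappa> \<in> net_affine TYPE('d) s" for \<kappa>
    unfolding net_affine_def Let_def D_def[symmetric] Q_def[symmetric] r_def
    using floor_in[of "a \<kappa>" "3 * int D"] a_le[of \<kappa>] floor_in[of "W \<kappa> $ _" 4] W(1)[of \<kappa>]
    by (intro image_eqI[of _ _ "(\<lfloor>a \<kappa> * Q\<rfloor>, \<lambda>i. \<lfloor>W \<kappa> $ i * Q\<rfloor>)"]) auto
  have r_close: "\<bar>(fst (r \<kappa>) + snd (r \<kappa>) \<bullet> z) - (a \<kappa> + W \<kappa> \<bullet> z)\<bar> \<le> 1 / 2 / 4 ^ s" if z: "z \<in> cube j" for \<kappa> z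
  proof -
    have "\<bar>(snd (r \<kappa>) - W \<kappa>) \<bullet> z\<bar> \<le> D * (1 / (2 * real_of_int Q))"
    proof (rule dot[OF _ z])
      fix i show "\<bar>(snd (r \<kappa>) - W \<kappa>) $ i\<bar> \<le> 2 * (1 / (2 * real_of_int Q))"
        using round[of "W \<kappa> $ i"] by (simp add: r_def)
    qed
    moreover have "\<bar>fst (r \<kappa>) - a \<kappa>\<bar> \<le> 1 / Q" using round[of "a \<kappa>"] by (simp add: r_def)
    ultimately have "\<bar>(fst (r \<kappa>) + snd (r \<kappa>) \<bullet> z) - (a \<kappa> + W \<kappa> \<bullet> z)\<bar> \<le> 1 / Q + D * (1 / (2 * real_of_int Q))"
      by (simp add: inner_diff_left)
    also have "\<dots> \<le> D / Q + D / Q" using D1 Q0 by (intro add_mono) (auto simp: field_simps)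
    also have "\<dots> = 1 / 2 / 4 ^ s" using D1 by (simp add: Q field_simps)
    finally show ?thesis .
  qed
  have below: "a \<kappa> + W \<kappa> \<bullet> z \<le> u z" if "z \<in> cube j" for \<kappa> z
    using P_ok[of \<kappa>] that by (auto simp: ok_def touches_def a_def W_def inner_diff_right)
  have cells: "cell z w \<in> net_cells j s" if zw: "ok (z, w)" for z w
  proof -
    have "\<bar>z $ i + w $ i\<bar> \<le> 5" for i using zw cubeD(2)[of z i] by (auto simp: ok_def touches_def dest!: spec[of _ i])
    have "cell z w i \<in> {- (5 * int D * 2 ^ s) .. 5 * int D * 2 ^ s}" for i
    proof -
      have "\<bar>real D * 2 ^ s * (z $ i + w $ i)\<bar> \<le> real D * 2 ^ s * 5"
        unfolding abs_mult using \<open>\<bar>z $ i + w $ i\<bar> \<le> 5\<close> by (intro mult_mono) auto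
      then have "real_of_int (- (5 * int D * 2 ^ s)) \<le> real D * 2 ^ s * (z $ i + w $ i)"
          "real D * 2 ^ s * (z $ i + w $ i) \<le> real_of_int (5 * int D * 2 ^ s)" by auto
      then have "- (5 * int D * 2 ^ s) \<le> \<lfloor>real D * 2 ^ s * (z $ i + w $ i)\<rfloor>"
          "real_of_int \<lfloor>real D * 2 ^ s * (z $ i + w $ i)\<rfloor> \<le> real_of_int (5 * int D * 2 ^ s)"
        by (simp_all only: le_floor_iff) linarith
      then show ?thesis unfolding cell_def by (simp only: of_int_le_iff atLeastAtMost_iff)
    qed
    moreover have "cell z w j = 0" using zw by (simp add: cell_def ok_def touches_def cube_def)
    ultimately show ?thesis unfolding net_cells_def D_def[symmetric] by (auto simp: PiE_def)
  qed
  let ?v = "\<lambda>z. Max ((\<lambda>\<kappa>. fst (r \<kappa>) + snd (r \<kappa>) \<bullet> z) ` net_cells j s)"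
  have v_in: "?v \<in> bron_net j s"
    unfolding bron_net_def
  proof (rule image_eqI)
    show "restrict r (net_cells j s) \<in> net_cells j s \<rightarrow>\<^sub>E net_affine TYPE('d) s" using rT by auto
    show "?v = (\<lambda>z. Max ((\<lambda>\<kappa>. fst (restrict r (net_cells j s) \<kappa>) + snd (restrict r (net_cells j s) \<kappa>) \<bullet> z) ` net_cells j s))"
      by (rule ext, rule arg_cong[of _ _ Max], rule image_cong) simp_all
  qed
  have v_close: "\<bar>u z - ?v z\<bar> \<le> 1 / 4 ^ s" if z: "z \<in> cube j" for z
  proof -
    have "?v z \<le> u z + 1 / 2 / 4 ^ s"
    proof (subst Max_le_iff, use net_cells[of j s] in blast, use net_cells[of j s] in blast, safe)
      fix \<kappa>
      show "fst (r \<kappa>) + snd (r \<kappa>) \<bullet> z \<le> u z + 1 / 2 / 4 ^ s"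
        using r_close[OF z, of \<kappa>] below[OF z, of \<kappa>] by linarith
    qed
    \<comment> \<open>The affine function stored for the cell of a subgradient at \<open>z\<close>
      nearly attains \<open>u z\<close>: \<open>touches_close\<close> at distance 1 / (D 2^s) loses
      at most a quarter of 4^(-s), and rounding at most a half.\<close>
    moreover have "u z - 3 / 4 / 4 ^ s \<le> ?v z"
    proof -
      obtain w where w: "ok (z, w)" using u z by (auto simp: cvx_class_def ok_def)
      define \<kappa> where "\<kappa> = cell z w"
      define z' w' where "z' = fst (P \<kappa>)" "w' = snd (P \<kappa>)"
      have zw': "ok (z', w')" using P_ok[of \<kappa>] by (simp add: z'_w'_def)
      have cc: "cell z' w' = cell z w" using P_cell[OF w] by (simp add: z'_w'_def \<kappa>_def)
      have "\<bar>(z $ i + w $ i) - (z' $ i + w' $ i)\<bar> \<le> 1 / (real D * 2 ^ s)" for i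
      proof -
        have "\<bar>real D * 2 ^ s * (z $ i + w $ i) - real D * 2 ^ s * (z' $ i + w' $ i)\<bar> \<le> 1"
          using fun_cong[OF cc, of i] unfolding cell_def by (intro floor_close) simp
        then have "\<bar>real D * 2 ^ s * ((z $ i + w $ i) - (z' $ i + w' $ i))\<bar> \<le> 1" by (simp only: right_diff_distrib)
        then have "real D * 2 ^ s * \<bar>(z $ i + w $ i) - (z' $ i + w' $ i)\<bar> \<le> 1" by (simp only: abs_mult) simp
        moreover have "0 < real D * 2 ^ s" using D1 by simp
        ultimately show ?thesis by (simp only: pos_le_divide_eq) (simp only: mult.commute)
      qed
      then have "u z - (u z' + w' \<bullet> (z - z')) \<le> CARD('d) * (1 / (real D * 2 ^ s))\<^sup>2 / 4"
        using w zw' by (intro touches_close[of j u z w z' w']) (auto simp: ok_def)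
      also have "\<dots> = (1 / D) * (1 / 4 / 4 ^ s)"
      proof -
        have "(2 ^ s)\<^sup>2 = (4 ^ s :: real)" by (simp add: power2_eq_square flip: power_mult_distrib)
        then show ?thesis using D1 by (simp add: D_def power2_eq_square field_simps)
      qed
      also have "\<dots> \<le> 1 * (1 / 4 / 4 ^ s)" using D1 by (intro mult_right_mono) auto
      finally have "u z \<le> a \<kappa> + W \<kappa> \<bullet> z + 1 / 4 / 4 ^ s"
        by (simp add: a_def W_def z'_w'_def inner_diff_right)
      moreover have "fst (r \<kappa>) + snd (r \<kappa>) \<bullet> z \<le> ?v z"
        using net_cells(1)[of j s] cells[OF w] by (intro Max_ge) (auto simp: \<kappa>_def)
      moreover have "1 / 2 / 4 ^ s + 1 / 4 / 4 ^ s = (3 / 4 / 4 ^ s :: real)" by simp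
      ultimately show ?thesis using r_close[OF z, of \<kappa>] by linarith
    qed
    moreover have "0 \<le> 1 / (4::real) ^ s" "1 / 2 / 4 ^ s = (1 / 2) * (1 / (4::real) ^ s)" "3 / 4 / 4 ^ s = (3 / 4) * (1 / (4::real) ^ s)"
      by simp_all
    ultimately show ?thesis by linarith
  qed
  show ?thesis using v_in by (rule bexI[rotated]) (rule ballI, rule v_close)
qed

text \<open>Links of the chain. Two approximations of the same function at consecutive levels differ
  by at most 4^(-s) + 4^(-(s - 1)) = 5 / 4^s; discarding larger differences supplies the variance
  bound for chaining.\<close>

definition inc_net :: "'d::finite \<Rightarrow> nat \<Rightarrow> (real ^ 'd \<Rightarrow> real) set" where
  "inc_net j s = (if s = 0 then {v \<in> bron_net j 0. \<forall>z\<in>cube j. \<bar>v z\<bar> \<le> 5}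
     else (\<lambda>(v, v') z. v z - v' z) `
       {(v, v'). v \<in> bron_net j s \<and> v' \<in> bron_net j (s - 1) \<and> (\<forall>z\<in>cube j. \<bar>v z - v' z\<bar> \<le> 5 / 4 ^ s)})"

lemma finite_inc_net: "finite (inc_net j s)"
proof -
  have "finite {(v, v'). v \<in> bron_net j s \<and> v' \<in> bron_net j (s - 1) \<and> (\<forall>z\<in>cube j. \<bar>v z - v' z\<bar> \<le> 5 / 4 ^ s)}"
    by (rule finite_subset[OF _ finite_cartesian_product[OF finite_bron_net[of j s] finite_bron_net[of j "s - 1"]]]) auto
  then show ?thesis unfolding inc_net_def using finite_bron_net[of j 0] by simp
qed

lemma inc_net_measurable: "g \<in> inc_net j s \<Longrightarrow> g \<in> borel_measurable borel"
  by (auto simp: inc_net_def split: if_splits intro!: borel_measurable_diff dest: bron_net_measurable)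

lemma inc_net_le: "g \<in> inc_net j s \<Longrightarrow> z \<in> cube j \<Longrightarrow> \<bar>g z\<bar> \<le> 5 / 4 ^ s"
  by (auto simp: inc_net_def split: if_splits)

lemma bron_const_nonneg: "0 < D \<Longrightarrow> 0 \<le> bron_const D"
proof -
  assume "0 < D"
  then have "1 \<le> (real D)\<^sup>2" by (intro one_le_power) simp
  then have "1 \<le> 36 * (real D)\<^sup>2" by linarith
  then show ?thesis by (simp add: bron_const_def)
qed

lemma card_inc_net:
  "ln (real (card (inc_net (j::'d::finite) s))) \<le> 2 * bron_const CARD('d) * 2 ^ (s * (CARD('d) - 1)) * (real s + 1)"
proof (cases "inc_net j s = {}")
  case True
  then show ?thesis using bron_const_nonneg[of "CARD('d)"] by simp
next
  case False
  let ?b = "bron_const CARD('d)"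
  have c0: "0 < card (inc_net j s)" using False finite_inc_net[of j s] by (simp add: card_gt_0_iff)
  have bm: "?b * 2 ^ ((s - 1) * (CARD('d) - 1)) * (real (s - 1) + 1) \<le> ?b * 2 ^ (s * (CARD('d) - 1)) * (real s + 1)"
    using bron_const_nonneg[of "CARD('d)"] by (intro mult_mono mult_left_mono power_increasing mult_le_mono1) auto
  have b0: "0 \<le> ?b * 2 ^ (s * (CARD('d) - 1)) * (real s + 1)" using bron_const_nonneg[of "CARD('d)"] by simp
  show ?thesis
  proof (cases "s = 0")
    case True
    have "card (inc_net j s) \<le> card (bron_net j s)"
      unfolding inc_net_def using finite_bron_net[of j 0] True by (auto intro: card_mono)
    then have "ln (real (card (inc_net j s))) \<le> ln (real (card (bron_net j s)))"
      using c0 by (subst ln_le_cancel_iff) auto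
    moreover have "2 * ?b * 2 ^ (s * (CARD('d) - 1)) * (real s + 1) = 2 * (?b * 2 ^ (s * (CARD('d) - 1)) * (real s + 1))" by simp
    ultimately show ?thesis using card_bron_net[of j s] b0 by linarith
  next
    case s: False
    let ?X = "bron_net j s \<times> bron_net j (s - 1)"
    have fX: "finite ?X" using finite_bron_net by auto
    have "inc_net j s \<subseteq> (\<lambda>(v, v') z. v z - v' z) ` ?X" using s by (auto simp: inc_net_def)
    then have "card (inc_net j s) \<le> card ?X" using fX by (meson card_image_le card_mono finite_imageI le_trans)
    then have le: "card (inc_net j s) \<le> card (bron_net j s) * card (bron_net j (s - 1))" by (simp add: card_cartesian_product)
    with c0 have pos: "0 < card (bron_net j s)" "0 < card (bron_net j (s - 1))" by (auto intro!: Nat.gr0I)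
    have "ln (real (card (inc_net j s))) \<le> ln (real (card (bron_net j s) * card (bron_net j (s - 1))))"
      using le c0 pos by (subst ln_le_cancel_iff) (auto simp flip: of_nat_mult)
    also have "\<dots> = ln (real (card (bron_net j s))) + ln (real (card (bron_net j (s - 1))))"
      using pos by (simp add: ln_mult)
    also have "\<dots> \<le> 2 * (?b * 2 ^ (s * (CARD('d) - 1)) * (real s + 1))"
      using card_bron_net[of j s] card_bron_net[of j "s - 1"] bm by linarith
    finally show ?thesis by simp
  qed
qed

text \<open>The increments telescope to a net function of level \<open>S\<close> that approximates
  \<open>u\<close> to within 4^(-S).\<close>

lemma inc_net_chain:
  assumes u: "u \<in> cvx_class j"
  shows "\<exists>g. (\<forall>s. g s \<in> inc_net j s) \<and> (\<forall>S. \<forall>z\<in>cube j. \<bar>u z - (\<Sum>s\<le>S. g s z)\<bar> \<le> 1 / 4 ^ S)"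
proof -
  have "\<forall>s. \<exists>v. v \<in> bron_net j s \<and> (\<forall>z\<in>cube j. \<bar>u z - v z\<bar> \<le> 1 / 4 ^ s)"
    using bron_net_approx[OF u] by blast
  then obtain v where v: "\<And>s. v s \<in> bron_net j s" "\<And>s z. z \<in> cube j \<Longrightarrow> \<bar>u z - v s z\<bar> \<le> 1 / 4 ^ s"
    by metis
  define g where "g s = (if s = 0 then v 0 else (\<lambda>z. v s z - v (s - 1) z))" for s
  have "g s \<in> inc_net j s" for s
  proof (cases "s = 0")
    case True
    have "\<bar>v 0 z\<bar> \<le> 5" if "z \<in> cube j" for z
      using v(2)[OF that, of 0] u that by (auto simp: cvx_class_def dest!: bspec[of _ _ z])
    then show ?thesis using True v(1)[of 0] by (simp add: g_def inc_net_def)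
  next
    case False
    then obtain t where t: "s = Suc t" by (cases s) auto
    have "\<bar>v s z - v (s - 1) z\<bar> \<le> 5 / 4 ^ s" if "z \<in> cube j" for z
    proof -
      have "1 / 4 ^ t = (4 / 4 ^ s :: real)" by (simp add: t)
      then have "1 / 4 ^ s + 1 / 4 ^ t = (5 / 4 ^ s :: real)" by simp
      then show ?thesis using v(2)[OF that, of s] v(2)[OF that, of t] unfolding t by (simp add: abs_le_iff)
    qed
    then show ?thesis using False v(1)[of s] v(1)[of "s - 1"] by (auto simp: g_def inc_net_def intro!: rev_image_eqI[of "(v s, v (s - 1))"])
  qed
  moreover have "(\<Sum>s\<le>S. g s z) = v S z" for S z
    by (induction S) (auto simp: g_def)
  ultimately show ?thesis using v(2) by (intro exI[of _ g]) auto
qed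

section \<open>Upper bound for the correlation with the noise\<close>

text \<open>Equals 1 - 2 / m with m = D - 1: up to logarithms, the supremum of the noise sums over N
  points and \<open>cvx_class\<close> grows like N to this power.\<close>

definition expo :: "nat \<Rightarrow> real" where
  "expo D = 1 - 2 / (real D - 1)"

text \<open>All that the upper bound needs from the noise, as a property of fixed data. The weight
  \<open>infnorm (X i)\<close> appears because support functions are homogeneous while the charts
  live on the surface of the cube. The alternative \<open>Lay\<close> allows a bound by the number
  of layer points alone.\<close>

definition noise_ok ::
    "nat \<Rightarrow> (nat \<Rightarrow> real ^ 'd::finite) \<Rightarrow> (nat \<Rightarrow> real) \<Rightarrow> (real ^ 'd) set \<Rightarrow> nat \<Rightarrow> real \<Rightarrow> bool" where
  "noise_ok n X \<xi> Lay kmax \<Lambda> \<longleftrightarrow>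
     (\<forall>k\<le>kmax. \<forall>B\<in>labs k. \<forall>A\<in>{UNIV, Lay}. \<forall>u\<in>cvx_class (fst B).
        \<bar>\<Sum>i | i < n \<and> lab k (X i) = B \<and> X i \<in> A. \<xi> i * (infnorm (X i) * u (2 ^ k *\<^sub>R (nu (X i) - snd B)))\<bar>
          \<le> \<Lambda> * real (card {i. i < n \<and> lab k (X i) = B \<and> X i \<in> A}) powr expo CARD('d))"

text \<open>Jensen's inequality for a concave power. The factor 2 comes from an elementary proof
  that splits the summands at the average N / card S.\<close>

lemma sum_powr_le:
  fixes \<theta> N :: real
  assumes "finite S" "0 < \<theta>" "\<theta> < 1" "\<And>B. B \<in> S \<Longrightarrow> 0 \<le> a B" "sum a S \<le> N"
  shows "(\<Sum>B\<in>S. a B powr \<theta>) \<le> 2 * real (card S) powr (1 - \<theta>) * N powr \<theta>"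
proof (cases "S = {} \<or> N \<le> 0")
  case True
  moreover have "a B = 0" if "N \<le> 0" "B \<in> S" for B
  proof -
    have "a B \<le> sum a S" using assms that by (intro member_le_sum) auto
    with assms(4)[OF that(2)] assms(5) that show ?thesis by linarith
  qed
  ultimately show ?thesis by auto
next
  case False
  define c where "c = real (card S)"
  have c: "c > 0" using False assms(1) by (simp add: c_def card_gt_0_iff)
  have N: "N > 0" using False by simp
  define x where "x = N / c"
  have x: "x > 0" using c N by (simp add: x_def)
  have each: "a B powr \<theta> \<le> x powr \<theta> + a B * x powr (\<theta> - 1)" if B: "B \<in> S" for B
  proof (cases "a B \<le> x")
    case True
    then have "a B powr \<theta> \<le> x powr \<theta>" using assms B by (intro powr_mono2) auto
    moreover have "0 \<le> a B * x powr (\<theta> - 1)" using assms(4)[OF B] by simp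
    ultimately show ?thesis by linarith
  next
    case gt: False
    have "a B powr \<theta> = a B * a B powr (\<theta> - 1)" using gt x by (simp add: powr_mult_base)
    also have "\<dots> \<le> a B * x powr (\<theta> - 1)"
      using gt x assms by (intro mult_left_mono powr_mono2') auto
    finally show ?thesis using powr_ge_zero[of x \<theta>] by linarith
  qed
  have "(\<Sum>B\<in>S. a B powr \<theta>) \<le> (\<Sum>B\<in>S. x powr \<theta> + a B * x powr (\<theta> - 1))" by (intro sum_mono each)
  also have "\<dots> = c * x powr \<theta> + sum a S * x powr (\<theta> - 1)" by (simp add: sum.distrib c_def sum_distrib_right)
  also have "\<dots> \<le> c * x powr \<theta> + N * x powr (\<theta> - 1)" using assms(5) by (intro add_left_mono mult_right_mono) auto
  also have "N * x powr (\<theta> - 1) = c * (x * x powr (\<theta> - 1))" using c by (simp add: x_def)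
  also have "x * x powr (\<theta> - 1) = x powr \<theta>" using x by (simp add: powr_mult_base)
  also have "c * x powr \<theta> + c * x powr \<theta> = 2 * (c * x powr \<theta>)" by simp
  also have "c * x powr \<theta> = c powr (1 - \<theta>) * N powr \<theta>"
    using c N by (simp add: x_def powr_divide powr_diff)
  finally show ?thesis by (simp add: c_def mult.assoc)
qed

text \<open>The bound is assumed on the box of radius \<open>l\<close> about \<open>c\<close>, which
  after rescaling has twice the radius of \<open>cube\<close>. The additional room bounds the
  subgradients.\<close>

lemma cvx_class_support:
  fixes c :: "real ^ 'd::finite"
  assumes G: "G \<in> convex_bodies" and S: "0 < S" and l: "0 < l"
    and bd: "\<And>y. y $ j = c $ j \<Longrightarrow> (\<And>i. \<bar>y $ i - c $ i\<bar> \<le> l) \<Longrightarrow> \<bar>support_fun G y - p \<bullet> y\<bar> \<le> S"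
  shows "(\<lambda>z. (support_fun G (c + l *\<^sub>R z) - p \<bullet> (c + l *\<^sub>R z)) / S) \<in> cvx_class j"
proof -
  define u where "u z = (support_fun G (c + l *\<^sub>R z) - p \<bullet> (c + l *\<^sub>R z)) / S" for z
  have u1: "\<bar>u z\<bar> \<le> 1" if "z $ j = 0" "\<And>i. \<bar>z $ i\<bar> \<le> 1" for z
  proof -
    have "\<bar>support_fun G (c + l *\<^sub>R z) - p \<bullet> (c + l *\<^sub>R z)\<bar> \<le> S"
      using that l by (intro bd) (auto simp: abs_mult mult_left_le)
    then show ?thesis using S by (simp add: u_def abs_divide)
  qed
  have cubeD: "z $ j = 0" "\<bar>z $ i\<bar> \<le> 1 / 2" if "z \<in> cube j" for z i using that by (auto simp: cube_def)
  have "\<bar>u z\<bar> \<le> 1 \<and> (\<exists>w. touches j u z w)" if z: "z \<in> cube j" for z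
  proof
    show "\<bar>u z\<bar> \<le> 1" by (rule u1) (use cubeD(1)[OF z] in blast, rule order_trans[OF cubeD(2)[OF z]], simp)
    obtain q where q: "support_fun G (c + l *\<^sub>R z) = q \<bullet> (c + l *\<^sub>R z)" "\<And>y. q \<bullet> y \<le> support_fun G y"
      using support_fun_touch[OF G] by blast
    define w where "w = (\<chi> i. if i = j then 0 else l * (q - p) $ i / S)"
    have wdot: "w \<bullet> (z' - z) = l * ((q - p) \<bullet> (z' - z)) / S" if "z' $ j = 0" for z'
    proof -
      have "w \<bullet> (z' - z) = (\<Sum>i\<in>UNIV. l * ((q - p) $ i * (z' - z) $ i) / S)"
        unfolding inner_vec_sum using that cubeD(1)[OF z] by (intro sum.cong) (auto simp: w_def)
      also have "\<dots> = l * ((q - p) \<bullet> (z' - z)) / S"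
        unfolding inner_vec_sum by (simp add: sum_distrib_left sum_divide_distrib)
      finally show ?thesis .
    qed
    have tch: "u z + w \<bullet> (z' - z) \<le> u z'" if "z' $ j = 0" for z'
    proof -
      have "u z + w \<bullet> (z' - z) = (q \<bullet> (c + l *\<^sub>R z') - p \<bullet> (c + l *\<^sub>R z')) / S"
        unfolding wdot[OF that] u_def q(1) using S
        by (simp add: field_simps inner_add_right inner_diff_left inner_diff_right)
      also have "\<dots> \<le> u z'" unfolding u_def using q(2) S by (intro divide_right_mono diff_right_mono) auto
      finally show ?thesis .
    qed
    have "\<bar>w $ i\<bar> \<le> 4" for i
    proof (cases "i = j")
      case False
      define z' where "z' = z + axis i (sgn (w $ i) / 2)"
      have z'j: "z' $ j = 0" using False cubeD(1)[OF z] by (simp add: z'_def axis_def)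
      have "\<bar>z' $ i'\<bar> \<le> 1" for i'
        using cubeD(2)[OF z, of i'] by (auto simp: z'_def axis_def sgn_if)
      then have "\<bar>u z'\<bar> \<le> 1" by (rule u1[OF z'j])
      moreover have "w \<bullet> (z' - z) = \<bar>w $ i\<bar> / 2"
        by (simp add: z'_def inner_axis sgn_if abs_if)
      ultimately show ?thesis using tch[OF z'j] \<open>\<bar>u z\<bar> \<le> 1\<close> by linarith
    qed (simp add: w_def)
    moreover have "w $ j = 0" by (simp add: w_def)
    ultimately show "\<exists>w. touches j u z w"
      unfolding touches_def using tch cubeD(1) by blast
  qed
  then have "u \<in> cvx_class j" unfolding cvx_class_def by blast
  then show ?thesis unfolding u_def[abs_def] .
qed

lemma noise_box:
  fixes X :: "nat \<Rightarrow> real ^ 'd::finite"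
  assumes ok: "noise_ok n X \<xi> Lay kmax \<Lambda>" and k: "k \<le> kmax" and B: "(j, c) \<in> labs k" and A: "A \<in> {UNIV, Lay}"
    and X: "\<And>i. i < n \<Longrightarrow> X i \<noteq> 0"
    and G: "G \<in> convex_bodies" and S: "0 < S"
    and bd: "\<And>y. y $ j = c $ j \<Longrightarrow> (\<And>i. \<bar>y $ i - c $ i\<bar> \<le> 1 / 2 ^ k) \<Longrightarrow> \<bar>support_fun G y - p \<bullet> y\<bar> \<le> S"
  shows "\<bar>\<Sum>i | i < n \<and> lab k (X i) = (j, c) \<and> X i \<in> A. \<xi> i * (support_fun G (X i) - p \<bullet> X i)\<bar>
    \<le> S * \<Lambda> * real (card {i. i < n \<and> lab k (X i) = (j, c) \<and> X i \<in> A}) powr expo CARD('d)"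
proof -
  define u where "u z = (support_fun G (c + (1 / 2 ^ k) *\<^sub>R z) - p \<bullet> (c + (1 / 2 ^ k) *\<^sub>R z)) / S" for z
  let ?I = "{i. i < n \<and> lab k (X i) = (j, c) \<and> X i \<in> A}"
  have "u \<in> cvx_class j" unfolding u_def using bd by (intro cvx_class_support[OF G S]) auto
  then have *: "\<bar>\<Sum>i\<in>?I. \<xi> i * (infnorm (X i) * u (2 ^ k *\<^sub>R (nu (X i) - c)))\<bar>
          \<le> \<Lambda> * real (card ?I) powr expo CARD('d)"
    using ok k B A unfolding noise_ok_def by force
  have "support_fun G (X i) - p \<bullet> X i = S * (infnorm (X i) * u (2 ^ k *\<^sub>R (nu (X i) - c)))" for i
  proof -
    have "support_fun G (X i) = infnorm (X i) * support_fun G (nu (X i))"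
      by (subst scale_nu) (rule support_fun_scale[OF G infnorm_pos_le])
    moreover have "p \<bullet> X i = infnorm (X i) * (p \<bullet> nu (X i))" by (subst scale_nu) simp
    moreover have "c + (1 / 2 ^ k) *\<^sub>R (2 ^ k *\<^sub>R (nu (X i) - c)) = nu (X i)" by simp
    ultimately show ?thesis using S unfolding u_def by (simp add: right_diff_distrib diff_divide_distrib)
  qed
  then have "(\<Sum>i\<in>?I. \<xi> i * (support_fun G (X i) - p \<bullet> X i))
      = S * (\<Sum>i\<in>?I. \<xi> i * (infnorm (X i) * u (2 ^ k *\<^sub>R (nu (X i) - c))))"
    by (simp add: sum_distrib_left mult_ac)
  then show ?thesis using * S by (simp add: abs_mult mult.assoc mult_left_mono)
qed

lemma expo_bounds: "6 \<le> D \<Longrightarrow> 0 < expo D \<and> expo D < 1 \<and> 1 - expo D \<le> 1"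
  by (auto simp: expo_def field_simps)

text \<open>Both support functions are compared with the same linear function, which cancels in the
  difference. Thus two convex functions are controlled by \<open>noise_ok\<close>, although their
  difference is not convex. The boxes are then combined by \<open>sum_powr_le\<close>.\<close>

lemma noise_boxes:
  fixes X :: "nat \<Rightarrow> real ^ 'd::finite"
  assumes d: "6 \<le> CARD('d)"
    and ok: "noise_ok n X \<xi> Lay kmax \<Lambda>" and k: "k \<le> kmax" and SS: "SS \<subseteq> labs k" and A: "A \<in> {UNIV, Lay}"
    and X: "\<And>i. i < n \<Longrightarrow> X i \<noteq> 0" and \<Lambda>: "0 \<le> \<Lambda>"
    and G: "G \<in> convex_bodies" and K: "K \<in> convex_bodies" and S: "0 < S"
    and bd: "\<And>j c. (j, c) \<in> SS \<Longrightarrow> \<exists>p. \<forall>y. y $ j = c $ j \<longrightarrow> (\<forall>i. \<bar>y $ i - c $ i\<bar> \<le> 1 / 2 ^ k) \<longrightarrow>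
         \<bar>support_fun G y - p \<bullet> y\<bar> \<le> S \<and> \<bar>support_fun K y - p \<bullet> y\<bar> \<le> S"
    and N: "real (card {i. i < n \<and> lab k (X i) \<in> SS \<and> X i \<in> A}) \<le> N" and M: "real (card SS) \<le> M"
  shows "\<bar>\<Sum>i | i < n \<and> lab k (X i) \<in> SS \<and> X i \<in> A. \<xi> i * (support_fun G (X i) - support_fun K (X i))\<bar>
    \<le> 4 * S * \<Lambda> * M powr (1 - expo CARD('d)) * N powr expo CARD('d)"
proof -
  let ?\<theta> = "expo CARD('d)"
  let ?I = "\<lambda>B. {i. i < n \<and> lab k (X i) = B \<and> X i \<in> A}"
  let ?D = "\<lambda>i. \<xi> i * (support_fun G (X i) - support_fun K (X i))"
  have finS: "finite SS" using SS card_labs(1) finite_subset by blast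
  have un: "{i. i < n \<and> lab k (X i) \<in> SS \<and> X i \<in> A} = (\<Union>B\<in>SS. ?I B)" by auto
  have each: "\<bar>\<Sum>i\<in>?I B. ?D i\<bar> \<le> 2 * S * \<Lambda> * real (card (?I B)) powr ?\<theta>" if B: "B \<in> SS" for B
  proof -
    obtain j c where jc: "B = (j, c)" by (cases B)
    have "(j, c) \<in> SS" using B jc by simp
    from bd[OF this] obtain p where p0: "\<forall>y. y $ j = c $ j \<longrightarrow> (\<forall>i. \<bar>y $ i - c $ i\<bar> \<le> 1 / 2 ^ k) \<longrightarrow>
         \<bar>support_fun G y - p \<bullet> y\<bar> \<le> S \<and> \<bar>support_fun K y - p \<bullet> y\<bar> \<le> S" by (elim exE)
    have p: "\<bar>support_fun G y - p \<bullet> y\<bar> \<le> S" "\<bar>support_fun K y - p \<bullet> y\<bar> \<le> S"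
      if "y $ j = c $ j" "\<And>i. \<bar>y $ i - c $ i\<bar> \<le> 1 / 2 ^ k" for y
    proof -
      have "\<forall>i. \<bar>y $ i - c $ i\<bar> \<le> 1 / 2 ^ k" using that(2) by (rule allI)
      from mp[OF mp[OF spec[OF p0, of y] that(1)] this]
      show "\<bar>support_fun G y - p \<bullet> y\<bar> \<le> S" "\<bar>support_fun K y - p \<bullet> y\<bar> \<le> S" by (rule conjunct1, rule conjunct2)
    qed
    have BL: "(j, c) \<in> labs k" using SS \<open>(j, c) \<in> SS\<close> by (rule subsetD)
    have "(\<Sum>i\<in>?I B. ?D i) = (\<Sum>i\<in>?I B. \<xi> i * (support_fun G (X i) - p \<bullet> X i)) - (\<Sum>i\<in>?I B. \<xi> i * (support_fun K (X i) - p \<bullet> X i))"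
      unfolding sum_subtractf[symmetric] by (intro sum.cong refl) (simp add: right_diff_distrib)
    moreover have "\<bar>\<Sum>i\<in>?I B. \<xi> i * (support_fun G (X i) - p \<bullet> X i)\<bar> \<le> S * \<Lambda> * real (card (?I B)) powr ?\<theta>"
      unfolding jc
    proof (rule noise_box[OF ok k BL A _ G S])
      fix i assume "i < n" then show "X i \<noteq> 0" by (rule X)
    next
      fix y :: "real ^ 'd" assume "y $ j = c $ j" "\<And>i. \<bar>y $ i - c $ i\<bar> \<le> 1 / 2 ^ k"
      then show "\<bar>support_fun G y - p \<bullet> y\<bar> \<le> S" by (rule p(1))
    qed
    moreover have "\<bar>\<Sum>i\<in>?I B. \<xi> i * (support_fun K (X i) - p \<bullet> X i)\<bar> \<le> S * \<Lambda> * real (card (?I B)) powr ?\<theta>"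
      unfolding jc
    proof (rule noise_box[OF ok k BL A _ K S])
      fix i assume "i < n" then show "X i \<noteq> 0" by (rule X)
    next
      fix y :: "real ^ 'd" assume "y $ j = c $ j" "\<And>i. \<bar>y $ i - c $ i\<bar> \<le> 1 / 2 ^ k"
      then show "\<bar>support_fun K y - p \<bullet> y\<bar> \<le> S" by (rule p(2))
    qed
    ultimately show ?thesis by linarith
  qed
  have sumI: "(\<Sum>i\<in>(\<Union>B\<in>SS. ?I B). f i) = (\<Sum>B\<in>SS. \<Sum>i\<in>?I B. f i)" for f :: "nat \<Rightarrow> real"
    using finS by (intro sum.UNION_disjoint) auto
  have "\<bar>\<Sum>i | i < n \<and> lab k (X i) \<in> SS \<and> X i \<in> A. ?D i\<bar> \<le> (\<Sum>B\<in>SS. \<bar>\<Sum>i\<in>?I B. ?D i\<bar>)"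
    unfolding un sumI by (rule sum_abs)
  also have "\<dots> \<le> (\<Sum>B\<in>SS. 2 * S * \<Lambda> * real (card (?I B)) powr ?\<theta>)" by (intro sum_mono each)
  also have "\<dots> = 2 * S * \<Lambda> * (\<Sum>B\<in>SS. real (card (?I B)) powr ?\<theta>)" by (simp add: sum_distrib_left)
  also have "\<dots> \<le> 2 * S * \<Lambda> * (2 * real (card SS) powr (1 - ?\<theta>) * N powr ?\<theta>)"
  proof (intro mult_left_mono sum_powr_le finS)
    have "(\<Sum>B\<in>SS. real (card (?I B))) = real (card {i. i < n \<and> lab k (X i) \<in> SS \<and> X i \<in> A})"
      unfolding un using sumI[of "\<lambda>_. 1"] by simp
    then show "(\<Sum>B\<in>SS. real (card (?I B))) \<le> N" using N by simp
  qed (use expo_bounds[OF d] S \<Lambda> in auto)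
  also have "\<dots> \<le> 2 * S * \<Lambda> * (2 * M powr (1 - ?\<theta>) * N powr ?\<theta>)"
    using M expo_bounds[OF d] S \<Lambda> by (intro mult_left_mono mult_right_mono powr_mono2) auto
  finally show ?thesis by simp
qed

lemma norm_le_l1_bound:
  fixes x :: "real ^ 'd::finite" and b :: real
  assumes "\<And>i. \<bar>x $ i\<bar> \<le> b"
  shows "norm x \<le> CARD('d) * b"
proof -
  have "norm x \<le> (\<Sum>i\<in>UNIV. \<bar>x $ i\<bar>)" by (rule norm_le_l1_cart)
  also have "\<dots> \<le> (\<Sum>i\<in>(UNIV::'d set). b)" by (intro sum_mono assms)
  finally show ?thesis by simp
qed

text \<open>The norm exceeds its tangent in the direction \<open>ch\<close> of \<open>c\<close> by
  at most (norm e)^2 / 2, and \<open>p\<close> is within 2 h of \<open>ch\<close>. Since the support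
  function of \<open>K\<close> lies below the norm, it is within a multiple of l^2 of its own
  supporting functional at \<open>c\<close>, for every box with side \<open>l\<close> at least
  \<open>h\<close>.\<close>

lemma tangent_gap:
  fixes c :: "real ^ 'd::finite"
  assumes K: "K \<in> convex_bodies"
    and sand: "\<And>x. (1 - 2 * h\<^sup>2) * norm x \<le> support_fun K x" "\<And>x. support_fun K x \<le> norm x"
    and p: "p \<in> K" "support_fun K c = p \<bullet> c" "norm p \<le> 1"
    and c: "\<bar>c $ j\<bar> = 1" "\<And>i. \<bar>c $ i\<bar> \<le> 2" and h: "0 \<le> h" "h \<le> l"
    and x: "x \<in> chart_cone j c (3 * l)"
  shows "support_fun K x - p \<bullet> x \<le> 15 * (real CARD('d))\<^sup>2 * l\<^sup>2"
proof -
  let ?D = "real CARD('d)"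
  have D1: "1 \<le> ?D" by (simp add: Suc_leI)
  have l0: "0 \<le> l" using h by simp
  define t where "t = \<bar>x $ j\<bar>"
  have t0: "t > 0" using x by (auto simp: t_def chart_cone_def)
  have t1: "t \<le> 1"
    using x component_le_norm_cart[of x j] by (simp add: t_def chart_cone_def)
  define y where "y = (1 / t) *\<^sub>R x"
  define e where "e = y - c"
  have xy: "x = t *\<^sub>R y" using t0 by (simp add: y_def)
  have e3: "\<bar>e $ i\<bar> \<le> 3 * l" for i
    using x by (simp add: e_def y_def t_def chart_cone_def)
  have ne: "norm e \<le> ?D * (3 * l)" by (rule norm_le_l1_bound[OF e3])
  have nc: "norm c \<le> ?D * 2" by (rule norm_le_l1_bound[OF c(2)])
  have nc1: "1 \<le> norm c" using component_le_norm_cart[of c j] c(1) by simp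
  define a where "a = norm c"
  define ch where "ch = (1 / a) *\<^sub>R c"
  have a: "1 \<le> a" "a \<le> 2 * ?D" using nc nc1 by (auto simp: a_def)
  have c0: "c \<noteq> 0" using nc1 by auto
  have nch: "norm ch = 1" using a c0 by (simp add: ch_def a_def)
  have ca: "c = a *\<^sub>R ch" using a by (simp add: ch_def)
  have yce: "y = c + e" by (simp add: e_def)
  have ny: "norm y \<le> ch \<bullet> y + (norm e)\<^sup>2 / 2"
  proof -
    have "(norm y)\<^sup>2 = a\<^sup>2 + 2 * (c \<bullet> e) + (norm e)\<^sup>2"
      unfolding yce a_def by (simp add: power2_norm_eq_inner inner_add_left inner_add_right inner_commute)
    moreover have "ch \<bullet> c = a" "c \<bullet> e = a * (ch \<bullet> e)"
      using a by (simp_all add: ch_def a_def power2_norm_eq_inner[symmetric] power2_eq_square)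
    ultimately have y2: "(norm y)\<^sup>2 = a\<^sup>2 + 2 * a * (ch \<bullet> e) + (norm e)\<^sup>2" and chy: "ch \<bullet> y = a + ch \<bullet> e"
      by (simp_all add: yce inner_add_right)
    have "2 * a * norm y \<le> a\<^sup>2 + (norm y)\<^sup>2"
      using zero_le_power2[of "a - norm y"] by (simp add: power2_eq_square algebra_simps)
    also have "\<dots> = 2 * a * (ch \<bullet> y) + (norm e)\<^sup>2" unfolding y2 chy by (simp add: power2_eq_square algebra_simps)
    also have "\<dots> \<le> 2 * a * (ch \<bullet> y) + a * (norm e)\<^sup>2"
      using a by (intro add_left_mono) (simp add: mult_le_cancel_right1)
    also have "\<dots> = 2 * a * (ch \<bullet> y + (norm e)\<^sup>2 / 2)" by (simp add: algebra_simps)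
    finally show ?thesis using a by simp
  qed
  have gapc: "(ch - p) \<bullet> c \<le> 2 * h\<^sup>2 * a"
  proof -
    have "(1 - 2 * h\<^sup>2) * a \<le> p \<bullet> c" using sand(1)[of c] p(2) by (simp add: a_def)
    moreover have "ch \<bullet> c = a" using a by (simp add: ch_def a_def power2_norm_eq_inner[symmetric] power2_eq_square)
    ultimately show ?thesis by (simp add: inner_diff_left algebra_simps)
  qed
  \<comment> \<open>A point of the unit ball whose inner product with a unit vector is at least 1 -
    2 h^2 lies within 2 h of that vector.\<close>
  have nchp: "norm (ch - p) \<le> 2 * h"
  proof -
    have "a * (1 - 2 * h\<^sup>2) \<le> a * (p \<bullet> ch)"
      using sand(1)[of c] p(2) by (simp add: a_def[symmetric]) (simp add: ca mult.commute)
    then have pc: "1 - 2 * h\<^sup>2 \<le> p \<bullet> ch" using a by simp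
    have "(norm (ch - p))\<^sup>2 = 1 - 2 * (p \<bullet> ch) + (norm p)\<^sup>2"
      using nch by (simp add: power2_norm_eq_inner inner_diff_left inner_diff_right inner_commute norm_eq_1)
    moreover have "(norm p)\<^sup>2 \<le> 1" using p(3) by (simp add: power_le_one)
    ultimately have "(norm (ch - p))\<^sup>2 \<le> (2 * h)\<^sup>2" using pc by (simp add: power2_eq_square)
    then show ?thesis using h by (rule_tac power2_le_imp_le) auto
  qed
  have "support_fun K y - p \<bullet> y \<le> norm y - p \<bullet> y" using sand(2)[of y] by simp
  also have "\<dots> \<le> (ch - p) \<bullet> c + (ch - p) \<bullet> e + (norm e)\<^sup>2 / 2"
    using ny by (simp add: yce inner_diff_left inner_add_right)
  also have "\<dots> \<le> 2 * h\<^sup>2 * a + (2 * h) * norm e + (norm e)\<^sup>2 / 2"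
  proof -
    have "(ch - p) \<bullet> e \<le> norm (ch - p) * norm e" by (rule norm_cauchy_schwarz)
    also have "\<dots> \<le> (2 * h) * norm e" using nchp by (intro mult_right_mono) auto
    finally show ?thesis using gapc by linarith
  qed
  also have "\<dots> \<le> 2 * l\<^sup>2 * (2 * ?D) + (2 * l) * (?D * (3 * l)) + (?D * (3 * l))\<^sup>2 / 2"
    using h a ne l0 D1 by (intro add_mono mult_mono divide_right_mono power_mono) auto
  also have "\<dots> = (10 * ?D + 9 / 2 * ?D\<^sup>2) * l\<^sup>2" by (simp add: power2_eq_square algebra_simps)
  also have "\<dots> \<le> 15 * ?D\<^sup>2 * l\<^sup>2"
  proof (rule mult_right_mono)
    have "?D * 1 \<le> ?D * ?D" using D1 by (intro mult_left_mono) auto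
    then show "10 * ?D + 9 / 2 * ?D\<^sup>2 \<le> 15 * ?D\<^sup>2" unfolding power2_eq_square using D1 by linarith
  qed simp
  finally have y_le: "support_fun K y - p \<bullet> y \<le> 15 * ?D\<^sup>2 * l\<^sup>2" .
  have "support_fun K x - p \<bullet> x = t * (support_fun K y - p \<bullet> y)"
    using support_fun_scale[OF K, of t y] t0 by (simp add: xy right_diff_distrib)
  also have "\<dots> \<le> 1 * (15 * ?D\<^sup>2 * l\<^sup>2)"
    using t0 t1 y_le support_fun_ge[OF K p(1), of y] by (intro mult_mono) auto
  finally show ?thesis by simp
qed

text \<open>For \<open>G\<close> this is \<open>box_bound\<close>, since G - p exceeds the energy
  function G - K by an amount between 0 and \<tau>. For \<open>K\<close> the gap itself suffices,
  after \<open>y\<close> has been scaled into the part of the cone inside the unit ball.\<close>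

lemma sup_level:
  fixes c :: "real ^ 'd::finite"
  assumes K: "K \<in> convex_bodies" and G: "G \<in> convex_bodies"
    and fin: "finite_measure (energy (\<lambda>x. support_fun G x - support_fun K x))"
    and p: "p \<in> K"
    and c: "\<bar>c $ j\<bar> = 1" "\<And>i. \<bar>c $ i\<bar> \<le> 2" and l: "0 < l" "l \<le> 1" and tau: "0 \<le> \<tau>"
    and gap: "\<And>x. x \<in> chart_cone j c (3 * l) \<Longrightarrow> support_fun K x - p \<bullet> x \<le> \<tau>"
    and I: "measure (energy (\<lambda>x. support_fun G x - support_fun K x)) (chart_cone j c (3 * l)) \<le> w\<^sup>2 * l ^ (CARD('d) - 1)"
    and w: "0 \<le> w"
    and y: "y $ j = c $ j" "\<And>i. \<bar>y $ i - c $ i\<bar> \<le> 2 * l"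
  shows "\<bar>support_fun G y - p \<bullet> y\<bar> \<le> box_const CARD('d) * (\<tau> + w)" "\<bar>support_fun K y - p \<bullet> y\<bar> \<le> box_const CARD('d) * (\<tau> + w)"
proof -
  let ?f = "\<lambda>x. support_fun G x - support_fun K x"
  let ?u = "\<lambda>x. support_fun G x - p \<bullet> x"
  have D1: "1 \<le> real CARD('d)" by (simp add: Suc_leI)
  have "\<bar>?u y\<bar> \<le> box_const CARD('d) * (\<tau> + sqrt (measure (energy ?f) (chart_cone j c (3 * l)) / l ^ (CARD('d) - 1)))"
  proof (rule box_bound[OF fin _ _ _ c l tau _ y])
    show "?f \<in> borel_measurable borel" using support_fun_measurable[OF K] support_fun_measurable[OF G] by measurable
    fix x
    obtain q where q: "support_fun G x = q \<bullet> x" "\<And>y. q \<bullet> y \<le> support_fun G y" using support_fun_touch[OF G] by blast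
    have "support_fun G x - p \<bullet> x + (q - p) \<bullet> (y - x) \<le> support_fun G y - p \<bullet> y" for y
      using q(1) q(2)[of y] by (simp add: inner_diff_left inner_diff_right)
    then show "\<exists>q. \<forall>y. support_fun G x - p \<bullet> x + q \<bullet> (y - x) \<le> support_fun G y - p \<bullet> y" by blast
  next
    fix a :: real and x :: "real ^ 'd" assume "0 \<le> a"
    then show "support_fun G (a *\<^sub>R x) - p \<bullet> a *\<^sub>R x = a * (support_fun G x - p \<bullet> x)"
      by (simp add: support_fun_scale[OF G] right_diff_distrib)
  next
    fix x assume "x \<in> chart_cone j c (3 * l)"
    then show "support_fun G x - support_fun K x \<le> support_fun G x - p \<bullet> x \<and>
         support_fun G x - p \<bullet> x - \<tau> \<le> support_fun G x - support_fun K x"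
      using gap[of x] support_fun_ge[OF K p, of x] by auto
  qed
  also have "sqrt (measure (energy ?f) (chart_cone j c (3 * l)) / l ^ (CARD('d) - 1)) \<le> w"
    using I l w by (intro real_le_lsqrt) (auto simp: field_simps)
  finally show "\<bar>?u y\<bar> \<le> box_const CARD('d) * (\<tau> + w)"
    using box_const_pos[of "CARD('d)"] by (simp add: mult_left_mono)
  define lam where "lam = 1 / (16 * real CARD('d))"
  have lam: "0 < lam" "lam \<le> 1 / 16" using D1 by (auto simp: lam_def field_simps)
  have y4: "\<bar>y $ i\<bar> \<le> 4" for i using y(2)[of i] c(2)[of i] l by linarith
  have "norm y \<le> real CARD('d) * 4" by (rule norm_le_l1_bound[OF y4])
  then have "norm (lam *\<^sub>R y) \<le> lam * (CARD('d) * 4)" using lam by simp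
  also have "\<dots> < 1" using D1 by (simp add: lam_def)
  finally have in1: "lam *\<^sub>R y \<in> ball 0 1" by simp
  have "lam * l \<le> lam * 1" using lam l by (intro mult_left_mono) auto
  then have "lam *\<^sub>R y \<in> chart_cone j c (3 * l)"
    using in1 lam l by (intro ball_subset_chart_cone[OF c(1) y y4, where lam = lam and r = "lam * l / 20"]) auto
  then have "support_fun K (lam *\<^sub>R y) - p \<bullet> (lam *\<^sub>R y) \<le> \<tau>" by (rule gap)
  then have "lam * (support_fun K y - p \<bullet> y) \<le> \<tau>"
    using lam by (simp add: support_fun_scale[OF K] right_diff_distrib)
  then have "support_fun K y - p \<bullet> y \<le> 16 * real CARD('d) * \<tau>" using D1 by (simp add: lam_def field_simps)
  also have "\<dots> \<le> box_const CARD('d) * \<tau>"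
    using tau by (intro mult_right_mono) (auto simp: box_const_def algebra_simps)
  also have "\<dots> \<le> box_const CARD('d) * (\<tau> + w)" using w box_const_pos[of "CARD('d)"] by (intro mult_left_mono) auto
  finally show "\<bar>support_fun K y - p \<bullet> y\<bar> \<le> box_const CARD('d) * (\<tau> + w)"
    using support_fun_ge[OF K p, of y] by simp
qed

text \<open>The number of boxes of level \<open>k\<close>, raised to the power 2 / m, is 4^k up to
  constants. This cancels the size 4^(-k) of the functions on these boxes and makes all scales
  equally important.\<close>

lemma pow_beta: "6 \<le> D \<Longrightarrow> ((2 ^ k) ^ (D - 1) :: real) powr (1 - expo D) = 4 ^ k"
proof -
  assume D: "6 \<le> D"
  have "((2 ^ k) ^ (D - 1) :: real) = 2 powr (real k * real (D - 1))"
    by (simp add: powr_realpow flip: power_mult of_nat_mult)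
  then have "((2 ^ k) ^ (D - 1) :: real) powr (1 - expo D) = 2 powr (real k * real (D - 1) * (1 - expo D))"
    by (simp add: powr_powr)
  also have "real k * real (D - 1) * (1 - expo D) = real (2 * k)" using D by (simp add: expo_def of_nat_diff)
  also have "2 powr real (2 * k) = (4::real) ^ k" by (subst powr_realpow) (auto simp: power_mult)
  finally show ?thesis .
qed

lemma powr_le_self: "1 \<le> x \<Longrightarrow> b \<le> 1 \<Longrightarrow> x powr b \<le> (x::real)"
  using powr_mono[of b 1 x] by simp

definition upper_const :: "nat \<Rightarrow> real" where
  "upper_const D = 4 * (box_const D * (60 * (real D)\<^sup>2 + 4)) * (real D * 7 ^ D + 2 * real D * 3 ^ D)"

lemma labsD:
  assumes "(j, c) \<in> labs k"
  shows "\<bar>c $ j\<bar> = 1" "\<bar>c $ i\<bar> \<le> 2"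
proof -
  obtain x where "x \<noteq> 0" "j = face x" "c = cen k x" using assms by (auto simp: labs_def lab_def)
  then show "\<bar>c $ j\<bar> = 1" "\<bar>c $ i\<bar> \<le> 2" by (simp_all add: abs_cen_face abs_cen_le)
qed

lemma descend:
  fixes x :: "real ^ 'd::finite"
  assumes x: "x \<noteq> 0" and k: "k' < k" and y: "y $ face x = cen k x $ face x" "\<And>i. \<bar>y $ i - cen k x $ i\<bar> \<le> 1 / 2 ^ k"
  shows "y $ face x = cen k' x $ face x" "\<bar>y $ i - cen k' x $ i\<bar> \<le> 2 * (1 / 2 ^ k')"
proof -
  show "y $ face x = cen k' x $ face x" using y(1) by (simp add: cen_face)
  have "1 / 2 ^ k \<le> (1 / 2 ^ Suc k' :: real)" using k by (intro two_power_le) simp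
  then have "1 / 2 ^ k \<le> (1 / 2) * (1 / 2 ^ k' :: real)" by simp
  moreover have "\<bar>cen k x $ i - cen k' x $ i\<bar> \<le> (1 / 2) * (1 / 2 ^ k) + (1 / 2) * (1 / 2 ^ k')" using cen_cen[OF x, of k i k'] by simp
  moreover have "0 \<le> 1 / (2::real) ^ k'" by simp
  ultimately show "\<bar>y $ i - cen k' x $ i\<bar> \<le> 2 * (1 / 2 ^ k')" using y(2)[of i] by linarith
qed

text \<open>A property of points that is constant on boxes becomes membership of the label in a set
  of labels, which is the form that \<open>noise_boxes\<close> expects.\<close>

lemma lab_class_iff:
  assumes "\<And>x y. lab k x = lab k y \<Longrightarrow> Q x = Q y" "x0 \<noteq> 0"
  shows "lab k x0 \<in> {B \<in> labs k. \<exists>x. x \<noteq> 0 \<and> lab k x = B \<and> Q x} \<longleftrightarrow> Q x0"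
proof
  assume "lab k x0 \<in> {B \<in> labs k. \<exists>x. x \<noteq> 0 \<and> lab k x = B \<and> Q x}"
  then obtain x where "lab k x = lab k x0" "Q x" by blast
  then show "Q x0" using assms(1) by metis
next
  assume "Q x0"
  moreover have "lab k x0 \<in> labs k" using assms(2) by (simp add: labs_def)
  ultimately show "lab k x0 \<in> {B \<in> labs k. \<exists>x. x \<noteq> 0 \<and> lab k x = B \<and> Q x}" using assms(2) by blast
qed

text \<open>
  Each point is assigned to the coarsest dyadic box in which the energy is large, or to a box at the
  finest scale if there is none. A box selected in this way inherits the sup-norm bound from its
  parent, and the number of selected boxes is controlled by the total energy.
\<close>

theorem noise_upper_bound:
  fixes X :: "nat \<Rightarrow> real ^ 'd::finite" and K G :: "(real ^ 'd) set"
  assumes d: "6 \<le> CARD('d)"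
    and K: "K \<in> convex_bodies" "K \<subseteq> cball 0 1" and G: "G \<in> convex_bodies"
    and sand: "\<And>x. (1 - 2 * (1 / 2 ^ J)\<^sup>2) * norm x \<le> support_fun K x" "\<And>x. support_fun K x \<le> norm x"
    and fin: "finite_measure (energy (\<lambda>x. support_fun G x - support_fun K x))"
    and E: "measure (energy (\<lambda>x. support_fun G x - support_fun K x)) UNIV = E" "E \<le> 1"
    and X: "\<And>i. i < n \<Longrightarrow> X i \<noteq> 0"
    and lin: "\<And>j c. (j, c) \<in> labs (J + q) - LL \<Longrightarrow> \<exists>p\<in>K. \<forall>x\<in>chart_cone j c (3 / 2 ^ (J + q)). support_fun K x = p \<bullet> x"
    and Lay: "Lay = {x. lab (J + q) x \<in> LL}" and q: "0 < q"
    and ok: "noise_ok n X \<xi> Lay (J + q) \<Lambda>" and \<Lambda>: "0 \<le> \<Lambda>"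
    and nL: "real (card {i. i < n \<and> X i \<in> Lay}) \<le> nL" and a: "0 < a" "a \<le> 1"
  shows "(\<Sum>i<n. \<xi> i * (support_fun G (X i) - support_fun K (X i))) \<le>
    upper_const CARD('d) * \<Lambda> *
     ((real J + 1) * ((E * 16 ^ J) powr (1 - expo CARD('d)) * real n powr expo CARD('d)) + nL powr expo CARD('d)
       + 4 ^ q * (E * 16 ^ J / a) powr (1 - expo CARD('d)) * real n powr expo CARD('d)
       + 4 ^ q * sqrt a * real n powr expo CARD('d))"
proof -
  let ?D = "CARD('d)"
  let ?f = "\<lambda>x. support_fun G x - support_fun K x"
  define \<theta> where "\<theta> = expo ?D"
  define \<beta> where "\<beta> = 1 - \<theta>"
  have \<theta>: "0 < \<theta>" "\<theta> < 1" "0 < \<beta>" "\<beta> \<le> 1" using expo_bounds[OF d] by (auto simp: \<theta>_def \<beta>_def)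
  define T where "T i = \<xi> i * ?f (X i)" for i
  define bc where "bc = box_const ?D"
  have bc0: "0 < bc" unfolding bc_def by (rule box_const_pos) simp
  define M where "M k B = measure (energy ?f) (chart_cone (fst B) (snd B) (3 / 2 ^ k))" for k :: nat and B :: "'d \<times> (real ^ 'd)"
  interpret finite_measure "energy ?f" by fact
  have E0: "0 \<le> E" using E(1) by auto
  have M0: "0 \<le> M k B" for k B by (simp add: M_def)
  have ME: "M k B \<le> E" for k B unfolding M_def E(1)[symmetric] by (intro finite_measure_mono) auto
  \<comment> \<open>At side l the threshold is l^4 l^(D - 1). Below it \<open>sup_level\<close>
    applies with w = l^2, the size of the curvature gap of \<open>tangent_gap\<close>.\<close>
  define bad where "bad k x \<longleftrightarrow> (1 / 2 ^ k) ^ (?D + 3) < M k (lab k x)" for k x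
  have bad_lab: "bad k' x = bad k' y" if "lab k x = lab k y" "k' \<le> k" for k k' x y
    using lab_coarsen[OF that] by (simp add: bad_def)
  define Cs where "Cs = bc * (60 * (real ?D)\<^sup>2 + 4)"
  define Co where "Co = real ?D * 7 ^ ?D"
  define Cl where "Cl = 2 * real ?D * 3 ^ ?D"
  have D1: "1 \<le> real ?D" by (simp add: Suc_leI)
  have Cs0: "0 < Cs" "bc \<le> Cs"
  proof -
    have "0 < 60 * (real ?D)\<^sup>2 + 4" by (intro add_nonneg_pos) auto
    then show "0 < Cs" unfolding Cs_def using bc0 by simp
    have "bc * 1 \<le> bc * (60 * (real ?D)\<^sup>2 + 4)" using bc0 by (intro mult_left_mono) auto
    then show "bc \<le> Cs" by (simp add: Cs_def)
  qed
  have Co1: "1 \<le> Co"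
    unfolding Co_def using D1 mult_mono[of 1 "real ?D" 1 "7 ^ ?D"] by simp
  have Cl1: "1 \<le> Cl"
  proof -
    have "1 \<le> 2 * real ?D" using D1 by linarith
    then have "1 * 1 \<le> (2 * real ?D) * 3 ^ ?D" by (intro mult_mono) auto
    then show ?thesis by (simp add: Cl_def)
  qed
  have UC: "upper_const ?D = 4 * Cs * (Co + Cl)" by (simp add: upper_const_def Cs_def Co_def Cl_def bc_def)
  have I_sum: "(\<Sum>B\<in>SS. M k B) \<le> Co * E" if "SS \<subseteq> labs k" for SS k
    using sum_energy_labs[OF fin that] by (simp add: M_def Co_def E(1) case_prod_beta)
  have count: "real (card SS) * b \<le> Co * E" if "SS \<subseteq> labs k" "\<And>B. B \<in> SS \<Longrightarrow> b \<le> M k B" for SS k b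
  proof -
    have "real (card SS) * b = (\<Sum>B\<in>SS. b)" by simp
    also have "\<dots> \<le> (\<Sum>B\<in>SS. M k B)" by (intro sum_mono that)
    finally show ?thesis using I_sum[OF that(1)] by simp
  qed
  \<comment> \<open>The bound at a level \<open>k'\<close> that is not bad also covers the smaller
    box of level \<open>k\<close>, because that box lies in the doubled box of level
    \<open>k'\<close>.\<close>
  have anc: "\<exists>p. \<forall>y. y $ j = c $ j \<longrightarrow> (\<forall>i. \<bar>y $ i - c $ i\<bar> \<le> 1 / 2 ^ k) \<longrightarrow>
         \<bar>support_fun G y - p \<bullet> y\<bar> \<le> Cs / 4 / 4 ^ k' \<and> \<bar>support_fun K y - p \<bullet> y\<bar> \<le> Cs / 4 / 4 ^ k'"
    if x: "x \<noteq> 0" "lab k x = (j, c)" and k: "k' \<le> k" "k' \<le> J" and nb: "\<not> bad k' x" for j c x k k'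
  proof -
    define l where "l = (1 / 2 ^ k' :: real)"
    have l: "0 < l" "l \<le> 1" "(1 / 2 ^ J :: real) \<le> l"
      using two_power_le[OF k(2)] two_power_le[of 0 k'] by (auto simp: l_def)
    have c': "\<bar>cen k' x $ j\<bar> = 1" "\<bar>cen k' x $ i\<bar> \<le> 2" for i
      using x abs_cen_face[OF x(1)] abs_cen_le[OF x(1)] by (auto simp: lab_def)
    obtain p where p: "p \<in> K" "support_fun K (cen k' x) = p \<bullet> cen k' x" using support_fun_touch[OF K(1)] by blast
    have np: "norm p \<le> 1" using p(1) K(2) by auto
    have tau: "support_fun K z - p \<bullet> z \<le> 15 * (real ?D)\<^sup>2 * l\<^sup>2" if "z \<in> chart_cone j (cen k' x) (3 * l)" for z
      by (rule tangent_gap[OF K(1) sand p np c' _ l(3) that]) simp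
    have e: "3 / 2 ^ k' = 3 * l" by (simp add: l_def)
    have Ml: "measure (energy ?f) (chart_cone j (cen k' x) (3 * l)) \<le> (l\<^sup>2)\<^sup>2 * l ^ (?D - 1)"
    proof -
      have "measure (energy ?f) (chart_cone j (cen k' x) (3 * l)) \<le> l ^ (?D + 3)"
        using nb x by (simp add: bad_def M_def lab_def l_def not_less)
      also have "?D + 3 = 2 * 2 + (?D - 1)" using d by simp
      finally show ?thesis by (simp only: power_add power_mult)
    qed
    have S: "bc * (15 * (real ?D)\<^sup>2 * l\<^sup>2 + l\<^sup>2) = Cs / 4 / 4 ^ k'"
    proof -
      have "l\<^sup>2 = 1 / 4 ^ k'" by (simp add: l_def power_divide power2_eq_square flip: power_mult_distrib)
      then show ?thesis by (simp add: Cs_def field_simps)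
    qed
    have "\<bar>support_fun G y - p \<bullet> y\<bar> \<le> Cs / 4 / 4 ^ k' \<and> \<bar>support_fun K y - p \<bullet> y\<bar> \<le> Cs / 4 / 4 ^ k'"
      if y: "y $ j = c $ j" "\<forall>i. \<bar>y $ i - c $ i\<bar> \<le> 1 / 2 ^ k" for y
    proof -
      have jc: "j = face x" "c = cen k x" using x(2) by (auto simp: lab_def)
      have y': "y $ j = cen k' x $ j \<and> (\<forall>i. \<bar>y $ i - cen k' x $ i\<bar> \<le> 2 * l)"
      proof (cases "k' = k")
        case True
        have "\<bar>y $ i - cen k' x $ i\<bar> \<le> 2 * l" for i
          using y(2)[rule_format, of i] l(1) True by (simp add: jc l_def)
        then show ?thesis using y(1) True by (simp add: jc)
      next
        case False
        then have "k' < k" using k by simp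
        from descend[OF x(1) this] y jc show ?thesis by (auto simp: l_def)
      qed
      have l2: "0 \<le> l\<^sup>2" "0 \<le> 15 * (real ?D)\<^sup>2 * l\<^sup>2" by auto
      note sl = sup_level[OF K(1) G fin p(1) c' l(1,2) l2(2) tau Ml l2(1) conjunct1[OF y'] conjunct2[OF y', rule_format]]
      show ?thesis using sl unfolding bc_def[symmetric] S by blast
    qed
    then show ?thesis by blast
  qed

  \<comment> \<open>The classes of sample points and their contributions\<close>
  define st where "st k x \<longleftrightarrow> bad k x \<and> (\<forall>k'<k. \<not> bad k' x)" for k x
  define Sk where "Sk k = {B \<in> labs k. \<exists>x. x \<noteq> 0 \<and> lab k x = B \<and> st k x}" for k
  define un where "un x \<longleftrightarrow> (\<forall>k\<le>J. \<not> bad k x)" for x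
  have lab_in: "lab k (X i) \<in> labs k" if "i < n" for i k using X[OF that] by (simp add: labs_def)
  have st_lab: "st k x = st k y" if "lab k x = lab k y" for k x y
    using bad_lab[OF that] by (auto simp: st_def)
  have un_lab: "un x = un y" if "lab k x = lab k y" "J \<le> k" for k x y
    using bad_lab[OF that(1)] that(2) by (auto simp: un_def)
  have Sk_iff: "lab k (X i) \<in> Sk k \<longleftrightarrow> st k (X i)" if "i < n" for i k
    unfolding Sk_def by (rule lab_class_iff[OF _ X[OF that]]) (rule st_lab)
  define nn where "nn = real n powr \<theta>"
  have nn0: "0 \<le> nn" by (simp add: nn_def)
  have pb: "((2 ^ k) ^ (?D - 1) :: real) powr \<beta> = 4 ^ k" for k
    unfolding \<beta>_def \<theta>_def by (rule pow_beta[OF d])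
  have cardn: "real (card {i. i < n \<and> P i}) \<le> real n" for P
    using card_mono[of "{..<n}" "{i. i < n \<and> P i}"] by auto
  define Z where "Z = (E * 16 ^ J) powr \<beta>"
  have Z0: "0 \<le> Z" by (simp add: Z_def)
  \<comment> \<open>Level 0 never stops, since its threshold is 1. At other levels the energy bounds
    the proportion of bad boxes by a multiple of E 16^k, and the functions have the size 4^(-(k -
    1)) inherited from the parent. By \<open>pow_beta\<close> the level cancels and only E 16^J is
    left.\<close>
  have stage1: "\<bar>\<Sum>i | i < n \<and> st k (X i). T i\<bar> \<le> 4 * Cs * \<Lambda> * Co * (Z * nn)" if k: "k \<le> J" for k
  proof (cases k)
    case 0
    have "\<not> bad 0 x" for x using ME[of 0 "lab 0 x"] E(2) by (simp add: bad_def)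
    then have "{i. i < n \<and> st k (X i)} = {}" by (auto simp: st_def 0)
    moreover have "0 \<le> 4 * Cs * \<Lambda> * Co * (Z * nn)" using Cs0 \<Lambda> Co1 Z0 nn0 by simp
    ultimately show ?thesis by (simp only: sum.empty abs_zero)
  next
    case (Suc k')
    have e: "{i. i < n \<and> st k (X i)} = {i. i < n \<and> lab k (X i) \<in> Sk k \<and> X i \<in> UNIV}" using Sk_iff by auto
    define b where "b = (1 / 2 ^ k :: real) ^ (?D + 3)"
    have b0: "b > 0" by (simp add: b_def)
    have cb: "real (card (Sk k)) * b \<le> Co * E"
      by (rule count[of _ k]) (auto simp: Sk_def st_def bad_def b_def)
    have b_eq: "1 / b = 16 ^ k * (2 ^ k) ^ (?D - 1)"
    proof -
      have "1 / b = (2 ^ k) ^ (?D + 3)" by (simp add: b_def power_divide)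
      also have "?D + 3 = 4 + (?D - 1)" using d by simp
      also have "(2 ^ k :: real) ^ (4 + (?D - 1)) = (2 ^ k) ^ 4 * (2 ^ k) ^ (?D - 1)" by (rule power_add)
      also have "(2 ^ k :: real) ^ 4 = (2 ^ 4) ^ k" by (metis power_mult mult.commute)
      finally show ?thesis by simp
    qed
    have cM: "real (card (Sk k)) \<le> Co * (E * 16 ^ J) * (2 ^ k) ^ (?D - 1)"
    proof -
      have "real (card (Sk k)) \<le> Co * E * (1 / b)" using cb b0 by (simp add: field_simps)
      also have "\<dots> = Co * (E * 16 ^ k) * (2 ^ k) ^ (?D - 1)" by (simp add: b_eq)
      also have "\<dots> \<le> Co * (E * 16 ^ J) * (2 ^ k) ^ (?D - 1)"
        using k Co1 E0 by (intro mult_right_mono mult_left_mono power_increasing) auto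
      finally show ?thesis .
    qed
    have "\<bar>\<Sum>i | i < n \<and> st k (X i). T i\<bar> \<le> 4 * (Cs / 4 / 4 ^ k') * \<Lambda> * (Co * (E * 16 ^ J) * (2 ^ k) ^ (?D - 1)) powr (1 - expo ?D) * real n powr expo ?D"
      unfolding e T_def
    proof (rule noise_boxes[OF d ok _ _ _ X \<Lambda> G K(1) _ _ cardn cM])
      fix j c assume "(j, c) \<in> Sk k"
      then obtain x where x: "x \<noteq> 0" "lab k x = (j, c)" "st k x" by (auto simp: Sk_def)
      have "\<not> bad k' x" using x(3) Suc by (simp add: st_def)
      then show "\<exists>p. \<forall>y. y $ j = c $ j \<longrightarrow> (\<forall>i. \<bar>y $ i - c $ i\<bar> \<le> 1 / 2 ^ k) \<longrightarrow>
         \<bar>support_fun G y - p \<bullet> y\<bar> \<le> Cs / 4 / 4 ^ k' \<and> \<bar>support_fun K y - p \<bullet> y\<bar> \<le> Cs / 4 / 4 ^ k'"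
        using anc[OF x(1,2)] Suc k by simp
    qed (use k Cs0 in \<open>auto simp: Sk_def\<close>)
    also have "(Co * (E * 16 ^ J) * (2 ^ k) ^ (?D - 1)) powr (1 - expo ?D) = Co powr \<beta> * Z * 4 ^ k"
      using pb[of k] Co1 E0 by (simp add: powr_mult Z_def \<beta>_def \<theta>_def)
    also have "4 * (Cs / 4 / 4 ^ k') * \<Lambda> * (Co powr \<beta> * Z * 4 ^ k) * real n powr expo ?D = 4 * Cs * \<Lambda> * Co powr \<beta> * (Z * nn)"
      by (simp add: Suc nn_def \<theta>_def)
    also have "\<dots> \<le> 4 * Cs * \<Lambda> * Co * (Z * nn)"
      using powr_le_self[OF Co1 \<theta>(4)] Cs0 \<Lambda> Z0 nn0 by (intro mult_right_mono mult_left_mono) auto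
    finally show ?thesis .
  qed
  have S4: "Cs / 4 / 4 ^ J > 0" using Cs0 by simp
  have cl: "real (card SS) \<le> Cl * (2 ^ k) ^ (?D - 1)" if "SS \<subseteq> labs k" for SS :: "('d \<times> (real ^ 'd)) set" and k
  proof -
    have "real (card SS) \<le> real (card (labs k :: ('d \<times> (real ^ 'd)) set))"
      using card_mono[OF card_labs(1) that] by (simp only: of_nat_le_iff)
    also have "\<dots> \<le> Cl * (2 ^ k) ^ (?D - 1)" using card_labs(2)[where 'd='d, of k] by (simp only: Cl_def of_nat_mult of_nat_power of_nat_numeral)
    finally show ?thesis .
  qed
  \<comment> \<open>In the layer no more than the curvature size 4^(-J) is available; the saving is
    the small number of sample points. The boxes used are those of level J.\<close>
  have stage2: "\<bar>\<Sum>i | i < n \<and> un (X i) \<and> X i \<in> Lay. T i\<bar> \<le> 4 * Cs * \<Lambda> * Cl * nL powr \<theta>"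
  proof -
    define SL where "SL = {B \<in> labs J. \<exists>x. x \<noteq> 0 \<and> lab J x = B \<and> un x}"
    have "lab J (X i) \<in> SL \<longleftrightarrow> un (X i)" if "i < n" for i
      unfolding SL_def by (rule lab_class_iff[OF _ X[OF that]]) (rule un_lab, auto)
    then have e: "{i. i < n \<and> un (X i) \<and> X i \<in> Lay} = {i. i < n \<and> lab J (X i) \<in> SL \<and> X i \<in> Lay}" by blast
    have nL': "real (card {i. i < n \<and> lab J (X i) \<in> SL \<and> X i \<in> Lay}) \<le> nL"
    proof -
      have "card {i. i < n \<and> lab J (X i) \<in> SL \<and> X i \<in> Lay} \<le> card {i. i < n \<and> X i \<in> Lay}"
        by (intro card_mono) auto
      then show ?thesis using nL by linarith
    qed
    have "\<bar>\<Sum>i | i < n \<and> un (X i) \<and> X i \<in> Lay. T i\<bar> \<le> 4 * (Cs / 4 / 4 ^ J) * \<Lambda> * (Cl * (2 ^ J) ^ (?D - 1)) powr (1 - expo ?D) * nL powr expo ?D"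
      unfolding e T_def
    proof (rule noise_boxes[OF d ok _ _ _ X \<Lambda> G K(1) S4 _ nL' cl])
      fix j c assume "(j, c) \<in> SL"
      then obtain x where x: "x \<noteq> 0" "lab J x = (j, c)" "un x" by (auto simp: SL_def)
      then show "\<exists>p. \<forall>y. y $ j = c $ j \<longrightarrow> (\<forall>i. \<bar>y $ i - c $ i\<bar> \<le> 1 / 2 ^ J) \<longrightarrow>
         \<bar>support_fun G y - p \<bullet> y\<bar> \<le> Cs / 4 / 4 ^ J \<and> \<bar>support_fun K y - p \<bullet> y\<bar> \<le> Cs / 4 / 4 ^ J"
        using anc[OF x(1,2), of J] by (simp add: un_def)
    qed (auto simp: SL_def)
    also have "(Cl * (2 ^ J) ^ (?D - 1)) powr (1 - expo ?D) = Cl powr \<beta> * 4 ^ J"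
      using pb[of J] Cl1 by (simp add: powr_mult \<beta>_def \<theta>_def)
    also have "4 * (Cs / 4 / 4 ^ J) * \<Lambda> * (Cl powr \<beta> * 4 ^ J) * nL powr expo ?D = Cs * \<Lambda> * Cl powr \<beta> * nL powr \<theta>"
      by (simp add: \<theta>_def)
    also have "\<dots> \<le> 4 * Cs * \<Lambda> * Cl * nL powr \<theta>"
      using powr_le_self[OF Cl1 \<theta>(4)] Cs0 \<Lambda> by (intro mult_right_mono mult_mono) auto
    finally show ?thesis .
  qed
  \<comment> \<open>A second threshold, for the fine boxes on which \<open>K\<close> is linear.
    There the curvature gap vanishes and energy below the threshold forces the size sqrt a / 4^J.
    The parameter \<open>a\<close> balances the number of boxes above the threshold
    (\<open>stage3\<close>) against the size below it (\<open>stage4\<close>).\<close>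
  define big where "big x \<longleftrightarrow> a * (1 / 2 ^ (J + q)) ^ (?D - 1) / 16 ^ J < M (J + q) (lab (J + q) x)" for x
  have stage3: "\<bar>\<Sum>i | i < n \<and> un (X i) \<and> X i \<notin> Lay \<and> big (X i). T i\<bar> \<le> 4 * Cs * \<Lambda> * Co * (4 ^ q * (E * 16 ^ J / a) powr \<beta> * nn)"
  proof -
    define SB where "SB = {B \<in> labs (J + q). \<exists>x. x \<noteq> 0 \<and> lab (J + q) x = B \<and> un x \<and> x \<notin> Lay \<and> big x}"
    have "lab (J + q) (X i) \<in> SB \<longleftrightarrow> un (X i) \<and> X i \<notin> Lay \<and> big (X i)" if "i < n" for i
      unfolding SB_def
    proof (rule lab_class_iff[OF _ X[OF that]])
      fix x y :: "real ^ 'd" assume xy: "lab (J + q) x = lab (J + q) y"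
      show "(un x \<and> x \<notin> Lay \<and> big x) = (un y \<and> y \<notin> Lay \<and> big y)"
        using un_lab[OF xy] xy by (simp add: Lay big_def)
    qed
    then have e: "{i. i < n \<and> un (X i) \<and> X i \<notin> Lay \<and> big (X i)} = {i. i < n \<and> lab (J + q) (X i) \<in> SB \<and> X i \<in> UNIV}" by blast
    define b where "b = a * (1 / 2 ^ (J + q)) ^ (?D - 1) / 16 ^ J"
    have b0: "b > 0" using a by (simp add: b_def)
    have cb: "real (card SB) * b \<le> Co * E"
      by (rule count[of _ "J + q"]) (auto simp: SB_def big_def b_def)
    have cM: "real (card SB) \<le> Co * (E * 16 ^ J / a) * (2 ^ (J + q)) ^ (?D - 1)"
    proof -
      have "real (card SB) \<le> Co * E * (1 / b)" using cb b0 by (simp add: field_simps)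
      also have "1 / b = 16 ^ J / a * (2 ^ (J + q)) ^ (?D - 1)" using a by (simp add: b_def power_divide field_simps)
      finally show ?thesis by simp
    qed
    have "\<bar>\<Sum>i | i < n \<and> un (X i) \<and> X i \<notin> Lay \<and> big (X i). T i\<bar> \<le> 4 * (Cs / 4 / 4 ^ J) * \<Lambda> * (Co * (E * 16 ^ J / a) * (2 ^ (J + q)) ^ (?D - 1)) powr (1 - expo ?D) * real n powr expo ?D"
      unfolding e T_def
    proof (rule noise_boxes[OF d ok _ _ _ X \<Lambda> G K(1) S4 _ cardn cM])
      fix j c assume "(j, c) \<in> SB"
      then obtain x where x: "x \<noteq> 0" "lab (J + q) x = (j, c)" "un x" by (auto simp: SB_def)
      then show "\<exists>p. \<forall>y. y $ j = c $ j \<longrightarrow> (\<forall>i. \<bar>y $ i - c $ i\<bar> \<le> 1 / 2 ^ (J + q)) \<longrightarrow>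
         \<bar>support_fun G y - p \<bullet> y\<bar> \<le> Cs / 4 / 4 ^ J \<and> \<bar>support_fun K y - p \<bullet> y\<bar> \<le> Cs / 4 / 4 ^ J"
        using anc[OF x(1,2), of J] by (simp add: un_def)
    qed (auto simp: SB_def)
    also have "(Co * (E * 16 ^ J / a) * (2 ^ (J + q)) ^ (?D - 1)) powr (1 - expo ?D) = Co powr \<beta> * (E * 16 ^ J / a) powr \<beta> * 4 ^ (J + q)"
    proof -
      define Y where "Y = E * 16 ^ J / a"
      have "0 \<le> Y" using E0 a by (simp add: Y_def)
      then show ?thesis unfolding Y_def[symmetric] using pb[of "J + q"] Co1 by (simp add: powr_mult \<beta>_def \<theta>_def)
    qed
    also have "4 * (Cs / 4 / 4 ^ J) * \<Lambda> * (Co powr \<beta> * (E * 16 ^ J / a) powr \<beta> * 4 ^ (J + q)) * real n powr expo ?D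
       = Cs * \<Lambda> * Co powr \<beta> * (4 ^ q * (E * 16 ^ J / a) powr \<beta> * nn)"
      by (simp add: nn_def \<theta>_def power_add)
    also have "\<dots> \<le> 4 * Cs * \<Lambda> * Co * (4 ^ q * (E * 16 ^ J / a) powr \<beta> * nn)"
      using powr_le_self[OF Co1 \<theta>(4)] Cs0 \<Lambda> nn0 by (intro mult_right_mono mult_mono) auto
    finally show ?thesis .
  qed
  have stage4: "\<bar>\<Sum>i | i < n \<and> un (X i) \<and> X i \<notin> Lay \<and> \<not> big (X i). T i\<bar> \<le> 4 * Cs * \<Lambda> * Cl * (4 ^ q * sqrt a * nn)"
  proof -
    define SG where "SG = {B \<in> labs (J + q). \<exists>x. x \<noteq> 0 \<and> lab (J + q) x = B \<and> un x \<and> x \<notin> Lay \<and> \<not> big x}"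
    have "lab (J + q) (X i) \<in> SG \<longleftrightarrow> un (X i) \<and> X i \<notin> Lay \<and> \<not> big (X i)" if "i < n" for i
      unfolding SG_def
    proof (rule lab_class_iff[OF _ X[OF that]])
      fix x y :: "real ^ 'd" assume xy: "lab (J + q) x = lab (J + q) y"
      show "(un x \<and> x \<notin> Lay \<and> \<not> big x) = (un y \<and> y \<notin> Lay \<and> \<not> big y)"
        using un_lab[OF xy] xy by (simp add: Lay big_def)
    qed
    then have e: "{i. i < n \<and> un (X i) \<and> X i \<notin> Lay \<and> \<not> big (X i)} = {i. i < n \<and> lab (J + q) (X i) \<in> SG \<and> X i \<in> UNIV}" by blast
    define l where "l = (1 / 2 ^ (J + q) :: real)"
    have l: "0 < l" "l \<le> 1" using two_power_le[of 0 "J + q"] by (auto simp: l_def)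
    define w where "w = sqrt a / 4 ^ J"
    have w0: "0 < w" using a by (simp add: w_def)
    have w2: "w\<^sup>2 = a / 16 ^ J" using a by (simp add: w_def power_divide power2_eq_square flip: power_mult_distrib)
    have bw: "0 < bc * w" using bc0 w0 by simp
    have bd: "\<exists>p. \<forall>y. y $ j = c $ j \<longrightarrow> (\<forall>i. \<bar>y $ i - c $ i\<bar> \<le> 1 / 2 ^ (J + q)) \<longrightarrow>
         \<bar>support_fun G y - p \<bullet> y\<bar> \<le> bc * w \<and> \<bar>support_fun K y - p \<bullet> y\<bar> \<le> bc * w" if jc: "(j, c) \<in> SG" for j c
    proof -
      obtain x where x: "x \<noteq> 0" "lab (J + q) x = (j, c)" "x \<notin> Lay" "\<not> big x" "(j, c) \<in> labs (J + q)" using jc by (auto simp: SG_def)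
      then have "(j, c) \<in> labs (J + q) - LL" by (auto simp: Lay)
      from lin[OF this] obtain p where p: "p \<in> K" "\<And>z. z \<in> chart_cone j c (3 * l) \<Longrightarrow> support_fun K z = p \<bullet> z"
        by (auto simp: l_def)
      have gap: "support_fun K z - p \<bullet> z \<le> 0" if "z \<in> chart_cone j c (3 * l)" for z using p(2)[OF that] by simp
      have Ml: "measure (energy ?f) (chart_cone j c (3 * l)) \<le> w\<^sup>2 * l ^ (?D - 1)"
        using x(2,4) by (simp add: big_def M_def w2 l_def not_less)
      have "\<bar>support_fun G y - p \<bullet> y\<bar> \<le> bc * w \<and> \<bar>support_fun K y - p \<bullet> y\<bar> \<le> bc * w"
        if y: "y $ j = c $ j" "\<forall>i. \<bar>y $ i - c $ i\<bar> \<le> 1 / 2 ^ (J + q)" for y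
      proof -
        have y2: "\<bar>y $ i - c $ i\<bar> \<le> 2 * l" for i using y(2)[rule_format, of i] l by (simp add: l_def)
        note sl = sup_level[OF K(1) G fin p(1) labsD(1)[OF x(5)] labsD(2)[OF x(5)] l order_refl gap Ml less_imp_le[OF w0] y(1) y2]
        show ?thesis using sl unfolding bc_def[symmetric] by simp
      qed
      then show ?thesis by blast
    qed
    have "\<bar>\<Sum>i | i < n \<and> un (X i) \<and> X i \<notin> Lay \<and> \<not> big (X i). T i\<bar> \<le> 4 * (bc * w) * \<Lambda> * (Cl * (2 ^ (J + q)) ^ (?D - 1)) powr (1 - expo ?D) * real n powr expo ?D"
      unfolding e T_def by (rule noise_boxes[OF d ok _ _ _ X \<Lambda> G K(1) bw bd cardn cl]) (auto simp: SG_def)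
    also have "(Cl * (2 ^ (J + q)) ^ (?D - 1)) powr (1 - expo ?D) = Cl powr \<beta> * 4 ^ (J + q)"
      using pb[of "J + q"] Cl1 by (simp add: powr_mult \<beta>_def \<theta>_def)
    also have "4 * (bc * w) * \<Lambda> * (Cl powr \<beta> * 4 ^ (J + q)) * real n powr expo ?D = 4 * bc * \<Lambda> * Cl powr \<beta> * (4 ^ q * sqrt a * nn)"
      by (simp add: nn_def \<theta>_def w_def power_add)
    also have "\<dots> \<le> 4 * Cs * \<Lambda> * Cl * (4 ^ q * sqrt a * nn)"
      using powr_le_self[OF Cl1 \<theta>(4)] Cs0 bc0 \<Lambda> nn0 a by (intro mult_right_mono mult_mono) auto
    finally show ?thesis .
  qed

  \<comment> \<open>Summation over the classes\<close>
  have split: "{..<n} = (\<Union>k\<in>{..J}. {i. i < n \<and> st k (X i)}) \<union> {i. i < n \<and> un (X i)}"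
  proof -
    have "un x \<or> (\<exists>k\<le>J. st k x)" for x
    proof (rule disjCI)
      assume "\<not> (\<exists>k\<le>J. st k x)"
      then have ns: "\<not> st k x" if "k \<le> J" for k using that by blast
      have "\<not> bad k x" if "k \<le> J" for k
        using that
      proof (induction k rule: less_induct)
        case (less k)
        then show ?case using ns[of k] by (auto simp: st_def)
      qed
      then show "un x" by (simp add: un_def)
    qed
    then show ?thesis by blast
  qed
  have "(\<Sum>i<n. T i) = (\<Sum>i\<in>(\<Union>k\<in>{..J}. {i. i < n \<and> st k (X i)}). T i) + (\<Sum>i | i < n \<and> un (X i). T i)"
    unfolding split by (rule sum.union_disjoint) (auto simp: st_def un_def)
  also have "(\<Sum>i\<in>(\<Union>k\<in>{..J}. {i. i < n \<and> st k (X i)}). T i) = (\<Sum>k\<le>J. \<Sum>i | i < n \<and> st k (X i). T i)"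
    by (rule sum.UNION_disjoint) (auto simp: st_def, metis linorder_neqE_nat)
  also have "(\<Sum>i | i < n \<and> un (X i). T i) = (\<Sum>i | i < n \<and> un (X i) \<and> X i \<in> Lay. T i) + (\<Sum>i | i < n \<and> un (X i) \<and> X i \<notin> Lay. T i)"
    by (subst sum.union_disjoint[symmetric]) (auto intro!: sum.cong)
  also have "(\<Sum>i | i < n \<and> un (X i) \<and> X i \<notin> Lay. T i) =
     (\<Sum>i | i < n \<and> un (X i) \<and> X i \<notin> Lay \<and> big (X i). T i) + (\<Sum>i | i < n \<and> un (X i) \<and> X i \<notin> Lay \<and> \<not> big (X i). T i)"
    by (subst sum.union_disjoint[symmetric]) (auto intro!: sum.cong)
  finally have total: "(\<Sum>i<n. T i) = (\<Sum>k\<le>J. \<Sum>i | i < n \<and> st k (X i). T i) + ((\<Sum>i | i < n \<and> un (X i) \<and> X i \<in> Lay. T i)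
     + ((\<Sum>i | i < n \<and> un (X i) \<and> X i \<notin> Lay \<and> big (X i). T i) + (\<Sum>i | i < n \<and> un (X i) \<and> X i \<notin> Lay \<and> \<not> big (X i). T i)))" .
  have "(\<Sum>k\<le>J. \<Sum>i | i < n \<and> st k (X i). T i) \<le> (\<Sum>k\<le>J. 4 * Cs * \<Lambda> * Co * (Z * nn))"
    using stage1 by (intro sum_mono) (metis abs_le_D1 atMost_iff)
  also have "\<dots> = 4 * Cs * \<Lambda> * Co * ((real J + 1) * (Z * nn))" by simp
  finally have t1: "(\<Sum>k\<le>J. \<Sum>i | i < n \<and> st k (X i). T i) \<le> 4 * Cs * \<Lambda> * Co * ((real J + 1) * (Z * nn))" .
  define W where "W = 4 * Cs * \<Lambda> * (Co + Cl)"
  have W: "4 * Cs * \<Lambda> * Co \<le> W" "4 * Cs * \<Lambda> * Cl \<le> W"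
    unfolding W_def using Cs0 \<Lambda> Co1 Cl1 by (auto intro!: mult_left_mono)
  have "(\<Sum>i<n. T i) \<le> W * ((real J + 1) * (Z * nn)) + (W * nL powr \<theta>
     + (W * (4 ^ q * (E * 16 ^ J / a) powr \<beta> * nn) + W * (4 ^ q * sqrt a * nn)))"
    unfolding total
  proof (intro add_mono)
    show "(\<Sum>k\<le>J. \<Sum>i | i < n \<and> st k (X i). T i) \<le> W * ((real J + 1) * (Z * nn))"
      by (rule order_trans[OF t1 mult_right_mono[OF W(1)]]) (use Z0 nn0 in simp)
    show "(\<Sum>i | i < n \<and> un (X i) \<and> X i \<in> Lay. T i) \<le> W * nL powr \<theta>"
      by (rule order_trans[OF abs_le_D1[OF stage2] mult_right_mono[OF W(2)]]) simp
    show "(\<Sum>i | i < n \<and> un (X i) \<and> X i \<notin> Lay \<and> big (X i). T i) \<le> W * (4 ^ q * (E * 16 ^ J / a) powr \<beta> * nn)"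
      by (rule order_trans[OF abs_le_D1[OF stage3] mult_right_mono[OF W(1)]]) (use nn0 in simp)
    show "(\<Sum>i | i < n \<and> un (X i) \<and> X i \<notin> Lay \<and> \<not> big (X i). T i) \<le> W * (4 ^ q * sqrt a * nn)"
      by (rule order_trans[OF abs_le_D1[OF stage4] mult_right_mono[OF W(2)]]) (use nn0 a in simp)
  qed
  then show ?thesis
    unfolding T_def UC W_def Z_def nn_def \<beta>_def \<theta>_def by (simp add: algebra_simps)
qed

section \<open>Tail bounds in the regression model\<close>

abbreviation std_gauss :: "real measure" where
  "std_gauss \<equiv> density lborel std_normal_density"

lemma sets_observation_law [simp, measurable_cong]: "sets (observation_law P K) = sets (borel \<Otimes>\<^sub>M borel)"
  by (simp add: observation_law_def)

lemma space_observation_law [simp]: "space (observation_law P K) = UNIV"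
  by (simp add: observation_law_def space_pair_measure)

lemma prob_space_std_gauss: "prob_space std_gauss"
  by (rule prob_space_normal_density) simp

definition resid :: "'a::euclidean_space set \<Rightarrow> 'a \<times> real \<Rightarrow> real" where
  "resid K w = snd w - support_fun K (fst w)"

locale obs_model =
  fixes P :: "(real ^ 'd::finite) measure" and K :: "(real ^ 'd) set"
  assumes P: "prob_space P" and sets_P [measurable_cong]: "sets P = sets borel" and K: "K \<in> convex_bodies"
begin

abbreviation O_law where "O_law \<equiv> observation_law P K"

lemma F_meas [measurable]: "support_fun K \<in> borel_measurable borel"
  by (rule support_fun_measurable[OF K])

lemma resid_meas [measurable]: "resid K \<in> borel_measurable (borel \<Otimes>\<^sub>M borel)"
  unfolding resid_def by measurable

lemma nn_integral_obs:
  assumes [measurable]: "f \<in> borel_measurable (borel \<Otimes>\<^sub>M borel)"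
  shows "(\<integral>\<^sup>+w. f w \<partial>O_law) = (\<integral>\<^sup>+x. \<integral>\<^sup>+\<xi>. f (x, support_fun K x + \<xi>) \<partial>std_gauss \<partial>P)"
proof -
  interpret N: prob_space std_gauss by (rule prob_space_std_gauss)
  interpret P: prob_space P by (rule P)
  interpret PN: pair_prob_space P std_gauss ..
  have "(\<integral>\<^sup>+w. f w \<partial>O_law) = (\<integral>\<^sup>+v. f (case v of (x, \<xi>) \<Rightarrow> (x, support_fun K x + \<xi>)) \<partial>(P \<Otimes>\<^sub>M std_gauss))"
    unfolding observation_law_def by (subst nn_integral_distr) measurable
  also have "\<dots> = (\<integral>\<^sup>+x. \<integral>\<^sup>+\<xi>. f (case (x, \<xi>) of (x, \<xi>) \<Rightarrow> (x, support_fun K x + \<xi>)) \<partial>std_gauss \<partial>P)"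
    by (rule N.nn_integral_fst[symmetric]) measurable
  finally show ?thesis by simp
qed

lemma prob_space_obs: "prob_space O_law"
proof
  interpret N: prob_space std_gauss by (rule prob_space_std_gauss)
  interpret P: prob_space P by (rule P)
  have "emeasure O_law (space O_law) = (\<integral>\<^sup>+w. 1 \<partial>O_law)" by simp
  also have "\<dots> = 1" by (subst nn_integral_obs) (simp_all add: N.emeasure_space_1[simplified] P.emeasure_space_1)
  finally show "emeasure O_law (space O_law) = 1" .
qed

sublocale O: prob_space O_law by (rule prob_space_obs)

sublocale OP: product_prob_space "\<lambda>_::nat. O_law" by standard

lemma prob_space_sample: "prob_space (sample_law P n K)"
  by (rule prob_space_sample_law[OF P sets_P K])

lemma sets_sample [measurable_cong]: "sets (sample_law P n K) = sets (\<Pi>\<^sub>M i\<in>{..<n}. borel \<Otimes>\<^sub>M borel)"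
  unfolding sample_law_def by (intro sets_PiM_cong) auto

lemma coord_meas [measurable]: "i < n \<Longrightarrow> (\<lambda>\<omega>. \<omega> i) \<in> sample_law P n K \<rightarrow>\<^sub>M borel \<Otimes>\<^sub>M borel"
  unfolding measurable_cong_sets[OF sets_sample refl] by measurable

lemma nn_integral_sample_prod:
  assumes "f \<in> borel_measurable (borel \<Otimes>\<^sub>M borel)"
  shows "(\<integral>\<^sup>+\<omega>. (\<Prod>i<n. f (\<omega> i)) \<partial>sample_law P n K) = (\<integral>\<^sup>+w. f w \<partial>O_law) ^ n"
  unfolding sample_law_def using assms
  by (subst OP.product_nn_integral_prod) (auto simp: measurable_cong_sets[OF sets_observation_law refl])

lemma exp_gauss: "(\<integral>\<^sup>+\<xi>. ennreal (exp (a * \<xi> - a\<^sup>2 / 2)) \<partial>std_gauss) = 1"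
proof -
  interpret N: prob_space "density lborel (normal_density a 1)" by (rule prob_space_normal_density) simp
  have "(\<integral>\<^sup>+\<xi>. ennreal (exp (a * \<xi> - a\<^sup>2 / 2)) \<partial>std_gauss)
      = (\<integral>\<^sup>+\<xi>. ennreal (normal_density a 1 \<xi>) \<partial>lborel)"
    by (subst nn_integral_density)
      (auto intro!: nn_integral_cong simp: normal_density_def power2_eq_square field_simps simp flip: ennreal_mult exp_add)
  also have "\<dots> = emeasure (density lborel (normal_density a 1)) (space (density lborel (normal_density a 1)))"
    by (subst emeasure_density) auto
  finally show ?thesis by (simp only: N.emeasure_space_1)
qed

lemma exp_obs:
  assumes [measurable]: "g \<in> borel_measurable borel"
  shows "(\<integral>\<^sup>+w. ennreal (exp (resid K w * g (fst w) - (g (fst w))\<^sup>2 / 2)) \<partial>O_law) = 1"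
proof -
  interpret P: prob_space P by (rule P)
  have "(\<integral>\<^sup>+w. ennreal (exp (resid K w * g (fst w) - (g (fst w))\<^sup>2 / 2)) \<partial>O_law)
     = (\<integral>\<^sup>+x. \<integral>\<^sup>+\<xi>. ennreal (exp (g x * \<xi> - (g x)\<^sup>2 / 2)) \<partial>std_gauss \<partial>P)"
    by (subst nn_integral_obs) (auto simp: resid_def mult.commute)
  also have "\<dots> = 1" by (simp add: exp_gauss P.emeasure_space_1)
  finally show ?thesis .
qed

text \<open>Chernoff's bound: by independence the exponential moment of the sum is a product of
  factors at most 1.\<close>

lemma markov_exp:
  assumes [measurable]: "h \<in> borel_measurable (borel \<Otimes>\<^sub>M borel)"
    and le: "(\<integral>\<^sup>+w. ennreal (exp (h w)) \<partial>O_law) \<le> 1"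
  shows "emeasure (sample_law P n K) {\<omega> \<in> space (sample_law P n K). L \<le> (\<Sum>i<n. h (\<omega> i))} \<le> ennreal (exp (- L))"
proof -
  let ?S = "sample_law P n K"
  have [measurable]: "(\<lambda>\<omega>. \<Sum>i<n. h (\<omega> i)) \<in> borel_measurable ?S"
    by (intro borel_measurable_sum measurable_compose[OF coord_meas]) auto
  have "emeasure ?S {\<omega> \<in> space ?S. L \<le> (\<Sum>i<n. h (\<omega> i))}
      = (\<integral>\<^sup>+\<omega>. indicator {\<omega> \<in> space ?S. L \<le> (\<Sum>i<n. h (\<omega> i))} \<omega> \<partial>?S)"
    by (subst nn_integral_indicator) auto
  also have "\<dots> \<le> (\<integral>\<^sup>+\<omega>. ennreal (exp (- L)) * (\<Prod>i<n. ennreal (exp (h (\<omega> i)))) \<partial>?S)"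
  proof (rule nn_integral_mono)
    fix \<omega>
    have "1 \<le> exp (- L) * exp (\<Sum>i<n. h (\<omega> i))" if "L \<le> (\<Sum>i<n. h (\<omega> i))"
      using that by (simp flip: exp_add)
    moreover have "ennreal (exp (- L)) * (\<Prod>i<n. ennreal (exp (h (\<omega> i)))) = ennreal (exp (- L) * exp (\<Sum>i<n. h (\<omega> i)))"
      by (simp add: exp_sum ennreal_mult prod_ennreal prod_nonneg)
    ultimately show "indicator {\<omega> \<in> space ?S. L \<le> (\<Sum>i<n. h (\<omega> i))} \<omega> \<le> ennreal (exp (- L)) * (\<Prod>i<n. ennreal (exp (h (\<omega> i))))"
      by (auto simp: indicator_def simp flip: ennreal_1 intro!: ennreal_leI)
  qed
  also have "\<dots> = ennreal (exp (- L)) * (\<integral>\<^sup>+\<omega>. (\<Prod>i<n. ennreal (exp (h (\<omega> i)))) \<partial>?S)"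
  proof (rule nn_integral_cmult)
    have "(\<lambda>\<omega>. \<Prod>i<n. ennreal (exp (h (\<omega> i)))) = (\<lambda>\<omega>. ennreal (exp (\<Sum>i<n. h (\<omega> i))))"
      by (simp add: prod_ennreal exp_sum)
    then show "(\<lambda>\<omega>. \<Prod>i<n. ennreal (exp (h (\<omega> i)))) \<in> borel_measurable ?S" by simp
  qed
  also have "(\<integral>\<^sup>+\<omega>. (\<Prod>i<n. ennreal (exp (h (\<omega> i)))) \<partial>?S) = (\<integral>\<^sup>+w. ennreal (exp (h w)) \<partial>O_law) ^ n"
    by (rule nn_integral_sample_prod) measurable
  also have "\<dots> \<le> 1" using power_mono[OF le, of n] by simp
  finally show ?thesis by (simp add: mult_left_mono)
qed

lemma sum_filter:
  "(\<Sum>i | i < n \<and> Q i. f i) = (\<Sum>i<n. if Q i then f i else (0::real))" for n :: nat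
proof -
  have "{i. i < n \<and> Q i} = {..<n} \<inter> {i. Q i}" by auto
  then show ?thesis by (simp add: sum.inter_restrict)
qed

text \<open>The deviation is normalised by the random number of design points in \<open>A\<close>. A
  union over the possible values 1, ..., n costs the factor \<open>n\<close> and lets the Chernoff
  parameter be tuned to each value.\<close>

lemma subgaussian_tail:
  assumes [measurable]: "g \<in> borel_measurable borel" "A \<in> sets borel"
    and b: "0 < b" "\<And>x. x \<in> A \<Longrightarrow> \<bar>g x\<bar> \<le> b" and L: "0 < L"
  shows "emeasure (sample_law P n K) {\<omega> \<in> space (sample_law P n K).
      3 / 2 * b * sqrt (real (card {i. i < n \<and> fst (\<omega> i) \<in> A}) * L)
        < (\<Sum>i | i < n \<and> fst (\<omega> i) \<in> A. resid K (\<omega> i) * g (fst (\<omega> i)))} \<le> ennreal (n * exp (- L))"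
proof -
  let ?S = "sample_law P n K"
  \<comment> \<open>With this parameter the linear term is at least 3 L / 2 on the event and the
    quadratic term at most L / 2, which leaves the exponent \<open>L\<close>. This is the origin of
    the factor 3 / 2.\<close>
  define lam where "lam k = sqrt L / (b * sqrt (real k))" for k :: nat
  define h where "h k w = resid K w * (lam k * g (fst w) * indicator A (fst w)) - (lam k * g (fst w) * indicator A (fst w))\<^sup>2 / 2" for k w
  have hm [measurable]: "h k \<in> borel_measurable (borel \<Otimes>\<^sub>M borel)" for k unfolding h_def by measurable
  have [measurable]: "(\<lambda>\<omega>. \<Sum>i<n. h k (\<omega> i)) \<in> borel_measurable ?S" for k
    by (intro borel_measurable_sum measurable_compose[OF coord_meas]) auto
  define E where "E k = {\<omega> \<in> space ?S. L \<le> (\<Sum>i<n. h k (\<omega> i))}" for k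
  have Em: "E k \<in> sets ?S" for k unfolding E_def by measurable
  have EL: "emeasure ?S (E k) \<le> ennreal (exp (- L))" for k
    unfolding E_def
  proof (rule markov_exp[OF hm])
    show "(\<integral>\<^sup>+w. ennreal (exp (h k w)) \<partial>O_law) \<le> 1"
      unfolding h_def by (subst exp_obs) auto
  qed
  let ?T = "{\<omega> \<in> space ?S. 3 / 2 * b * sqrt (real (card {i. i < n \<and> fst (\<omega> i) \<in> A}) * L)
        < (\<Sum>i | i < n \<and> fst (\<omega> i) \<in> A. resid K (\<omega> i) * g (fst (\<omega> i)))}"
  have sub: "?T \<subseteq> (\<Union>k\<in>{1..n}. E k)"
  proof
    fix \<omega> assume \<omega>: "\<omega> \<in> ?T"
    define k where "k = card {i. i < n \<and> fst (\<omega> i) \<in> A}"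
    define s where "s = (\<Sum>i | i < n \<and> fst (\<omega> i) \<in> A. resid K (\<omega> i) * g (fst (\<omega> i)))"
    have s: "3 / 2 * b * sqrt (real k * L) < s" using \<omega> by (simp add: k_def s_def)
    have kn: "k \<le> n" using card_mono[of "{..<n}" "{i. i < n \<and> fst (\<omega> i) \<in> A}"] by (auto simp: k_def)
    have k1: "1 \<le> k"
    proof (rule ccontr)
      assume "\<not> 1 \<le> k"
      then have "k = 0" by simp
      then have "{i. i < n \<and> fst (\<omega> i) \<in> A} = {}" by (simp add: k_def)
      then have "s = 0" unfolding s_def by (simp only: sum.empty)
      with s \<open>k = 0\<close> show False by simp
    qed
    then have sk: "sqrt (real k) > 0" "sqrt L > 0" using L by auto
    have "(\<Sum>i<n. h k (\<omega> i)) = lam k * s - (lam k)\<^sup>2 / 2 * (\<Sum>i | i < n \<and> fst (\<omega> i) \<in> A. (g (fst (\<omega> i)))\<^sup>2)"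
      unfolding s_def sum_filter sum_distrib_left sum_subtractf[symmetric]
      by (intro sum.cong refl) (simp add: h_def power_mult_distrib)
    moreover have "(\<Sum>i | i < n \<and> fst (\<omega> i) \<in> A. (g (fst (\<omega> i)))\<^sup>2) \<le> (\<Sum>i | i < n \<and> fst (\<omega> i) \<in> A. b\<^sup>2)"
      using b by (intro sum_mono) (auto simp: abs_le_square_iff[symmetric])
    then have "(lam k)\<^sup>2 / 2 * (\<Sum>i | i < n \<and> fst (\<omega> i) \<in> A. (g (fst (\<omega> i)))\<^sup>2) \<le> (lam k)\<^sup>2 / 2 * (real k * b\<^sup>2)"
      by (intro mult_left_mono) (auto simp: k_def)
    moreover have "(lam k)\<^sup>2 / 2 * (real k * b\<^sup>2) = L / 2"
      using sk b L k1 by (simp add: lam_def power_divide power_mult_distrib)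
    moreover have "lam k * (3 / 2 * b * sqrt (real k * L)) \<le> lam k * s"
      using s b sk by (intro mult_left_mono) (auto simp: lam_def)
    moreover have "lam k * (3 / 2 * b * sqrt (real k * L)) = 3 / 2 * L"
      using sk b L by (simp add: lam_def real_sqrt_mult)
    ultimately have "L \<le> (\<Sum>i<n. h k (\<omega> i))" by linarith
    then have "\<omega> \<in> E k" using \<omega> by (simp add: E_def)
    then show "\<omega> \<in> (\<Union>k\<in>{1..n}. E k)" using k1 kn by auto
  qed
  have "emeasure ?S ?T \<le> emeasure ?S (\<Union>k\<in>{1..n}. E k)" using sub Em by (intro emeasure_mono) auto
  also have "\<dots> \<le> (\<Sum>k\<in>{1..n}. emeasure ?S (E k))" using Em by (intro emeasure_subadditive_finite) auto
  also have "\<dots> \<le> (\<Sum>k\<in>{1..n}. ennreal (exp (- L)))" by (intro sum_mono EL)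
  also have "\<dots> = ennreal (n * exp (- L))" by (simp add: ennreal_mult ennreal_of_nat_eq_real_of_nat)
  finally show ?thesis .
qed

text \<open>Centring at 2 brings the exponential moment below 1: the expectation of exp |\<xi>| is
  at most 2 exp (1 / 2), and 2 \<le> exp (3 / 2).\<close>

lemma abs_tail:
  assumes [measurable]: "A \<in> sets borel"
  shows "emeasure (sample_law P n K) {\<omega> \<in> space (sample_law P n K).
     L \<le> (\<Sum>i | i < n \<and> fst (\<omega> i) \<in> A. \<bar>resid K (\<omega> i)\<bar> - 2)} \<le> ennreal (exp (- L))"
proof -
  interpret P: prob_space P by (rule P)
  define h where "h w = (\<bar>resid K w\<bar> - 2) * indicator A (fst w)" for w
  have hm [measurable]: "h \<in> borel_measurable (borel \<Otimes>\<^sub>M borel)" unfolding h_def by measurable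
  have e: "(\<Sum>i | i < n \<and> fst (\<omega> i) \<in> A. \<bar>resid K (\<omega> i)\<bar> - 2) = (\<Sum>i<n. h (\<omega> i))" for \<omega>
    unfolding sum_filter by (intro sum.cong refl) (simp add: h_def)
  have e2: "2 \<le> exp (3 / 2 :: real)"
    using exp_ge_add_one_self[of "3 / 2 :: real"] by simp
  have "(\<integral>\<^sup>+w. ennreal (exp (h w)) \<partial>O_law) \<le> 1"
  proof -
    have gm: "(\<integral>\<^sup>+\<xi>. ennreal (exp (\<bar>\<xi>\<bar> - 2)) \<partial>std_gauss) \<le> 1"
    proof -
      have "(\<integral>\<^sup>+\<xi>. ennreal (exp (\<bar>\<xi>\<bar> - 2)) \<partial>std_gauss)
          \<le> (\<integral>\<^sup>+\<xi>. ennreal (exp (- 3 / 2)) * (ennreal (exp (1 * \<xi> - 1\<^sup>2 / 2)) + ennreal (exp ((- 1) * \<xi> - (- 1)\<^sup>2 / 2))) \<partial>std_gauss)"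
      proof (rule nn_integral_mono)
        fix \<xi> :: real
        have "exp (- 3 / 2) * (exp (1 * \<xi> - 1\<^sup>2 / 2) + exp ((- 1) * \<xi> - (- 1)\<^sup>2 / 2)) = exp (\<xi> - 2) + exp (- \<xi> - 2)"
          by (simp add: distrib_left flip: exp_add)
        moreover have "exp (\<bar>\<xi>\<bar> - 2) \<le> exp (\<xi> - 2) + exp (- \<xi> - 2)"
          by (cases "0 \<le> \<xi>") (auto simp: add_increasing add_increasing2)
        ultimately have "exp (\<bar>\<xi>\<bar> - 2) \<le> exp (- 3 / 2) * (exp (1 * \<xi> - 1\<^sup>2 / 2) + exp ((- 1) * \<xi> - (- 1)\<^sup>2 / 2))" by simp
        then show "ennreal (exp (\<bar>\<xi>\<bar> - 2)) \<le> ennreal (exp (- 3 / 2)) * (ennreal (exp (1 * \<xi> - 1\<^sup>2 / 2)) + ennreal (exp ((- 1) * \<xi> - (- 1)\<^sup>2 / 2)))"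
          by (simp flip: ennreal_mult ennreal_plus add: ennreal_leI del: minus_mult_left)
      qed
      also have "\<dots> = ennreal (exp (- 3 / 2)) * ((\<integral>\<^sup>+\<xi>. ennreal (exp (1 * \<xi> - 1\<^sup>2 / 2)) \<partial>std_gauss) + (\<integral>\<^sup>+\<xi>. ennreal (exp ((- 1) * \<xi> - (- 1)\<^sup>2 / 2)) \<partial>std_gauss))"
        by (subst nn_integral_cmult, measurable, subst nn_integral_add) auto
      also have "\<dots> = ennreal (exp (- 3 / 2) * 2)"
        unfolding exp_gauss by (simp add: ennreal_mult)
      also have "\<dots> \<le> 1" using e2 by (simp add: exp_minus field_simps)
      finally show ?thesis .
    qed
    have "(\<integral>\<^sup>+w. ennreal (exp (h w)) \<partial>O_law) = (\<integral>\<^sup>+x. \<integral>\<^sup>+\<xi>. ennreal (exp ((\<bar>\<xi>\<bar> - 2) * indicator A x)) \<partial>std_gauss \<partial>P)"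
      by (subst nn_integral_obs) (auto simp: h_def resid_def)
    also have "\<dots> \<le> (\<integral>\<^sup>+x. 1 \<partial>P)"
    proof (rule nn_integral_mono)
      interpret N: prob_space std_gauss by (rule prob_space_std_gauss)
      fix x
      show "(\<integral>\<^sup>+\<xi>. ennreal (exp ((\<bar>\<xi>\<bar> - 2) * indicator A x)) \<partial>std_gauss) \<le> 1"
        using gm N.emeasure_space_1 by (cases "x \<in> A") auto
    qed
    also have "\<dots> = 1" by (simp add: P.emeasure_space_1)
    finally show ?thesis .
  qed
  from markov_exp[OF hm this, of n L] show ?thesis by (simp only: e)
qed

end

section \<open>Chaining for fixed data, and the probability that it applies\<close>

lemma powr_base_le: "0 < p \<Longrightarrow> 0 \<le> b \<Longrightarrow> a powr p \<le> b powr p \<Longrightarrow> a \<le> (b::real)"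
  by (meson not_le powr_less_mono2)

text \<open>The chain stops at the first level \<open>S\<close> with 2^(S m) at least N = card I.
  The remainder 4^(-S) N is then at most N^(1 - 2 / m). Level s contributes sqrt N 2^(s (m / 2 - 2))
  up to the factor sqrt V; for m \<ge> 5 this increases with s and has the order N^(1 - 2 / m) at s
  = S.\<close>

lemma chain_bound:
  fixes z :: "'b \<Rightarrow> real ^ 'd::finite"
  assumes d: "6 \<le> CARD('d)" and I: "finite I" "I \<noteq> {}"
    and z: "\<And>i. i \<in> I \<Longrightarrow> z i \<in> cube j" and \<rho>: "\<And>i. i \<in> I \<Longrightarrow> 0 \<le> \<rho> i \<and> \<rho> i \<le> 1"
    and u: "u \<in> cvx_class j" and Smax: "card I \<le> 2 ^ (Smax * (CARD('d) - 1))" and V: "0 \<le> V"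
    and net: "\<And>s g. s \<le> Smax \<Longrightarrow> g \<in> inc_net j s \<Longrightarrow>
      \<bar>\<Sum>i\<in>I. \<xi> i * (\<rho> i * g (z i))\<bar> \<le> 3 / 2 * (5 / 4 ^ s) * sqrt (real (card I) * (V * 2 ^ (s * (CARD('d) - 1))))"
    and ab: "(\<Sum>i\<in>I. \<bar>\<xi> i\<bar>) \<le> (2 + L) * real (card I)" and L: "0 \<le> L"
  shows "\<bar>\<Sum>i\<in>I. \<xi> i * (\<rho> i * u (z i))\<bar> \<le> ((real Smax + 1) * (15 / 2) * sqrt V * 2 ^ CARD('d) + 2 + L) * real (card I) powr expo CARD('d)"
proof -
  define m where "m = CARD('d) - 1"
  define N where "N = real (card I)"
  have m: "5 \<le> m" "real m = real CARD('d) - 1" using d by (auto simp: m_def of_nat_diff)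
  have N1: "1 \<le> N" using I by (simp add: N_def Suc_le_eq card_gt_0_iff)
  define S where "S = (LEAST s. card I \<le> 2 ^ (s * m))"
  have S1: "card I \<le> 2 ^ (S * m)" unfolding S_def using Smax[folded m_def] by (rule LeastI)
  have S2: "S \<le> Smax" unfolding S_def using Smax[folded m_def] by (rule Least_le)
  define a where "a = N powr (1 / m)"
  have a1: "1 \<le> a" unfolding a_def using N1 by (intro ge_one_powr_ge_zero) auto
  have am: "a powr m = N" unfolding a_def using N1 m by (simp add: powr_powr)
  have pw: "2 ^ (s * m) = ((2::real) ^ s) powr m" for s
    by (simp add: powr_realpow power_mult)
  have S_ge: "a \<le> 2 ^ S"
  proof -
    have "N \<le> 2 ^ (S * m)" using S1 unfolding N_def by (metis of_nat_le_iff of_nat_numeral of_nat_power)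
    then have "a powr m \<le> (2 ^ S) powr m" unfolding am pw .
    then show ?thesis by (rule powr_base_le[rotated 2]) (use a1 m in auto)
  qed
  have S_le: "2 ^ S \<le> 2 * a"
  proof (cases S)
    case 0
    then show ?thesis using a1 by simp
  next
    case (Suc t)
    have "\<not> card I \<le> 2 ^ (t * m)" using not_less_Least[of t "\<lambda>s. card I \<le> 2 ^ (s * m)"] Suc by (simp add: S_def)
    then have "2 ^ (t * m) \<le> N" unfolding N_def by (metis linear of_nat_le_iff of_nat_numeral of_nat_power)
    then have "(2 ^ t) powr m \<le> a powr m" unfolding am pw .
    then have "2 ^ t \<le> a" by (rule powr_base_le[rotated 2]) (use a1 m in auto)
    then show ?thesis by (simp add: Suc)
  qed
  define e where "e = real m / 2 - 2"
  have m5: "5 \<le> real m" using m(1) by simp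
  have e0: "0 < e" "e \<le> real CARD('d)" using m5 m(2) unfolding e_def by linarith+
  have level: "(1 / 4 ^ s) * sqrt (2 ^ (s * m)) \<le> 2 ^ CARD('d) * a powr e" if s: "s \<le> S" for s
  proof -
    have "(1 / 4 ^ s) * sqrt (2 ^ (s * m)) = (2 ^ s) powr e"
    proof -
      have "(4::real) ^ s = (2 ^ s) powr 2" by (simp add: power2_eq_square flip: power_mult_distrib)
      moreover have "sqrt (2 ^ (s * m)) = ((2::real) ^ s) powr (m / 2)"
        unfolding pw by (simp add: powr_half_sqrt[symmetric] powr_powr)
      ultimately show ?thesis by (simp add: e_def powr_diff)
    qed
    also have "\<dots> \<le> (2 * a) powr e"
    proof -
      have "(2::real) ^ s \<le> 2 ^ S" using s by (intro power_increasing) auto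
      then have "(2::real) ^ s \<le> 2 * a" using S_le by linarith
      then show ?thesis using e0 by (intro powr_mono2) auto
    qed
    also have "\<dots> = 2 powr e * a powr e" using a1 by (simp add: powr_mult)
    also have "\<dots> \<le> 2 powr real CARD('d) * a powr e" using e0 by (intro mult_right_mono powr_mono) auto
    finally show ?thesis by (simp add: powr_realpow)
  qed
  have aN: "sqrt N * a powr e = N powr expo CARD('d)"
  proof -
    have "sqrt N * a powr e = N powr (1 / 2 + (1 / m) * e)"
      using N1 by (simp add: a_def powr_powr powr_add powr_half_sqrt)
    also have "1 / 2 + (1 / m) * e = expo CARD('d)" using m by (simp add: expo_def e_def field_simps flip: m(2))
    finally show ?thesis .
  qed
  have fin4: "1 / 4 ^ S * N \<le> N powr expo CARD('d)"
  proof -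
    have "1 / 4 ^ S \<le> 1 / a\<^sup>2"
    proof -
      have "a\<^sup>2 \<le> (2 ^ S)\<^sup>2" using S_ge a1 by (intro power_mono) auto
      also have "(2 ^ S)\<^sup>2 = (4 ^ S :: real)" by (simp add: power2_eq_square flip: power_mult_distrib)
      finally show ?thesis using a1 by (intro divide_left_mono) auto
    qed
    also have "1 / a\<^sup>2 = N powr (- (2 / m))"
    proof -
      have "a\<^sup>2 = N powr (2 / m)" unfolding a_def using N1 by (simp add: powr_realpow[symmetric] powr_powr)
      then show ?thesis by (simp add: powr_minus_divide)
    qed
    finally have "1 / 4 ^ S * N \<le> N powr (- (2 / m)) * N" using N1 by (intro mult_right_mono) auto
    also have "\<dots> = N powr (1 - 2 / m)" using N1 by (simp add: powr_diff powr_minus_divide)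
    finally show ?thesis by (simp add: expo_def m(2)[symmetric])
  qed
  obtain g where g: "\<And>s. g s \<in> inc_net j s" "\<And>S x. x \<in> cube j \<Longrightarrow> \<bar>u x - (\<Sum>s\<le>S. g s x)\<bar> \<le> 1 / 4 ^ S"
    using inc_net_chain[OF u] by blast
  have lvl: "\<bar>\<Sum>i\<in>I. \<xi> i * (\<rho> i * g s (z i))\<bar> \<le> 15 / 2 * sqrt V * (2 ^ CARD('d) * N powr expo CARD('d))" if s: "s \<le> S" for s
  proof -
    have "\<bar>\<Sum>i\<in>I. \<xi> i * (\<rho> i * g s (z i))\<bar> \<le> 3 / 2 * (5 / 4 ^ s) * sqrt (N * (V * 2 ^ (s * m)))"
      unfolding N_def m_def using s S2 by (intro net g) auto
    also have "\<dots> = 15 / 2 * sqrt V * (sqrt N * ((1 / 4 ^ s) * sqrt (2 ^ (s * m))))"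
      by (simp add: real_sqrt_mult)
    also have "\<dots> \<le> 15 / 2 * sqrt V * (sqrt N * (2 ^ CARD('d) * a powr e))"
      using level[OF s] V N1 by (intro mult_left_mono) auto
    also have "sqrt N * (2 ^ CARD('d) * a powr e) = 2 ^ CARD('d) * N powr expo CARD('d)" using aN by simp
    finally show ?thesis .
  qed
  have "(\<Sum>i\<in>I. \<xi> i * (\<rho> i * u (z i))) = (\<Sum>i\<in>I. \<xi> i * (\<rho> i * (u (z i) - (\<Sum>s\<le>S. g s (z i))))) + (\<Sum>s\<le>S. \<Sum>i\<in>I. \<xi> i * (\<rho> i * g s (z i)))"
    by (subst sum.swap) (simp add: right_diff_distrib sum_subtractf sum_distrib_left)
  moreover have "\<bar>\<Sum>i\<in>I. \<xi> i * (\<rho> i * (u (z i) - (\<Sum>s\<le>S. g s (z i))))\<bar> \<le> (2 + L) * N powr expo CARD('d)"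
  proof -
    have "\<bar>\<Sum>i\<in>I. \<xi> i * (\<rho> i * (u (z i) - (\<Sum>s\<le>S. g s (z i))))\<bar> \<le> (\<Sum>i\<in>I. \<bar>\<xi> i * (\<rho> i * (u (z i) - (\<Sum>s\<le>S. g s (z i))))\<bar>)"
      by (rule sum_abs)
    also have "\<dots> \<le> (\<Sum>i\<in>I. \<bar>\<xi> i\<bar> * (1 * (1 / 4 ^ S)))"
      unfolding abs_mult using \<rho> g(2)[OF z] by (intro sum_mono mult_left_mono mult_mono) auto
    also have "\<dots> = (\<Sum>i\<in>I. \<bar>\<xi> i\<bar>) * (1 / 4 ^ S)" by (simp add: sum_divide_distrib)
    also have "\<dots> \<le> ((2 + L) * N) * (1 / 4 ^ S)" using ab unfolding N_def by (intro mult_right_mono) auto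
    also have "\<dots> = (2 + L) * (1 / 4 ^ S * N)" by simp
    also have "\<dots> \<le> (2 + L) * N powr expo CARD('d)" using fin4 L by (intro mult_left_mono) auto
    finally show ?thesis .
  qed
  moreover have "\<bar>\<Sum>s\<le>S. \<Sum>i\<in>I. \<xi> i * (\<rho> i * g s (z i))\<bar> \<le> (real Smax + 1) * (15 / 2 * sqrt V * (2 ^ CARD('d) * N powr expo CARD('d)))"
  proof -
    have "\<bar>\<Sum>s\<le>S. \<Sum>i\<in>I. \<xi> i * (\<rho> i * g s (z i))\<bar> \<le> (\<Sum>s\<le>S. \<bar>\<Sum>i\<in>I. \<xi> i * (\<rho> i * g s (z i))\<bar>)" by (rule sum_abs)
    also have "\<dots> \<le> (\<Sum>s\<le>S. 15 / 2 * sqrt V * (2 ^ CARD('d) * N powr expo CARD('d)))" by (intro sum_mono lvl) auto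
    also have "\<dots> = (real S + 1) * (15 / 2 * sqrt V * (2 ^ CARD('d) * N powr expo CARD('d)))" by (simp add: algebra_simps)
    also have "\<dots> \<le> (real Smax + 1) * (15 / 2 * sqrt V * (2 ^ CARD('d) * N powr expo CARD('d)))"
      using S2 V by (intro mult_right_mono) auto
    finally show ?thesis .
  qed
  ultimately have "\<bar>\<Sum>i\<in>I. \<xi> i * (\<rho> i * u (z i))\<bar> \<le> (2 + L) * N powr expo CARD('d) + (real Smax + 1) * (15 / 2 * sqrt V * (2 ^ CARD('d) * N powr expo CARD('d)))"
    by linarith
  then show ?thesis by (simp add: N_def algebra_simps)
qed

lemma emeasure_UN_le:
  assumes "finite I" "\<And>i. i \<in> I \<Longrightarrow> A i \<in> sets M" "\<And>i. i \<in> I \<Longrightarrow> emeasure M (A i) \<le> ennreal c" "0 \<le> c" "real (card I) \<le> N"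
  shows "emeasure M (\<Union>i\<in>I. A i) \<le> ennreal (N * c)"
proof -
  have "emeasure M (\<Union>i\<in>I. A i) \<le> (\<Sum>i\<in>I. emeasure M (A i))" using assms by (intro emeasure_subadditive_finite) auto
  also have "\<dots> \<le> (\<Sum>i\<in>I. ennreal c)" using assms by (intro sum_mono) auto
  also have "\<dots> = ennreal (real (card I) * c)" using assms by (simp add: ennreal_mult ennreal_of_nat_eq_real_of_nat)
  also have "\<dots> \<le> ennreal (N * c)" using assms by (intro ennreal_leI mult_right_mono) auto
  finally show ?thesis .
qed

lemma lab_cube:
  assumes "x \<noteq> 0" "lab k x = B"
  shows "2 ^ k *\<^sub>R (nu x - snd B) \<in> cube (fst B)"
proof -
  have B: "fst B = face x" "snd B = cen k x" using assms by (auto simp: lab_def)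
  have "\<bar>2 ^ k * (nu x $ i - cen k x $ i)\<bar> \<le> 1 / 2" for i
    using mult_left_mono[OF nu_cen[OF assms(1), of i k], of "2 ^ k"] by (simp add: abs_mult)
  then show ?thesis by (simp add: cube_def B nu_cen_face[OF assms(1), of k])
qed

text \<open>The factor of \<open>chain_bound\<close>, with the deviation parameter \<open>V\<close>
  of \<open>noise_event\<close> under the root: the entropy coefficient plus the confidence level
  \<open>L\<close>.\<close>

definition noise_const :: "nat \<Rightarrow> nat \<Rightarrow> real \<Rightarrow> real" where
  "noise_const D Smax L = (real Smax + 1) * (15 / 2) * sqrt (2 * bron_const D * (real Smax + 1) + L) * 2 ^ D + 2 + L"

context obs_model
begin

lemma card_meas [measurable]:
  assumes [measurable]: "A \<in> sets borel"
  shows "(\<lambda>\<omega>. real (card {i. i < n \<and> fst (\<omega> i) \<in> A})) \<in> borel_measurable (sample_law P n K)"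
proof -
  have "real (card {i. i < n \<and> fst (\<omega> i) \<in> A}) = (\<Sum>i<n. indicator A (fst (\<omega> i)))" for \<omega>
  proof -
    have "real (card {i. i < n \<and> fst (\<omega> i) \<in> A}) = (\<Sum>i | i < n \<and> fst (\<omega> i) \<in> A. 1)" by simp
    also have "\<dots> = (\<Sum>i<n. indicator A (fst (\<omega> i)))" unfolding sum_filter by (intro sum.cong) (auto simp: indicator_def)
    finally show ?thesis .
  qed
  moreover have "(\<lambda>\<omega>. \<Sum>i<n. indicator A (fst (\<omega> i)) :: real) \<in> borel_measurable (sample_law P n K)"
    by (intro borel_measurable_sum measurable_compose[OF measurable_compose[OF coord_meas measurable_fst]]) auto
  ultimately show ?thesis by simp
qed

lemma sum_meas:
  assumes [measurable]: "A \<in> sets borel" "h \<in> borel_measurable (borel \<Otimes>\<^sub>M borel)"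
  shows "(\<lambda>\<omega>. \<Sum>i | i < n \<and> fst (\<omega> i) \<in> A. h (\<omega> i) :: real) \<in> borel_measurable (sample_law P n K)"
proof -
  have m: "(\<lambda>w. h w * indicator A (fst w)) \<in> borel_measurable (borel \<Otimes>\<^sub>M borel)" by measurable
  have "(\<Sum>i | i < n \<and> fst (\<omega> i) \<in> A. h (\<omega> i)) = (\<Sum>i<n. h (\<omega> i) * indicator A (fst (\<omega> i)))" for \<omega>
    unfolding sum_filter by (intro sum.cong) auto
  moreover have "(\<lambda>\<omega>. \<Sum>i<n. h (\<omega> i) * indicator A (fst (\<omega> i))) \<in> borel_measurable (sample_law P n K)"
    by (intro borel_measurable_sum measurable_compose[OF coord_meas m]) auto
  ultimately show ?thesis by simp
qed

lemma subgaussian_tail2: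
  assumes g [measurable]: "g \<in> borel_measurable borel" and A [measurable]: "A \<in> sets borel"
    and b: "0 < b" "\<And>x. x \<in> A \<Longrightarrow> \<bar>g x\<bar> \<le> b" and L: "0 < L"
  shows "{\<omega> \<in> space (sample_law P n K). 3 / 2 * b * sqrt (real (card {i. i < n \<and> fst (\<omega> i) \<in> A}) * L)
        < \<bar>\<Sum>i | i < n \<and> fst (\<omega> i) \<in> A. resid K (\<omega> i) * g (fst (\<omega> i))\<bar>} \<in> sets (sample_law P n K)" (is "?T \<in> _")
    and "emeasure (sample_law P n K) {\<omega> \<in> space (sample_law P n K). 3 / 2 * b * sqrt (real (card {i. i < n \<and> fst (\<omega> i) \<in> A}) * L)
        < \<bar>\<Sum>i | i < n \<and> fst (\<omega> i) \<in> A. resid K (\<omega> i) * g (fst (\<omega> i))\<bar>} \<le> ennreal (2 * real n * exp (- L))"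
proof -
  have [measurable]: "(\<lambda>\<omega>. \<Sum>i | i < n \<and> fst (\<omega> i) \<in> A. resid K (\<omega> i) * g (fst (\<omega> i))) \<in> borel_measurable (sample_law P n K)"
    by (rule sum_meas[OF A, where h = "\<lambda>w. resid K w * g (fst w)"]) measurable
  have [measurable]: "(\<lambda>\<omega>. \<Sum>i | i < n \<and> fst (\<omega> i) \<in> A. resid K (\<omega> i) * - g (fst (\<omega> i))) \<in> borel_measurable (sample_law P n K)"
    by (rule sum_meas[OF A, where h = "\<lambda>w. resid K w * - g (fst w)"]) measurable
  show "?T \<in> sets (sample_law P n K)" by measurable
  let ?S = "sample_law P n K"
  let ?U = "\<lambda>g. {\<omega> \<in> space ?S. 3 / 2 * b * sqrt (real (card {i. i < n \<and> fst (\<omega> i) \<in> A}) * L)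
        < (\<Sum>i | i < n \<and> fst (\<omega> i) \<in> A. resid K (\<omega> i) * g (fst (\<omega> i)))}"
  have 1: "emeasure ?S (?U g) \<le> ennreal (n * exp (- L))" by (rule subgaussian_tail[OF g A b L])
  have 2: "emeasure ?S (?U (\<lambda>x. - g x)) \<le> ennreal (n * exp (- L))"
    by (rule subgaussian_tail[OF _ A b(1) _ L]) (use b in auto)
  have Um: "?U g \<in> sets ?S" "?U (\<lambda>x. - g x) \<in> sets ?S" by measurable
  have "?T \<subseteq> ?U g \<union> ?U (\<lambda>x. - g x)" by (auto simp: sum_negf abs_if split: if_splits)
  then have "emeasure ?S ?T \<le> emeasure ?S (?U g \<union> ?U (\<lambda>x. - g x))"
    by (rule emeasure_mono) (rule sets.Un[OF Um])
  also have "\<dots> \<le> emeasure ?S (?U g) + emeasure ?S (?U (\<lambda>x. - g x))" by (rule emeasure_subadditive[OF Um])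
  also have "\<dots> \<le> ennreal (n * exp (- L)) + ennreal (n * exp (- L))" by (intro add_mono 1 2)
  also have "\<dots> = ennreal (2 * real n * exp (- L))" by (simp flip: ennreal_plus)
  finally show "emeasure ?S ?T \<le> ennreal (2 * real n * exp (- L))" .
qed

text \<open>A union bound over levels, labels, the two sets, the chain levels and the net functions.
  The deviation parameter V 2^(s m) exceeds the entropy of \<open>inc_net\<close> by at least
  \<open>L\<close>, so a whole net costs no more than 2 n exp (- L).\<close>

lemma noise_event:
  assumes d: "6 \<le> CARD('d)" and Lay [measurable]: "Lay \<in> sets borel" and L: "0 < L"
    and Smax: "n \<le> 2 ^ (Smax * (CARD('d) - 1))"
  shows "\<exists>Bad\<in>sets (sample_law P n K).
     emeasure (sample_law P n K) Bad \<le>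
       ennreal ((2 * (real J + 1) * (2 * real CARD('d) * 3 ^ CARD('d)) * (2 ^ J) ^ (CARD('d) - 1)) * ((2 * real n * (real Smax + 1) + 1) * exp (- L))) \<and>
     (\<forall>\<omega>\<in>space (sample_law P n K) - Bad. (\<forall>i<n. norm (fst (\<omega> i)) = 1) \<longrightarrow>
        noise_ok n (\<lambda>i. fst (\<omega> i)) (\<lambda>i. resid K (\<omega> i)) Lay J (noise_const CARD('d) Smax L))"
proof -
  let ?S = "sample_law P n K"
  let ?m = "CARD('d) - 1"
  define V where "V = 2 * bron_const CARD('d) * (real Smax + 1) + L"
  have bc: "0 \<le> bron_const CARD('d)" by (rule bron_const_nonneg) simp
  then have V0: "0 < V" unfolding V_def using L by (intro add_nonneg_pos) auto
  \<comment> \<open>The unit sphere is built in so that \<open>infnorm\<close> is at most 1 and the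
    increments keep the bound 5 / 4^s. For samples on the sphere the selected indices are the
    same.\<close>
  define AA where "AA k B A = {x :: real ^ 'd. norm x = 1} \<inter> {x. lab k x = B} \<inter> A" for k B A
  have AAm: "AA k B A \<in> sets borel" if "A \<in> {UNIV, Lay}" for k B A
  proof -
    have "{x :: real ^ 'd. norm x = 1} \<in> sets borel" by measurable
    then show ?thesis unfolding AA_def using lab_measurable[of k B] that by auto
  qed
  define gg where "gg k B v x = infnorm x * v (2 ^ k *\<^sub>R (nu x - snd B))" for k and B :: "'d \<times> (real ^ 'd)" and v :: "real ^ 'd \<Rightarrow> real" and x
  have ggm: "gg k B v \<in> borel_measurable borel" if [measurable]: "v \<in> borel_measurable borel" for k B v
    unfolding gg_def by measurable
  define T where "T k B A s v = {\<omega> \<in> space ?S. 3 / 2 * (5 / 4 ^ s) * sqrt (real (card {i. i < n \<and> fst (\<omega> i) \<in> AA k B A}) * (V * 2 ^ (s * ?m)))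
        < \<bar>\<Sum>i | i < n \<and> fst (\<omega> i) \<in> AA k B A. resid K (\<omega> i) * gg k B v (fst (\<omega> i))\<bar>}" for k B A s v
  define R where "R k B A = {\<omega> \<in> space ?S. L \<le> (\<Sum>i | i < n \<and> fst (\<omega> i) \<in> AA k B A. \<bar>resid K (\<omega> i)\<bar> - 2)}" for k B A
  have in_cube: "2 ^ k *\<^sub>R (nu x - snd B) \<in> cube (fst B)" if "x \<in> AA k B A" for x k B A
    using that by (intro lab_cube) (auto simp: AA_def)
  have inf1: "0 \<le> infnorm x" "infnorm x \<le> 1" if "x \<in> AA k B A" for x k B A
    using that infnorm_unit(1)[of x] infnorm_pos_le[of x] by (auto simp: AA_def)
  have T: "T k B A s v \<in> sets ?S" "emeasure ?S (T k B A s v) \<le> ennreal (2 * real n * exp (- (V * 2 ^ (s * ?m))))"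
    if A: "A \<in> {UNIV, Lay}" and v: "v \<in> inc_net (fst B) s" for k B A s v
  proof -
    have bd: "\<bar>gg k B v x\<bar> \<le> 5 / 4 ^ s" if "x \<in> AA k B A" for x
    proof -
      have "\<bar>gg k B v x\<bar> \<le> 1 * (5 / 4 ^ s)"
        unfolding gg_def abs_mult using inf1[OF that] inc_net_le[OF v in_cube[OF that]] by (intro mult_mono) auto
      then show ?thesis by simp
    qed
    have b0: "0 < 5 / (4::real) ^ s" "0 < V * 2 ^ (s * ?m)" using V0 by auto
    show "T k B A s v \<in> sets ?S"
      unfolding T_def by (rule subgaussian_tail2(1)[OF ggm[OF inc_net_measurable[OF v]] AAm[OF A] b0(1) bd b0(2)])
    show "emeasure ?S (T k B A s v) \<le> ennreal (2 * real n * exp (- (V * 2 ^ (s * ?m))))"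
      unfolding T_def by (rule order_trans[OF subgaussian_tail2(2)[OF ggm[OF inc_net_measurable[OF v]] AAm[OF A] b0(1) bd b0(2)]]) auto
  qed
  have R: "R k B A \<in> sets ?S" "emeasure ?S (R k B A) \<le> ennreal (1 * exp (- L))" if A: "A \<in> {UNIV, Lay}" for k B A
  proof -
    have [measurable]: "(\<lambda>\<omega>. \<Sum>i | i < n \<and> fst (\<omega> i) \<in> AA k B A. \<bar>resid K (\<omega> i)\<bar> - 2) \<in> borel_measurable ?S"
      by (intro sum_meas AAm A) measurable
    show "R k B A \<in> sets ?S" unfolding R_def by measurable
    show "emeasure ?S (R k B A) \<le> ennreal (1 * exp (- L))" unfolding R_def using abs_tail[OF AAm[OF A]] by simp
  qed
  define U1 where "U1 k B A s = (\<Union>v\<in>inc_net (fst B) s. T k B A s v)" for k B A s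
  have U1: "U1 k B A s \<in> sets ?S" "emeasure ?S (U1 k B A s) \<le> ennreal (2 * real n * exp (- L))"
    if A: "A \<in> {UNIV, Lay}" and s: "s \<le> Smax" for k B A s
  proof -
    show "U1 k B A s \<in> sets ?S" unfolding U1_def by (intro sets.finite_UN finite_inc_net T(1)[OF A])
    have cd: "real (card (inc_net (fst B) s)) \<le> exp (V * 2 ^ (s * ?m) - L)"
    proof (cases "inc_net (fst B) s = {}")
      case False
      then have c0: "0 < real (card (inc_net (fst B) s))" using finite_inc_net[of "fst B" s] by (simp add: card_gt_0_iff)
      have "ln (real (card (inc_net (fst B) s))) \<le> 2 * bron_const CARD('d) * 2 ^ (s * ?m) * (real s + 1)" by (rule card_inc_net)
      also have "\<dots> \<le> 2 * bron_const CARD('d) * 2 ^ (s * ?m) * (real Smax + 1)" using s bc by (intro mult_left_mono) auto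
      also have "\<dots> \<le> V * 2 ^ (s * ?m) - L"
      proof -
        have "L * 1 \<le> L * 2 ^ (s * ?m)" using L by (intro mult_left_mono) auto
        then show ?thesis by (simp add: V_def algebra_simps)
      qed
      finally show ?thesis using c0 by (metis exp_ln exp_le_cancel_iff)
    qed simp
    have "emeasure ?S (U1 k B A s) \<le> ennreal (exp (V * 2 ^ (s * ?m) - L) * (2 * real n * exp (- (V * 2 ^ (s * ?m)))))"
      unfolding U1_def by (rule emeasure_UN_le[OF finite_inc_net T(1)[OF A] T(2)[OF A] _ cd]) auto
    also have "exp (V * 2 ^ (s * ?m) - L) * (2 * real n * exp (- (V * 2 ^ (s * ?m)))) = 2 * real n * exp (- L)"
      by (simp add: mult.left_commute flip: exp_add)
    finally show "emeasure ?S (U1 k B A s) \<le> ennreal (2 * real n * exp (- L))" .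
  qed
  define U2 where "U2 k B A = (\<Union>s\<in>{..Smax}. U1 k B A s) \<union> R k B A" for k B A
  have U2: "U2 k B A \<in> sets ?S" "emeasure ?S (U2 k B A) \<le> ennreal ((2 * real n * (real Smax + 1) + 1) * exp (- L))"
    if A: "A \<in> {UNIV, Lay}" for k B A
  proof -
    have m: "(\<Union>s\<in>{..Smax}. U1 k B A s) \<in> sets ?S" by (intro sets.finite_UN U1(1)[OF A]) auto
    show "U2 k B A \<in> sets ?S" unfolding U2_def using m R(1)[OF A] by auto
    have "emeasure ?S (\<Union>s\<in>{..Smax}. U1 k B A s) \<le> ennreal ((real Smax + 1) * (2 * real n * exp (- L)))"
      by (rule emeasure_UN_le[OF _ U1(1)[OF A] U1(2)[OF A]]) auto
    then have "emeasure ?S (U2 k B A) \<le> ennreal ((real Smax + 1) * (2 * real n * exp (- L))) + ennreal (1 * exp (- L))"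
      unfolding U2_def by (intro order_trans[OF emeasure_subadditive[OF m R(1)[OF A]]] add_mono R(2)[OF A])
    also have "\<dots> = ennreal ((2 * real n * (real Smax + 1) + 1) * exp (- L))"
      by (subst ennreal_plus[symmetric]) (auto simp: algebra_simps)
    finally show "emeasure ?S (U2 k B A) \<le> ennreal ((2 * real n * (real Smax + 1) + 1) * exp (- L))" .
  qed
  define idx where "idx = Sigma {..J} (\<lambda>k. (labs k :: ('d \<times> (real ^ 'd)) set) \<times> {UNIV, Lay})"
  define Bad where "Bad = (\<Union>t\<in>idx. case t of (k, B, A) \<Rightarrow> U2 k B A)"
  have fidx: "finite idx" unfolding idx_def using card_labs(1) by auto
  have Bm: "(case t of (k, B, A) \<Rightarrow> U2 k B A) \<in> sets ?S" if "t \<in> idx" for t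
    using that U2(1) by (auto simp: idx_def)
  have Be: "emeasure ?S (case t of (k, B, A) \<Rightarrow> U2 k B A) \<le> ennreal ((2 * real n * (real Smax + 1) + 1) * exp (- L))" if "t \<in> idx" for t
    using that U2(2) by (auto simp: idx_def)
  have cidx: "real (card idx) \<le> 2 * (real J + 1) * (2 * real CARD('d) * 3 ^ CARD('d)) * (2 ^ J) ^ ?m"
  proof -
    have "card idx = (\<Sum>k\<le>J. card (labs k :: ('d \<times> (real ^ 'd)) set) * card {UNIV, Lay})"
      unfolding idx_def using card_labs(1) by (subst card_SigmaI) (auto simp: card_cartesian_product)
    then have "real (card idx) = (\<Sum>k\<le>J. real (card (labs k :: ('d \<times> (real ^ 'd)) set)) * real (card {UNIV, Lay}))" by simp
    also have "\<dots> \<le> (\<Sum>k\<le>J. ((2 * real CARD('d) * 3 ^ CARD('d)) * (2 ^ J) ^ ?m) * 2)"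
    proof (intro sum_mono mult_mono)
      fix k assume k: "k \<in> {..J}"
      have "real (card (labs k :: ('d \<times> (real ^ 'd)) set)) \<le> 2 * real CARD('d) * 3 ^ CARD('d) * (2 ^ k) ^ ?m"
        using card_labs(2)[where 'd='d, of k] by simp
      also have "\<dots> \<le> 2 * real CARD('d) * 3 ^ CARD('d) * (2 ^ J) ^ ?m"
        using k by (intro mult_left_mono power_mono power_increasing) auto
      finally show "real (card (labs k :: ('d \<times> (real ^ 'd)) set)) \<le> 2 * real CARD('d) * 3 ^ CARD('d) * (2 ^ J) ^ ?m" .
      have "card {UNIV, Lay} \<le> 2" by (simp add: card_insert_if)
      then show "real (card {UNIV, Lay}) \<le> 2" by simp
    qed auto
    also have "\<dots> = 2 * (real J + 1) * (2 * real CARD('d) * 3 ^ CARD('d)) * (2 ^ J) ^ ?m" by simp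
    finally show ?thesis .
  qed
  show ?thesis
  proof (intro bexI[of _ Bad] conjI ballI impI)
    show "Bad \<in> sets ?S" unfolding Bad_def by (intro sets.finite_UN fidx Bm)
    show "emeasure ?S Bad \<le> ennreal ((2 * (real J + 1) * (2 * real CARD('d) * 3 ^ CARD('d)) * (2 ^ J) ^ ?m) * ((2 * real n * (real Smax + 1) + 1) * exp (- L)))"
      unfolding Bad_def by (rule emeasure_UN_le[OF fidx Bm Be _ cidx]) auto
    fix \<omega> assume \<omega>: "\<omega> \<in> space ?S - Bad" and unit: "\<forall>i<n. norm (fst (\<omega> i)) = 1"
    show "noise_ok n (\<lambda>i. fst (\<omega> i)) (\<lambda>i. resid K (\<omega> i)) Lay J (noise_const CARD('d) Smax L)"
      unfolding noise_ok_def
    proof (intro allI impI ballI)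
      fix k and B :: "'d \<times> (real ^ 'd)" and A u assume k: "k \<le> J" and B: "B \<in> labs k" and A: "A \<in> {UNIV, Lay}" and u: "u \<in> cvx_class (fst B)"
      define I where "I = {i. i < n \<and> lab k (fst (\<omega> i)) = B \<and> fst (\<omega> i) \<in> A}"
      have I: "I = {i. i < n \<and> fst (\<omega> i) \<in> AA k B A}" using unit by (auto simp: I_def AA_def)
      have nU2: "\<omega> \<notin> U2 k B A" using \<omega> k B A by (auto simp: Bad_def idx_def)
      have sp: "\<omega> \<in> space ?S" using \<omega> by simp
      show "\<bar>\<Sum>i | i < n \<and> lab k (fst (\<omega> i)) = B \<and> fst (\<omega> i) \<in> A. resid K (\<omega> i) * (infnorm (fst (\<omega> i)) * u (2 ^ k *\<^sub>R (nu (fst (\<omega> i)) - snd B)))\<bar>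
        \<le> noise_const CARD('d) Smax L * real (card {i. i < n \<and> lab k (fst (\<omega> i)) = B \<and> fst (\<omega> i) \<in> A}) powr expo CARD('d)"
        unfolding I_def[symmetric]
      proof (cases "I = {}")
        case True
        then show "\<bar>\<Sum>i\<in>I. resid K (\<omega> i) * (infnorm (fst (\<omega> i)) * u (2 ^ k *\<^sub>R (nu (fst (\<omega> i)) - snd B)))\<bar>
        \<le> noise_const CARD('d) Smax L * real (card I) powr expo CARD('d)" by simp
      next
        case False
        have fI: "finite I" unfolding I_def by simp
        have cI: "1 \<le> real (card I)" using False fI by (simp add: Suc_le_eq card_gt_0_iff)
        have "card I \<le> n" using card_mono[of "{..<n}" I] by (auto simp: I_def)
        then have cS: "card I \<le> 2 ^ (Smax * ?m)" using Smax by linarith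
        have AAi: "fst (\<omega> i) \<in> AA k B A" if "i \<in> I" for i using that I by auto
        show "\<bar>\<Sum>i\<in>I. resid K (\<omega> i) * (infnorm (fst (\<omega> i)) * u (2 ^ k *\<^sub>R (nu (fst (\<omega> i)) - snd B)))\<bar>
        \<le> noise_const CARD('d) Smax L * real (card I) powr expo CARD('d)"
          unfolding noise_const_def V_def[symmetric]
        proof (rule chain_bound[OF d fI False _ _ u cS])
          show "2 ^ k *\<^sub>R (nu (fst (\<omega> i)) - snd B) \<in> cube (fst B)" if "i \<in> I" for i by (rule in_cube[OF AAi[OF that]])
          show "0 \<le> infnorm (fst (\<omega> i)) \<and> infnorm (fst (\<omega> i)) \<le> 1" if "i \<in> I" for i using inf1[OF AAi[OF that]] by simp
          show "0 \<le> V" "0 \<le> L" using V0 L by auto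
          show "(\<Sum>i\<in>I. \<bar>resid K (\<omega> i)\<bar>) \<le> (2 + L) * real (card I)"
          proof -
            have "\<omega> \<notin> R k B A" using nU2 by (simp add: U2_def)
            then have "(\<Sum>i\<in>I. \<bar>resid K (\<omega> i)\<bar> - 2) < L" using sp by (simp add: R_def I not_le)
            then have "(\<Sum>i\<in>I. \<bar>resid K (\<omega> i)\<bar>) < L * 1 + 2 * real (card I)" by (simp add: sum_subtractf)
            also have "\<dots> \<le> L * real (card I) + 2 * real (card I)" using L cI by (intro add_right_mono mult_left_mono) auto
            finally show ?thesis by (simp add: algebra_simps)
          qed
          fix s v assume s: "s \<le> Smax" and v: "v \<in> inc_net (fst B) s"
          have "\<omega> \<notin> T k B A s v" using nU2 s v by (auto simp: U2_def U1_def)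
          then show "\<bar>\<Sum>i\<in>I. resid K (\<omega> i) * (infnorm (fst (\<omega> i)) * v (2 ^ k *\<^sub>R (nu (fst (\<omega> i)) - snd B)))\<bar>
            \<le> 3 / 2 * (5 / 4 ^ s) * sqrt (real (card I) * (V * 2 ^ (s * ?m)))"
            using sp by (simp add: T_def gg_def I not_less)
        qed
      qed
    qed
  qed
qed

end

section \<open>Polytopes with a small boundary layer\<close>

lemma norm_sgn_diff_le:
  fixes p q :: "'a::real_normed_vector"
  assumes "p \<noteq> 0" "q \<noteq> 0"
  shows "norm (sgn p - sgn q) \<le> 2 * norm (p - q) / norm p"
proof -
  have "sgn p - sgn q = (1 / norm p) *\<^sub>R (p - q) + ((norm q - norm p) / norm p) *\<^sub>R sgn q"
    using assms by (simp add: sgn_div_norm divide_inverse algebra_simps)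
  also have "norm \<dots> \<le> norm ((1 / norm p) *\<^sub>R (p - q)) + norm (((norm q - norm p) / norm p) *\<^sub>R sgn q)" by (rule norm_triangle_ineq)
  also have "\<dots> = norm (p - q) / norm p + \<bar>norm q - norm p\<bar> / norm p" using assms by (simp add: norm_sgn)
  also have "\<dots> \<le> norm (p - q) / norm p + norm (p - q) / norm p"
    by (intro add_left_mono divide_right_mono) (auto simp: norm_minus_commute norm_triangle_ineq3 abs_minus_commute)
  finally show ?thesis by simp
qed

lemma inner_unit: "norm x = 1 \<Longrightarrow> norm v = 1 \<Longrightarrow> x \<bullet> v = 1 - (norm (x - v))\<^sup>2 / 2" for x v :: "'a::real_inner"
proof -
  assume "norm x = 1" "norm v = 1"
  then have "(norm (x - v))\<^sup>2 = 2 - 2 * (x \<bullet> v)"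
    by (simp add: power2_norm_eq_inner inner_diff_left inner_diff_right inner_commute norm_eq_1)
  then show ?thesis by (simp add: diff_divide_distrib)
qed

text \<open>Fubini for counting: all coordinates except \<open>v\<close> are fixed.\<close>

lemma card_PiE_slice:
  assumes V: "finite V" "v \<in> V"
    and Q: "\<And>s. s \<in> PiE (V - {v}) (\<lambda>_. {0..<M::nat}) \<Longrightarrow> card {y \<in> {0..<M}. Q (s(v := y))} \<le> b"
  shows "card {t \<in> PiE V (\<lambda>_. {0..<M}). Q t} \<le> b * M ^ (card V - 1)"
proof -
  let ?T = "{t \<in> PiE V (\<lambda>_. {0..<M}). Q t}"
  let ?D = "Sigma (PiE (V - {v}) (\<lambda>_. {0..<M})) (\<lambda>s. {y \<in> {0..<M}. Q (s(v := y))})"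
  let ?f = "\<lambda>t. (restrict t (V - {v}), t v)"
  have upd: "(restrict t (V - {v}))(v := t v) = t" if "t \<in> PiE V (\<lambda>_. {0..<M})" for t
    using that V by (auto simp: fun_eq_iff PiE_def extensional_def restrict_def)
  have fin: "finite ?D" using V by (intro finite_SigmaI finite_PiE) auto
  have "?f ` ?T \<subseteq> ?D"
  proof
    fix p assume "p \<in> ?f ` ?T"
    then obtain t where t: "t \<in> PiE V (\<lambda>_. {0..<M})" "Q t" and p: "p = ?f t" by blast
    have "restrict t (V - {v}) \<in> PiE (V - {v}) (\<lambda>_. {0..<M})" using t by auto
    moreover have "t v \<in> {0..<M}" using t V by (auto simp: PiE_def)
    moreover have "Q ((restrict t (V - {v}))(v := t v))" using upd[OF t(1)] t(2) by simp
    ultimately show "p \<in> ?D" unfolding p by blast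
  qed
  moreover have "inj_on ?f ?T" by (rule inj_on_inverseI[where g = "\<lambda>(s, y). s(v := y)"]) (use upd in auto)
  ultimately have "card ?T \<le> card ?D" using fin card_inj_on_le by blast
  also have "\<dots> = (\<Sum>s\<in>PiE (V - {v}) (\<lambda>_. {0..<M}). card {y \<in> {0..<M}. Q (s(v := y))})"
    using V by (intro card_SigmaI finite_PiE ballI) auto
  also have "\<dots> \<le> (\<Sum>s\<in>PiE (V - {v}) (\<lambda>_. {0..<M}). b)" using Q by (intro sum_mono) auto
  also have "\<dots> = b * M ^ (card V - 1)" using V by (simp add: card_PiE)
  finally show ?thesis .
qed

lemma card_le_2_nat:
  assumes "finite (A :: nat set)" "\<And>x y. x \<in> A \<Longrightarrow> y \<in> A \<Longrightarrow> x \<le> y + 1"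
  shows "card A \<le> 2"
proof (cases "A = {}")
  case False
  have "A \<subseteq> {Min A, Min A + 1}"
  proof
    fix x assume "x \<in> A"
    then have "Min A \<le> x" "x \<le> Min A + 1" using assms False by auto
    then show "x \<in> {Min A, Min A + 1}" by auto
  qed
  then have "card A \<le> card {Min A, Min A + 1}" by (intro card_mono) auto
  then show ?thesis by simp
qed simp

definition near_const :: "nat \<Rightarrow> real" where
  "near_const D = real D * (72 * (real D)\<^sup>2 * 2 ^ D + 1) ^ D"

text \<open>Box centres moved radially to the sphere. They form a net whose local multiplicity is
  controlled by the counts already available for labels.\<close>

definition vtx :: "nat \<Rightarrow> (real ^ 'd::finite) set" where
  "vtx k = (\<lambda>B. sgn (snd B)) ` labs k"

lemma finite_vtx: "finite (vtx k)"
  unfolding vtx_def using card_labs(1) by auto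

lemma norm_vtx: "v \<in> vtx k \<Longrightarrow> norm v = 1"
proof -
  assume "v \<in> vtx k"
  then obtain j c where jc: "(j, c) \<in> labs k" "v = sgn c" by (auto simp: vtx_def)
  then have "c \<noteq> 0" using labsD(1)[OF jc(1)] by auto
  then show ?thesis by (simp add: jc norm_sgn)
qed

text \<open>The additional D levels absorb the dimension: the distance is at most D / 2^D times
  2^(-J).\<close>

lemma vtx_net:
  fixes x :: "real ^ 'd::finite"
  assumes x: "norm x = 1"
  shows "\<exists>v\<in>vtx (J + CARD('d)). norm (x - v) \<le> 1 / 2 ^ J"
proof -
  let ?k = "J + CARD('d)"
  have x0: "x \<noteq> 0" using x by auto
  have i0: "0 < infnorm x" by (rule infnorm_pos[OF x0])
  define c where "c = cen ?k x"
  have jc: "(face x, c) \<in> labs ?k" using x0 by (auto simp: labs_def lab_def c_def)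
  have c0: "c \<noteq> 0" using labsD(1)[OF jc] by auto
  have sx: "sgn (nu x) = x" using x i0 by (simp add: nu_def sgn_scaleR) (simp add: sgn_div_norm)
  have nu0: "nu x \<noteq> 0" using i0 x0 by (simp add: nu_def)
  have n1: "1 \<le> norm (nu x)"
    using component_le_norm_cart[of "nu x" "face x"] nu_cen_face[OF x0, of 0] abs_cen_face[OF x0, of 0] by simp
  have "norm (nu x - c) \<le> CARD('d) * (1 / 2 / 2 ^ ?k)"
    using nu_cen[OF x0, of _ ?k] by (intro norm_le_l1_bound) (simp add: c_def)
  moreover have "norm (x - sgn c) \<le> 2 * norm (nu x - c) / norm (nu x)"
    using norm_sgn_diff_le[OF nu0 c0] by (simp add: sx)
  moreover have "2 * norm (nu x - c) / norm (nu x) \<le> 2 * norm (nu x - c) / 1"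
    using n1 by (intro divide_left_mono) auto
  ultimately have "norm (x - sgn c) \<le> 2 * (CARD('d) * (1 / 2 / 2 ^ ?k))" by linarith
  also have "\<dots> = (real CARD('d) / 2 ^ CARD('d)) * (1 / 2 ^ J)" by (simp add: power_add)
  also have "\<dots> \<le> 1 * (1 / 2 ^ J)"
    using of_nat_less_two_power[of "CARD('d)", where 'a=real] by (intro mult_right_mono) (auto simp: less_imp_le)
  finally have "norm (x - sgn c) \<le> 1 / 2 ^ J" by simp
  moreover have "sgn c \<in> vtx ?k" unfolding vtx_def using jc by force
  ultimately show ?thesis by blast
qed

text \<open>A nearby vertex belongs to a box whose centre is within A / 2^k of \<open>x\<close> in
  the chart, so \<open>card_labs_near\<close> gives a bound independent of \<open>J\<close>. The
  lower bound on \<open>J\<close> keeps the facet coordinate of \<open>x\<close> away from 0 and of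
  the right sign.\<close>

lemma card_vtx_near:
  fixes x :: "real ^ 'd::finite"
  assumes x: "norm x = 1" and h: "12 * real CARD('d) \<le> 2 ^ J"
  shows "real (card {v \<in> vtx (J + CARD('d)). norm (x - v) \<le> 3 * (1 / 2 ^ J)}) \<le> near_const CARD('d)"
proof -
  let ?D = "real CARD('d)" and ?k = "J + CARD('d)"
  define h where "h = (1 / 2 ^ J :: real)"
  have D1: "1 \<le> ?D" by (simp add: Suc_leI)
  have h0: "0 < h" "12 * ?D * h \<le> 1" using h by (auto simp: h_def)
  define A where "A = 36 * ?D\<^sup>2 * 2 ^ CARD('d)"
  let ?L = "{B \<in> labs ?k. 0 < x $ fst B * snd B $ fst B \<and> (\<forall>i. \<bar>x $ i / \<bar>x $ fst B\<bar> - snd B $ i\<bar> \<le> A / 2 ^ ?k)}"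
  have finL: "finite ?L" using card_labs(1)[of ?k] by auto
  have "{v \<in> vtx ?k. norm (x - v) \<le> 3 * h} \<subseteq> (\<lambda>B. sgn (snd B)) ` ?L"
  proof
    fix v assume "v \<in> {v \<in> vtx ?k. norm (x - v) \<le> 3 * h}"
    then obtain j c where jc: "(j, c) \<in> labs ?k" "v = sgn c" "norm (x - v) \<le> 3 * h" by (auto simp: vtx_def)
    note cj = labsD(1)[OF jc(1)] and ci = labsD(2)[OF jc(1)]
    have c0: "c \<noteq> 0" using cj by auto
    define r where "r = norm c"
    have r: "1 \<le> r" "r \<le> 2 * ?D"
      using component_le_norm_cart[of c j] cj norm_le_l1_bound[OF ci] by (auto simp: r_def)
    have v: "v $ i = c $ i / r" for i by (simp add: jc r_def sgn_div_norm divide_inverse)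
    have dx: "\<bar>x $ i - v $ i\<bar> \<le> 3 * h" for i using component_le_norm_cart[of "x - v" i] jc(3) by simp
    have h4: "3 * h \<le> 1 / (4 * ?D)" using h0 D1 by (simp add: field_simps)
    have vj: "1 / (2 * ?D) \<le> \<bar>v $ j\<bar>" using cj r D1 by (simp add: v frac_le)
    have half: "1 / (2 * ?D) = 1 / (4 * ?D) + 1 / (4 * ?D)" by simp
    define t where "t = \<bar>x $ j\<bar>"
    have q4: "0 < 1 / (4 * ?D)" using D1 by simp
    have t: "1 / (4 * ?D) \<le> t" unfolding t_def using dx[of j] h4 vj half by linarith
    have t0: "0 < t" using t q4 by linarith
    have cc: "c $ j * c $ j = 1" using cj by (metis abs_mult_self_eq mult_1)
    have "x $ j * c $ j = (1 / r) + (x $ j - v $ j) * c $ j" using cc by (simp add: v left_diff_distrib)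
    moreover have "\<bar>(x $ j - v $ j) * c $ j\<bar> \<le> 3 * h" using dx[of j] cj by (simp add: abs_mult)
    moreover have "1 / (2 * ?D) \<le> 1 / r" using r by (intro divide_left_mono) auto
    ultimately have pos: "0 < x $ j * c $ j" using h4 half q4 by linarith
    have "\<bar>x $ i / \<bar>x $ j\<bar> - c $ i\<bar> \<le> A / 2 ^ ?k" for i
    proof -
      define s where "s = \<bar>v $ j\<bar>"
      have s: "1 / (2 * ?D) \<le> s" "s = 1 / r" using vj cj r by (auto simp: s_def v)
      have s0: "0 < s" using s r by simp
      have c_eq: "c $ i = v $ i / s" using r by (simp add: v s)
      have st: "\<bar>s - t\<bar> \<le> 3 * h" using dx[of j] unfolding s_def t_def by linarith
      have vi: "\<bar>v $ i\<bar> \<le> 1" using component_le_norm_cart[of v i] c0 by (simp add: jc(2) norm_sgn)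
      have "x $ i / t - v $ i / s = (x $ i - v $ i) * (1 / t) + v $ i * (s - t) * (1 / t) * (1 / s)"
        using t0 s0 by (simp add: field_simps)
      then have "\<bar>x $ i / t - v $ i / s\<bar> \<le> \<bar>(x $ i - v $ i) * (1 / t)\<bar> + \<bar>v $ i * (s - t) * (1 / t) * (1 / s)\<bar>" by linarith
      also have "\<dots> \<le> 3 * h * (4 * ?D) + 1 * (3 * h) * (4 * ?D) * (2 * ?D)"
      proof -
        have t': "1 / t \<le> 4 * ?D" using t t0 D1 by (simp add: field_simps)
        have s': "1 / s \<le> 2 * ?D" using s(2) r by simp
        show ?thesis unfolding abs_mult
          using dx[of i] vi st t' s' t0 s0 h0 D1 by (intro add_mono mult_mono) auto
      qed
      also have "\<dots> \<le> 36 * ?D\<^sup>2 * h"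
      proof -
        have "?D * 1 \<le> ?D * ?D" using D1 by (intro mult_left_mono) auto
        then have "12 * ?D + 24 * (?D * ?D) \<le> 36 * (?D * ?D)" by linarith
        then have "(12 * ?D + 24 * (?D * ?D)) * h \<le> 36 * (?D * ?D) * h" using h0 by (intro mult_right_mono) auto
        then show ?thesis by (simp add: power2_eq_square algebra_simps)
      qed
      also have "\<dots> = A / 2 ^ ?k" by (simp add: A_def h_def power_add)
      finally show ?thesis by (simp add: c_eq t_def)
    qed
    then show "v \<in> (\<lambda>B. sgn (snd B)) ` ?L" using jc pos by (intro image_eqI[of _ _ "(j, c)"]) auto
  qed
  then have "card {v \<in> vtx ?k. norm (x - v) \<le> 3 * h} \<le> card ?L" using finL by (meson card_image_le card_mono finite_imageI le_trans)
  moreover have "real (card ?L) \<le> near_const CARD('d)"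
    using card_labs_near[of A ?k x] by (simp add: near_const_def A_def mult.assoc)
  ultimately show ?thesis by (simp add: h_def)
qed

text \<open>
  The vertices of the polytope are pushed inwards by random amounts. For a fixed direction it is
  unlikely that two of them nearly tie, hence for some choice the set of directions close to the
  boundary of a normal cone has small \<open>P\<close>-measure, although \<open>P\<close> is arbitrary.
\<close>

definition wgt :: "nat \<Rightarrow> nat \<Rightarrow> nat \<Rightarrow> real" where
  "wgt J M t = 1 - (1 / 2 ^ J)\<^sup>2 + real t * (1 / 2 ^ J)\<^sup>2 / real M"

text \<open>Only vertices within 3 / 2^J of \<open>x\<close> are compared, since all others are
  beaten by a quadratic margin in \<open>polytope_linear\<close>. The tolerance is one eighth of the
  spacing of the weights.\<close>

definition tie :: "nat \<Rightarrow> nat \<Rightarrow> (real ^ 'd::finite \<Rightarrow> nat) \<Rightarrow> real ^ 'd \<Rightarrow> bool" where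
  "tie J M t x \<longleftrightarrow> (\<exists>v\<in>vtx (J + CARD('d)). \<exists>v'\<in>vtx (J + CARD('d)). v \<noteq> v' \<and>
     norm (x - v) \<le> 3 * (1 / 2 ^ J) \<and> norm (x - v') \<le> 3 * (1 / 2 ^ J) \<and>
     \<bar>wgt J M (t v) * (x \<bullet> v) - wgt J M (t v') * (x \<bullet> v')\<bar> \<le> (1 / 2 ^ J)\<^sup>2 / (8 * real M))"

lemma tie_measurable: "{x :: real ^ 'd::finite. tie J M t x} \<in> sets borel"
proof -
  let ?V = "vtx (J + CARD('d)) :: (real ^ 'd) set"
  let ?A = "\<lambda>v v'. {x :: real ^ 'd. v \<noteq> v' \<and> norm (x - v) \<le> 3 * (1 / 2 ^ J) \<and> norm (x - v') \<le> 3 * (1 / 2 ^ J) \<and>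
     \<bar>wgt J M (t v) * (x \<bullet> v) - wgt J M (t v') * (x \<bullet> v')\<bar> \<le> (1 / 2 ^ J)\<^sup>2 / (8 * real M)}"
  have "{x :: real ^ 'd. tie J M t x} = (\<Union>v\<in>?V. \<Union>v'\<in>?V. ?A v v')" by (auto simp: tie_def)
  moreover have "?A v v' \<in> sets borel" for v v' by measurable
  ultimately show ?thesis using finite_vtx[of "J + CARD('d)"] by (auto intro!: sets.finite_UN)
qed

text \<open>Fix a pair of near vertices and all weights but that of \<open>v\<close>. As x . v is at
  least 1 / 2, one step of this weight moves the difference by at least half a spacing, so at most
  two values produce a near tie. Each of the boundedly many pairs thus excludes a fraction 2 / M of
  the choices.\<close>

lemma card_tie:
  fixes x :: "real ^ 'd::finite"
  assumes x: "norm x = 1" and h: "12 * real CARD('d) \<le> 2 ^ J" and M: "0 < M"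
  shows "real (card {t \<in> PiE (vtx (J + CARD('d))) (\<lambda>_. {0..<M}). tie J M t x})
    \<le> 2 * (near_const CARD('d))\<^sup>2 * real M ^ (card (vtx (J + CARD('d)) :: (real ^ 'd) set) - 1)"
proof -
  let ?V = "vtx (J + CARD('d)) :: (real ^ 'd) set"
  define h' where "h' = (1 / 2 ^ J :: real)"
  have D1: "1 \<le> real CARD('d)" by (simp add: Suc_leI)
  have h0: "0 < h'" "12 * h' \<le> 1"
  proof -
    show "0 < h'" by (simp add: h'_def)
    have "12 \<le> (2::real) ^ J" using h D1 by linarith
    then show "12 * h' \<le> 1" by (simp add: h'_def)
  qed
  define Nr where "Nr = {v \<in> ?V. norm (x - v) \<le> 3 * h'}"
  have finN: "finite Nr" unfolding Nr_def using finite_vtx[of "J + CARD('d)"] by auto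
  have cN: "real (card Nr) \<le> near_const CARD('d)"
    using card_vtx_near[OF x h] by (simp add: Nr_def h'_def)
  define pr where "pr = {(v, v') \<in> Nr \<times> Nr. v \<noteq> v'}"
  define Q where "Q v v' t \<longleftrightarrow> \<bar>wgt J M (t v) * (x \<bullet> v) - wgt J M (t v') * (x \<bullet> v')\<bar> \<le> h'\<^sup>2 / (8 * real M)" for v v' :: "real ^ 'd" and t :: "real ^ 'd \<Rightarrow> nat"
  let ?P = "PiE ?V (\<lambda>_. {0..<M})"
  have finP: "finite ?P" using finite_vtx by (intro finite_PiE) auto
  have finpr: "finite pr" unfolding pr_def using finN by (auto intro: finite_subset[OF _ finite_cartesian_product[OF finN finN]])
  have sub: "{t \<in> ?P. tie J M t x} \<subseteq> (\<Union>(v, v')\<in>pr. {t \<in> ?P. Q v v' t})"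
  proof
    fix t assume t: "t \<in> {t \<in> ?P. tie J M t x}"
    then obtain v v' where "v \<in> Nr" "v' \<in> Nr" "v \<noteq> v'" "Q v v' t"
      by (auto simp: tie_def Nr_def Q_def h'_def)
    then show "t \<in> (\<Union>(v, v')\<in>pr. {t \<in> ?P. Q v v' t})" using t by (auto simp: pr_def)
  qed
  have each: "card {t \<in> ?P. Q v v' t} \<le> 2 * M ^ (card ?V - 1)" if vv: "(v, v') \<in> pr" for v v'
  proof (rule card_PiE_slice[OF finite_vtx])
    have v: "v \<in> ?V" "norm (x - v) \<le> 3 * h'" "v \<noteq> v'" using vv by (auto simp: pr_def Nr_def)
    then show "v \<in> ?V" by simp
    have "norm v = 1" by (rule norm_vtx[OF v(1)])
    then have "x \<bullet> v = 1 - (norm (x - v))\<^sup>2 / 2" by (rule inner_unit[OF x])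
    moreover have "(norm (x - v))\<^sup>2 \<le> (3 * h')\<^sup>2" using v by (intro power_mono) auto
    moreover have "(3 * h')\<^sup>2 \<le> 1" using h0 by (intro power_le_one) auto
    ultimately have xv: "1 / 2 \<le> x \<bullet> v" by linarith
    fix s
    let ?Y = "{y \<in> {0..<M}. Q v v' (s(v := y))}"
    show "card ?Y \<le> 2"
    proof (rule card_le_2_nat)
      fix y y' assume y: "y \<in> ?Y" "y' \<in> ?Y"
      define W where "W = h'\<^sup>2 / real M"
      have W0: "0 < W" using h0 M by (simp add: W_def)
      define e where "e = wgt J M y * (x \<bullet> v) - wgt J M y' * (x \<bullet> v)"
      have "\<bar>e\<bar> \<le> h'\<^sup>2 / (8 * real M) + h'\<^sup>2 / (8 * real M)"
        using y v(3) by (auto simp: Q_def e_def)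
      then have e: "\<bar>e\<bar> \<le> W / 4" by (simp add: W_def)
      have e2: "e = (real y - real y') * (W * (x \<bullet> v))"
        by (simp add: e_def W_def wgt_def h'_def[symmetric] algebra_simps diff_divide_distrib)
      show "y \<le> y' + 1"
      proof (rule ccontr)
        assume "\<not> y \<le> y' + 1"
        then have "2 \<le> real y - real y'" by simp
        then have "2 * (W * (1 / 2)) \<le> e"
          unfolding e2 using xv W0 by (intro mult_mono mult_left_mono) auto
        then show False using e W0 by linarith
      qed
    qed auto
  qed
  have "card {t \<in> ?P. tie J M t x} \<le> card (\<Union>(v, v')\<in>pr. {t \<in> ?P. Q v v' t})"
    using sub finpr finP by (intro card_mono) auto
  also have "\<dots> \<le> (\<Sum>(v, v')\<in>pr. card {t \<in> ?P. Q v v' t})"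
    using card_UN_le[OF finpr, of "\<lambda>(v, v'). {t \<in> ?P. Q v v' t}"] by (simp add: case_prod_beta)
  also have "\<dots> \<le> (\<Sum>p\<in>pr. 2 * M ^ (card ?V - 1))" using each by (intro sum_mono) auto
  also have "\<dots> = card pr * (2 * M ^ (card ?V - 1))" by simp
  finally have "real (card {t \<in> ?P. tie J M t x}) \<le> real (card pr * (2 * M ^ (card ?V - 1)))" by (simp only: of_nat_le_iff)
  also have "\<dots> = real (card pr) * (2 * real M ^ (card ?V - 1))" by simp
  also have "\<dots> \<le> (near_const CARD('d))\<^sup>2 * (2 * real M ^ (card ?V - 1))"
  proof (rule mult_right_mono)
    have "card pr \<le> card (Nr \<times> Nr)" using finN by (intro card_mono) (auto simp: pr_def)
    then have "real (card pr) \<le> real (card Nr) * real (card Nr)" by (simp add: card_cartesian_product flip: of_nat_mult)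
    also have "\<dots> \<le> near_const CARD('d) * near_const CARD('d)" using cN by (intro mult_mono) auto
    finally show "real (card pr) \<le> (near_const CARD('d))\<^sup>2" by (simp add: power2_eq_square)
  qed simp
  finally show ?thesis by simp
qed

text \<open>First moment method: the measure of the tie set is averaged over all weights. After
  exchanging sum and integral the bound holds pointwise in \<open>x\<close>, hence for every
  \<open>P\<close>.\<close>

lemma exists_few_ties:
  fixes P :: "(real ^ 'd::finite) measure"
  assumes P: "prob_space P" and sP: "sets P = sets borel" and h: "12 * real CARD('d) \<le> 2 ^ J" and M: "0 < M"
  shows "\<exists>t. (\<forall>v. t v < M) \<and> measure P {x. norm x = 1 \<and> tie J M t x} \<le> 2 * (near_const CARD('d))\<^sup>2 / M"
proof (rule ccontr)
  assume neg: "\<not> ?thesis"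
  interpret P: prob_space P by (rule P)
  let ?V = "vtx (J + CARD('d)) :: (real ^ 'd) set"
  let ?T = "PiE ?V (\<lambda>_. {0..<M})"
  let ?c = "2 * (near_const CARD('d))\<^sup>2"
  let ?A = "\<lambda>t. {x :: real ^ 'd. norm x = 1 \<and> tie J M t x}"
  have Am: "?A t \<in> sets P" for t
  proof -
    have "{x :: real ^ 'd. norm x = 1} \<in> sets borel" by measurable
    then have "{x :: real ^ 'd. norm x = 1} \<inter> {x. tie J M t x} \<in> sets borel" using tie_measurable[of J M t] by auto
    then show ?thesis unfolding sP by (simp add: Int_def)
  qed
  have finT: "finite ?T" using finite_vtx by (intro finite_PiE) auto
  have cV: "0 < card ?V"
  proof -
    have "axis undefined 1 \<noteq> (0 :: real ^ 'd)" by (simp add: axis_eq_0_iff)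
    then have "?V \<noteq> {}" unfolding vtx_def labs_def by auto
    then show ?thesis using finite_vtx by (simp add: card_gt_0_iff)
  qed
  have cT: "real (card ?T) = real M ^ card ?V" by (simp add: card_PiE finite_vtx)
  have gt: "?c / M < measure P (?A t)" if t: "t \<in> ?T" for t
  proof (rule ccontr)
    assume le: "\<not> ?c / M < measure P (?A t)"
    \<comment> \<open>Functions of the product are \<open>undefined\<close> off the vertex set. The
      value 0 there makes the bound by \<open>M\<close> hold everywhere and leaves
      \<open>tie\<close> unchanged.\<close>
    define t' where "t' v = (if v \<in> ?V then t v else 0)" for v
    have eq: "?A t' = ?A t" by (auto simp: tie_def t'_def)
    have "\<forall>v. t' v < M" using t M by (auto simp: t'_def PiE_def)
    moreover have "measure P (?A t') \<le> ?c / M" unfolding eq using le by simp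
    ultimately have "\<exists>t. (\<forall>v. t v < M) \<and> measure P (?A t) \<le> ?c / M" by (intro exI[of _ t'] conjI)
    with neg show False by (rule notE)
  qed
  have int: "integrable P (indicator (?A t) :: _ \<Rightarrow> real)" for t
    using Am by (intro integrable_real_indicator) (auto simp: P.emeasure_eq_measure)
  have "(\<Sum>t\<in>?T. measure P (?A t)) = (\<Sum>t\<in>?T. \<integral>x. indicator (?A t) x \<partial>P)"
    using Am by (intro sum.cong) (auto simp: sets_eq_imp_space_eq[OF sP])
  also have "\<dots> = (\<integral>x. (\<Sum>t\<in>?T. indicator (?A t) x) \<partial>P)"
    by (rule Bochner_Integration.integral_sum[symmetric]) (rule int)
  also have "\<dots> \<le> (\<integral>x. ?c * real M ^ (card ?V - 1) \<partial>P)"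
  proof (rule integral_mono)
    show "integrable P (\<lambda>x. \<Sum>t\<in>?T. indicator (?A t) x :: real)" using int by auto
    fix x :: "real ^ 'd"
    show "(\<Sum>t\<in>?T. indicator (?A t) x :: real) \<le> ?c * real M ^ (card ?V - 1)"
    proof (cases "norm x = 1")
      case True
      have "(\<Sum>t\<in>?T. indicator (?A t) x :: real) = real (card {t \<in> ?T. tie J M t x})"
        using finT True by (simp add: indicator_def sum.If_cases Int_def)
      then show ?thesis using card_tie[OF True h M] by simp
    qed (simp add: indicator_def)
  qed auto
  also have "\<dots> = ?c * real M ^ (card ?V - 1)" by (simp add: P.prob_space)
  finally have le: "(\<Sum>t\<in>?T. measure P (?A t)) \<le> ?c * real M ^ (card ?V - 1)" .
  have "?c * real M ^ (card ?V - 1) = (\<Sum>t\<in>?T. ?c / M)"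
    using M cV by (simp add: cT power_eq_if)
  also have "\<dots> < (\<Sum>t\<in>?T. measure P (?A t))"
  proof (rule sum_strict_mono[OF finT])
    have "0 < card ?T" using cT M by (metis of_nat_0_less_iff zero_less_power)
    then show "?T \<noteq> {}" by auto
  qed (rule gt)
  finally show False using le by simp
qed

lemma wgt_bounds:
  assumes "t < M" shows "1 - (1 / 2 ^ J)\<^sup>2 \<le> wgt J M t" "wgt J M t \<le> 1"
proof -
  have "real t * (1 / 2 ^ J)\<^sup>2 / real M = (real t / real M) * (1 / 2 ^ J)\<^sup>2" by simp
  also have "\<dots> \<le> 1 * (1 / 2 ^ J)\<^sup>2" using assms by (intro mult_right_mono) auto
  finally show "wgt J M t \<le> 1" by (simp add: wgt_def)
  show "1 - (1 / 2 ^ J)\<^sup>2 \<le> wgt J M t" by (simp add: wgt_def)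
qed

text \<open>The vertex maximising the weighted inner product at \<open>y\<close> remains the
  maximiser on a ball about \<open>y\<close>: near competitors trail by the tie tolerance, far ones
  by d^2 / 3, and a displacement by less than \<rho> changes a difference by at most \<rho> times
  the distance of the weighted vertices.\<close>

lemma polytope_linear:
  fixes t :: "real ^ 'd::finite \<Rightarrow> nat"
  assumes h: "12 * real CARD('d) \<le> 2 ^ J" and t: "\<And>v. t v < M"
  defines "K \<equiv> convex hull ((\<lambda>v. wgt J M (t v) *\<^sub>R v) ` vtx (J + CARD('d)))"
  shows "K \<in> unit_convex_bodies" "(1 - 2 * (1 / 2 ^ J)\<^sup>2) * norm x \<le> support_fun K x" "support_fun K x \<le> norm x"
    and "norm y = 1 \<Longrightarrow> \<not> tie J M t y \<Longrightarrow> \<exists>p\<in>K. \<forall>z\<in>ball y (1 / 2 ^ J / (64 * real M)). support_fun K z = p \<bullet> z"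
proof -
  let ?V = "vtx (J + CARD('d)) :: (real ^ 'd) set"
  define hh where "hh = (1 / 2 ^ J :: real)"
  have D1: "1 \<le> real CARD('d)" by (simp add: Suc_leI)
  have h0: "0 < hh" "12 * hh \<le> 1"
  proof -
    show "0 < hh" by (simp add: hh_def)
    have "12 \<le> (2::real) ^ J" using h D1 by linarith
    then show "12 * hh \<le> 1" by (simp add: hh_def)
  qed
  have hh2: "hh\<^sup>2 \<le> hh" "hh\<^sup>2 \<le> 1 / 12" "0 < hh\<^sup>2"
  proof -
    have "hh * hh \<le> hh * (1 / 12)" using h0 by (intro mult_left_mono) auto
    then show "hh\<^sup>2 \<le> hh" "hh\<^sup>2 \<le> 1 / 12" unfolding power2_eq_square using h0 by linarith+
    show "0 < hh\<^sup>2" using h0 by simp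
  qed
  define s where "s v = wgt J M (t v)" for v
  have s: "1 - hh\<^sup>2 \<le> s v" "s v \<le> 1" for v using wgt_bounds[OF t] by (auto simp: s_def hh_def)
  have s0: "0 < s v" for v using s(1)[of v] hh2 by linarith
  let ?W = "(\<lambda>v. s v *\<^sub>R v) ` ?V"
  have K_def': "K = convex hull ?W" by (simp add: K_def s_def)
  have finW: "finite ?W" using finite_vtx by auto
  have V0: "?V \<noteq> {}"
  proof -
    have "norm (axis undefined 1 :: real ^ 'd) = 1" by simp
    from vtx_net[OF this] show ?thesis by blast
  qed
  have K: "K \<in> convex_bodies"
    unfolding K_def' using V0 finW by (intro convex_hull_convex_bodies finite_imp_compact) auto
  have nW: "norm (s v *\<^sub>R v) \<le> 1" if "v \<in> ?V" for v using s(2)[of v] s0[of v] norm_vtx[OF that] by simp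
  have Kb: "K \<subseteq> cball 0 1" unfolding K_def' using nW by (intro hull_minimal convex_cball) auto
  then show "K \<in> unit_convex_bodies" using K by (simp add: unit_convex_bodies_def)
  have in_K: "s v *\<^sub>R v \<in> K" if "v \<in> ?V" for v unfolding K_def' using that by (intro hull_inc) auto
  have val_le: "s v * (z \<bullet> v) \<le> support_fun K z" if "v \<in> ?V" for v z
    using support_fun_ge[OF K in_K[OF that], of z] by (simp add: inner_commute)
  have lower: "1 - 3 / 2 * hh\<^sup>2 \<le> s v * (z \<bullet> v)" if "norm z = 1" "v \<in> ?V" "norm (z - v) \<le> hh" for z v
  proof -
    have "(norm (z - v))\<^sup>2 \<le> hh\<^sup>2" using that by (intro power_mono) auto
    then have "1 - hh\<^sup>2 / 2 \<le> z \<bullet> v" using inner_unit[OF that(1) norm_vtx[OF that(2)]] by linarith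
    then have "(1 - hh\<^sup>2) * (1 - hh\<^sup>2 / 2) \<le> s v * (z \<bullet> v)" using s(1)[of v] hh2 by (intro mult_mono) auto
    moreover have "(1 - b) * (1 - b / 2) = 1 - 3 / 2 * b + b * b / 2" for b :: real by (simp add: field_simps)
    then have "(1 - hh\<^sup>2) * (1 - hh\<^sup>2 / 2) = 1 - 3 / 2 * hh\<^sup>2 + hh\<^sup>2 * hh\<^sup>2 / 2" .
    moreover have "0 \<le> hh\<^sup>2 * hh\<^sup>2" by simp
    ultimately show ?thesis by linarith
  qed
  have low1: "1 - 3 / 2 * hh\<^sup>2 \<le> support_fun K z" if z: "norm z = 1" for z
  proof -
    obtain v where v: "v \<in> ?V" "norm (z - v) \<le> hh" using vtx_net[OF z, of J] by (auto simp: hh_def)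
    show ?thesis using lower[OF z v] val_le[OF v(1), of z] by linarith
  qed
  show "(1 - 2 * (1 / 2 ^ J)\<^sup>2) * norm x \<le> support_fun K x"
  proof (cases "x = 0")
    case False
    have ns: "norm (sgn x) = 1" using False by (simp add: norm_sgn)
    have "1 - 2 * hh\<^sup>2 \<le> support_fun K (sgn x)" using low1[OF ns] hh2(3) by linarith
    then have "norm x * (1 - 2 * hh\<^sup>2) \<le> norm x * support_fun K (sgn x)" by (intro mult_left_mono) auto
    also have "\<dots> = support_fun K (norm x *\<^sub>R sgn x)" by (simp add: support_fun_scale[OF K])
    also have "norm x *\<^sub>R sgn x = x" using False by (simp add: sgn_div_norm)
    finally show ?thesis by (simp add: hh_def mult.commute)
  qed (use support_fun_scale[OF K, of 0 0] in simp)
  show "support_fun K x \<le> norm x"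
  proof -
    obtain p where p: "p \<in> K" "support_fun K x = p \<bullet> x" using support_fun_touch[OF K] by blast
    have "p \<bullet> x \<le> norm p * norm x" by (rule norm_cauchy_schwarz)
    also have "\<dots> \<le> 1 * norm x" using p(1) Kb by (intro mult_right_mono) auto
    finally show ?thesis using p(2) by simp
  qed
  assume y: "norm y = 1" and nt: "\<not> tie J M t y"
  have M0: "0 < real M" using t[of 0] by simp
  have M1: "1 \<le> real M" using M0 by simp
  have fv: "finite ((\<lambda>v. s v * (y \<bullet> v)) ` ?V)" using finite_vtx by auto
  obtain v where v: "v \<in> ?V" and vmax: "\<And>v'. v' \<in> ?V \<Longrightarrow> s v' * (y \<bullet> v') \<le> s v * (y \<bullet> v)"
  proof -
    have "Max ((\<lambda>v. s v * (y \<bullet> v)) ` ?V) \<in> (\<lambda>v. s v * (y \<bullet> v)) ` ?V" using V0 fv by (intro Max_in) auto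
    then obtain v where "v \<in> ?V" "Max ((\<lambda>v. s v * (y \<bullet> v)) ` ?V) = s v * (y \<bullet> v)" by auto
    then show ?thesis using that[of v] Max_ge[OF fv] by (metis image_eqI)
  qed
  have vtop: "1 - 3 / 2 * hh\<^sup>2 \<le> s v * (y \<bullet> v)"
  proof -
    obtain v0 where v0: "v0 \<in> ?V" "norm (y - v0) \<le> hh" using vtx_net[OF y, of J] by (auto simp: hh_def)
    show ?thesis using lower[OF y v0] vmax[OF v0(1)] by linarith
  qed
  have far: "s v' * (y \<bullet> v') \<le> 1 - (norm (y - v'))\<^sup>2 / 2" if v': "v' \<in> ?V" "0 \<le> y \<bullet> v'" for v'
  proof -
    have "s v' * (y \<bullet> v') \<le> 1 * (y \<bullet> v')" using s(2) v'(2) by (intro mult_right_mono) auto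
    then show ?thesis using inner_unit[OF y norm_vtx[OF v'(1)]] by simp
  qed
  have yv0: "0 \<le> y \<bullet> v"
  proof -
    have "0 < s v * (y \<bullet> v)" using vtop hh2 by linarith
    then show ?thesis using s0[of v] by (simp add: zero_less_mult_iff)
  qed
  have vnear: "norm (y - v) \<le> 2 * hh"
  proof -
    have "(norm (y - v))\<^sup>2 \<le> 3 * hh\<^sup>2" using far[OF v yv0] vtop by linarith
    also have "\<dots> \<le> (2 * hh)\<^sup>2" by (simp add: power_mult_distrib)
    finally show ?thesis by (rule power2_le_imp_le) (use h0 in simp)
  qed
  \<comment> \<open>Weighted near competitors are at distance at most 8 hh, and 8 hh \<rho> is
    exactly the tie tolerance.\<close>
  define \<rho> where "\<rho> = hh / (64 * real M)"
  have \<rho>: "0 < \<rho>" "\<rho> \<le> hh / 64"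
  proof -
    show "0 < \<rho>" using h0 M0 by (simp add: \<rho>_def)
    show "\<rho> \<le> hh / 64" unfolding \<rho>_def using h0 M1 by (intro divide_left_mono) auto
  qed
  have wdiff: "norm (s v *\<^sub>R v - s v' *\<^sub>R v') \<le> norm (v - v') + hh\<^sup>2" if "v' \<in> ?V" for v'
  proof -
    have "s v *\<^sub>R v - s v' *\<^sub>R v' = s v *\<^sub>R (v - v') + (s v - s v') *\<^sub>R v'" by (simp add: algebra_simps)
    then have "norm (s v *\<^sub>R v - s v' *\<^sub>R v') \<le> norm (s v *\<^sub>R (v - v')) + norm ((s v - s v') *\<^sub>R v')" by (simp only: norm_triangle_ineq)
    also have "\<dots> = s v * norm (v - v') + \<bar>s v - s v'\<bar>" using s0[of v] norm_vtx[OF that] by simp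
    also have "\<dots> \<le> 1 * norm (v - v') + hh\<^sup>2"
      using s[of v] s[of v'] by (intro add_mono mult_right_mono) auto
    finally show ?thesis by simp
  qed
  have win: "s v' * (z \<bullet> v') \<le> s v * (z \<bullet> v)" if z: "z \<in> ball y \<rho>" and v': "v' \<in> ?V" for z v'
  proof (cases "v' = v")
    case False
    define d where "d = norm (y - v')"
    define gap where "gap = s v * (y \<bullet> v) - s v' * (y \<bullet> v')"
    have key: "gap - \<rho> * norm (s v *\<^sub>R v - s v' *\<^sub>R v') \<le> s v * (z \<bullet> v) - s v' * (z \<bullet> v')"
    proof -
      have "s v * (z \<bullet> v) - s v' * (z \<bullet> v') = gap + (z - y) \<bullet> (s v *\<^sub>R v - s v' *\<^sub>R v')"
        by (simp add: gap_def inner_diff_left inner_diff_right right_diff_distrib)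
      moreover have "\<bar>(z - y) \<bullet> (s v *\<^sub>R v - s v' *\<^sub>R v')\<bar> \<le> norm (z - y) * norm (s v *\<^sub>R v - s v' *\<^sub>R v')" by (rule Cauchy_Schwarz_ineq2)
      moreover have "norm (z - y) * norm (s v *\<^sub>R v - s v' *\<^sub>R v') \<le> \<rho> * norm (s v *\<^sub>R v - s v' *\<^sub>R v')"
        using z by (intro mult_right_mono) (auto simp: dist_norm norm_minus_commute)
      ultimately show ?thesis by linarith
    qed
    have vv': "norm (v - v') \<le> 2 * hh + d"
      using norm_triangle_ineq4[of "y - v'" "y - v"] vnear by (simp add: d_def)
    show ?thesis
    proof (cases "d \<le> 3 * hh")
      case True
      have "\<not> \<bar>gap\<bar> \<le> hh\<^sup>2 / (8 * real M)"
      proof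
        assume g: "\<bar>gap\<bar> \<le> hh\<^sup>2 / (8 * real M)"
        have "v \<noteq> v'" "norm (y - v) \<le> 3 * hh" "norm (y - v') \<le> 3 * hh" using False vnear h0 True by (auto simp: d_def)
        with g have "tie J M t y"
          unfolding tie_def hh_def[symmetric] s_def[symmetric] gap_def using v v' by (intro bexI conjI)
        with nt show False by contradiction
      qed
      moreover have "0 \<le> gap" using vmax[OF v'] by (simp add: gap_def)
      ultimately have g: "hh\<^sup>2 / (8 * real M) \<le> gap" by linarith
      have "norm (s v *\<^sub>R v - s v' *\<^sub>R v') \<le> 8 * hh" using wdiff[OF v'] vv' True hh2 h0 by linarith
      then have "\<rho> * norm (s v *\<^sub>R v - s v' *\<^sub>R v') \<le> \<rho> * (8 * hh)" using \<rho> by (intro mult_left_mono) auto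
      also have "\<dots> = hh\<^sup>2 / (8 * real M)" by (simp add: \<rho>_def power2_eq_square)
      finally show ?thesis using key g by linarith
    next
      case far_v: False
      have d0: "0 < d" "3 * hh < d" using far_v h0 by auto
      \<comment> \<open>If y . v' is nonnegative, v' loses d^2 / 2 and the maximiser at most 3 hh^2
        / 2, which is at most d^2 / 6 because d > 3 hh.\<close>
      have "d * d / 3 \<le> gap"
      proof (cases "0 \<le> y \<bullet> v'")
        case True
        have "(3 * hh)\<^sup>2 \<le> d\<^sup>2" using d0 h0 by (intro power_mono) auto
        then have "9 * hh\<^sup>2 \<le> d\<^sup>2" by (simp add: power_mult_distrib)
        then show ?thesis using far[OF v' True] vtop unfolding gap_def d_def[symmetric] power2_eq_square by linarith
      next
        case False
        have "s v' * (y \<bullet> v') \<le> 0" using False s0[of v'] by (simp add: mult_le_0_iff)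
        moreover have "d \<le> norm y + norm v'" unfolding d_def by (rule norm_triangle_ineq4)
        then have "d \<le> 2" using y norm_vtx[OF v'] by simp
        have "1 / 2 \<le> s v * (y \<bullet> v)" using vtop hh2 by linarith
        have "d\<^sup>2 = 2 - 2 * (y \<bullet> v')" using inner_unit[OF y norm_vtx[OF v']] by (simp add: d_def)
        have "- (y \<bullet> v') * (1 - hh\<^sup>2) \<le> - (y \<bullet> v') * s v'" using False s(1)[of v'] by (intro mult_left_mono) auto
        moreover have "- (y \<bullet> v') * (11 / 12) \<le> - (y \<bullet> v') * (1 - hh\<^sup>2)" using False hh2 by (intro mult_left_mono) auto
        ultimately have "- (y \<bullet> v') * (11 / 12) \<le> - (s v' * (y \<bullet> v'))" by (simp add: mult.commute)
        then show ?thesis using \<open>d\<^sup>2 = 2 - 2 * (y \<bullet> v')\<close> vtop hh2 False unfolding gap_def power2_eq_square by linarith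
      qed
      moreover have "\<rho> * norm (s v *\<^sub>R v - s v' *\<^sub>R v') \<le> d * d / 3"
      proof -
        have "norm (s v *\<^sub>R v - s v' *\<^sub>R v') \<le> 2 * d" using wdiff[OF v'] vv' d0 hh2 by linarith
        then have "\<rho> * norm (s v *\<^sub>R v - s v' *\<^sub>R v') \<le> (d / 6) * (2 * d)"
          using \<rho> d0 h0 by (intro mult_mono) auto
        then show ?thesis by simp
      qed
      ultimately show ?thesis using key by linarith
    qed
  qed simp
  have "support_fun K z = (s v *\<^sub>R v) \<bullet> z" if "z \<in> ball y \<rho>" for z
    unfolding K_def'
  proof (rule support_fun_convex_hull)
    show "s v *\<^sub>R v \<in> ?W" using v by auto
    fix w assume "w \<in> ?W"
    then obtain v' where "v' \<in> ?V" "w = s v' *\<^sub>R v'" by auto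
    then show "w \<bullet> z \<le> (s v *\<^sub>R v) \<bullet> z" using win[OF that] by (simp add: inner_commute)
  qed simp
  then show "\<exists>p\<in>K. \<forall>z\<in>ball y (1 / 2 ^ J / (64 * real M)). support_fun K z = p \<bullet> z"
    using in_K[OF v] unfolding \<rho>_def hh_def by blast
qed

text \<open>The level \<open>k\<close> makes enlarged boxes fit into the balls of linearity:
  \<open>r\<close> accounts for the 2^r weights, \<open>D\<close> for the dimension factor through D
  / 2^D < 1, and 8 for the constants 4 and 64.\<close>

theorem exists_polytope:
  fixes P :: "(real ^ 'd::finite) measure" and r :: nat
  assumes P: "prob_space P" and sP: "sets P = sets borel" and ae: "AE x in P. norm x = 1" and h: "12 * real CARD('d) \<le> 2 ^ J"
  defines "k \<equiv> J + (r + CARD('d) + 8)"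
  shows "\<exists>K LL. K \<in> unit_convex_bodies \<and>
    (\<forall>x. (1 - 2 * (1 / 2 ^ J)\<^sup>2) * norm x \<le> support_fun K x) \<and> (\<forall>x. support_fun K x \<le> norm x) \<and>
    {x. lab k x \<in> LL} \<in> sets borel \<and> measure P {x. lab k x \<in> LL} \<le> 2 * (near_const CARD('d))\<^sup>2 / 2 ^ r \<and>
    (\<forall>j c. (j, c) \<in> labs k - LL \<longrightarrow> (\<exists>p\<in>K. \<forall>x\<in>chart_cone j c (3 / 2 ^ k). support_fun K x = p \<bullet> x))"
proof -
  interpret P: prob_space P by (rule P)
  define M where "M = (2::nat) ^ r"
  have M: "0 < M" by (simp add: M_def)
  obtain t where t: "\<And>v. t v < M" "measure P {x. norm x = 1 \<and> tie J M t x} \<le> 2 * (near_const CARD('d))\<^sup>2 / M"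
    using exists_few_ties[OF P sP h M] by blast
  define K where "K = convex hull ((\<lambda>v. wgt J M (t v) *\<^sub>R v) ` vtx (J + CARD('d)))"
  note pl = polytope_linear[where t = t and M = M, OF h t(1), folded K_def]
  have Kc: "K \<in> convex_bodies" using pl(1) by (simp add: unit_convex_bodies_def)
  \<comment> \<open>A box enters the layer only if all its unit vectors tie. So the layer lies in
    the tie set almost surely, and every other box has an untied unit vector whose ball of
    linearity, up to radial scaling, covers the enlarged box.\<close>
  define LL where "LL = {B \<in> labs k. \<forall>x. norm x = 1 \<and> lab k x = B \<longrightarrow> tie J M t x}"
  have finLL: "finite LL" unfolding LL_def using card_labs(1)[of k] by auto
  have "{x. lab k x \<in> LL} = (\<Union>B\<in>LL. {x. lab k x = B})" by auto
  then have Lm: "{x. lab k x \<in> LL} \<in> sets borel" using finLL lab_measurable by (auto intro!: sets.finite_UN)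
  have nm: "{x. norm x = 1 \<and> tie J M t x} \<in> sets borel"
  proof -
    have "{x :: real ^ 'd. norm x = 1} \<in> sets borel" by measurable
    then have "{x :: real ^ 'd. norm x = 1} \<inter> {x. tie J M t x} \<in> sets borel" using tie_measurable[of J M t] by auto
    then show ?thesis by (simp add: Int_def)
  qed
  have "measure P {x. lab k x \<in> LL} \<le> measure P {x. norm x = 1 \<and> tie J M t x}"
  proof (rule P.finite_measure_mono_AE)
    show "AE x in P. x \<in> {x. lab k x \<in> LL} \<longrightarrow> x \<in> {x. norm x = 1 \<and> tie J M t x}"
      using ae by eventually_elim (auto simp: LL_def)
    show "{x. norm x = 1 \<and> tie J M t x} \<in> sets P" using nm sP by simp
  qed
  then have Lp: "measure P {x. lab k x \<in> LL} \<le> 2 * (near_const CARD('d))\<^sup>2 / 2 ^ r" using t(2) by (simp add: M_def)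
  have lin: "\<exists>p\<in>K. \<forall>x\<in>chart_cone j c (3 / 2 ^ k). support_fun K x = p \<bullet> x" if jc: "(j, c) \<in> labs k - LL" for j c
  proof -
    obtain y where y: "norm y = 1" "lab k y = (j, c)" "\<not> tie J M t y" using jc by (auto simp: LL_def)
    have y0: "y \<noteq> 0" using y(1) by auto
    have jy: "j = face y" "c = cen k y" using y(2) by (auto simp: lab_def)
    obtain p where p: "p \<in> K" "\<And>z. z \<in> ball y (1 / 2 ^ J / (64 * real M)) \<Longrightarrow> support_fun K z = p \<bullet> z"
      using pl(4)[OF y(1,3)] by blast
    have "support_fun K x = p \<bullet> x" if x: "x \<in> chart_cone j c (3 / 2 ^ k)" for x
    proof -
      define s where "s = \<bar>x $ j\<bar>"
      have s0: "0 < s" using x by (auto simp: chart_cone_def s_def)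
      define z where "z = (infnorm y / s) *\<^sub>R x"
      have i0: "0 < infnorm y" "infnorm y \<le> 1" using infnorm_pos[OF y0] infnorm_unit(1)[OF y(1)] by auto
      have "\<bar>(z - y) $ i\<bar> \<le> 4 / 2 ^ k" for i
      proof -
        have "\<bar>x $ i / s - c $ i\<bar> \<le> 3 / 2 ^ k" using x by (simp add: chart_cone_def s_def)
        moreover have "\<bar>nu y $ i - c $ i\<bar> \<le> 1 / 2 / 2 ^ k" using nu_cen[OF y0, of i k] by (simp add: jy)
        moreover have "3 / 2 ^ k + 1 / 2 / 2 ^ k \<le> 4 / (2::real) ^ k" by (simp add: field_simps)
        ultimately have "\<bar>x $ i / s - nu y $ i\<bar> \<le> 4 / 2 ^ k" by linarith
        moreover have "(z - y) $ i = infnorm y * (x $ i / s - nu y $ i)"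
          using arg_cong[OF scale_nu[of y], of "\<lambda>v. v $ i"] by (simp add: z_def right_diff_distrib)
        ultimately have "\<bar>(z - y) $ i\<bar> \<le> 1 * (4 / 2 ^ k)" using i0 unfolding abs_mult[symmetric]
          by (simp add: abs_mult) (metis mult_mono' abs_ge_zero less_imp_le mult_1)
        then show ?thesis by simp
      qed
      then have "norm (z - y) \<le> CARD('d) * (4 / 2 ^ k)" by (rule norm_le_l1_bound)
      also have "\<dots> = (real CARD('d) / 2 ^ CARD('d)) * (1 / 2 ^ J / (64 * real M))"
        by (simp add: k_def M_def power_add)
      also have "\<dots> < 1 * (1 / 2 ^ J / (64 * real M))"
        using of_nat_less_two_power[of "CARD('d)", where 'a=real] M by (intro mult_strict_right_mono) auto
      finally have "z \<in> ball y (1 / 2 ^ J / (64 * real M))" by (simp add: dist_norm norm_minus_commute)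
      then have "support_fun K z = p \<bullet> z" by (rule p(2))
      then have "(infnorm y / s) * support_fun K x = (infnorm y / s) * (p \<bullet> x)"
        using support_fun_scale[OF Kc, of "infnorm y / s" x] i0 s0 by (simp add: z_def)
      then show ?thesis using i0 s0 by simp
    qed
    then show ?thesis using p(1) by blast
  qed
  show ?thesis using pl(1-3) Lm Lp lin by (intro exI[of _ K] exI[of _ LL]) blast
qed

section \<open>Spiked balls that fit the noise\<close>

text \<open>About 1 / a disjoint balls of radius a / 8, with centres on the ray between u / 2 and 3
  u / 4, are projected into the cap. Their number turns the volume a^D into a^(D - 1).\<close>

lemma cap_sphere_uniform:
  fixes u :: "'a::euclidean_space"
  assumes u: "norm u = 1" and a: "0 < a" "a \<le> 1"
  shows "ennreal (a ^ (DIM('a) - 1) / (2 * 8 ^ DIM('a))) \<le> emeasure sphere_uniform {x. norm (x - u) \<le> a}"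
proof -
  let ?B = "ball (0::'a) 1" and ?C = "{x. norm (x - u) \<le> a}"
  define r where "r = a / 8"
  define N where "N = nat \<lfloor>1 / a\<rfloor>"
  define lam where "lam q = 1 / 2 + 2 * r * real q" for q
  define v where "v = unit_ball_vol (real DIM('a))"
  have v0: "0 < v" by (simp add: v_def)
  have r0: "0 < r" "r \<le> 1 / 8" using a by (auto simp: r_def)
  have a1: "1 \<le> 1 / a" using a by simp
  have N: "1 / (2 * a) \<le> real N" "real N \<le> 1 / a"
  proof -
    have "1 \<le> \<lfloor>1 / a\<rfloor>" using a1 by (simp add: le_floor_iff)
    then have "real N = of_int \<lfloor>1 / a\<rfloor>" by (simp only: N_def of_nat_nat)
    moreover have "1 / a < of_int \<lfloor>1 / a\<rfloor> + 1" "of_int \<lfloor>1 / a\<rfloor> \<le> 1 / a" by linarith+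
    moreover have "1 \<le> real_of_int \<lfloor>1 / a\<rfloor>" using \<open>1 \<le> \<lfloor>1 / a\<rfloor>\<close> by simp
    moreover have "1 / (2 * a) = (1 / a) / 2" by simp
    ultimately show "1 / (2 * a) \<le> real N" "real N \<le> 1 / a" by linarith+
  qed
  have lam: "1 / 2 \<le> lam q" "lam q \<le> 3 / 4" if "q < N" for q
  proof -
    show "1 / 2 \<le> lam q" using r0 by (simp add: lam_def)
    have "2 * r * real q \<le> 2 * r * (1 / a)" using that N(2) r0 by (intro mult_left_mono) auto
    also have "\<dots> = 1 / 4" using a by (simp add: r_def)
    finally show "lam q \<le> 3 / 4" by (simp add: lam_def)
  qed
  define A where "A q = ball (lam q *\<^sub>R u) r" for q
  have sub: "A q \<subseteq> ?B \<inter> sgn -` ?C" if q: "q < N" for q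
  proof
    fix z assume z: "z \<in> A q"
    have nl: "norm (lam q *\<^sub>R u) = lam q" using lam(1)[OF q] u by simp
    have zz: "norm (lam q *\<^sub>R u - z) < r" using z by (simp add: A_def dist_norm)
    have "norm z < 1" using norm_triangle_sub[of z "lam q *\<^sub>R u"] zz nl lam(2)[OF q] r0 by (simp add: norm_minus_commute)
    have z0: "z \<noteq> 0" using zz nl lam(1)[OF q] r0 by auto
    have u0: "lam q *\<^sub>R u \<noteq> 0" using nl lam(1)[OF q] by auto
    have "norm (u - sgn z) \<le> 2 * norm (lam q *\<^sub>R u - z) / lam q"
      using norm_sgn_diff_le[OF u0 z0] lam(1)[OF q] u nl by (simp add: sgn_scaleR) (simp add: sgn_div_norm)
    moreover have "2 * norm (lam q *\<^sub>R u - z) / lam q \<le> 2 * r / (1 / 2)" using zz lam(1)[OF q] r0 by (intro frac_le) auto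
    moreover have "2 * r / (1 / 2) \<le> a" using a by (simp add: r_def)
    ultimately have "norm (u - sgn z) \<le> a" by linarith
    then have "norm (sgn z - u) \<le> a" by (simp add: norm_minus_commute)
    with \<open>norm z < 1\<close> show "z \<in> ?B \<inter> sgn -` ?C" by simp
  qed
  have disj: "disjoint_family_on A {..<N}"
  proof (clarsimp simp: disjoint_family_on_def A_def)
    fix p q assume pq: "p < N" "q < N" "p \<noteq> q"
    have "2 * r * 1 \<le> 2 * r * \<bar>real p - real q\<bar>" using r0 pq by (intro mult_left_mono) auto
    also have "\<dots> = \<bar>lam p - lam q\<bar>" using r0 by (simp add: lam_def abs_mult flip: right_diff_distrib)
    also have "\<dots> = dist (lam p *\<^sub>R u) (lam q *\<^sub>R u)" using u by (simp add: dist_norm flip: scaleR_left_diff_distrib)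
    finally show "ball (lam p *\<^sub>R u) r \<inter> ball (lam q *\<^sub>R u) r = {}" by (intro disjoint_ballI) simp
  qed
  have Cm: "?C \<in> sets borel" by measurable
  have Sm: "sgn -` ?C \<in> sets borel"
    using measurable_sets[of sgn "borel :: 'a measure" borel ?C] Cm by simp
  have "v * (a ^ (DIM('a) - 1) / (2 * 8 ^ DIM('a))) = 1 / (2 * a) * (v * r ^ DIM('a))"
  proof -
    have "a ^ DIM('a) = a * a ^ (DIM('a) - 1)" using DIM_positive[where 'a='a] by (metis power_eq_if neq0_conv)
    then show ?thesis using a by (simp add: r_def power_divide)
  qed
  also have "\<dots> \<le> real N * (v * r ^ DIM('a))" using N(1) v0 r0 by (intro mult_right_mono) auto
  finally have 1: "v * (a ^ (DIM('a) - 1) / (2 * 8 ^ DIM('a))) \<le> real N * (v * r ^ DIM('a))" .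
  have Am: "A q \<in> sets lborel" for q by (simp add: A_def)
  have eA: "emeasure lborel (A q) = ennreal (v * r ^ DIM('a))" for q
    unfolding A_def v_def using r0 by (simp add: emeasure_ball)
  have "ennreal (real N * (v * r ^ DIM('a))) = (\<Sum>q<N. emeasure lborel (A q))"
    using v0 r0 by (simp add: eA ennreal_mult ennreal_of_nat_eq_real_of_nat)
  also have "\<dots> = emeasure lborel (\<Union>q<N. A q)" using disj Am by (intro sum_emeasure) auto
  also have "\<dots> \<le> emeasure lborel (?B \<inter> sgn -` ?C)" using sub Sm by (intro emeasure_mono) auto
  finally have 2: "ennreal (v * (a ^ (DIM('a) - 1) / (2 * 8 ^ DIM('a)))) \<le> emeasure lborel (?B \<inter> sgn -` ?C)"
    using 1 by (meson ennreal_leI order_trans)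
  have eB: "emeasure lborel ?B = ennreal v" unfolding v_def using emeasure_ball[of 1 "0::'a"] by simp
  have "emeasure sphere_uniform ?C = emeasure lborel (?B \<inter> sgn -` ?C) / ennreal v"
    unfolding sphere_uniform_def using Cm Sm by (subst emeasure_distr) (auto simp: eB)
  moreover have "ennreal (v * (a ^ (DIM('a) - 1) / (2 * 8 ^ DIM('a)))) / ennreal v \<le> emeasure lborel (?B \<inter> sgn -` ?C) / ennreal v"
    using 2 by (rule divide_right_mono_ennreal)
  moreover have "ennreal (v * (a ^ (DIM('a) - 1) / (2 * 8 ^ DIM('a)))) / ennreal v = ennreal (a ^ (DIM('a) - 1) / (2 * 8 ^ DIM('a)))"
    using v0 a by (subst divide_ennreal) auto
  ultimately show ?thesis by simp
qed

text \<open>Here \<open>undefined\<close> is an arbitrary but fixed coordinate, so the grid lies in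
  a single facet of the cube, which provides enough directions.\<close>

definition grid_pt :: "nat \<Rightarrow> ('d::finite \<Rightarrow> nat) \<Rightarrow> real ^ 'd" where
  "grid_pt k \<kappa> = (\<chi> i. if i = undefined then 1 else real (\<kappa> i) / 2 ^ k)"

definition grid_dirs :: "nat \<Rightarrow> (real ^ 'd::finite) set" where
  "grid_dirs k = (\<lambda>\<kappa>. sgn (grid_pt k \<kappa>)) ` PiE (UNIV - {undefined}) (\<lambda>_. {0..<2 ^ k})"

text \<open>A quarter of the separation of directions obtained in \<open>grid_sep\<close>, so that
  bumps supported within twice this radius are disjoint.\<close>

definition cap_radius :: "nat \<Rightarrow> nat \<Rightarrow> real" where
  "cap_radius D k = 1 / (8 * real D * 2 ^ k)"

text \<open>The fixed coordinate 1 recovers the norm of a grid point from its direction, and with it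
  the other coordinates. A coordinate difference is therefore at most 2 D times the distance of the
  directions.\<close>

lemma grid_sep:
  fixes \<kappa> \<kappa>' :: "'d::finite \<Rightarrow> nat"
  assumes \<kappa>: "\<kappa> \<in> PiE (UNIV - {undefined}) (\<lambda>_. {0..<2 ^ k})" "\<kappa>' \<in> PiE (UNIV - {undefined}) (\<lambda>_. {0..<2 ^ k})" and ne: "\<kappa> \<noteq> \<kappa>'"
  shows "4 * cap_radius CARD('d) k \<le> norm (sgn (grid_pt k \<kappa>) - sgn (grid_pt k \<kappa>') :: real ^ 'd)"
proof -
  define c where "c = (grid_pt k \<kappa> :: real ^ 'd)"
  define c' where "c' = (grid_pt k \<kappa>' :: real ^ 'd)"
  define e where "e = norm (sgn c - sgn c')"
  have b: "\<bar>c $ i\<bar> \<le> 1" "\<bar>c' $ i\<bar> \<le> 1" for i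
    using \<kappa> by (auto simp: c_def c'_def grid_pt_def PiE_def Pi_def less_imp_le)
  have n: "norm c \<le> CARD('d)" "norm c' \<le> CARD('d)" using norm_le_l1_bound[of c 1] norm_le_l1_bound[of c' 1] b by auto
  have one: "c $ undefined = 1" "c' $ undefined = 1" by (auto simp: c_def c'_def grid_pt_def)
  have n1: "1 \<le> norm c" "1 \<le> norm c'" using component_le_norm_cart[of c undefined] component_le_norm_cart[of c' undefined] one by auto
  have d: "\<bar>c $ i / norm c - c' $ i / norm c'\<bar> \<le> e" for i
    using component_le_norm_cart[of "sgn c - sgn c'" i] by (simp add: e_def sgn_div_norm divide_inverse mult.commute)
  obtain i where i: "i \<noteq> undefined" "\<kappa> i \<noteq> \<kappa>' i"
    using ne PiE_ext[OF \<kappa>] by blast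
  have "1 \<le> \<bar>real (\<kappa> i) - real (\<kappa>' i)\<bar>" using i(2) by (cases "\<kappa> i < \<kappa>' i") auto
  moreover have alg: "y - z = p * (y / p - z / q) + p * z * (1 / q - 1 / p)" if "p \<noteq> 0" "q \<noteq> 0" for y z p q :: real
    using that by (simp add: field_simps)
  ultimately have "1 / 2 ^ k \<le> \<bar>real (\<kappa> i) - real (\<kappa>' i)\<bar> / 2 ^ k" by (intro divide_right_mono) auto
  also have "\<dots> = \<bar>c $ i - c' $ i\<bar>" using i by (simp add: c_def c'_def grid_pt_def flip: diff_divide_distrib)
  also have "c $ i - c' $ i = norm c * (c $ i / norm c - c' $ i / norm c') + norm c * c' $ i * (1 / norm c' - 1 / norm c)"
    using n1 by (intro alg) auto
  also have "\<bar>\<dots>\<bar> \<le> \<bar>norm c * (c $ i / norm c - c' $ i / norm c')\<bar> + \<bar>norm c * c' $ i * (1 / norm c' - 1 / norm c)\<bar>" by (rule abs_triangle_ineq)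
  also have "\<dots> \<le> CARD('d) * e + CARD('d) * 1 * e"
  proof -
    have "\<bar>1 / norm c' - 1 / norm c\<bar> \<le> e" using d[of undefined] one by (simp add: abs_minus_commute)
    moreover have "norm c * \<bar>c' $ i\<bar> \<le> real CARD('d) * 1" using n b[of i] by (intro mult_mono) auto
    ultimately show ?thesis unfolding abs_mult using n d[of i] by (intro add_mono mult_mono) (auto simp: e_def)
  qed
  finally have "1 / 2 ^ k \<le> 2 * CARD('d) * e" by (simp add: mult_ac)
  then have "1 / (2 * real CARD('d) * 2 ^ k) \<le> e" by (simp add: field_simps)
  then show ?thesis by (simp add: e_def c_def c'_def cap_radius_def)
qed

lemma cap_radius: "0 < D \<Longrightarrow> 0 < cap_radius D k" "0 < D \<Longrightarrow> cap_radius D k \<le> 1 / 8"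
proof -
  assume "0 < D"
  then have "1 * 1 \<le> real D * 2 ^ k" by (intro mult_mono) auto
  then show "0 < cap_radius D k" "cap_radius D k \<le> 1 / 8" using \<open>0 < D\<close> by (auto simp: cap_radius_def field_simps)
qed

lemma grid_dirs:
  "finite (grid_dirs k :: (real ^ 'd::finite) set)" "card (grid_dirs k :: (real ^ 'd) set) = 2 ^ (k * (CARD('d) - 1))"
  "u \<in> (grid_dirs k :: (real ^ 'd) set) \<Longrightarrow> norm u = 1"
  "u \<in> (grid_dirs k :: (real ^ 'd) set) \<Longrightarrow> u' \<in> grid_dirs k \<Longrightarrow> u \<noteq> u' \<Longrightarrow> 4 * cap_radius CARD('d) k \<le> norm (u - u')"
proof -
  let ?S = "PiE (UNIV - {undefined :: 'd}) (\<lambda>_. {0..<2 ^ k :: nat})"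
  let ?f = "\<lambda>\<kappa>. sgn (grid_pt k \<kappa>) :: real ^ 'd"
  show "finite (grid_dirs k :: (real ^ 'd) set)" unfolding grid_dirs_def by (intro finite_imageI finite_PiE) auto
  have "inj_on ?f ?S"
  proof (rule inj_onI, rule ccontr)
    fix x y assume "x \<in> ?S" "y \<in> ?S" "?f x = ?f y" "x \<noteq> y"
    with grid_sep[of x k y] cap_radius(1)[of "CARD('d)" k] show False by simp
  qed
  then have "card (grid_dirs k :: (real ^ 'd) set) = card ?S" unfolding grid_dirs_def by (rule card_image)
  also have "\<dots> = 2 ^ (k * (CARD('d) - 1))" by (simp add: card_PiE power_mult)
  finally show "card (grid_dirs k :: (real ^ 'd) set) = 2 ^ (k * (CARD('d) - 1))" .
  assume "u \<in> (grid_dirs k :: (real ^ 'd) set)"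
  then obtain \<kappa> where \<kappa>: "\<kappa> \<in> ?S" "u = ?f \<kappa>" by (auto simp: grid_dirs_def)
  have "(grid_pt k \<kappa> :: real ^ 'd) $ undefined = 1" by (simp add: grid_pt_def)
  then have "(grid_pt k \<kappa> :: real ^ 'd) \<noteq> 0" by auto
  then show "norm u = 1" by (simp add: \<kappa> norm_sgn)
  assume "u' \<in> grid_dirs k" "u \<noteq> u'"
  then obtain \<kappa>' where \<kappa>': "\<kappa>' \<in> ?S" "u' = ?f \<kappa>'" by (auto simp: grid_dirs_def)
  then show "4 * cap_radius CARD('d) k \<le> norm (u - u')" using \<kappa> \<kappa>' \<open>u \<noteq> u'\<close> by (auto intro!: grid_sep)
qed

text \<open>The amount by which a spike with tip (1 + \<rho>) u raises the support function of the
  unit ball in a unit direction \<open>x\<close>.\<close>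

definition bump :: "real \<Rightarrow> 'a::real_inner \<Rightarrow> 'a \<Rightarrow> real" where
  "bump \<rho> u x = max 0 ((1 + \<rho>) * (x \<bullet> u) - 1)"

text \<open>For unit vectors x . u = 1 - r^2 / 2 with r their distance, so the bump vanishes once
  r^2 reaches 2 \<rho> = (2 \<eta>)^2.\<close>

lemma bump_bounds:
  assumes x: "norm x = 1" and u: "norm u = 1" and \<rho>: "\<rho> = 2 * \<eta>\<^sup>2" "0 < \<eta>" "\<eta> \<le> 1 / 8"
  shows "0 \<le> bump \<rho> u x" "bump \<rho> u x \<le> \<rho>" "0 < bump \<rho> u x \<Longrightarrow> norm (x - u) < 2 * \<eta>"
    "norm (x - u) \<le> \<eta> \<Longrightarrow> \<rho> / 2 \<le> bump \<rho> u x"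
proof -
  have xu: "x \<bullet> u = 1 - (norm (x - u))\<^sup>2 / 2" by (rule inner_unit[OF x u])
  have \<rho>0: "0 < \<rho>" using \<rho> by simp
  show "0 \<le> bump \<rho> u x" by (simp add: bump_def)
  have "(1 + \<rho>) * (x \<bullet> u) \<le> (1 + \<rho>) * 1" using xu \<rho>0 by (intro mult_left_mono) auto
  then have "(1 + \<rho>) * (x \<bullet> u) \<le> 1 + \<rho>" by (simp only: mult_1_right)
  moreover have "max 0 (t - 1) \<le> \<rho>" if "t \<le> 1 + \<rho>" for t using that \<rho>0 by auto
  ultimately show "bump \<rho> u x \<le> \<rho>" unfolding bump_def by blast
  {
    assume "0 < bump \<rho> u x"
    then have "1 < (1 + \<rho>) * (x \<bullet> u)" by (simp add: bump_def)
    also have "\<dots> = 1 + \<rho> - (1 + \<rho>) * ((norm (x - u))\<^sup>2 / 2)" unfolding xu by (simp add: algebra_simps)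
    also have "\<dots> \<le> 1 + \<rho> - 1 * ((norm (x - u))\<^sup>2 / 2)" using \<rho>0 by (intro diff_left_mono mult_right_mono) auto
    finally have "(norm (x - u))\<^sup>2 < (2 * \<eta>)\<^sup>2" using \<rho> by (simp add: power_mult_distrib)
    then show "norm (x - u) < 2 * \<eta>" by (rule power2_less_imp_less) (use \<rho> in simp)
  }
  assume "norm (x - u) \<le> \<eta>"
  then have "(norm (x - u))\<^sup>2 \<le> \<eta>\<^sup>2" by (intro power_mono) auto
  then have "1 - \<rho> / 4 \<le> x \<bullet> u" using xu \<rho> by simp
  then have "(1 + \<rho>) * (1 - \<rho> / 4) \<le> (1 + \<rho>) * (x \<bullet> u)" using \<rho>0 by (intro mult_left_mono) auto
  moreover have "(1 + \<rho>) * (1 - \<rho> / 4) = 1 + 3 / 4 * \<rho> - \<rho> * \<rho> / 4" by (simp add: field_simps)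
  moreover have "\<rho> * \<rho> \<le> \<rho> * 1"
  proof -
    have "\<eta>\<^sup>2 \<le> (1 / 8)\<^sup>2" using \<rho> by (intro power_mono) auto
    then have "\<rho> \<le> 1" using \<rho> by (simp add: power2_eq_square)
    then show ?thesis using \<rho>0 by (intro mult_left_mono) auto
  qed
  ultimately show "\<rho> / 2 \<le> bump \<rho> u x" unfolding bump_def by linarith
qed

text \<open>By the separation at most one bump is positive at a given direction, so the maximum over
  the spikes is a sum. This makes the gain additive in the chosen spikes.\<close>

lemma bumped_ball:
  fixes U :: "'a::euclidean_space set"
  assumes fin: "finite U" and U: "\<And>u. u \<in> U \<Longrightarrow> norm u = 1" and \<rho>: "\<rho> = 2 * \<eta>\<^sup>2" "0 < \<eta>" "\<eta> \<le> 1 / 8"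
    and sep: "\<And>u u'. u \<in> U \<Longrightarrow> u' \<in> U \<Longrightarrow> u \<noteq> u' \<Longrightarrow> 4 * \<eta> \<le> norm (u - u')"
  defines "G \<equiv> convex hull (cball 0 1 \<union> (\<lambda>u. (1 + \<rho>) *\<^sub>R u) ` U)"
  shows "G \<in> convex_bodies" "norm x = 1 \<Longrightarrow> support_fun G x = 1 + (\<Sum>u\<in>U. bump \<rho> u x)"
    "norm x = 1 \<Longrightarrow> (\<Sum>u\<in>U. bump \<rho> u x) \<le> \<rho>"
proof -
  show "G \<in> convex_bodies" unfolding G_def
    by (intro convex_hull_convex_bodies compact_Un[OF compact_cball finite_imp_compact] finite_imageI fin) auto
  assume x: "norm x = 1"
  have uniq: "u = u'" if "u \<in> U" "u' \<in> U" "0 < bump \<rho> u x" "0 < bump \<rho> u' x" for u u'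
  proof (rule ccontr)
    assume "u \<noteq> u'"
    then have "4 * \<eta> \<le> norm (u - u')" using sep that by blast
    also have "norm (u - u') \<le> norm (x - u') + norm (x - u)" using norm_triangle_ineq4[of "x - u'" "x - u"] by simp
    also have "\<dots> < 4 * \<eta>" using bump_bounds(3)[OF x U \<rho>] that by (smt (verit))
    finally show False by simp
  qed
  have b0: "0 \<le> bump \<rho> u x" for u by (simp add: bump_def)
  have "support_fun G x = 1 + (\<Sum>u\<in>U. bump \<rho> u x) \<and> (\<Sum>u\<in>U. bump \<rho> u x) \<le> \<rho>"
  proof (cases "\<exists>u\<in>U. 0 < bump \<rho> u x")
    case True
    then obtain u where u: "u \<in> U" "0 < bump \<rho> u x" by blast
    have z: "bump \<rho> u' x = 0" if "u' \<in> U - {u}" for u' using uniq[of u' u] u that b0[of u'] by (metis DiffD1 DiffD2 order_le_less singletonI)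
    have s: "(\<Sum>u\<in>U. bump \<rho> u x) = bump \<rho> u x" using fin u z by (subst sum.remove[of _ u]) auto
    have val: "1 + bump \<rho> u x = (1 + \<rho>) * (x \<bullet> u)" using u(2) by (simp add: bump_def)
    have "support_fun G x = 1 + bump \<rho> u x"
      unfolding G_def
    proof (rule support_fun_convex_hull[of "(1 + \<rho>) *\<^sub>R u"])
      fix s assume "s \<in> cball 0 1 \<union> (\<lambda>u. (1 + \<rho>) *\<^sub>R u) ` U"
      then show "s \<bullet> x \<le> 1 + bump \<rho> u x"
      proof
        assume "s \<in> cball 0 1"
        then have "s \<bullet> x \<le> 1" using norm_cauchy_schwarz[of s x] x by simp
        then show ?thesis using u(2) by simp
      next
        assume "s \<in> (\<lambda>u. (1 + \<rho>) *\<^sub>R u) ` U"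
        then obtain u' where u': "u' \<in> U" "s = (1 + \<rho>) *\<^sub>R u'" by auto
        have "s \<bullet> x \<le> 1 + bump \<rho> u' x" unfolding u'(2) by (simp add: bump_def inner_commute)
        also have "\<dots> \<le> 1 + bump \<rho> u x" using z[of u'] u' u(2) by (cases "u' = u") auto
        finally show ?thesis .
      qed
    qed (use u val in \<open>auto simp: inner_commute\<close>)
    then show ?thesis using s bump_bounds(2)[OF x U[OF u(1)] \<rho>] by simp
  next
    case False
    then have z: "bump \<rho> u x = 0" if "u \<in> U" for u using that b0[of u] by (metis order_le_less)
    have "support_fun G x = 1"
      unfolding G_def
    proof (rule support_fun_convex_hull[of x])
      show "x \<bullet> x = 1" using x by (simp add: norm_eq_1)
      fix s assume "s \<in> cball 0 1 \<union> (\<lambda>u. (1 + \<rho>) *\<^sub>R u) ` U"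
      then show "s \<bullet> x \<le> 1"
      proof
        assume "s \<in> cball 0 1"
        then show ?thesis using norm_cauchy_schwarz[of s x] x by simp
      next
        assume "s \<in> (\<lambda>u. (1 + \<rho>) *\<^sub>R u) ` U"
        then obtain u' where u': "u' \<in> U" "s = (1 + \<rho>) *\<^sub>R u'" by auto
        have "s \<bullet> x \<le> 1 + bump \<rho> u' x" unfolding u'(2) by (simp add: bump_def inner_commute)
        then show ?thesis using z[OF u'(1)] by simp
      qed
    qed (use x in auto)
    then show ?thesis using z \<rho> by simp
  qed
  then show "support_fun G x = 1 + (\<Sum>u\<in>U. bump \<rho> u x)" "(\<Sum>u\<in>U. bump \<rho> u x) \<le> \<rho>" by auto
qed

text \<open>The density is at most 1 / 2 and the interval has length 2 a / b.\<close>

lemma gauss_small_ball: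
  assumes b: "0 < b" and a: "0 \<le> a"
  shows "emeasure std_gauss {\<xi>. \<bar>s + \<xi> * b\<bar> < a} \<le> ennreal (a / b)"
proof -
  let ?I = "{(- s - a) / b .. (- s + a) / b}"
  have m: "{\<xi>. \<bar>s + \<xi> * b\<bar> < a} \<in> sets borel" by measurable
  have sub: "{\<xi>. \<bar>s + \<xi> * b\<bar> < a} \<subseteq> ?I" using b by (auto simp: field_simps abs_less_iff)
  have le: "std_normal_density x \<le> 1 / 2" for x
  proof -
    have "2\<^sup>2 \<le> 2 * pi" using pi_ge_two by simp
    then have "2 \<le> sqrt (2 * pi)" by (rule real_le_rsqrt)
    then have "1 / sqrt (2 * pi) * exp (- x\<^sup>2 / 2) \<le> (1 / 2) * 1" by (intro mult_mono) (auto simp: field_simps)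
    then show ?thesis by (simp add: normal_density_def)
  qed
  have "emeasure std_gauss {\<xi>. \<bar>s + \<xi> * b\<bar> < a} \<le> emeasure std_gauss ?I" using sub by (intro emeasure_mono) auto
  also have "\<dots> = (\<integral>\<^sup>+x. ennreal (std_normal_density x) * indicator ?I x \<partial>lborel)" by (subst emeasure_density) auto
  also have "\<dots> \<le> (\<integral>\<^sup>+x. ennreal (1 / 2) * indicator ?I x \<partial>lborel)"
    using le by (intro nn_integral_mono mult_right_mono ennreal_leI) auto
  also have "\<dots> = ennreal (1 / 2) * emeasure lborel ?I" by (subst nn_integral_cmult) auto
  also have "emeasure lborel ?I = ennreal ((- s + a) / b - (- s - a) / b)" using a b by (simp add: divide_right_mono)
  also have "ennreal (1 / 2) * \<dots> = ennreal (a / b)" using a b by (subst ennreal_mult[symmetric]) (auto simp: field_simps)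
  finally show ?thesis .
qed

context obs_model
begin

text \<open>Given all other observations, the sum is affine in the i-th noise variable with slope at
  least \<open>b\<close>, so \<open>gauss_small_ball\<close> applies. The factor
  \<open>emeasure P A\<close> is kept because the bound is later summed over all
  \<open>i\<close>.\<close>

lemma hit_small:
  assumes A [measurable]: "A \<in> sets borel" and \<phi> [measurable]: "\<phi> \<in> borel_measurable borel"
    and b: "0 < b" "\<And>x. x \<in> A \<Longrightarrow> b \<le> \<phi> x" and a: "0 \<le> a" and i: "i < n"
  shows "emeasure (sample_law P n K) {\<omega> \<in> space (sample_law P n K). fst (\<omega> i) \<in> A \<and>
     \<bar>\<Sum>k<n. resid K (\<omega> k) * \<phi> (fst (\<omega> k))\<bar> < a} \<le> emeasure P A * ennreal (a / b)"
proof -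
  let ?I = "{..<n} - {i}"
  let ?S = "sample_law P n K"
  let ?T = "{\<omega> \<in> space ?S. fst (\<omega> i) \<in> A \<and> \<bar>\<Sum>k<n. resid K (\<omega> k) * \<phi> (fst (\<omega> k))\<bar> < a}"
  have ins: "insert i ?I = {..<n}" using i by auto
  have S: "?S = PiM (insert i ?I) (\<lambda>_. O_law)" unfolding ins sample_law_def ..
  have rm: "(\<lambda>w. resid K w * \<phi> (fst w)) \<in> borel_measurable (borel \<Otimes>\<^sub>M borel)" by measurable
  have [measurable]: "(\<lambda>\<omega>. \<Sum>k<n. resid K (\<omega> k) * \<phi> (fst (\<omega> k))) \<in> borel_measurable ?S"
    by (intro borel_measurable_sum measurable_compose[OF coord_meas rm]) auto
  have [measurable]: "(\<lambda>\<omega>. fst (\<omega> i)) \<in> ?S \<rightarrow>\<^sub>M borel"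
    by (rule measurable_compose[OF coord_meas[OF i] measurable_fst])
  have Tm: "?T \<in> sets ?S" by measurable
  have inner: "(\<integral>\<^sup>+y. indicator ?T (x(i := y)) \<partial>O_law) \<le> emeasure P A * ennreal (a / b)" for x
  proof -
    define s where "s = (\<Sum>k\<in>?I. resid K (x k) * \<phi> (fst (x k)))"
    have e: "(\<Sum>k<n. resid K ((x(i := y)) k) * \<phi> (fst ((x(i := y)) k))) = resid K y * \<phi> (fst y) + s" for y
      using i by (subst sum.remove[of _ i]) (auto simp: s_def)
    have "(\<integral>\<^sup>+y. indicator ?T (x(i := y)) \<partial>O_law)
        \<le> (\<integral>\<^sup>+y. indicator A (fst y) * indicator {y. \<bar>s + resid K y * \<phi> (fst y)\<bar> < a} y \<partial>O_law)"
      using e by (intro nn_integral_mono) (auto simp: indicator_def add.commute)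
    also have "\<dots> = (\<integral>\<^sup>+z. \<integral>\<^sup>+\<xi>. indicator A z * indicator {\<xi>. \<bar>s + \<xi> * \<phi> z\<bar> < a} \<xi> \<partial>std_gauss \<partial>P)"
      by (subst nn_integral_obs) (auto simp: resid_def indicator_def intro!: nn_integral_cong)
    also have "\<dots> \<le> (\<integral>\<^sup>+z. ennreal (a / b) * indicator A z \<partial>P)"
    proof (rule nn_integral_mono)
      fix z
      show "(\<integral>\<^sup>+\<xi>. indicator A z * indicator {\<xi>. \<bar>s + \<xi> * \<phi> z\<bar> < a} \<xi> \<partial>std_gauss) \<le> ennreal (a / b) * indicator A z"
      proof (cases "z \<in> A")
        case True
        have "0 < \<phi> z" using b True by force
        have m: "{\<xi>. \<bar>s + \<xi> * \<phi> z\<bar> < a} \<in> sets std_gauss" by measurable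
        have "(\<integral>\<^sup>+\<xi>. indicator {\<xi>. \<bar>s + \<xi> * \<phi> z\<bar> < a} \<xi> \<partial>std_gauss) = emeasure std_gauss {\<xi>. \<bar>s + \<xi> * \<phi> z\<bar> < a}"
          by (rule nn_integral_indicator[OF m])
        also have "\<dots> \<le> ennreal (a / \<phi> z)" by (rule gauss_small_ball[OF \<open>0 < \<phi> z\<close> a])
        also have "\<dots> \<le> ennreal (a / b)" using b(1) b(2)[OF True] a by (intro ennreal_leI divide_left_mono) auto
        finally show ?thesis using True by simp
      qed simp
    qed
    also have "\<dots> = ennreal (a / b) * emeasure P A" by (subst nn_integral_cmult_indicator) auto
    finally show ?thesis by (simp add: mult.commute)
  qed
  interpret I: prob_space "PiM ?I (\<lambda>_. O_law)" by (intro prob_space_PiM prob_space_obs)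
  have "emeasure ?S ?T = (\<integral>\<^sup>+\<omega>. indicator ?T \<omega> \<partial>PiM (insert i ?I) (\<lambda>_. O_law))"
    unfolding S[symmetric] by (rule nn_integral_indicator[OF Tm, symmetric])
  also have "\<dots> = (\<integral>\<^sup>+x. (\<integral>\<^sup>+y. indicator ?T (x(i := y)) \<partial>O_law) \<partial>PiM ?I (\<lambda>_. O_law))"
    using Tm unfolding S by (intro OP.product_nn_integral_insert borel_measurable_indicator) (auto simp del: insert_Diff_single)
  also have "\<dots> \<le> (\<integral>\<^sup>+x. emeasure P A * ennreal (a / b) \<partial>PiM ?I (\<lambda>_. O_law))" by (intro nn_integral_mono inner)
  also have "\<dots> = emeasure P A * ennreal (a / b)" by (simp add: I.emeasure_space_1)
  finally show ?thesis .
qed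

lemma miss_all:
  assumes A [measurable]: "A \<in> sets borel" and p: "(p :: real) \<le> measure P A"
  shows "emeasure (sample_law P n K) {\<omega> \<in> space (sample_law P n K). \<forall>i<n. fst (\<omega> i) \<notin> A} \<le> ennreal (exp (- (n * p)))"
proof -
  interpret P: prob_space P by (rule P)
  let ?S = "sample_law P n K"
  let ?T = "{\<omega> \<in> space ?S. \<forall>i<n. fst (\<omega> i) \<notin> A}"
  have "(\<lambda>\<omega>. fst (\<omega> i)) \<in> ?S \<rightarrow>\<^sub>M borel" if "i < n" for i
    by (rule measurable_compose[OF coord_meas[OF that] measurable_fst])
  then have Tm: "?T \<in> sets ?S" by measurable
  have fm: "(\<lambda>w. indicator (- A) (fst w) :: ennreal) \<in> borel_measurable (borel \<Otimes>\<^sub>M borel)" by measurable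
  have "emeasure ?S ?T = (\<integral>\<^sup>+\<omega>. indicator ?T \<omega> \<partial>?S)" by (rule nn_integral_indicator[OF Tm, symmetric])
  also have "\<dots> \<le> (\<integral>\<^sup>+\<omega>. (\<Prod>i<n. indicator (- A) (fst (\<omega> i))) \<partial>?S)"
    by (intro nn_integral_mono) (auto simp: indicator_def)
  also have "\<dots> = (\<integral>\<^sup>+w. indicator (- A) (fst w) \<partial>O_law) ^ n" by (rule nn_integral_sample_prod[OF fm])
  also have "(\<integral>\<^sup>+w. indicator (- A) (fst w) \<partial>O_law) = (\<integral>\<^sup>+x. indicator (- A) x \<partial>P)"
    using prob_space.emeasure_space_1[OF prob_space_std_gauss] by (subst nn_integral_obs) auto
  also have "\<dots> = emeasure P (- A)" by (rule nn_integral_indicator) simp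
  also have "\<dots> = ennreal (1 - measure P A)"
    using P.prob_compl[of A] sets_eq_imp_space_eq[OF sets_P] by (simp add: P.emeasure_eq_measure Compl_eq_Diff_UNIV)
  also have "ennreal (1 - measure P A) ^ n \<le> ennreal (exp (- (n * p)))"
  proof -
    have "1 - measure P A \<le> exp (- p)" using exp_ge_add_one_self[of "- p"] p by linarith
    then have "(1 - measure P A) ^ n \<le> exp (- p) ^ n" by (intro power_mono) auto
    also have "\<dots> = exp (- (n * p))" by (simp add: exp_of_nat_mult[symmetric])
    finally show ?thesis by (simp add: ennreal_power ennreal_leI)
  qed
  finally show ?thesis .
qed

text \<open>A spike is used exactly if its noise sum \<open>Gs u\<close> is positive, and for a
  fixed proportion of the spikes |Gs u| is at least \<tau> \<rho>. The spike fits well only because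
  of the noise; its quadratic cost and the distance of \<open>K\<close> from the ball are
  subtracted.\<close>

lemma gain_event:
  fixes k n :: nat and U :: "(real ^ 'd) set" and \<eta> p0 e0 \<tau> L :: real
  defines "U \<equiv> grid_dirs k" and "\<eta> \<equiv> cap_radius CARD('d) k"
  assumes F: "\<And>x. norm x = 1 \<Longrightarrow> 1 - e0 \<le> support_fun K x \<and> support_fun K x \<le> 1"
    and p0: "\<And>u. u \<in> U \<Longrightarrow> p0 \<le> measure P {x. norm (x - u) \<le> \<eta>}"
    and \<tau>: "0 < \<tau>" and L: "0 < L" and e0: "0 \<le> e0"
  shows "\<exists>Bad\<in>sets (sample_law P n K).
    emeasure (sample_law P n K) Bad \<le> ennreal (2 * (exp (- (n * p0)) + 4 * \<tau> * n / card U) + 2 * real n * exp (- L)) \<and>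
    (\<forall>\<omega>\<in>space (sample_law P n K) - Bad. (\<forall>i<n. norm (fst (\<omega> i)) = 1) \<longrightarrow>
      (\<exists>G\<in>convex_bodies.
        real (card U) * \<tau> * (2 * \<eta>\<^sup>2) / 4 - 3 * (e0 + 2 * \<eta>\<^sup>2) * sqrt (n * L) - n * (e0 + 2 * \<eta>\<^sup>2)\<^sup>2
        \<le> (\<Sum>i<n. 2 * (resid K (\<omega> i) * (support_fun G (fst (\<omega> i)) - support_fun K (fst (\<omega> i))))
            - (support_fun G (fst (\<omega> i)) - support_fun K (fst (\<omega> i)))\<^sup>2)))"
proof -
  interpret P: prob_space P by (rule P)
  let ?S = "sample_law P n K"
  define \<rho> where "\<rho> = 2 * \<eta>\<^sup>2"
  have \<eta>: "0 < \<eta>" "\<eta> \<le> 1 / 8" unfolding \<eta>_def by (rule cap_radius, simp)+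
  have \<rho>0: "0 < \<rho>" using \<eta> by (simp add: \<rho>_def)
  have finU: "finite U" unfolding U_def by (rule grid_dirs)
  have cU: "0 < card U" unfolding U_def grid_dirs(2) by simp
  have nU: "norm u = 1" if "u \<in> U" for u using that unfolding U_def by (rule grid_dirs)
  have sep: "4 * \<eta> \<le> norm (u - u')" if "u \<in> U" "u' \<in> U" "u \<noteq> u'" for u u'
    using that unfolding U_def \<eta>_def by (rule grid_dirs)
  define A where "A u = {x :: real ^ 'd. norm x = 1 \<and> norm (x - u) \<le> \<eta>}" for u
  define A' where "A' u = {x :: real ^ 'd. norm (x - u) \<le> \<eta>}" for u
  have A'm [measurable]: "A' u \<in> sets borel" for u unfolding A'_def by measurable
  define sp where "sp = {x :: real ^ 'd. norm x = 1}"
  have spm [measurable]: "sp \<in> sets borel" unfolding sp_def by measurable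
  have bm [measurable]: "bump \<rho> u \<in> borel_measurable borel" for u :: "real ^ 'd" unfolding bump_def by measurable
  \<comment> \<open>The caps are disjoint, so at least half of them have mass at most 2 / card U.
    This takes the place of an upper bound for the density, which \<open>hit_small\<close> would
    otherwise require.\<close>
  define U' where "U' = {u \<in> U. measure P (A' u) \<le> 2 / card U}"
  have finU': "finite U'" using finU by (simp add: U'_def)
  have half: "real (card U) / 2 \<le> card U'"
  proof -
    have disj: "disjoint_family_on A' U"
    proof (clarsimp simp: disjoint_family_on_def)
      fix u u' assume u: "u \<in> U" "u' \<in> U" "u \<noteq> u'"
      have False if "x \<in> A' u" "x \<in> A' u'" for x
      proof -
        have "norm (u - u') \<le> norm (x - u') + norm (x - u)" using norm_triangle_ineq4[of "x - u'" "x - u"] by simp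
        also have "\<dots> \<le> 2 * \<eta>" using that by (simp add: A'_def)
        finally show False using sep[OF u] \<eta> by linarith
      qed
      then show "A' u \<inter> A' u' = {}" by auto
    qed
    have "(\<Sum>u\<in>U. measure P (A' u)) = measure P (\<Union>u\<in>U. A' u)"
      using disj finU by (intro P.finite_measure_finite_Union[symmetric]) (auto simp: sets_P)
    also have "\<dots> \<le> 1" by simp
    finally have le1: "(\<Sum>u\<in>U. measure P (A' u)) \<le> 1" .
    have "real (card (U - U')) * (2 / card U) = (\<Sum>u\<in>U - U'. 2 / card U)" by simp
    also have "\<dots> \<le> (\<Sum>u\<in>U - U'. measure P (A' u))" by (intro sum_mono) (auto simp: U'_def)
    also have "\<dots> \<le> (\<Sum>u\<in>U. measure P (A' u))" using finU by (intro sum_mono2) auto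
    finally have "real (card (U - U')) * (2 / card U) \<le> 1" using le1 by simp
    then have "real (card (U - U')) \<le> card U / 2" using cU by (simp add: field_simps)
    moreover have "card (U - U') = card U - card U'" "card U' \<le> card U"
      using finU by (auto simp: U'_def intro!: card_Diff_subset card_mono)
    ultimately show ?thesis by (simp add: of_nat_diff)
  qed
  define Gs where "Gs u \<omega> = (\<Sum>i<n. resid K (\<omega> i) * bump \<rho> u (fst (\<omega> i)))" for u \<omega>
  have Gsm [measurable]: "Gs u \<in> borel_measurable ?S" for u
  proof -
    have rm: "(\<lambda>w. resid K w * bump \<rho> u (fst w)) \<in> borel_measurable (borel \<Otimes>\<^sub>M borel)" by measurable
    show ?thesis unfolding Gs_def by (intro borel_measurable_sum measurable_compose[OF coord_meas rm]) auto
  qed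
  define a where "a = \<tau> * \<rho>"
  have a0: "0 < a" using \<tau> \<rho>0 by (simp add: a_def)
  define fail where "fail u = {\<omega> \<in> space ?S. \<bar>Gs u \<omega>\<bar> < a}" for u
  have failm [measurable]: "fail u \<in> sets ?S" for u unfolding fail_def by measurable
  define unit where "unit = {\<omega> \<in> space ?S. \<forall>i<n. fst (\<omega> i) \<in> sp}"
  have fstm: "(\<lambda>\<omega>. fst (\<omega> i)) \<in> ?S \<rightarrow>\<^sub>M borel" if "i < n" for i
    by (rule measurable_compose[OF coord_meas[OF that] measurable_fst])
  have unitm: "unit \<in> sets ?S" unfolding unit_def using fstm by measurable
  \<comment> \<open>The first term covers the case that no sample point falls into the cap. The
    second is n times the mass 2 / card U times the small ball probability 2 \<tau>.\<close>
  define \<delta> where "\<delta> = exp (- (n * p0)) + 4 * \<tau> * n / card U"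
  have \<delta>0: "0 \<le> \<delta>" using \<tau> by (simp add: \<delta>_def)
  have fail_le: "emeasure ?S (fail u \<inter> unit) \<le> ennreal \<delta>" if u: "u \<in> U'" for u
  proof -
    have uU: "u \<in> U" using u by (simp add: U'_def)
    let ?M = "{\<omega> \<in> space ?S. \<forall>i<n. fst (\<omega> i) \<notin> A' u}"
    let ?H = "\<lambda>i. {\<omega> \<in> space ?S. fst (\<omega> i) \<in> A' u \<inter> sp \<and> \<bar>Gs u \<omega>\<bar> < a}"
    have Mm: "?M \<in> sets ?S" using fstm by measurable
    have Hm: "?H i \<in> sets ?S" if "i < n" for i using fstm[OF that] by measurable
    have M: "emeasure ?S ?M \<le> ennreal (exp (- (n * p0)))" using p0[OF uU] by (intro miss_all) (auto simp: A'_def)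
    have H: "emeasure ?S (?H i) \<le> ennreal (4 * \<tau> / card U)" if i: "i < n" for i
    proof -
      have "emeasure ?S (?H i) \<le> emeasure P (A' u \<inter> sp) * ennreal (a / (\<rho> / 2))"
        unfolding Gs_def
      proof (rule hit_small[OF _ bm _ _ _ i])
        fix x assume "x \<in> A' u \<inter> sp"
        then show "\<rho> / 2 \<le> bump \<rho> u x" using bump_bounds(4)[OF _ nU[OF uU] \<rho>_def \<eta>, of x] by (auto simp: A'_def sp_def)
      qed (use \<rho>0 a0 in auto)
      also have "\<dots> \<le> ennreal (2 / card U) * ennreal (a / (\<rho> / 2))"
      proof (rule mult_right_mono)
        have "emeasure P (A' u \<inter> sp) \<le> emeasure P (A' u)" by (intro emeasure_mono) (auto simp: sets_P)
        also have "\<dots> \<le> ennreal (2 / card U)" using u by (simp add: U'_def P.emeasure_eq_measure ennreal_leI)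
        finally show "emeasure P (A' u \<inter> sp) \<le> ennreal (2 / card U)" .
      qed simp
      also have "\<dots> = ennreal (4 * \<tau> / card U)"
        using a0 \<rho>0 \<tau> by (subst ennreal_mult[symmetric]) (auto simp: a_def)
      finally show ?thesis .
    qed
    have UH: "emeasure ?S (\<Union>i\<in>{..<n}. ?H i) \<le> ennreal (real n * (4 * \<tau> / card U))"
      by (rule emeasure_UN_le) (use Hm H \<tau> in auto)
    have "fail u \<inter> unit \<subseteq> ?M \<union> (\<Union>i\<in>{..<n}. ?H i)" by (auto simp: fail_def unit_def)
    then have "emeasure ?S (fail u \<inter> unit) \<le> emeasure ?S (?M \<union> (\<Union>i\<in>{..<n}. ?H i))"
      using Mm Hm by (intro emeasure_mono) auto
    also have "\<dots> \<le> emeasure ?S ?M + emeasure ?S (\<Union>i\<in>{..<n}. ?H i)"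
      using Mm Hm by (intro emeasure_subadditive) auto
    also have "\<dots> \<le> ennreal (exp (- (n * p0))) + ennreal (real n * (4 * \<tau> / card U))" by (intro add_mono M UH)
    also have "\<dots> = ennreal \<delta>" using \<tau> by (simp add: \<delta>_def mult_ac flip: ennreal_plus)
    finally show ?thesis .
  qed
  \<comment> \<open>The failures share the same noise and design, so their number is bounded by
    Markov's inequality: half of \<open>U'\<close> fails with probability at most 2
    \<delta>.\<close>
  define cnt where "cnt \<omega> = (\<Sum>u\<in>U'. indicator (fail u \<inter> unit) \<omega> :: ennreal)" for \<omega>
  define B1 where "B1 = {\<omega> \<in> space ?S. ennreal (card U' / 2) \<le> cnt \<omega>}"
  have FU: "fail u \<inter> unit \<in> sets ?S" for u using failm unitm by auto
  have cntm [measurable]: "cnt \<in> borel_measurable ?S"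
    unfolding cnt_def using FU by (intro borel_measurable_sum borel_measurable_indicator)
  have B1m: "B1 \<in> sets ?S" unfolding B1_def by measurable
  have cU': "0 < real (card U')" using half cU by linarith
  have B1e: "emeasure ?S B1 \<le> ennreal (2 * \<delta>)"
  proof -
    have "(\<integral>\<^sup>+\<omega>. cnt \<omega> \<partial>?S) = (\<Sum>u\<in>U'. emeasure ?S (fail u \<inter> unit))"
      unfolding cnt_def using FU by (subst nn_integral_sum) auto
    also have "\<dots> \<le> (\<Sum>u\<in>U'. ennreal \<delta>)" by (intro sum_mono fail_le)
    also have "\<dots> = ennreal (card U' * \<delta>)" using \<delta>0 by (simp add: ennreal_mult ennreal_of_nat_eq_real_of_nat)
    finally have int: "(\<integral>\<^sup>+\<omega>. cnt \<omega> \<partial>?S) \<le> ennreal (card U' * \<delta>)" .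
    have "emeasure ?S B1 = (\<integral>\<^sup>+\<omega>. indicator B1 \<omega> \<partial>?S)" by (rule nn_integral_indicator[OF B1m, symmetric])
    also have "\<dots> \<le> (\<integral>\<^sup>+\<omega>. ennreal (2 / card U') * cnt \<omega> \<partial>?S)"
    proof (rule nn_integral_mono)
      fix \<omega>
      show "indicator B1 \<omega> \<le> ennreal (2 / card U') * cnt \<omega>"
      proof (cases "\<omega> \<in> B1")
        case True
        have "1 = ennreal (2 / card U') * ennreal (card U' / 2)" using cU' by (subst ennreal_mult[symmetric]) auto
        also have "\<dots> \<le> ennreal (2 / card U') * cnt \<omega>" using True by (intro mult_left_mono) (auto simp: B1_def)
        finally show ?thesis using True by simp
      qed simp
    qed
    also have "\<dots> = ennreal (2 / card U') * (\<integral>\<^sup>+\<omega>. cnt \<omega> \<partial>?S)" by (rule nn_integral_cmult) measurable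
    also have "\<dots> \<le> ennreal (2 / card U') * ennreal (card U' * \<delta>)" using int by (intro mult_left_mono) auto
    also have "\<dots> = ennreal (2 * \<delta>)" using cU' \<delta>0 by (subst ennreal_mult[symmetric]) auto
    finally show ?thesis .
  qed
  \<comment> \<open>A positive part is half the absolute value plus half the signed value. The
    signed halves do not depend on the selection of spikes; together with
    \<open>1 - support_fun K x\<close> they form one fixed function, whose noise is controlled by a
    single tail bound.\<close>
  define g where "g x = (1 - support_fun K x) + (\<Sum>u\<in>U'. bump \<rho> u x) / 2" for x
  have gm: "g \<in> borel_measurable borel" unfolding g_def by measurable
  have bb: "(\<Sum>u\<in>V. bump \<rho> u x) \<le> \<rho>" "0 \<le> (\<Sum>u\<in>V. bump \<rho> u x)" if "V \<subseteq> U" "norm x = 1" for V x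
  proof -
    have "finite V" using that finU finite_subset by blast
    then show "(\<Sum>u\<in>V. bump \<rho> u x) \<le> \<rho>"
      by (rule bumped_ball(3)[OF _ _ \<rho>_def \<eta> _ that(2)]) (use that(1) nU sep in blast)+
    show "0 \<le> (\<Sum>u\<in>V. bump \<rho> u x)" by (intro sum_nonneg) (simp add: bump_def)
  qed
  have U'U: "U' \<subseteq> U" by (auto simp: U'_def)
  have gb: "\<bar>g x\<bar> \<le> e0 + \<rho>" if "x \<in> sp" for x
    using F[of x] bb[OF U'U, of x] that \<rho>0 e0 unfolding g_def sp_def by auto
  have eb: "0 < e0 + \<rho>" using e0 \<rho>0 by simp
  define B2 where "B2 = {\<omega> \<in> space ?S. 3 / 2 * (e0 + \<rho>) * sqrt (real (card {i. i < n \<and> fst (\<omega> i) \<in> sp}) * L)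
        < \<bar>\<Sum>i | i < n \<and> fst (\<omega> i) \<in> sp. resid K (\<omega> i) * g (fst (\<omega> i))\<bar>}"
  have B2: "B2 \<in> sets ?S" "emeasure ?S B2 \<le> ennreal (2 * real n * exp (- L))"
    unfolding B2_def by (rule subgaussian_tail2(1)[OF gm spm eb gb L], assumption) (rule subgaussian_tail2(2)[OF gm spm eb gb L], assumption)
  show ?thesis
  proof (intro bexI[of _ "B1 \<union> B2"] conjI ballI impI)
    show "B1 \<union> B2 \<in> sets ?S" using B1m B2 by auto
    have "emeasure ?S (B1 \<union> B2) \<le> emeasure ?S B1 + emeasure ?S B2" by (rule emeasure_subadditive[OF B1m B2(1)])
    also have "\<dots> \<le> ennreal (2 * \<delta>) + ennreal (2 * real n * exp (- L))" by (intro add_mono B1e B2)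
    also have "\<dots> = ennreal (2 * \<delta> + 2 * real n * exp (- L))" using \<delta>0 by (subst ennreal_plus) auto
    finally show "emeasure ?S (B1 \<union> B2) \<le> ennreal (2 * (exp (- (n * p0)) + 4 * \<tau> * n / card U) + 2 * real n * exp (- L))"
      unfolding \<delta>_def .
    fix \<omega> assume \<omega>: "\<omega> \<in> space ?S - (B1 \<union> B2)" and un: "\<forall>i<n. norm (fst (\<omega> i)) = 1"
    have wu: "\<omega> \<in> unit" using \<omega> un by (auto simp: unit_def sp_def)
    define J where "J = {u \<in> U'. 0 < Gs u \<omega>}"
    have JU: "J \<subseteq> U" "finite J" using U'U finU' by (auto simp: J_def)
    define G where "G = convex hull (cball 0 1 \<union> (\<lambda>u. (1 + \<rho>) *\<^sub>R u) ` J)"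
    have Jn: "norm u = 1" if "u \<in> J" for u using nU JU that by blast
    have Js: "4 * \<eta> \<le> norm (u - u')" if "u \<in> J" "u' \<in> J" "u \<noteq> u'" for u u' using sep JU that by blast
    note bbG = bumped_ball[OF JU(2) Jn \<rho>_def \<eta> Js, folded G_def]
    let ?X = "\<lambda>i. fst (\<omega> i)" and ?r = "\<lambda>i. resid K (\<omega> i)"
    define d where "d i = support_fun G (?X i) - support_fun K (?X i)" for i
    have d_eq: "d i = (1 - support_fun K (?X i)) + (\<Sum>u\<in>J. bump \<rho> u (?X i))" if "i < n" for i
      using bbG(2)[of "?X i"] un that by (simp add: d_def)
    have d_abs: "(d i)\<^sup>2 \<le> (e0 + \<rho>)\<^sup>2" if i: "i < n" for i
    proof -
      have ui: "norm (?X i) = 1" using un i by simp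
      have "0 \<le> d i" "d i \<le> e0 + \<rho>" using d_eq[OF i] F[OF ui] bb[OF JU(1) ui] by linarith+
      then show ?thesis by (intro power_mono) auto
    qed
    have all: "{i. i < n \<and> ?X i \<in> sp} = {..<n}" using un by (auto simp: sp_def)
    have "\<bar>\<Sum>i<n. ?r i * g (?X i)\<bar> \<le> 3 / 2 * (e0 + \<rho>) * sqrt (n * L)"
      using \<omega> by (simp add: B2_def all not_less)
    then have n1: "- (3 / 2 * (e0 + \<rho>) * sqrt (n * L)) \<le> (\<Sum>i<n. ?r i * g (?X i))" by linarith
    have swap: "(\<Sum>i<n. ?r i * (\<Sum>u\<in>V. bump \<rho> u (?X i))) = (\<Sum>u\<in>V. Gs u \<omega>)" for V
      unfolding Gs_def sum_distrib_left by (rule sum.swap)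
    have Jsum: "(\<Sum>u\<in>J. Gs u \<omega>) = (\<Sum>u\<in>U'. \<bar>Gs u \<omega>\<bar>) / 2 + (\<Sum>u\<in>U'. Gs u \<omega>) / 2"
    proof -
      have "(\<Sum>u\<in>J. Gs u \<omega>) = (\<Sum>u\<in>U'. if 0 < Gs u \<omega> then Gs u \<omega> else 0)"
        unfolding J_def using finU' by (intro sum.inter_filter)
      also have "\<dots> = (\<Sum>u\<in>U'. (\<bar>Gs u \<omega>\<bar> + Gs u \<omega>) / 2)" by (intro sum.cong) auto
      also have "\<dots> = (\<Sum>u\<in>U'. \<bar>Gs u \<omega>\<bar>) / 2 + (\<Sum>u\<in>U'. Gs u \<omega>) / 2"
        by (simp add: sum.distrib add_divide_distrib sum_divide_distrib)
      finally show ?thesis .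
    qed
    have "(\<Sum>i<n. ?r i * d i) = (\<Sum>i<n. ?r i * (1 - support_fun K (?X i)) + ?r i * (\<Sum>u\<in>J. bump \<rho> u (?X i)))"
      using d_eq by (intro sum.cong) (auto simp: distrib_left)
    also have "\<dots> = (\<Sum>i<n. ?r i * (1 - support_fun K (?X i))) + (\<Sum>u\<in>J. Gs u \<omega>)" by (simp add: sum.distrib swap)
    also have "\<dots> = (\<Sum>i<n. ?r i * g (?X i)) + (\<Sum>u\<in>U'. \<bar>Gs u \<omega>\<bar>) / 2"
    proof -
      have "(\<Sum>i<n. ?r i * g (?X i)) = (\<Sum>i<n. ?r i * (1 - support_fun K (?X i)) + ?r i * (\<Sum>u\<in>U'. bump \<rho> u (?X i)) / 2)"
        by (intro sum.cong) (auto simp: g_def distrib_left)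
      also have "\<dots> = (\<Sum>i<n. ?r i * (1 - support_fun K (?X i))) + (\<Sum>u\<in>U'. Gs u \<omega>) / 2"
        by (simp add: sum.distrib swap[symmetric] sum_divide_distrib)
      finally show ?thesis unfolding Jsum by simp
    qed
    finally have rd: "(\<Sum>i<n. ?r i * d i) = (\<Sum>i<n. ?r i * g (?X i)) + (\<Sum>u\<in>U'. \<bar>Gs u \<omega>\<bar>) / 2" .
    have few: "real (card {u \<in> U'. \<omega> \<in> fail u}) < card U' / 2"
    proof -
      have "cnt \<omega> = of_nat (card {u \<in> U'. \<omega> \<in> fail u})"
        unfolding cnt_def using finU' wu by (simp add: indicator_def sum.If_cases Int_def)
      moreover have "cnt \<omega> < ennreal (card U' / 2)" using \<omega> by (simp add: B1_def not_le)
      ultimately show ?thesis by (simp add: ennreal_of_nat_eq_real_of_nat ennreal_less_iff)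
    qed
    have "real (card U) * \<tau> * \<rho> / 4 \<le> (\<Sum>u\<in>U'. \<bar>Gs u \<omega>\<bar>)"
    proof -
      let ?Z = "{u \<in> U'. \<omega> \<notin> fail u}"
      have "card U' = card {u \<in> U'. \<omega> \<in> fail u} + card ?Z"
        using finU' by (subst card_Un_disjoint[symmetric]) (auto intro: arg_cong[of _ _ card])
      then have "real (card U') / 2 \<le> card ?Z" using few by linarith
      then have z: "real (card U) / 4 \<le> card ?Z" using half by linarith
      have "real (card U) / 4 * a \<le> real (card ?Z) * a" using z a0 by (intro mult_right_mono) auto
      also have "\<dots> = (\<Sum>u\<in>?Z. a)" by simp
      also have "\<dots> \<le> (\<Sum>u\<in>?Z. \<bar>Gs u \<omega>\<bar>)" using \<omega> by (intro sum_mono) (auto simp: fail_def not_less)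
      also have "\<dots> \<le> (\<Sum>u\<in>U'. \<bar>Gs u \<omega>\<bar>)" using finU' by (intro sum_mono2) auto
      finally show ?thesis by (simp add: a_def mult_ac)
    qed
    moreover have "(\<Sum>i<n. (d i)\<^sup>2) \<le> n * (e0 + \<rho>)\<^sup>2"
    proof -
      have "(\<Sum>i<n. (d i)\<^sup>2) \<le> (\<Sum>i<n. (e0 + \<rho>)\<^sup>2)" using d_abs by (intro sum_mono) auto
      then show ?thesis by simp
    qed
    moreover have "(\<Sum>i<n. 2 * (?r i * d i) - (d i)\<^sup>2) = 2 * (\<Sum>i<n. ?r i * d i) - (\<Sum>i<n. (d i)\<^sup>2)"
      by (simp add: sum_subtractf sum_distrib_left)
    ultimately have "real (card U) * \<tau> * \<rho> / 4 - 3 * (e0 + \<rho>) * sqrt (n * L) - n * (e0 + \<rho>)\<^sup>2 \<le> (\<Sum>i<n. 2 * (?r i * d i) - (d i)\<^sup>2)"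
      using n1 rd by linarith
    then show "\<exists>G\<in>convex_bodies.
        real (card U) * \<tau> * (2 * \<eta>\<^sup>2) / 4 - 3 * (e0 + 2 * \<eta>\<^sup>2) * sqrt (n * L) - n * (e0 + 2 * \<eta>\<^sup>2)\<^sup>2
        \<le> (\<Sum>i<n. 2 * (resid K (\<omega> i) * (support_fun G (fst (\<omega> i)) - support_fun K (fst (\<omega> i))))
            - (support_fun G (fst (\<omega> i)) - support_fun K (fst (\<omega> i)))\<^sup>2)"
      using bbG(1) unfolding \<rho>_def d_def by blast
  qed
qed

end

section \<open>Risk of the least squares estimator\<close>

text \<open>The constant \<open>min c 1\<close> serves both alternatives of the definition: the
  uniform law itself, and a density at least \<open>c\<close>.\<close>

lemma admissible_design_props:
  fixes P :: "'a::euclidean_space measure"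
  assumes P: "admissible_design c P" and c: "0 < c"
  shows "prob_space P" "sets P = sets borel" "AE x in P. norm x = 1"
    "f \<in> borel_measurable borel \<Longrightarrow> ennreal (min c 1) * (\<integral>\<^sup>+x. f x \<partial>sphere_uniform) \<le> (\<integral>\<^sup>+x. f x \<partial>P)"
proof -
  have ss: "sets (sphere_uniform :: 'a measure) = sets borel" by (simp add: sphere_uniform_def)
  note [measurable_cong] = ss
  have ae: "AE x in (sphere_uniform :: 'a measure). norm x = 1" using AE_sphere_uniform by simp
  consider "P = sphere_uniform" | g where "g \<in> borel_measurable borel" "\<forall>x\<in>sphere 0 1. c \<le> g x"
      "P = density sphere_uniform (\<lambda>x. ennreal (g x))" "prob_space P"
    using P unfolding admissible_design_def by blast
  then have "prob_space P \<and> sets P = sets borel \<and> (AE x in P. norm x = 1) \<and>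
    (f \<in> borel_measurable borel \<longrightarrow> ennreal (min c 1) * (\<integral>\<^sup>+x. f x \<partial>sphere_uniform) \<le> (\<integral>\<^sup>+x. f x \<partial>P))"
  proof cases
    case 1
    have "ennreal (min c 1) * (\<integral>\<^sup>+x. f x \<partial>sphere_uniform) \<le> 1 * (\<integral>\<^sup>+x. f x \<partial>sphere_uniform)"
      by (intro mult_right_mono) (auto simp: ennreal_le_1)
    then show ?thesis using 1 ss ae prob_space_sphere_uniform by auto
  next
    case (2 g)
    note [measurable] = 2(1)
    have "ennreal (min c 1) * (\<integral>\<^sup>+x. f x \<partial>sphere_uniform) \<le> (\<integral>\<^sup>+x. f x \<partial>P)" if [measurable]: "f \<in> borel_measurable borel"
    proof -
      have "ennreal (min c 1) * (\<integral>\<^sup>+x. f x \<partial>sphere_uniform) = (\<integral>\<^sup>+x. ennreal (min c 1) * f x \<partial>sphere_uniform)"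
        by (rule nn_integral_cmult[symmetric]) measurable
      also have "\<dots> \<le> (\<integral>\<^sup>+x. ennreal (g x) * f x \<partial>sphere_uniform)"
      proof (rule nn_integral_mono_AE)
        show "AE x in sphere_uniform. ennreal (min c 1) * f x \<le> ennreal (g x) * f x"
          using ae by eventually_elim (use 2(2) in \<open>auto intro!: mult_right_mono ennreal_leI simp: min_le_iff_disj\<close>)
      qed
      also have "\<dots> = (\<integral>\<^sup>+x. f x \<partial>P)" unfolding 2(3) by (subst nn_integral_density) auto
      finally show ?thesis .
    qed
    moreover have "AE x in P. norm x = 1" unfolding 2(3) using ae by (subst AE_density) (measurable, auto)
    ultimately show ?thesis using 2 ss by auto
  qed
  then show "prob_space P" "sets P = sets borel" "AE x in P. norm x = 1"
    "f \<in> borel_measurable borel \<Longrightarrow> ennreal (min c 1) * (\<integral>\<^sup>+x. f x \<partial>sphere_uniform) \<le> (\<integral>\<^sup>+x. f x \<partial>P)" by auto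
qed

lemma admissible_design_cap:
  fixes P :: "'a::euclidean_space measure"
  assumes P: "admissible_design c P" and c: "0 < c" and u: "norm u = 1" and a: "0 < a" "a \<le> 1"
  shows "min c 1 * (a ^ (DIM('a) - 1) / (2 * 8 ^ DIM('a))) \<le> measure P {x. norm (x - u) \<le> a}"
proof -
  interpret P: prob_space P by (rule admissible_design_props[OF P c])
  let ?C = "{x. norm (x - u) \<le> a}"
  have m: "?C \<in> sets borel" by measurable
  have ss: "sets (sphere_uniform :: 'a measure) = sets borel" by (simp add: sphere_uniform_def)
  have "ennreal (min c 1 * (a ^ (DIM('a) - 1) / (2 * 8 ^ DIM('a)))) = ennreal (min c 1) * ennreal (a ^ (DIM('a) - 1) / (2 * 8 ^ DIM('a)))"
    using c a by (intro ennreal_mult) auto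
  also have "\<dots> \<le> ennreal (min c 1) * emeasure sphere_uniform ?C"
    by (intro mult_left_mono cap_sphere_uniform u a) auto
  also have "\<dots> = ennreal (min c 1) * (\<integral>\<^sup>+x. indicator ?C x \<partial>sphere_uniform)" using m by (simp add: ss)
  also have "\<dots> \<le> (\<integral>\<^sup>+x. indicator ?C x \<partial>P)" using m by (intro admissible_design_props(4)[OF P c]) simp
  also have "\<dots> = ennreal (measure P ?C)" using m admissible_design_props(2)[OF P c] by (simp add: P.emeasure_eq_measure)
  finally show ?thesis by simp
qed

section \<open>Energy against loss\<close>

lemma support_fun_bounded:
  fixes K :: "'a::euclidean_space set"
  assumes "K \<in> convex_bodies"
  shows "\<exists>B\<ge>0. \<forall>x. \<bar>support_fun K x\<bar> \<le> B * norm x"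
proof -
  obtain B where B: "\<And>x. x \<in> K \<Longrightarrow> norm x \<le> B"
    using assms compact_imp_bounded[of K] unfolding bounded_iff convex_bodies_def by auto
  have "\<bar>support_fun K x\<bar> \<le> B * norm x" for x
  proof -
    obtain p where p: "p \<in> K" "support_fun K x = p \<bullet> x" using support_fun_max[OF assms] by blast
    have "\<bar>p \<bullet> x\<bar> \<le> norm p * norm x" by (rule Cauchy_Schwarz_ineq2)
    also have "\<dots> \<le> B * norm x" using B[OF p(1)] by (intro mult_right_mono) auto
    finally show ?thesis using p by simp
  qed
  moreover have "0 \<le> B" using B support_fun_max[OF assms, of 0] order_trans[OF norm_ge_zero] by blast
  ultimately show ?thesis by blast
qed

lemma L2_norm_sq_support_fun:
  fixes P :: "'a::euclidean_space measure"
  assumes P: "prob_space P" and sP: "sets P = sets borel" and ae: "AE x in P. norm x = 1"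
    and K: "K \<in> convex_bodies" and G: "G \<in> convex_bodies"
  shows "(\<integral>\<^sup>+x. ennreal ((support_fun G x - support_fun K x)\<^sup>2) \<partial>P) = ennreal (L2_norm_sq P (\<lambda>x. support_fun G x - support_fun K x))"
proof -
  interpret P: prob_space P by (rule P)
  note [measurable_cong] = sP
  note [measurable] = support_fun_measurable[OF K] support_fun_measurable[OF G]
  obtain B1 B2 where B: "\<And>x. \<bar>support_fun K x\<bar> \<le> B1 * norm x" "\<And>x. \<bar>support_fun G x\<bar> \<le> B2 * norm x"
    using support_fun_bounded[OF K] support_fun_bounded[OF G] by blast
  have "integrable P (\<lambda>x. (support_fun G x - support_fun K x)\<^sup>2)"
  proof (rule P.integrable_const_bound)
    show "AE x in P. norm ((support_fun G x - support_fun K x)\<^sup>2) \<le> (B1 + B2)\<^sup>2"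
      using ae
    proof eventually_elim
      case (elim x)
      have "\<bar>support_fun G x - support_fun K x\<bar> \<le> B1 + B2" using B[of x] elim by simp
      then have "\<bar>support_fun G x - support_fun K x\<bar>\<^sup>2 \<le> (B1 + B2)\<^sup>2" by (intro power_mono) auto
      then show ?case by simp
    qed
  qed measurable
  then show ?thesis unfolding L2_norm_sq_def by (intro nn_integral_eq_integral) auto
qed

text \<open>Homogeneity bounds |f x| on the ball by |f (sgn x)|, and \<open>sgn x\<close> has the
  law \<open>sphere_uniform\<close> for a uniform point of the ball. That law is dominated by a
  multiple of \<open>P\<close>.\<close>

lemma energy_le_L2:
  fixes P :: "'a::euclidean_space measure"
  assumes P: "admissible_design c P" and c: "0 < c" and K: "K \<in> convex_bodies" and G: "G \<in> convex_bodies"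
  defines "f \<equiv> (\<lambda>x. support_fun G x - support_fun K x)"
  shows "finite_measure (energy f)" "measure (energy f) UNIV \<le> unit_ball_vol (real DIM('a)) / min c 1 * L2_norm_sq P f"
proof -
  define v where "v = unit_ball_vol (real DIM('a))"
  have v0: "0 < v" by (simp add: v_def)
  let ?B = "ball (0::'a) 1"
  have [measurable]: "?B \<in> sets borel" by simp
  have eB: "emeasure lborel ?B = ennreal v" unfolding v_def using emeasure_ball[of 1 "0::'a"] by simp
  have fm [measurable]: "f \<in> borel_measurable borel"
    unfolding f_def using support_fun_measurable[OF K] support_fun_measurable[OF G] by measurable
  have hom: "f x = norm x * f (sgn x)" for x
    using support_fun_scale[OF K, of "norm x" "sgn x"] support_fun_scale[OF G, of "norm x" "sgn x"]
    by (cases "x = 0") (auto simp: f_def sgn_div_norm right_diff_distrib)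
  have sm: "(\<lambda>x::'a. sgn x) \<in> borel_measurable borel" by measurable
  have "emeasure (energy f) UNIV = (\<integral>\<^sup>+x. ennreal ((f x)\<^sup>2 * indicator ?B x) \<partial>lborel)"
    unfolding energy_def by (subst emeasure_density) auto
  also have "\<dots> \<le> (\<integral>\<^sup>+x. ennreal ((f (sgn x))\<^sup>2) * indicator ?B x \<partial>lborel)"
  proof (rule nn_integral_mono)
    fix x :: 'a
    show "ennreal ((f x)\<^sup>2 * indicator ?B x) \<le> ennreal ((f (sgn x))\<^sup>2) * indicator ?B x"
    proof (cases "x \<in> ?B")
      case True
      have "(f x)\<^sup>2 = (norm x)\<^sup>2 * (f (sgn x))\<^sup>2" by (subst hom) (simp add: power_mult_distrib)
      also have "\<dots> \<le> 1 * (f (sgn x))\<^sup>2" using True by (intro mult_right_mono) (auto simp: power_le_one)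
      finally show ?thesis using True by (simp add: ennreal_leI)
    qed simp
  qed
  also have "\<dots> = ennreal v * ((\<integral>\<^sup>+x. ennreal ((f (sgn x))\<^sup>2) * indicator ?B x \<partial>lborel) / emeasure lborel ?B)"
  proof -
    have "Z = ennreal v * (Z / ennreal v)" for Z
      using v0 ennreal_mult_divide_eq[of "ennreal v" Z] by (simp add: ennreal_times_divide mult.commute)
    then show ?thesis unfolding eB .
  qed
  also have "(\<integral>\<^sup>+x. ennreal ((f (sgn x))\<^sup>2) * indicator ?B x \<partial>lborel) / emeasure lborel ?B
      = (\<integral>\<^sup>+x. ennreal ((f (sgn x))\<^sup>2) \<partial>uniform_measure lborel ?B)"
    using measurable_compose[OF sm fm] by (intro nn_integral_uniform_measure[symmetric]) auto
  also have "\<dots> = (\<integral>\<^sup>+x. ennreal ((f x)\<^sup>2) \<partial>sphere_uniform)"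
    unfolding sphere_uniform_def using sm by (subst nn_integral_distr) (auto simp: measurable_cong_sets[OF sets_uniform_measure refl])
  also have "ennreal v * (\<integral>\<^sup>+x. ennreal ((f x)\<^sup>2) \<partial>sphere_uniform)
      = ennreal (v / min c 1) * (ennreal (min c 1) * (\<integral>\<^sup>+x. ennreal ((f x)\<^sup>2) \<partial>sphere_uniform))"
    using c v0 by (subst mult.assoc[symmetric], subst ennreal_mult[symmetric]) (auto simp: min_def)
  also have "\<dots> \<le> ennreal (v / min c 1) * (\<integral>\<^sup>+x. ennreal ((f x)\<^sup>2) \<partial>P)"
    by (intro mult_left_mono admissible_design_props(4)[OF P c]) auto
  also have "(\<integral>\<^sup>+x. ennreal ((f x)\<^sup>2) \<partial>P) = ennreal (L2_norm_sq P f)"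
    unfolding f_def by (intro L2_norm_sq_support_fun admissible_design_props[OF P c] K G)
  also have "ennreal (v / min c 1) * ennreal (L2_norm_sq P f) = ennreal (v / min c 1 * L2_norm_sq P f)"
    using c v0 by (subst ennreal_mult) (auto simp: L2_norm_sq_def)
  finally have le: "emeasure (energy f) UNIV \<le> ennreal (v / min c 1 * L2_norm_sq P f)" .
  also have "\<dots> < \<infinity>" by simp
  finally have "emeasure (energy f) (space (energy f)) \<noteq> \<infinity>" by (metis less_irrefl space_energy)
  then show fin: "finite_measure (energy f)" by (rule finite_measureI)
  have "0 \<le> v / min c 1 * L2_norm_sq P f" using c v0 by (intro mult_nonneg_nonneg divide_nonneg_nonneg) (auto simp: L2_norm_sq_def)
  then show "measure (energy f) UNIV \<le> unit_ball_vol (real DIM('a)) / min c 1 * L2_norm_sq P f"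
    using le finite_measure.emeasure_eq_measure[OF fin] by (simp add: v_def)
qed

context obs_model
begin

section \<open>Typical samples and the least squares inequality\<close>

lemma AE_unit:
  assumes ae: "AE x in P. norm x = 1"
  shows "AE \<omega> in sample_law P n K. \<forall>i<n. norm (fst (\<omega> i)) = 1"
proof -
  let ?N = "{w :: (real ^ 'd) \<times> real. norm (fst w) \<noteq> 1}"
  have "{w \<in> space ((borel :: (real ^ 'd) measure) \<Otimes>\<^sub>M (borel :: real measure)). norm (fst w) \<noteq> 1} \<in> sets (borel \<Otimes>\<^sub>M borel)" by measurable
  then have Nm: "?N \<in> sets (borel \<Otimes>\<^sub>M borel)" by (simp add: space_pair_measure)
  have Nm': "{x :: real ^ 'd. norm x \<noteq> 1} \<in> sets borel" by measurable
  have "emeasure O_law ?N = (\<integral>\<^sup>+w. indicator ?N w \<partial>O_law)" using Nm by simp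
  also have "\<dots> = (\<integral>\<^sup>+x. \<integral>\<^sup>+\<xi>. indicator {x :: real ^ 'd. norm x \<noteq> 1} x \<partial>std_gauss \<partial>P)"
    using Nm by (subst nn_integral_obs) (auto simp: indicator_def)
  also have "\<dots> = (\<integral>\<^sup>+x. 0 \<partial>P)"
    by (rule nn_integral_cong_AE) (use ae in eventually_elim, simp)
  finally have "AE w in O_law. norm (fst w) = 1" using Nm by (intro AE_I[of _ _ ?N]) auto
  then have "AE \<omega> in sample_law P n K. norm (fst (\<omega> i)) = 1" if "i < n" for i
    unfolding sample_law_def using that by (intro AE_PiM_component prob_space_obs) auto
  then have "AE \<omega> in sample_law P n K. \<forall>i\<in>{..<n}. norm (fst (\<omega> i)) = 1" by (intro AE_finite_allI) auto
  then show ?thesis by (simp add: Ball_def)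
qed

text \<open>Markov's inequality; 1 / 16 is the share of this event in the failure budget of
  \<open>risk_at_scale\<close>.\<close>

lemma few_in:
  assumes A [measurable]: "A \<in> sets borel" and p: "measure P A \<le> p" "0 < p" and n: "0 < n"
  shows "\<exists>Bad\<in>sets (sample_law P n K). emeasure (sample_law P n K) Bad \<le> ennreal (1 / 16) \<and>
    (\<forall>\<omega>\<in>space (sample_law P n K) - Bad. real (card {i. i < n \<and> fst (\<omega> i) \<in> A}) \<le> 16 * real n * p)"
proof -
  interpret P: prob_space P by (rule P)
  let ?S = "sample_law P n K"
  let ?c = "\<lambda>\<omega>. real (card {i. i < n \<and> fst (\<omega> i) \<in> A})"
  define Bad where "Bad = {\<omega> \<in> space ?S. 16 * real n * p < ?c \<omega>}"
  have cm: "?c \<in> borel_measurable ?S" by (rule card_meas[OF A])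
  have Bm: "Bad \<in> sets ?S" unfolding Bad_def using cm by measurable
  have one: "(\<integral>\<^sup>+\<omega>. indicator A (fst (\<omega> i)) \<partial>?S) = emeasure P A" if i: "i < n" for i
  proof -
    have m: "(\<lambda>w. indicator A (fst w) :: ennreal) \<in> borel_measurable O_law"
      unfolding measurable_cong_sets[OF sets_observation_law refl] by measurable
    have "(\<integral>\<^sup>+\<omega>. indicator A (fst (\<omega> i)) \<partial>?S) = (\<integral>\<^sup>+w. indicator A (fst w) \<partial>distr ?S O_law (\<lambda>\<omega>. \<omega> i))"
      using m i by (subst nn_integral_distr) (auto simp: sample_law_def)
    also have "distr ?S O_law (\<lambda>\<omega>. \<omega> i) = O_law"
      unfolding sample_law_def using i prob_space_obs by (intro distr_PiM_component) auto
    also have "(\<integral>\<^sup>+w. indicator A (fst w) \<partial>O_law) = (\<integral>\<^sup>+x. indicator A x \<partial>P)"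
      using prob_space.emeasure_space_1[OF prob_space_std_gauss] by (subst nn_integral_obs) auto
    finally show ?thesis by simp
  qed
  have fm: "(\<lambda>\<omega>. indicator A (fst (\<omega> i)) :: ennreal) \<in> borel_measurable ?S" if "i < n" for i
    using measurable_compose[OF coord_meas[OF that] measurable_fst] by measurable
  have "emeasure ?S Bad = (\<integral>\<^sup>+\<omega>. indicator Bad \<omega> \<partial>?S)" using Bm by simp
  also have "\<dots> \<le> (\<integral>\<^sup>+\<omega>. ennreal (1 / (16 * real n * p)) * (\<Sum>i<n. indicator A (fst (\<omega> i))) \<partial>?S)"
  proof (rule nn_integral_mono)
    fix \<omega> :: "nat \<Rightarrow> (real ^ 'd) \<times> real"
    have s: "(\<Sum>i<n. indicator A (fst (\<omega> i))) = ennreal (?c \<omega>)"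
    proof -
      have "?c \<omega> = (\<Sum>i | i < n \<and> fst (\<omega> i) \<in> A. 1)" by simp
      also have "\<dots> = (\<Sum>i<n. if fst (\<omega> i) \<in> A then 1 else 0)" by (rule sum_filter)
      finally have "?c \<omega> = (\<Sum>i<n. indicator A (fst (\<omega> i)))" by (simp only: indicator_def of_bool_def)
      then have "ennreal (?c \<omega>) = (\<Sum>i<n. ennreal (indicator A (fst (\<omega> i))))" by (subst sum_ennreal) auto
      then show ?thesis by (simp only: ennreal_indicator)
    qed
    show "indicator Bad \<omega> \<le> ennreal (1 / (16 * real n * p)) * (\<Sum>i<n. indicator A (fst (\<omega> i)))"
    proof (cases "\<omega> \<in> Bad")
      case True
      have "1 = ennreal (1 / (16 * real n * p) * (16 * real n * p))" using n p by simp
      also have "\<dots> \<le> ennreal (1 / (16 * real n * p) * ?c \<omega>)" using True n p by (intro ennreal_leI mult_left_mono) (auto simp: Bad_def)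
      also have "\<dots> = ennreal (1 / (16 * real n * p)) * ennreal (?c \<omega>)" using n p by (intro ennreal_mult) auto
      finally show ?thesis using True unfolding s by simp
    qed simp
  qed
  also have "\<dots> = ennreal (1 / (16 * real n * p)) * (\<Sum>i<n. emeasure P A)"
  proof -
    have "(\<integral>\<^sup>+\<omega>. (\<Sum>i<n. indicator A (fst (\<omega> i))) \<partial>?S) = (\<Sum>i<n. \<integral>\<^sup>+\<omega>. indicator A (fst (\<omega> i)) \<partial>?S)"
      using fm by (intro nn_integral_sum) auto
    also have "\<dots> = (\<Sum>i<n. emeasure P A)" using one by (intro sum.cong) auto
    finally show ?thesis using fm by (subst nn_integral_cmult) (auto intro!: borel_measurable_sum)
  qed
  also have "\<dots> = ennreal (1 / (16 * real n * p) * (real n * measure P A))"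
  proof -
    have "(\<Sum>i<n. emeasure P A) = ennreal (real n * measure P A)"
      by (simp add: P.emeasure_eq_measure ennreal_mult ennreal_of_nat_eq_real_of_nat)
    then show ?thesis using n p by (simp only:) (intro ennreal_mult[symmetric], auto)
  qed
  also have "\<dots> \<le> ennreal (1 / 16)"
    using n p by (intro ennreal_leI) (simp add: field_simps)
  finally show ?thesis using Bm by (intro bexI[of _ Bad]) (auto simp: Bad_def not_less)
qed

lemma risk_ge:
  assumes ae: "AE x in P. norm x = 1" and W: "W \<in> sets (sample_law P n K)"
    and v: "\<And>\<omega>. \<omega> \<in> W \<Longrightarrow> \<forall>i<n. norm (fst (\<omega> i)) = 1 \<Longrightarrow> v \<le> L2_norm_sq P (\<lambda>u. support_fun (Khat \<omega>) u - support_fun K u)"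
  shows "ennreal v * emeasure (sample_law P n K) W \<le> risk P n Khat K"
proof -
  let ?S = "sample_law P n K"
  have "ennreal v * emeasure ?S W = (\<integral>\<^sup>+\<omega>. ennreal v * indicator W \<omega> \<partial>?S)" using W by (simp add: nn_integral_cmult_indicator)
  also have "\<dots> \<le> risk P n Khat K"
    unfolding risk_def
  proof (rule nn_integral_mono_AE)
    show "AE \<omega> in ?S. ennreal v * indicator W \<omega> \<le> ennreal (L2_norm_sq P (\<lambda>u. support_fun (Khat \<omega>) u - support_fun K u))"
      using AE_unit[OF ae, of n] by eventually_elim (auto simp: indicator_def intro!: ennreal_leI v)
  qed
  finally show ?thesis .
qed

lemma lse_props:
  assumes Khat: "least_squares_estimator n Khat" and \<omega>: "\<omega> \<in> space (sample_law P n K)" "\<forall>i<n. norm (fst (\<omega> i)) = 1"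
  shows "Khat \<omega> \<in> convex_bodies"
    "G \<in> convex_bodies \<Longrightarrow> (\<Sum>i<n. (snd (\<omega> i) - support_fun (Khat \<omega>) (fst (\<omega> i)))\<^sup>2) \<le> (\<Sum>i<n. (snd (\<omega> i) - support_fun G (fst (\<omega> i)))\<^sup>2)"
proof -
  have "\<omega> \<in> {..<n} \<rightarrow>\<^sub>E sphere 0 1 \<times> UNIV"
    using \<omega> by (auto simp: sample_law_def space_PiM PiE_def Pi_def mem_Times_iff)
  then have "is_arg_min (\<lambda>K. \<Sum>i<n. (snd (\<omega> i) - support_fun K (fst (\<omega> i)))\<^sup>2) (\<lambda>K. K \<in> convex_bodies) (Khat \<omega>)"
    using Khat by (auto simp: least_squares_estimator_def)
  then show "Khat \<omega> \<in> convex_bodies"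
    "G \<in> convex_bodies \<Longrightarrow> (\<Sum>i<n. (snd (\<omega> i) - support_fun (Khat \<omega>) (fst (\<omega> i)))\<^sup>2) \<le> (\<Sum>i<n. (snd (\<omega> i) - support_fun G (fst (\<omega> i)))\<^sup>2)"
    by (auto simp: is_arg_min_def not_less)
qed

text \<open>Up to the common residual sum of squares of \<open>K\<close>, the estimator maximises
  the quantity on the left among all convex bodies. The negative square in its own value is
  dropped.\<close>

lemma lse_basic_ineq:
  assumes Khat: "least_squares_estimator n Khat" and \<omega>: "\<omega> \<in> space (sample_law P n K)" "\<forall>i<n. norm (fst (\<omega> i)) = 1"
    and G: "G \<in> convex_bodies"
  shows "(\<Sum>i<n. 2 * (resid K (\<omega> i) * (support_fun G (fst (\<omega> i)) - support_fun K (fst (\<omega> i))))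
        - (support_fun G (fst (\<omega> i)) - support_fun K (fst (\<omega> i)))\<^sup>2)
    \<le> 2 * (\<Sum>i<n. resid K (\<omega> i) * (support_fun (Khat \<omega>) (fst (\<omega> i)) - support_fun K (fst (\<omega> i))))"
proof -
  have e: "(snd (\<omega> i) - support_fun H (fst (\<omega> i)))\<^sup>2 = (resid K (\<omega> i))\<^sup>2
      - (2 * (resid K (\<omega> i) * (support_fun H (fst (\<omega> i)) - support_fun K (fst (\<omega> i)))) - (support_fun H (fst (\<omega> i)) - support_fun K (fst (\<omega> i)))\<^sup>2)" for H i
    by (simp add: resid_def power2_eq_square algebra_simps)
  have "(\<Sum>i<n. 2 * (resid K (\<omega> i) * (support_fun G (fst (\<omega> i)) - support_fun K (fst (\<omega> i))))
        - (support_fun G (fst (\<omega> i)) - support_fun K (fst (\<omega> i)))\<^sup>2)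
     \<le> (\<Sum>i<n. 2 * (resid K (\<omega> i) * (support_fun (Khat \<omega>) (fst (\<omega> i)) - support_fun K (fst (\<omega> i))))
        - (support_fun (Khat \<omega>) (fst (\<omega> i)) - support_fun K (fst (\<omega> i)))\<^sup>2)"
    using lse_props(2)[OF Khat \<omega> G] unfolding e sum_subtractf[of "\<lambda>i. (resid K (\<omega> i))\<^sup>2"] by linarith
  also have "\<dots> \<le> (\<Sum>i<n. 2 * (resid K (\<omega> i) * (support_fun (Khat \<omega>) (fst (\<omega> i)) - support_fun K (fst (\<omega> i)))))"
    by (intro sum_mono) simp
  finally show ?thesis by (simp add: sum_distrib_left)
qed

end

text \<open>If the truth is {0} and all observations lie in [1, 2], the ball of radius 3 / 2 has
  residuals at most 1 / 2. So the minimiser has a support value at least 1 / 2 at some design point,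
  hence a point of norm at least 1 / 2, and its support function is at least 1 / 4 on a cap of
  radius 1. The event has probability \<open>q ^ n\<close>, whatever \<open>P\<close> is.\<close>

lemma risk_small_sample:
  assumes c: "0 < c"
  shows "\<exists>b>0. \<forall>(P :: (real ^ 'd::finite) measure) n Khat. admissible_design c P \<longrightarrow> 0 < n \<longrightarrow> n < n0 \<longrightarrow>
    least_squares_estimator n Khat \<longrightarrow> ennreal b \<le> risk P n Khat {0}"
proof -
  let ?D = "CARD('d)"
  interpret N: prob_space std_gauss by (rule prob_space_std_gauss)
  define q where "q = measure std_gauss {1..2}"
  have q1: "q \<le> 1" by (simp add: q_def)
  have q0: "0 < q"
  proof -
    have "emeasure std_gauss {1..2} \<noteq> 0"
    proof
      assume "emeasure std_gauss {1..2} = 0"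
      then have "{1..2} \<in> null_sets std_gauss" by auto
      then have "AE x in lborel. x \<in> {1..2} \<longrightarrow> ennreal (std_normal_density x) = 0"
        by (subst (asm) null_sets_density_iff) auto
      then have "AE x in lborel. x \<notin> {1..2::real}" 
      proof eventually_elim
        case (elim x)
        then show ?case using normal_density_pos[of 1 0 x] by (auto simp: ennreal_eq_0_iff)
      qed
      then have "{1..2::real} \<in> null_sets lborel" by (subst AE_iff_null_sets) auto
      then show False by (simp add: null_sets_def)
    qed
    then show ?thesis by (simp add: q_def N.emeasure_eq_measure zero_less_measure_iff)
  qed
  define v where "v = 1 / 16 * (min c 1 * (1 ^ (?D - 1) / (2 * 8 ^ ?D)))"
  have v0: "0 < v" using c by (simp add: v_def)
  show ?thesis
  proof (intro exI[of _ "v * q ^ n0"] conjI allI impI)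
    show "0 < v * q ^ n0" using v0 q0 by simp
    fix P :: "(real ^ 'd) measure" and n :: nat and Khat :: "(nat \<Rightarrow> (real ^ 'd) \<times> real) \<Rightarrow> (real ^ 'd) set"
    assume adm: "admissible_design c P" and n: "0 < n" "n < n0" and Khat: "least_squares_estimator n Khat"
    note Pp = admissible_design_props[OF adm c]
    have K0: "{0 :: real ^ 'd} \<in> convex_bodies" by (simp add: convex_bodies_def)
    interpret obs_model P "{0}" by (rule obs_model.intro[OF Pp(1,2) K0])
    interpret P: prob_space P by (rule Pp)
    have s0: "support_fun {0 :: real ^ 'd} x = 0" for x by (simp add: support_fun_def)
    let ?S = "sample_law P n {0}"
    define W where "W = {\<omega> \<in> space ?S. \<forall>i<n. snd (\<omega> i) \<in> {1..2}}"
    have sm: "(\<lambda>\<omega>. snd (\<omega> i)) \<in> borel_measurable ?S" if "i < n" for i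
      by (rule measurable_compose[OF coord_meas[OF that] measurable_snd])
    have Wm: "W \<in> sets ?S" unfolding W_def using sm by measurable
    have fm: "(\<lambda>w :: (real ^ 'd) \<times> real. indicator {1..2} (snd w) :: ennreal) \<in> borel_measurable (borel \<Otimes>\<^sub>M borel)" by measurable
    have "emeasure ?S W = (\<integral>\<^sup>+\<omega>. indicator W \<omega> \<partial>?S)" using Wm by simp
    also have "\<dots> = (\<integral>\<^sup>+\<omega>. (\<Prod>i<n. indicator {1..2} (snd (\<omega> i))) \<partial>?S)"
    proof (rule nn_integral_cong)
      fix \<omega> assume "\<omega> \<in> space ?S"
      then show "indicator W \<omega> = (\<Prod>i<n. indicator {1..2} (snd (\<omega> i)) :: ennreal)"
        by (cases "\<forall>i<n. snd (\<omega> i) \<in> {1..2}") (auto simp: W_def indicator_def prod_zero_iff)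
    qed
    also have "\<dots> = (\<integral>\<^sup>+w. indicator {1..2} (snd w) \<partial>O_law) ^ n" by (rule nn_integral_sample_prod[OF fm])
    also have "(\<integral>\<^sup>+w. indicator {1..2} (snd w) \<partial>O_law) = (\<integral>\<^sup>+x. \<integral>\<^sup>+\<xi>. indicator {1..2} \<xi> \<partial>std_gauss \<partial>P)"
      using fm by (subst nn_integral_obs) (auto simp: s0)
    also have "\<dots> = ennreal q" by (simp add: q_def N.emeasure_eq_measure P.emeasure_space_1)
    finally have We: "emeasure ?S W = ennreal (q ^ n)" using q0 by (simp add: ennreal_power)
    have "v \<le> L2_norm_sq P (\<lambda>u. support_fun (Khat \<omega>) u - support_fun {0} u)"
      if w: "\<omega> \<in> W" and un: "\<forall>i<n. norm (fst (\<omega> i)) = 1" for \<omega>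
    proof -
      have ws: "\<omega> \<in> space ?S" using w by (simp add: W_def)
      let ?H = "Khat \<omega>"
      have H: "?H \<in> convex_bodies" by (rule lse_props[OF Khat ws un])
      have ball: "cball (0 :: real ^ 'd) (3 / 2) \<in> convex_bodies" by (simp add: convex_bodies_def)
      have sb: "support_fun (cball 0 (3 / 2)) x = 3 / 2" if "norm x = 1" for x :: "real ^ 'd"
      proof -
        obtain p where p: "p \<in> cball 0 (3 / 2)" "support_fun (cball 0 (3 / 2)) x = p \<bullet> x" using support_fun_max[OF ball] by blast
        have "p \<bullet> x \<le> norm p * norm x" by (rule norm_cauchy_schwarz)
        moreover have "((3 / 2) *\<^sub>R x) \<bullet> x \<le> support_fun (cball 0 (3 / 2)) x" using that by (intro support_fun_ge[OF ball]) auto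
        moreover have "x \<bullet> x = 1" using that by (simp add: norm_eq_1)
        ultimately show ?thesis using p that by simp
      qed
      have "(\<Sum>i<n. (snd (\<omega> i) - support_fun ?H (fst (\<omega> i)))\<^sup>2) \<le> (\<Sum>i<n. (snd (\<omega> i) - 3 / 2)\<^sup>2)"
        using lse_props(2)[OF Khat ws un ball] un sb by simp
      also have "\<dots> \<le> (\<Sum>i<n. (1 / 2)\<^sup>2)"
      proof (rule sum_mono)
        fix i assume "i \<in> {..<n}"
        then have "snd (\<omega> i) \<in> {1..2}" using w by (simp add: W_def)
        then have "1 \<le> snd (\<omega> i)" "snd (\<omega> i) \<le> 2" by auto
        then have "\<bar>snd (\<omega> i) - 3 / 2\<bar> \<le> \<bar>1 / 2\<bar>" by arith
        then show "(snd (\<omega> i) - 3 / 2)\<^sup>2 \<le> (1 / 2)\<^sup>2" by (simp only: abs_le_square_iff)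
      qed
      finally have le: "(\<Sum>i<n. (snd (\<omega> i) - support_fun ?H (fst (\<omega> i)))\<^sup>2) \<le> (\<Sum>i<n. (1 / 2)\<^sup>2)" .
      have "\<exists>i\<in>{..<n}. (snd (\<omega> i) - support_fun ?H (fst (\<omega> i)))\<^sup>2 \<le> (1 / 2)\<^sup>2"
      proof (rule ccontr)
        assume "\<not> ?thesis"
        then have "(\<Sum>i<n. (1 / 2)\<^sup>2) < (\<Sum>i<n. (snd (\<omega> i) - support_fun ?H (fst (\<omega> i)))\<^sup>2)"
          using n by (intro sum_strict_mono) (auto simp: not_le)
        with le show False by linarith
      qed
      then obtain i where i: "i < n" "(snd (\<omega> i) - support_fun ?H (fst (\<omega> i)))\<^sup>2 \<le> (1 / 2)\<^sup>2" by auto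
      have ui: "norm (fst (\<omega> i)) = 1" using un i by simp
      have "\<bar>snd (\<omega> i) - support_fun ?H (fst (\<omega> i))\<bar> \<le> \<bar>1 / 2\<bar>" using i(2) by (simp only: abs_le_square_iff)
      moreover have "1 \<le> snd (\<omega> i)" using w i by (simp add: W_def)
      ultimately have h: "1 / 2 \<le> support_fun ?H (fst (\<omega> i))" by arith
      obtain p where p: "p \<in> ?H" "support_fun ?H (fst (\<omega> i)) = p \<bullet> fst (\<omega> i)" using support_fun_max[OF H] by blast
      have np: "1 / 2 \<le> norm p" using h p(2) norm_cauchy_schwarz[of p "fst (\<omega> i)"] ui by simp
      define u where "u = sgn p"
      have u: "norm u = 1" using np by (auto simp: u_def norm_sgn)
      let ?C = "{x. norm (x - u) \<le> 1}"
      have Cm: "?C \<in> sets P" unfolding Pp(2) by measurable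
      have big: "1 / 4 \<le> support_fun ?H x" if x: "norm x = 1" "x \<in> ?C" for x
      proof -
        have "x \<bullet> u = 1 - (norm (x - u))\<^sup>2 / 2" by (rule inner_unit[OF x(1) u])
        moreover have "(norm (x - u))\<^sup>2 \<le> 1" using x(2) by (simp add: power_le_one)
        ultimately have "1 / 2 \<le> x \<bullet> u" by simp
        then have "1 / 2 * (1 / 2) \<le> norm p * (x \<bullet> u)" using np by (intro mult_mono) auto
        also have "\<dots> = p \<bullet> x"
        proof -
          have "norm p \<noteq> 0" using np by linarith
          then have "norm p * inverse (norm p) = 1" by (rule right_inverse)
          then have "p = norm p *\<^sub>R u" unfolding u_def sgn_div_norm scaleR_scaleR by (metis scaleR_one)
          then have "p \<bullet> x = (norm p *\<^sub>R u) \<bullet> x" by simp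
          then show ?thesis by (simp add: inner_commute)
        qed
        also have "\<dots> \<le> support_fun ?H x" by (rule support_fun_ge[OF H p(1)])
        finally show ?thesis by simp
      qed
      have "ennreal (1 / 16 * measure P ?C) = ennreal (1 / 16) * emeasure P ?C"
        unfolding P.emeasure_eq_measure by (intro ennreal_mult) auto
      also have "\<dots> = (\<integral>\<^sup>+x. ennreal (1 / 16) * indicator ?C x \<partial>P)" using Cm by (simp add: nn_integral_cmult_indicator)
      also have "\<dots> \<le> (\<integral>\<^sup>+x. ennreal ((support_fun ?H x - support_fun {0} x)\<^sup>2) \<partial>P)"
      proof (rule nn_integral_mono_AE)
        show "AE x in P. ennreal (1 / 16) * indicator ?C x \<le> ennreal ((support_fun ?H x - support_fun {0} x)\<^sup>2)"
          using Pp(3)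
        proof eventually_elim
          case (elim x)
          show ?case
          proof (cases "x \<in> ?C")
            case True
            have "(1 / 4)\<^sup>2 \<le> (support_fun ?H x)\<^sup>2" using big[OF elim True] by (intro power_mono) auto
            then have "1 / 16 \<le> (support_fun ?H x - support_fun {0} x)\<^sup>2" by (simp add: s0 power2_eq_square)
            then have "ennreal (1 / 16) \<le> ennreal ((support_fun ?H x - support_fun {0} x)\<^sup>2)" by (rule ennreal_leI)
            then show ?thesis using True by simp
          qed simp
        qed
      qed
      also have "\<dots> = ennreal (L2_norm_sq P (\<lambda>x. support_fun ?H x - support_fun {0} x))"
        by (rule L2_norm_sq_support_fun[OF Pp(1-3) K0 H])
      finally have "1 / 16 * measure P ?C \<le> L2_norm_sq P (\<lambda>x. support_fun ?H x - support_fun {0} x)"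
        by (subst (asm) ennreal_le_iff) (auto simp: L2_norm_sq_def)
      moreover have "v \<le> 1 / 16 * measure P ?C"
        unfolding v_def using admissible_design_cap[OF adm c u, of 1] by (intro mult_left_mono) auto
      ultimately show ?thesis by linarith
    qed
    then have "ennreal v * ennreal (q ^ n) \<le> risk P n Khat {0}"
      unfolding We[symmetric] by (intro risk_ge Pp Wm)
    moreover have "v * q ^ n0 \<le> v * q ^ n" using v0 q0 q1 n by (intro mult_left_mono power_decreasing) auto
    then have "ennreal (v * q ^ n0) \<le> ennreal v * ennreal (q ^ n)"
      using v0 q0 by (subst ennreal_mult[symmetric]) (auto intro!: ennreal_leI)
    ultimately show "ennreal (v * q ^ n0) \<le> risk P n Khat {0}" by (rule order_trans[rotated])
  qed
qed

text \<open>Suppose that the loss is below \<open>t2\<close>. Then the energy is at most V t2 and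
  \<open>noise_upper_bound\<close> keeps twice the correlation below \<open>gg\<close>, whereas
  \<open>gain_event\<close> and \<open>lse_basic_ineq\<close> force it to be at least
  \<open>gg\<close>. The exceptional events have probability at most 1 / 8 + 1 / 16 + 1 / 16, so the
  loss is at least \<open>t2\<close> with probability at least 1 / 2.\<close>

lemma risk_at_scale:
  fixes P :: "(real ^ 'd::finite) measure" and n k J r Smax :: nat and c \<tau> L a t2 gg :: real
  assumes d: "6 \<le> CARD('d)" and adm: "admissible_design c P" and c: "0 < c"
    and Khat: "least_squares_estimator n Khat" and n: "0 < n"
    and h: "12 * real CARD('d) \<le> 2 ^ J" and Smax: "n \<le> 2 ^ (Smax * (CARD('d) - 1))" and L: "0 < L" and \<tau>: "0 < \<tau>"
    and a: "0 < a" "a \<le> 1" and t2: "0 \<le> t2"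
  defines "q \<equiv> r + CARD('d) + 8" and "\<eta> \<equiv> cap_radius CARD('d) k" and "e0 \<equiv> 2 * (1 / 2 ^ J)\<^sup>2"
    and "V \<equiv> unit_ball_vol (real CARD('d)) / min c 1"
  assumes b1: "2 * (exp (- (real n * (min c 1 * (\<eta> ^ (CARD('d) - 1) / (2 * 8 ^ CARD('d)))))) + 4 * \<tau> * real n / 2 ^ (k * (CARD('d) - 1)))
       + 2 * real n * exp (- L) \<le> 1 / 8"
    and b2: "(2 * (real (J + q) + 1) * (2 * real CARD('d) * 3 ^ CARD('d)) * (2 ^ (J + q)) ^ (CARD('d) - 1)) * ((2 * real n * (real Smax + 1) + 1) * exp (- L)) \<le> 1 / 16"
    and gain: "gg \<le> 2 ^ (k * (CARD('d) - 1)) * \<tau> * (2 * \<eta>\<^sup>2) / 4 - 3 * (e0 + 2 * \<eta>\<^sup>2) * sqrt (real n * L) - real n * (e0 + 2 * \<eta>\<^sup>2)\<^sup>2"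
    and V1: "V * t2 \<le> 1"
    and upper: "2 * (upper_const CARD('d) * noise_const CARD('d) Smax L *
     ((real J + 1) * ((V * t2 * 16 ^ J) powr (1 - expo CARD('d)) * real n powr expo CARD('d))
       + (16 * real n * (2 * (near_const CARD('d))\<^sup>2 / 2 ^ r)) powr expo CARD('d)
       + 4 ^ q * (V * t2 * 16 ^ J / a) powr (1 - expo CARD('d)) * real n powr expo CARD('d)
       + 4 ^ q * sqrt a * real n powr expo CARD('d))) < gg"
  shows "\<exists>K\<in>unit_convex_bodies. ennreal (t2 / 2) \<le> risk P n Khat K"
proof -
  let ?D = "CARD('d)"
  note Pp = admissible_design_props[OF adm c]
  have D0: "0 < ?D" by simp
  define p where "p = 2 * (near_const ?D)\<^sup>2 / 2 ^ r"
  have near0: "0 < near_const ?D" unfolding near_const_def by (intro mult_pos_pos zero_less_power add_nonneg_pos) auto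
  have p0: "0 < p" using near0 by (simp add: p_def)
  have \<Lambda>0: "0 \<le> noise_const ?D Smax L"
    unfolding noise_const_def using L bron_const_nonneg[OF D0]
    by (intro add_nonneg_nonneg mult_nonneg_nonneg real_sqrt_ge_zero) auto
  have up0: "0 \<le> upper_const ?D"
    unfolding upper_const_def using box_const_pos[OF D0] by (intro mult_nonneg_nonneg add_nonneg_nonneg) auto
  have q0: "0 < q" by (simp add: q_def)
  obtain K LL where Ku: "K \<in> unit_convex_bodies"
    and sand: "\<And>x. (1 - 2 * (1 / 2 ^ J)\<^sup>2) * norm x \<le> support_fun K x" "\<And>x. support_fun K x \<le> norm x"
    and Lm: "{x. lab (J + q) x \<in> LL} \<in> sets borel" and PL: "measure P {x. lab (J + q) x \<in> LL} \<le> p"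
    and lin: "\<And>j cc. (j, cc) \<in> labs (J + q) - LL \<Longrightarrow> \<exists>p\<in>K. \<forall>x\<in>chart_cone j cc (3 / 2 ^ (J + q)). support_fun K x = p \<bullet> x"
    using exists_polytope[OF Pp(1-3) h, of r] unfolding q_def p_def by blast
  have Kc: "K \<in> convex_bodies" "K \<subseteq> cball 0 1" using Ku by (auto simp: unit_convex_bodies_def)
  interpret obs_model P K by (rule obs_model.intro[OF Pp(1,2) Kc(1)])
  interpret P: prob_space P by (rule Pp(1))
  let ?S = "sample_law P n K"
  interpret S: prob_space ?S by (rule prob_space_sample)
  define Lay where "Lay = {x. lab (J + q) x \<in> LL}"
  define p1 where "p1 = min c 1 * (\<eta> ^ (?D - 1) / (2 * 8 ^ ?D))"
  have \<eta>: "0 < \<eta>" "\<eta> \<le> 1 / 8" unfolding \<eta>_def by (rule cap_radius, simp)+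
  have cap: "p1 \<le> measure P {x. norm (x - u) \<le> cap_radius CARD('d) k}" if "u \<in> grid_dirs k" for u
    using admissible_design_cap[OF adm c grid_dirs(3)[OF that], of \<eta>] \<eta> by (simp add: p1_def \<eta>_def)
  have F: "1 - e0 \<le> support_fun K x \<and> support_fun K x \<le> 1" if "norm x = 1" for x
    using sand[of x] that by (simp add: e0_def)
  have e00: "0 \<le> e0" by (simp add: e0_def)
  obtain B1 where B1: "B1 \<in> sets ?S" "emeasure ?S B1 \<le> ennreal (2 * (exp (- (real n * p1)) + 4 * \<tau> * real n / real (card (grid_dirs k :: (real ^ 'd) set))) + 2 * real n * exp (- L))"
    and G: "\<And>\<omega>. \<omega> \<in> space ?S - B1 \<Longrightarrow> \<forall>i<n. norm (fst (\<omega> i)) = 1 \<Longrightarrow>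
      \<exists>G\<in>convex_bodies.
        real (card (grid_dirs k :: (real ^ 'd) set)) * \<tau> * (2 * \<eta>\<^sup>2) / 4 - 3 * (e0 + 2 * \<eta>\<^sup>2) * sqrt (real n * L) - real n * (e0 + 2 * \<eta>\<^sup>2)\<^sup>2
        \<le> (\<Sum>i<n. 2 * (resid K (\<omega> i) * (support_fun G (fst (\<omega> i)) - support_fun K (fst (\<omega> i))))
            - (support_fun G (fst (\<omega> i)) - support_fun K (fst (\<omega> i)))\<^sup>2)"
    using gain_event[OF F cap \<tau> L e00, of n, folded \<eta>_def] by blast
  have cd: "real (card (grid_dirs k :: (real ^ 'd) set)) = 2 ^ (k * (?D - 1))" by (simp add: grid_dirs(2))
  have B1': "emeasure ?S B1 \<le> ennreal (1 / 8)"
    using B1(2) b1 unfolding cd p1_def by (meson ennreal_leI order_trans)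
  obtain B2 where B2: "B2 \<in> sets ?S"
      "emeasure ?S B2 \<le> ennreal ((2 * (real (J + q) + 1) * (2 * real ?D * 3 ^ ?D) * (2 ^ (J + q)) ^ (?D - 1)) * ((2 * real n * (real Smax + 1) + 1) * exp (- L)))"
    and ok: "\<And>\<omega>. \<omega> \<in> space ?S - B2 \<Longrightarrow> \<forall>i<n. norm (fst (\<omega> i)) = 1 \<Longrightarrow>
        noise_ok n (\<lambda>i. fst (\<omega> i)) (\<lambda>i. resid K (\<omega> i)) Lay (J + q) (noise_const ?D Smax L)"
    using noise_event[OF d, of Lay L n Smax "J + q"] Lm L Smax unfolding Lay_def by blast
  have B2': "emeasure ?S B2 \<le> ennreal (1 / 16)" using B2(2) b2 by (meson ennreal_leI order_trans)
  obtain B3 where B3: "B3 \<in> sets ?S" "emeasure ?S B3 \<le> ennreal (1 / 16)"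
    and few: "\<And>\<omega>. \<omega> \<in> space ?S - B3 \<Longrightarrow> real (card {i. i < n \<and> fst (\<omega> i) \<in> Lay}) \<le> 16 * real n * p"
    using few_in[OF Lm PL p0 n] unfolding Lay_def by blast
  define Bad where "Bad = B1 \<union> B2 \<union> B3"
  have Badm: "Bad \<in> sets ?S" using B1 B2 B3 by (auto simp: Bad_def)
  have "emeasure ?S Bad \<le> emeasure ?S B1 + emeasure ?S B2 + emeasure ?S B3"
    unfolding Bad_def using B1 B2 B3 by (meson add_mono emeasure_subadditive order_refl order_trans sets.Un)
  also have "\<dots> \<le> ennreal (1 / 8) + ennreal (1 / 16) + ennreal (1 / 16)" by (intro add_mono B1' B2' B3)
  also have "\<dots> = ennreal (1 / 4)" by (subst ennreal_plus[symmetric], simp, simp)+ simp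
  finally have Bade: "measure ?S Bad \<le> 1 / 4" by (simp add: S.emeasure_eq_measure)
  have We: "ennreal (1 / 2) \<le> emeasure ?S (space ?S - Bad)"
    unfolding S.emeasure_eq_measure using Bade S.prob_compl[OF Badm] by (intro ennreal_leI) linarith
  have "t2 \<le> L2_norm_sq P (\<lambda>u. support_fun (Khat \<omega>) u - support_fun K u)"
    if w: "\<omega> \<in> space ?S - Bad" and un: "\<forall>i<n. norm (fst (\<omega> i)) = 1" for \<omega>
  proof (rule ccontr)
    assume small: "\<not> ?thesis"
    have ws: "\<omega> \<in> space ?S" using w by blast
    have Hc: "Khat \<omega> \<in> convex_bodies" by (rule lse_props[OF Khat ws un])
    define E where "E = measure (energy (\<lambda>x. support_fun (Khat \<omega>) x - support_fun K x)) UNIV"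
    have V0: "0 < V" using c by (simp add: V_def)
    note en = energy_le_L2[OF adm c Kc(1) Hc]
    have "E \<le> V * L2_norm_sq P (\<lambda>u. support_fun (Khat \<omega>) u - support_fun K u)"
      using en(2) by (simp add: E_def V_def)
    also have "\<dots> \<le> V * t2" using small V0 by (intro mult_left_mono) auto
    finally have E: "E \<le> V * t2" .
    have E0: "0 \<le> E" by (simp add: E_def)
    have nz: "fst (\<omega> i) \<noteq> 0" if "i < n" for i using un that by force
    let ?\<Lambda> = "noise_const ?D Smax L"
    have okw: "noise_ok n (\<lambda>i. fst (\<omega> i)) (\<lambda>i. resid K (\<omega> i)) Lay (J + q) ?\<Lambda>"
      using ok w un by (auto simp: Bad_def)
    have fw: "real (card {i. i < n \<and> fst (\<omega> i) \<in> Lay}) \<le> 16 * real n * p" using few w by (auto simp: Bad_def)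
    have E1: "E \<le> 1" using E V1 by linarith
    have ub: "(\<Sum>i<n. resid K (\<omega> i) * (support_fun (Khat \<omega>) (fst (\<omega> i)) - support_fun K (fst (\<omega> i)))) \<le>
      upper_const ?D * ?\<Lambda> *
       ((real J + 1) * ((E * 16 ^ J) powr (1 - expo ?D) * real n powr expo ?D) + (16 * real n * p) powr expo ?D
         + 4 ^ q * (E * 16 ^ J / a) powr (1 - expo ?D) * real n powr expo ?D
         + 4 ^ q * sqrt a * real n powr expo ?D)"
      by (rule noise_upper_bound[OF d Kc Hc sand en(1) E_def[symmetric] E1 nz lin Lay_def q0 okw \<Lambda>0 fw a])
    have th: "0 < 1 - expo ?D" using expo_bounds[OF d] by simp
    have m1: "(E * 16 ^ J) powr (1 - expo ?D) \<le> (V * t2 * 16 ^ J) powr (1 - expo ?D)"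
      using E E0 th by (intro powr_mono2 mult_right_mono) auto
    have m2: "(E * 16 ^ J / a) powr (1 - expo ?D) \<le> (V * t2 * 16 ^ J / a) powr (1 - expo ?D)"
      using E E0 th a by (intro powr_mono2 mult_right_mono divide_right_mono) auto
    obtain G where Gc: "G \<in> convex_bodies" and Gg: "gg \<le> (\<Sum>i<n. 2 * (resid K (\<omega> i) * (support_fun G (fst (\<omega> i)) - support_fun K (fst (\<omega> i))))
            - (support_fun G (fst (\<omega> i)) - support_fun K (fst (\<omega> i)))\<^sup>2)"
      using G[of \<omega>] w un gain unfolding cd Bad_def by (blast intro: order_trans)
    have "gg \<le> 2 * (\<Sum>i<n. resid K (\<omega> i) * (support_fun (Khat \<omega>) (fst (\<omega> i)) - support_fun K (fst (\<omega> i))))"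
      using Gg lse_basic_ineq[OF Khat ws un Gc] by linarith
    also have "\<dots> \<le> 2 * (upper_const ?D * ?\<Lambda> *
     ((real J + 1) * ((V * t2 * 16 ^ J) powr (1 - expo ?D) * real n powr expo ?D) + (16 * real n * p) powr expo ?D
       + 4 ^ q * (V * t2 * 16 ^ J / a) powr (1 - expo ?D) * real n powr expo ?D
       + 4 ^ q * sqrt a * real n powr expo ?D))"
      by (rule mult_left_mono[OF order_trans[OF ub]])
        (use m1 m2 up0 \<Lambda>0 in \<open>auto intro!: mult_left_mono add_mono mult_right_mono\<close>)
    finally show False using upper unfolding p_def by linarith
  qed
  then have "ennreal t2 * emeasure ?S (space ?S - Bad) \<le> risk P n Khat K"
    using Badm by (intro risk_ge Pp) auto
  moreover have "ennreal (t2 / 2) \<le> ennreal t2 * emeasure ?S (space ?S - Bad)"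
  proof -
    have "ennreal (t2 / 2) = ennreal t2 * ennreal (1 / 2)" using t2 by (subst ennreal_mult[symmetric]) auto
    also have "\<dots> \<le> ennreal t2 * emeasure ?S (space ?S - Bad)" by (intro mult_left_mono We) simp
    finally show ?thesis .
  qed
  ultimately show ?thesis using Ku by (blast intro: order_trans)
qed

section \<open>Choice of the scales\<close>

text \<open>With at least k^5 weights per vertex the layer is thin enough for
  \<open>layer_powr_le\<close>; the upper bound limits what the finer boxes cost.\<close>

lemma exists_log_scale: "1 \<le> k \<Longrightarrow> \<exists>r. real k ^ 5 \<le> 2 ^ r \<and> (2 :: real) ^ r \<le> 32 * real k ^ 5" for k :: nat
proof -
  assume k: "1 \<le> k"
  obtain l where l: "2 ^ l \<le> k" "k < 2 ^ (l + 1)" using ex_power_ivl1[of 2 k] k by auto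
  have "real k \<le> 2 ^ (l + 1)" using l(2) by (metis less_imp_le of_nat_le_iff of_nat_numeral of_nat_power)
  then have "real k ^ 5 \<le> (2 ^ (l + 1)) ^ 5" by (intro power_mono) auto
  moreover have "(2::real) ^ l \<le> real k" using l(1) by (metis of_nat_le_iff of_nat_numeral of_nat_power)
  then have "(2::real) ^ (l + 1) \<le> 2 * real k" by simp
  then have "((2::real) ^ (l + 1)) ^ 5 \<le> (2 * real k) ^ 5" by (intro power_mono) auto
  ultimately show ?thesis by (intro exI[of _ "(l + 1) * 5"]) (simp only: power_mult, simp only: power_mult_distrib, simp)
qed

text \<open>Since 1 - expo D is 2 / (D - 1), the power 8 (D - 1) of \<open>k\<close> turns into
  16.\<close>

lemma scaled_powr_le:
  assumes d: "6 \<le> D" and W: "1 \<le> W" and k: "1 \<le> k" and x: "0 \<le> x" "x \<le> W / real k ^ (8 * (D - 1))"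
  shows "x powr (1 - expo D) \<le> W / real k ^ 16"
proof -
  have b: "0 < 1 - expo D" "1 - expo D \<le> 1" using expo_bounds[OF d] by auto
  have e: "real (8 * (D - 1)) * (1 - expo D) = 16" proof -
    have "real D - 1 \<noteq> 0" using d by simp
    then show ?thesis using d by (simp add: expo_def of_nat_diff field_simps)
  qed
  have "x powr (1 - expo D) \<le> (W / real k ^ (8 * (D - 1))) powr (1 - expo D)" using x b by (intro powr_mono2) auto
  also have "\<dots> = W powr (1 - expo D) / (real k ^ (8 * (D - 1))) powr (1 - expo D)" by (rule powr_divide)
  also have "(real k ^ (8 * (D - 1))) powr (1 - expo D) = real k powr 16"
  proof -
    have "real k ^ (8 * (D - 1)) = real k powr real (8 * (D - 1))" using k by (intro powr_realpow[symmetric]) simp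
    then show ?thesis by (simp only: powr_powr e)
  qed
  also have "real k powr 16 = real k ^ 16" using k by simp
  also have "W powr (1 - expo D) / real k ^ 16 \<le> W / real k ^ 16" using W b by (intro divide_right_mono powr_le_self) auto
  finally show ?thesis .
qed

text \<open>For D \<ge> 6 the exponent is at least 3 / 5, so k^5 turns into at least k^3.\<close>

lemma layer_powr_le:
  assumes d: "6 \<le> D" and W: "1 \<le> W" and k: "1 \<le> k" and x: "0 \<le> x" "x \<le> W / real k ^ 5"
  shows "x powr expo D \<le> W / real k ^ 3"
proof -
  have b: "0 < expo D" "expo D \<le> 1" using expo_bounds[OF d] by auto
  have e: "3 \<le> 5 * expo D" using d by (simp add: expo_def field_simps)
  have "x powr expo D \<le> (W / real k ^ 5) powr expo D" using x b by (intro powr_mono2) auto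
  also have "\<dots> = W powr expo D / (real k ^ 5) powr expo D" by (rule powr_divide)
  also have "\<dots> \<le> W / real k ^ 3"
  proof (rule frac_le)
    show "W powr expo D \<le> W" using W b by (intro powr_le_self) auto
    have "real k ^ 3 = real k powr 3" using k by simp
    also have "\<dots> \<le> real k powr (5 * expo D)" using e k by (intro powr_mono) auto
    also have "\<dots> = (real k powr 5) powr expo D" by (rule powr_powr[symmetric])
    also have "real k powr 5 = real k ^ 5" using k by simp
    finally show "real k ^ 3 \<le> (real k ^ 5) powr expo D" .
  qed (use W k in auto)
  finally show ?thesis .
qed

text \<open>The number of chain levels is of order \<open>k\<close>, and the root of the deviation
  parameter is bounded by a multiple of \<open>k\<close>.\<close>

lemma noise_const_le:
  assumes D: "0 < D"
  shows "\<exists>C>0. \<forall>k\<ge>1. noise_const D (k + s) (4 * real m * real k) \<le> C * (real k)\<^sup>2"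
proof -
  define b where "b = bron_const D"
  have b0: "0 \<le> b" unfolding b_def by (rule bron_const_nonneg[OF D])
  define X where "X = 2 * b * (real s + 2) + 4 * real m"
  have X0: "0 \<le> X" using b0 by (simp add: X_def)
  define C where "C = (real s + 2) * (15 / 2) * (X + 1) * 2 ^ D + 2 + 4 * real m"
  have "noise_const D (k + s) (4 * real m * real k) \<le> C * (real k)\<^sup>2" if k: "1 \<le> k" for k
  proof -
    let ?y = "real k"
    have y: "1 \<le> ?y" using k by simp
    have yy: "?y \<le> ?y\<^sup>2" using y by (simp add: power2_eq_square)
    have s: "real (k + s) + 1 \<le> (real s + 2) * ?y"
    proof -
      have "(real s + 1) * 1 \<le> (real s + 1) * ?y" using y by (intro mult_left_mono) auto
      then show ?thesis by (simp add: algebra_simps)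
    qed
    have "2 * b * (real (k + s) + 1) + 4 * real m * ?y \<le> 2 * b * ((real s + 2) * ?y) + 4 * real m * ?y"
      using b0 s by (intro add_mono mult_left_mono) auto
    also have "\<dots> = X * ?y" by (simp add: X_def algebra_simps)
    also have "\<dots> \<le> ((X + 1) * ?y)\<^sup>2"
    proof -
      have "X * ?y \<le> (X + 1) * ?y" using y by (intro mult_right_mono) auto
      also have "\<dots> \<le> ((X + 1) * ?y)\<^sup>2"
      proof -
        have "1 * 1 \<le> (X + 1) * ?y" using X0 y by (intro mult_mono) auto
        then show ?thesis unfolding power2_eq_square by (simp add: mult_le_cancel_right1)
      qed
      finally show ?thesis .
    qed
    finally have "sqrt (2 * b * (real (k + s) + 1) + 4 * real m * ?y) \<le> (X + 1) * ?y"
      using X0 y by (intro real_le_lsqrt) auto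
    then have "(real (k + s) + 1) * (15 / 2) * sqrt (2 * b * (real (k + s) + 1) + 4 * real m * ?y) * 2 ^ D
      \<le> ((real s + 2) * ?y) * (15 / 2) * ((X + 1) * ?y) * 2 ^ D"
      using s b0 y X0 by (intro mult_mono) auto
    also have "\<dots> = (real s + 2) * (15 / 2) * (X + 1) * 2 ^ D * ?y\<^sup>2" by (simp add: power2_eq_square)
    finally have "noise_const D (k + s) (4 * real m * ?y) \<le> (real s + 2) * (15 / 2) * (X + 1) * 2 ^ D * ?y\<^sup>2 + 2 * ?y\<^sup>2 + 4 * real m * ?y\<^sup>2"
      unfolding noise_const_def b_def[symmetric] using yy y by (intro add_mono mult_left_mono) auto
    also have "\<dots> = C * ?y\<^sup>2" by (simp add: C_def algebra_simps)
    finally show ?thesis .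
  qed
  moreover have "0 < C" using X0 unfolding C_def by (intro add_nonneg_pos add_pos_nonneg mult_nonneg_nonneg) auto
  ultimately show ?thesis by blast
qed

text \<open>The confidence level 4 m k outweighs the number of labels, at most of order 2^(2 k m) as
  J \<le> 2 k, and the sample size of order 2^(k m): their product is at most exp (3 m k). The
  remaining exp (- k) absorbs the polynomial factors.\<close>

lemma tail_small:
  assumes m: "1 \<le> m" and C: "0 \<le> C"
  shows "eventually (\<lambda>k::nat. \<forall>J n Smax. J \<le> 2 * k \<longrightarrow> real n \<le> B * 2 ^ (k * m) \<longrightarrow> Smax = k + s \<longrightarrow>
    (2 * (real J + 1) * C * (2 ^ J) ^ m) * ((2 * real n * (real Smax + 1) + 1) * exp (- (4 * real m * real k))) \<le> 1 / 16 \<and>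
    2 * real n * exp (- (4 * real m * real k)) \<le> 1 / 16) sequentially"
proof -
  define B' where "B' = max 1 B"
  define Q where "Q = 6 * C * (3 * B' * (real s + 2)) + 2 * B'"
  have B': "1 \<le> B'" "B \<le> B'" by (auto simp: B'_def)
  have Q0: "0 \<le> Q" using B' C by (simp add: Q_def)
  have "(\<lambda>k. (real k)\<^sup>2 * exp (- real k)) \<longlonglongrightarrow> 0" by real_asymp
  then have "(\<lambda>k. Q * ((real k)\<^sup>2 * exp (- real k))) \<longlonglongrightarrow> 0" by (rule tendsto_mult_right_zero)
  then have ev: "eventually (\<lambda>k. Q * ((real k)\<^sup>2 * exp (- real k)) < 1 / 16) sequentially" by (rule order_tendstoD) simp
  show ?thesis
    using ev eventually_ge_at_top[of 1]
  proof eventually_elim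
    case (elim k)
    let ?y = "real k" and ?e = "exp (- (4 * real m * real k))"
    have y: "1 \<le> ?y" using elim by simp
    have e2: "(2::real) ^ j \<le> exp (real j)" for j
    proof -
      have "(2::real) ^ j \<le> exp 1 ^ j" using exp_ge_add_one_self[of "1::real"] by (intro power_mono) auto
      then show ?thesis by (simp flip: exp_of_nat_mult)
    qed
    have main: "2 ^ (2 * k * m) * 2 ^ (k * m) * ?e \<le> exp (- ?y)"
    proof -
      have "2 ^ (2 * k * m) * 2 ^ (k * m) * ?e = 2 ^ (3 * k * m) * ?e" by (simp flip: power_add)
      also have "\<dots> \<le> exp (real (3 * k * m)) * ?e" by (intro mult_right_mono e2) simp
      also have "\<dots> = exp (- (real m * ?y))" by (simp flip: exp_add add: algebra_simps)
      also have "\<dots> \<le> exp (- ?y)"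
      proof -
        have "1 * ?y \<le> real m * ?y" using m by (intro mult_right_mono) auto
        then show ?thesis by simp
      qed
      finally show ?thesis .
    qed
    show ?case
    proof (intro allI impI conjI)
      fix J n Smax :: nat
      assume J: "J \<le> 2 * k" and n: "real n \<le> B * 2 ^ (k * m)" and S: "Smax = k + s"
      have n': "real n \<le> B' * 2 ^ (k * m)"
        using n B'(2) by (meson mult_right_mono order_trans zero_le_numeral zero_le_power)
      have two: "(1::real) \<le> 2 ^ j" for j by simp
      have "(real s + 1) * 1 \<le> (real s + 1) * ?y" using y by (intro mult_left_mono) auto
      then have s: "real Smax + 1 \<le> (real s + 2) * ?y" using S by (simp add: algebra_simps)
      have "2 * real n * (real Smax + 1) + 1 \<le> 2 * (B' * 2 ^ (k * m)) * ((real s + 2) * ?y) + B' * 2 ^ (k * m) * ((real s + 2) * ?y)"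
      proof (intro add_mono mult_mono)
        have "1 * 1 * (1 * 1) \<le> B' * 2 ^ (k * m) * ((real s + 2) * ?y)" using B' y two by (intro mult_mono) auto
        then show "1 \<le> B' * 2 ^ (k * m) * ((real s + 2) * ?y)" by simp
      qed (use n' s B' y in auto)
      also have "\<dots> = (3 * B' * (real s + 2)) * ?y * 2 ^ (k * m)" by (simp add: algebra_simps)
      finally have 1: "2 * real n * (real Smax + 1) + 1 \<le> (3 * B' * (real s + 2)) * ?y * 2 ^ (k * m)" .
      have 2: "2 * (real J + 1) * C * (2 ^ J) ^ m \<le> 6 * C * ?y * 2 ^ (2 * k * m)"
      proof -
        have "real J + 1 \<le> 3 * ?y" using J y by linarith
        moreover have "((2::real) ^ J) ^ m \<le> 2 ^ (2 * k * m)"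
          unfolding power_mult[symmetric] using J by (intro power_increasing) auto
        ultimately have "2 * (real J + 1) * C * (2 ^ J) ^ m \<le> 2 * (3 * ?y) * C * 2 ^ (2 * k * m)"
          using C y by (intro mult_mono) auto
        then show ?thesis by (simp add: mult_ac)
      qed
      have "(2 * (real J + 1) * C * (2 ^ J) ^ m) * ((2 * real n * (real Smax + 1) + 1) * ?e)
        \<le> (6 * C * ?y * 2 ^ (2 * k * m)) * (((3 * B' * (real s + 2)) * ?y * 2 ^ (k * m)) * ?e)"
        using C y B' by (intro mult_mono 2 1) auto
      also have "\<dots> = (6 * C * (3 * B' * (real s + 2))) * ?y\<^sup>2 * (2 ^ (2 * k * m) * 2 ^ (k * m) * ?e)"
        by (simp add: power2_eq_square)
      also have "\<dots> \<le> Q * ?y\<^sup>2 * exp (- ?y)"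
        using C B' Q0 by (intro mult_mono main) (auto simp: Q_def)
      finally show "(2 * (real J + 1) * C * (2 ^ J) ^ m) * ((2 * real n * (real Smax + 1) + 1) * ?e) \<le> 1 / 16"
        using elim(1) by (simp add: mult.assoc)
      have "2 * real n * ?e \<le> 2 * (B' * 2 ^ (k * m)) * ?e" using n' by (intro mult_right_mono) auto
      also have "\<dots> = 2 * B' * 1 * (1 * 2 ^ (k * m) * ?e)" by simp
      also have "\<dots> \<le> 2 * B' * ?y\<^sup>2 * (2 ^ (2 * k * m) * 2 ^ (k * m) * ?e)"
        using B' y by (intro mult_mono) (auto simp: one_le_power)
      also have "\<dots> \<le> Q * ?y\<^sup>2 * exp (- ?y)"
        using C B' Q0 by (intro mult_mono main) (auto simp: Q_def)
      finally show "2 * real n * ?e \<le> 1 / 16" using elim(1) by (simp add: mult.assoc)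
    qed
  qed
qed

text \<open>In units of \<delta> N / 4^k, with \<open>\<delta> = \<tau> / (512 D^2)\<close>, the
  spikes gain 4. The choice of \<open>b\<close> bounds the quadratic cost by 1, and a large
  \<open>k\<close> bounds the noise of the fixed part by 1, using sqrt N \<ge> 4^k. This leaves
  2.\<close>

lemma gain_lower:
  assumes d: "6 \<le> D" and bk: "b \<le> k" and J: "k + b \<le> 2 * J" and n: "real n \<le> B * 2 ^ (k * (D - 1))" and B: "0 < B" and \<tau>: "0 < \<tau>"
    and b: "9 * B * (1 / 4) ^ b \<le> \<tau> / (512 * (real D)\<^sup>2)"
    and k: "9 * sqrt (B * (4 * real (D - 1) * real k)) \<le> 2 ^ k * (\<tau> / (512 * (real D)\<^sup>2))"
  defines "\<eta> \<equiv> cap_radius D k" and "e0 \<equiv> 2 * (1 / 2 ^ J)\<^sup>2"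
  shows "2 ^ (k * (D - 1)) * (1 / 4) ^ k * \<tau> / (256 * (real D)\<^sup>2) \<le>
    2 ^ (k * (D - 1)) * \<tau> * (2 * \<eta>\<^sup>2) / 4 - 3 * (e0 + 2 * \<eta>\<^sup>2) * sqrt (real n * (4 * real (D - 1) * real k)) - real n * (e0 + 2 * \<eta>\<^sup>2)\<^sup>2"
proof -
  define N where "N = (2::real) ^ (k * (D - 1))"
  define w where "w = (1 / 2 :: real) ^ k"
  define z where "z = (1 / 2 :: real) ^ b"
  define \<delta> where "\<delta> = \<tau> / (512 * (real D)\<^sup>2)"
  define M where "M = 4 * real (D - 1) * real k"
  have N0: "0 < N" by (simp add: N_def)
  have w0: "0 < w" "0 < z" "z \<le> 1" "w \<le> z" using bk by (auto simp: w_def z_def power_le_one power_decreasing)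
  have w2: "w\<^sup>2 = (1 / 4) ^ k" "z\<^sup>2 = (1 / 4) ^ b"
    by (simp_all add: w_def z_def power2_eq_square flip: power_mult_distrib)
  have e2: "2 * \<eta>\<^sup>2 = w\<^sup>2 / (32 * (real D)\<^sup>2)"
    by (simp add: \<eta>_def cap_radius_def w_def power_divide power_mult_distrib)
  have D1: "1 \<le> (real D)\<^sup>2" using d by (simp add: one_le_power)
  have \<delta>0: "0 < \<delta>" using \<tau> d unfolding \<delta>_def by (intro divide_pos_pos mult_pos_pos zero_less_power) auto
  have eta_small: "2 * \<eta>\<^sup>2 \<le> w * z"
  proof -
    have D32: "1 \<le> 32 * (real D)\<^sup>2" "0 < 32 * (real D)\<^sup>2 * 1" using D1 by linarith+
    have "w\<^sup>2 / (32 * (real D)\<^sup>2) \<le> w\<^sup>2 / 1" using D32 w0 by (intro divide_left_mono) auto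
    also have "\<dots> \<le> w * z" using w0 by (simp add: power2_eq_square)
    finally show ?thesis unfolding e2 .
  qed
  have "(1 / 2 ^ J)\<^sup>2 = (1 / 2 :: real) ^ (2 * J)" by (simp add: power_one_over mult.commute flip: power_mult)
  also have "\<dots> \<le> (1 / 2) ^ (k + b)" using J by (intro power_decreasing) auto
  finally have "e0 \<le> 2 * (w * z)" by (simp add: e0_def w_def z_def power_add)
  then have e: "e0 + 2 * \<eta>\<^sup>2 \<le> 3 * (w * z)" "0 \<le> e0 + 2 * \<eta>\<^sup>2" using eta_small by (auto simp: e0_def)
  have "real n * (e0 + 2 * \<eta>\<^sup>2)\<^sup>2 \<le> (B * N) * (3 * (w * z))\<^sup>2"
    using n e by (intro mult_mono power_mono) (auto simp: N_def)
  also have "\<dots> = N * w\<^sup>2 * (9 * B * (1 / 4) ^ b)" by (simp add: power_mult_distrib flip: w2)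
  also have "\<dots> \<le> N * w\<^sup>2 * \<delta>" using b N0 unfolding \<delta>_def by (intro mult_left_mono) auto
  finally have 1: "real n * (e0 + 2 * \<eta>\<^sup>2)\<^sup>2 \<le> N * w\<^sup>2 * \<delta>" .
  have sN: "4 ^ k \<le> sqrt N"
  proof (rule real_le_rsqrt)
    have "((4::real) ^ k)\<^sup>2 = 2 ^ (k * 4)"
    proof -
      have "(4::real) ^ k = 2 ^ (2 * k)" by (simp add: power_mult)
      then show ?thesis by (simp flip: power_mult add: mult.commute)
    qed
    also have "\<dots> \<le> N" unfolding N_def using d by (intro power_increasing) auto
    finally show "((4::real) ^ k)\<^sup>2 \<le> N" .
  qed
  have w2k: "w * 2 ^ k = 1" by (simp add: w_def flip: power_mult_distrib)
  have w4k: "w * 4 ^ k = 2 ^ k" by (simp add: w_def flip: power_mult_distrib)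
  have "3 * (e0 + 2 * \<eta>\<^sup>2) * sqrt (real n * M) \<le> 3 * (3 * (w * 1)) * sqrt ((B * N) * M)"
  proof (intro mult_mono)
    show "e0 + 2 * \<eta>\<^sup>2 \<le> 3 * (w * 1)" using e(1) w0 by (meson mult_left_mono order_trans less_imp_le zero_le_numeral)
    show "sqrt (real n * M) \<le> sqrt ((B * N) * M)" using n unfolding M_def N_def by (intro real_sqrt_le_mono mult_right_mono) auto
  qed (use e w0 in \<open>auto simp: M_def\<close>)
  also have "\<dots> = w * sqrt N * (9 * sqrt (B * M))" by (simp add: real_sqrt_mult)
  also have "\<dots> \<le> w * sqrt N * (2 ^ k * \<delta>)" using k w0 N0 unfolding M_def \<delta>_def by (intro mult_left_mono) auto
  also have "\<dots> = w * (w * 4 ^ k) * sqrt N * \<delta>" unfolding w4k by simp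
  also have "\<dots> = (w\<^sup>2 * \<delta> * sqrt N) * 4 ^ k" by (simp add: power2_eq_square)
  also have "\<dots> \<le> (w\<^sup>2 * \<delta> * sqrt N) * sqrt N" using sN \<delta>0 N0 by (intro mult_left_mono) auto
  also have "\<dots> = N * w\<^sup>2 * \<delta>" using N0 by (simp add: mult_ac)
  finally have 2: "3 * (e0 + 2 * \<eta>\<^sup>2) * sqrt (real n * M) \<le> N * w\<^sup>2 * \<delta>" .
  have "N * \<tau> * (2 * \<eta>\<^sup>2) / 4 = 4 * (N * w\<^sup>2 * \<delta>)" unfolding e2 \<delta>_def by simp
  moreover have "N * (1 / 4) ^ k * \<tau> / (256 * (real D)\<^sup>2) = 2 * (N * w\<^sup>2 * \<delta>)" unfolding w2[symmetric] \<delta>_def by simp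
  ultimately show ?thesis using 1 2 unfolding N_def[symmetric] M_def[symmetric] by linarith
qed

text \<open>The balance of the powers of \<open>k\<close>. As 2^r is about k^5, the factor 4^q costs
  k^10. The value sqrt a = k^(-13) leaves k^(-3) in the last term. In \<open>t2\<close> the power 26
  compensates 1 / a and 8 (D - 1) becomes k^(-16) in the first and third terms. The layer gives
  k^(-3). With the factor k^2 of \<Lambda> a factor 1 / k survives.\<close>

lemma noise_total_le:
  assumes d: "6 \<le> D" and k: "1 \<le> k" and n: "real n \<le> B * 2 ^ (k * (D - 1))" and B: "1 \<le> B"
    and J: "J + 1 \<le> 2 * k" "2 * J \<le> k + b + 1" and r: "real k ^ 5 \<le> 2 ^ r" "(2::real) ^ r \<le> 32 * real k ^ 5"
    and U: "0 \<le> U" and \<Lambda>: "0 \<le> \<Lambda>" "\<Lambda> \<le> C * (real k)\<^sup>2" and V: "0 \<le> V" and p: "0 \<le> p"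
  defines "t2 \<equiv> (1 / 4) ^ k / real k ^ (26 + 8 * (D - 1))" and "a \<equiv> 1 / real k ^ 26"
    and "q \<equiv> r + D + 8" and "W \<equiv> max 1 (V * 4 ^ (b + 1))" and "C1 \<equiv> max 1 (32 * p)" and "Cq \<equiv> 4 ^ (D + 8) * 1024"
  shows "2 * (U * \<Lambda> * ((real J + 1) * ((V * t2 * 16 ^ J) powr (1 - expo D) * real n powr expo D)
       + (16 * real n * (2 * p / 2 ^ r)) powr expo D
       + 4 ^ q * (V * t2 * 16 ^ J / a) powr (1 - expo D) * real n powr expo D
       + 4 ^ q * sqrt a * real n powr expo D))
    \<le> 2 * U * C * (2 * W + C1 + Cq * W + Cq) * B / real k * (2 ^ (k * (D - 1)) * (1 / 4) ^ k)"
proof -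
  let ?y = "real k" and ?T = "real n powr expo D"
  define N where "N = (2::real) ^ (k * (D - 1))"
  have y: "1 \<le> ?y" using k by simp
  have th: "0 < expo D" "expo D < 1" "0 < 1 - expo D" using expo_bounds[OF d] by auto
  have W1: "1 \<le> W" "1 \<le> C1" "0 \<le> Cq" by (auto simp: W_def C1_def Cq_def)
  have yp: "0 < ?y ^ j" for j using y by simp
  have y1: "1 \<le> ?y ^ j" for j using y by (simp add: one_le_power)
  have T: "?T \<le> B * (N * (1 / 4) ^ k)"
  proof -
    have N0: "0 < N" by (simp add: N_def)
    have "?T \<le> (B * N) powr expo D" using n th by (intro powr_mono2) (auto simp: N_def)
    also have "\<dots> = B powr expo D * N powr expo D" by (rule powr_mult)
    also have "N powr expo D = N * N powr (- (1 - expo D))"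
    proof -
      have "N powr expo D = N powr (1 + - (1 - expo D))" by simp
      also have "\<dots> = N powr 1 * N powr (- (1 - expo D))" by (rule powr_add)
      finally show ?thesis using N0 by simp
    qed
    also have "N powr (- (1 - expo D)) = (1 / 4) ^ k"
      unfolding powr_minus N_def power_mult pow_beta[OF d] by (simp add: inverse_eq_divide power_one_over)
    also have "B powr expo D * (N * (1 / 4) ^ k) \<le> B * (N * (1 / 4) ^ k)"
      using B th N0 by (intro mult_right_mono powr_le_self) auto
    finally show ?thesis .
  qed
  have "(16::real) ^ J = 4 ^ (2 * J)" by (simp add: power_mult)
  also have "\<dots> \<le> 4 ^ (k + (b + 1))" using J by (intro power_increasing) auto
  finally have J16: "(16::real) ^ J \<le> 4 ^ k * 4 ^ (b + 1)" by (simp add: power_add)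
  have x0: "0 \<le> V * t2 * 16 ^ J" using V by (simp add: t2_def)
  have "V * t2 * 16 ^ J \<le> V * t2 * (4 ^ k * 4 ^ (b + 1))" using J16 V by (intro mult_left_mono) (auto simp: t2_def)
  also have "\<dots> = (V * 4 ^ (b + 1)) * ((1 / 4) ^ k * 4 ^ k) / ?y ^ (26 + 8 * (D - 1))" by (simp add: t2_def)
  also have "(1 / 4 :: real) ^ k * 4 ^ k = 1" by (simp flip: power_mult_distrib)
  also have "(V * 4 ^ (b + 1)) * 1 / ?y ^ (26 + 8 * (D - 1)) \<le> W / ?y ^ (26 + 8 * (D - 1))"
    using y by (intro divide_right_mono) (auto simp: W_def)
  finally have x1: "V * t2 * 16 ^ J \<le> W / ?y ^ (26 + 8 * (D - 1))" .
  have "V * t2 * 16 ^ J / a = V * t2 * 16 ^ J * ?y ^ 26" by (simp add: a_def)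
  also have "\<dots> \<le> W / ?y ^ (26 + 8 * (D - 1)) * ?y ^ 26" using x1 y by (intro mult_right_mono) auto
  also have "\<dots> = W / ?y ^ (8 * (D - 1))" using y by (simp add: power_add)
  finally have x2: "V * t2 * 16 ^ J / a \<le> W / ?y ^ (8 * (D - 1))" .
  have x3: "V * t2 * 16 ^ J \<le> W / ?y ^ (8 * (D - 1))"
  proof -
    have "W / ?y ^ (26 + 8 * (D - 1)) \<le> W / ?y ^ (8 * (D - 1))"
      using y W1 by (intro divide_left_mono power_increasing mult_pos_pos) auto
    then show ?thesis using x1 by linarith
  qed
  have x20: "0 \<le> V * t2 * 16 ^ J / a" using x0 by (simp add: a_def)
  have b1: "(V * t2 * 16 ^ J) powr (1 - expo D) \<le> W / ?y ^ 16" by (rule scaled_powr_le[OF d W1(1) k x0 x3])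
  have b3: "(V * t2 * 16 ^ J / a) powr (1 - expo D) \<le> W / ?y ^ 16" by (rule scaled_powr_le[OF d W1(1) k x20 x2])
  have b2: "(16 * (2 * p / 2 ^ r)) powr expo D \<le> C1 / ?y ^ 3"
  proof (rule layer_powr_le[OF d W1(2) k])
    have "16 * (2 * p / 2 ^ r) = 32 * p / 2 ^ r" by simp
    also have "\<dots> \<le> C1 / ?y ^ 5" using r(1) yp[of 5] p by (intro frac_le) (auto simp: C1_def)
    finally show "16 * (2 * p / 2 ^ r) \<le> C1 / ?y ^ 5" .
  qed (use p in simp)
  have q4: "(4::real) ^ q \<le> Cq * ?y ^ 10"
  proof -
    have "(4::real) ^ q = 4 ^ (D + 8) * (2 ^ r)\<^sup>2"
      by (simp add: q_def power_add power_mult[symmetric] mult.commute[of r] power_mult)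
    also have "\<dots> \<le> 4 ^ (D + 8) * (32 * ?y ^ 5)\<^sup>2" using r(2) by (intro mult_left_mono power_mono) auto
    also have "\<dots> = Cq * ?y ^ 10" by (simp add: Cq_def power_mult_distrib flip: power_mult)
    finally show ?thesis .
  qed
  have sa: "sqrt a = 1 / ?y ^ 13"
  proof -
    have "a = (1 / ?y ^ 13)\<^sup>2" by (simp add: a_def power_divide flip: power_mult)
    then show ?thesis using y by (simp add: real_sqrt_unique)
  qed
  have alg: "(u' * u) * (v' / (u * v)) * t = u' * v' / v * t" if "u \<noteq> 0" for u u' v v' t :: real
    using that by simp
  have t1: "(real J + 1) * ((V * t2 * 16 ^ J) powr (1 - expo D) * ?T) \<le> 2 * W / ?y ^ 3 * ?T"
  proof -
    have "real J + 1 \<le> 2 * ?y" using J(1) by linarith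
    then have "(real J + 1) * ((V * t2 * 16 ^ J) powr (1 - expo D) * ?T) \<le> (2 * ?y) * (W / ?y ^ 16 * ?T)"
      using b1 y W1 by (intro mult_mono mult_right_mono) auto
    also have "\<dots> = 2 * W / ?y ^ 15 * ?T"
    proof -
      have "?y ^ 16 = ?y * ?y ^ 15" by (simp flip: power_Suc)
      then show ?thesis using y by simp
    qed
    also have "\<dots> \<le> 2 * W / ?y ^ 3 * ?T"
      using y W1 by (intro mult_right_mono divide_left_mono power_increasing mult_pos_pos) auto
    finally show ?thesis .
  qed
  have t2': "(16 * real n * (2 * p / 2 ^ r)) powr expo D \<le> C1 / ?y ^ 3 * ?T"
  proof -
    have "(16 * real n * (2 * p / 2 ^ r)) powr expo D = ((16 * (2 * p / 2 ^ r)) * real n) powr expo D" by (simp add: mult_ac)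
    also have "\<dots> = (16 * (2 * p / 2 ^ r)) powr expo D * ?T" by (rule powr_mult)
    also have "\<dots> \<le> C1 / ?y ^ 3 * ?T" using b2 by (intro mult_right_mono) auto
    finally show ?thesis .
  qed
  have t3: "4 ^ q * (V * t2 * 16 ^ J / a) powr (1 - expo D) * ?T \<le> Cq * W / ?y ^ 3 * ?T"
  proof -
    have "4 ^ q * (V * t2 * 16 ^ J / a) powr (1 - expo D) * ?T \<le> (Cq * ?y ^ 10) * (W / ?y ^ 16) * ?T"
      using q4 b3 W1 y by (intro mult_mono mult_right_mono) auto
    also have "\<dots> = Cq * W / ?y ^ 6 * ?T"
    proof -
      have "?y ^ 16 = ?y ^ 10 * ?y ^ 6" by (simp flip: power_add)
      then show ?thesis using yp[of 10] by (simp only:) (intro alg, simp)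
    qed
    also have "\<dots> \<le> Cq * W / ?y ^ 3 * ?T"
      using y W1 by (intro mult_right_mono divide_left_mono power_increasing mult_pos_pos) auto
    finally show ?thesis .
  qed
  have t4: "4 ^ q * sqrt a * ?T \<le> Cq / ?y ^ 3 * ?T"
  proof -
    have "4 ^ q * sqrt a * ?T \<le> (Cq * ?y ^ 10) * (1 / ?y ^ 13) * ?T"
      unfolding sa using q4 y by (intro mult_right_mono) auto
    also have "\<dots> = Cq * 1 / ?y ^ 3 * ?T"
    proof -
      have "?y ^ 13 = ?y ^ 10 * ?y ^ 3" by (simp flip: power_add)
      then show ?thesis using yp[of 10] by (simp only:) (intro alg, simp)
    qed
    finally show ?thesis by simp
  qed
  define Z where "Z = 2 * W + C1 + Cq * W + Cq"
  have Z0: "0 \<le> Z" using W1 by (simp add: Z_def)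
  have "(real J + 1) * ((V * t2 * 16 ^ J) powr (1 - expo D) * ?T)
       + (16 * real n * (2 * p / 2 ^ r)) powr expo D
       + 4 ^ q * (V * t2 * 16 ^ J / a) powr (1 - expo D) * ?T
       + 4 ^ q * sqrt a * ?T \<le> Z / ?y ^ 3 * ?T"
    using t1 t2' t3 t4 by (simp add: Z_def add_divide_distrib distrib_right)
  also have "\<dots> \<le> Z / ?y ^ 3 * (B * (N * (1 / 4) ^ k))" using Z0 y by (intro mult_left_mono T) auto
  finally have tot: "(real J + 1) * ((V * t2 * 16 ^ J) powr (1 - expo D) * ?T)
       + (16 * real n * (2 * p / 2 ^ r)) powr expo D
       + 4 ^ q * (V * t2 * 16 ^ J / a) powr (1 - expo D) * ?T
       + 4 ^ q * sqrt a * ?T \<le> Z / ?y ^ 3 * (B * (N * (1 / 4) ^ k))" .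
  have R0: "0 \<le> Z / ?y ^ 3 * (B * (N * (1 / 4) ^ k))" using Z0 B y by (simp add: N_def)
  have "2 * (U * \<Lambda> * ((real J + 1) * ((V * t2 * 16 ^ J) powr (1 - expo D) * ?T)
       + (16 * real n * (2 * p / 2 ^ r)) powr expo D
       + 4 ^ q * (V * t2 * 16 ^ J / a) powr (1 - expo D) * ?T
       + 4 ^ q * sqrt a * ?T)) \<le> 2 * (U * \<Lambda> * (Z / ?y ^ 3 * (B * (N * (1 / 4) ^ k))))"
    using U \<Lambda>(1) by (intro mult_left_mono tot) auto
  also have "\<dots> \<le> 2 * (U * (C * ?y\<^sup>2) * (Z / ?y ^ 3 * (B * (N * (1 / 4) ^ k))))"
    using U \<Lambda>(2) R0 by (intro mult_left_mono mult_right_mono) auto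
  also have "\<dots> = 2 * U * C * Z * B / ?y * (N * (1 / 4) ^ k)"
  proof -
    have "?y ^ 3 = ?y\<^sup>2 * ?y" by (simp add: power2_eq_square power3_eq_cube)
    then show ?thesis using y by simp
  qed
  finally show ?thesis unfolding N_def Z_def .
qed

text \<open>All constants except the level \<open>k\<close> are fixed beforehand, in the order
  \<open>A\<close>, \<open>B\<close>, \<tau>, \<open>b\<close>, \<open>s\<close>; only then is
  \<open>k\<close> taken large. The exponent of the logarithm is that of \<open>t2\<close> in
  \<open>noise_total_le\<close>.\<close>

lemma risk_large_sample:
  fixes c :: real
  assumes d: "6 \<le> CARD('d::finite)" and c: "0 < c"
  shows "\<exists>n0. \<forall>(P :: (real ^ 'd) measure) n Khat. admissible_design c P \<longrightarrow> n0 \<le> n \<longrightarrow> least_squares_estimator n Khat \<longrightarrow>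
    (\<exists>K\<in>unit_convex_bodies. ennreal (1 / 2 * real n powr (- 2 / (real CARD('d) - 1)) * ln (real n) powr (- real (26 + 8 * (CARD('d) - 1)))) \<le> risk P n Khat K)"
proof -
  define D where "D = CARD('d)"
  define m where "m = D - 1"
  define \<kappa> where "\<kappa> = min c 1"
  define V where "V = unit_ball_vol (real D) / \<kappa>"
  define pp where "pp = \<kappa> * ((1 / (8 * real D)) ^ m / (2 * 8 ^ D))"
  have D6: "6 \<le> D" "0 < D" "1 \<le> m" using d by (auto simp: D_def m_def)
  have \<kappa>0: "0 < \<kappa>" using c by (simp add: \<kappa>_def)
  have V0: "0 < V" using \<kappa>0 by (simp add: V_def)
  have pp0: "0 < pp" using \<kappa>0 D6 by (simp add: pp_def)
  \<comment> \<open>A sample of size at least A 2^(k m) misses a given cap with probability at most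
    exp (- A pp), and this is made at most 1 / 128.\<close>
  obtain A0 :: nat where A0: "ln 128 / pp < real A0" using reals_Archimedean2 by blast
  define A where "A = max 1 A0"
  have A1: "1 \<le> A" by (simp add: A_def)
  have "ln 128 \<le> real A * pp"
  proof -
    have "ln 128 / pp \<le> real A" using A0 by (simp add: A_def)
    then show ?thesis using pp0 by (simp add: field_simps)
  qed
  then have "exp (- (real A * pp)) \<le> exp (- ln 128)" by simp
  then have eA: "exp (- (real A * pp)) \<le> 1 / 128" by (simp add: exp_minus inverse_eq_divide)
  define B where "B = real A * 2 ^ m"
  have B1: "1 \<le> B"
  proof -
    have "1 * 1 \<le> real A * 2 ^ m" using A1 by (intro mult_mono) auto
    then show ?thesis by (simp add: B_def)
  qed
  \<comment> \<open>The small ball term 4 \<tau> n / 2^(k m) of \<open>gain_event\<close> becomes at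
    most 1 / 128.\<close>
  define \<tau> where "\<tau> = 1 / (512 * B)"
  have \<tau>0: "0 < \<tau>" using B1 by (simp add: \<tau>_def)
  define \<delta> where "\<delta> = \<tau> / (512 * (real D)\<^sup>2)"
  have \<delta>0: "0 < \<delta>" using \<tau>0 D6 by (simp add: \<delta>_def)
  \<comment> \<open>The polytope is taken finer than 2^(- k / 2) by the fixed factor 2^(- b / 2),
    which makes the quadratic cost small against the gain.\<close>
  obtain b where "(1 / 4 :: real) ^ b < \<delta> / (9 * B)"
    using real_arch_pow_inv[of "\<delta> / (9 * B)" "1 / 4"] \<delta>0 B1 by auto
  then have b: "9 * B * (1 / 4) ^ b \<le> \<delta>" using B1 by (simp add: field_simps)
  \<comment> \<open>Ensures that k + s levels suffice for chaining over all sample sizes of the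
    block of level \<open>k\<close>.\<close>
  obtain s where "B < 2 ^ s" using real_arch_pow[of 2 B] by auto
  moreover have "(2::real) ^ s \<le> 2 ^ (s * m)" using D6 by (intro power_increasing) auto
  ultimately have s: "B \<le> 2 ^ (s * m)" by linarith
  obtain C\<Lambda> where C\<Lambda>: "0 < C\<Lambda>" "\<And>k. 1 \<le> k \<Longrightarrow> noise_const D (k + s) (4 * real m * real k) \<le> C\<Lambda> * (real k)\<^sup>2"
    using noise_const_le[OF D6(2), of s m] by blast
  define U where "U = upper_const D"
  have U0: "0 \<le> U"
    unfolding U_def upper_const_def using box_const_pos[OF D6(2)] by (intro mult_nonneg_nonneg add_nonneg_nonneg) auto
  define p where "p = (near_const D)\<^sup>2"
  have p0: "0 \<le> p" by (simp add: p_def)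
  define W where "W = max 1 (V * 4 ^ (b + 1))"
  define C1 where "C1 = max 1 (32 * p)"
  define Cq :: real where "Cq = 4 ^ (D + 8) * 1024"
  define T where "T = 2 * U * C\<Lambda> * (2 * W + C1 + Cq * W + Cq) * B"
  have ev_tail: "eventually (\<lambda>k::nat. \<forall>J n Smax. J \<le> 2 * k \<longrightarrow> real n \<le> B * 2 ^ (k * m) \<longrightarrow> Smax = k + s \<longrightarrow>
    (2 * (real J + 1) * (2 * real D * 3 ^ D) * (2 ^ J) ^ m) * ((2 * real n * (real Smax + 1) + 1) * exp (- (4 * real m * real k))) \<le> 1 / 16 \<and>
    2 * real n * exp (- (4 * real m * real k)) \<le> 1 / 16) sequentially"
    by (rule tail_small[OF D6(3)]) simp
  have ev1: "eventually (\<lambda>k. 32 * real k ^ 5 \<le> 2 ^ k) sequentially" by real_asymp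
  have "(\<lambda>k. real k / 2 ^ k) \<longlonglongrightarrow> 0" by real_asymp
  then have "(\<lambda>k. (9 * (B * (4 * real m))) * (real k / 2 ^ k)) \<longlonglongrightarrow> 0" by (rule tendsto_mult_right_zero)
  then have ev2: "eventually (\<lambda>k. (9 * (B * (4 * real m))) * (real k / 2 ^ k) < \<delta>) sequentially" using \<delta>0 by (rule order_tendstoD)
  have "(\<lambda>k. 1 / real k) \<longlonglongrightarrow> 0" by real_asymp
  then have "(\<lambda>k. T * (1 / real k)) \<longlonglongrightarrow> 0" by (rule tendsto_mult_right_zero)
  then have ev3: "eventually (\<lambda>k. T * (1 / real k) < 2 * \<delta>) sequentially" by (rule order_tendstoD) (use \<delta>0 in simp)
  have ev4: "eventually (\<lambda>k. nat \<lceil>V\<rceil> + 24 * D + 2 * b + 24 \<le> k) sequentially" by (rule eventually_ge_at_top)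
  obtain k0 where k0: "\<And>k. k0 \<le> k \<Longrightarrow>
     (\<forall>J n Smax. J \<le> 2 * k \<longrightarrow> real n \<le> B * 2 ^ (k * m) \<longrightarrow> Smax = k + s \<longrightarrow>
      (2 * (real J + 1) * (2 * real D * 3 ^ D) * (2 ^ J) ^ m) * ((2 * real n * (real Smax + 1) + 1) * exp (- (4 * real m * real k))) \<le> 1 / 16 \<and>
      2 * real n * exp (- (4 * real m * real k)) \<le> 1 / 16) \<and>
     32 * real k ^ 5 \<le> 2 ^ k \<and> (9 * (B * (4 * real m))) * (real k / 2 ^ k) < \<delta> \<and> T * (1 / real k) < 2 * \<delta> \<and>
     nat \<lceil>V\<rceil> + 24 * D + 2 * b + 24 \<le> k"
    using eventually_conj[OF ev_tail eventually_conj[OF ev1 eventually_conj[OF ev2 eventually_conj[OF ev3 ev4]]]]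
    unfolding eventually_sequentially by blast
  define n0 where "n0 = A * 2 ^ (k0 * m)"
  show ?thesis
  proof (intro exI[of _ n0] allI impI)
    fix P :: "(real ^ 'd) measure" and n :: nat and Khat :: "(nat \<Rightarrow> (real ^ 'd) \<times> real) \<Rightarrow> (real ^ 'd) set"
    assume adm: "admissible_design c P" and n: "n0 \<le> n" and Khat: "least_squares_estimator n Khat"
    \<comment> \<open>Sample sizes are cut into blocks on which n / 2^(k m) stays between
      \<open>A\<close> and \<open>B\<close>.\<close>
    have "\<exists>k\<ge>k0. A * 2 ^ (k * m) \<le> n \<and> n < A * 2 ^ (Suc k * m)"
    proof -
      define j where "j = (LEAST j. n < A * 2 ^ (j * m))"
      have "n < A * 2 ^ (n * m)"
      proof -
        have "n < 2 ^ n" by simp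
        also have "(2::nat) ^ n \<le> 2 ^ (n * m)" using D6 by (intro power_increasing) auto
        also have "\<dots> \<le> A * 2 ^ (n * m)" using A1 by simp
        finally show ?thesis .
      qed
      then have j: "n < A * 2 ^ (j * m)" unfolding j_def by (rule LeastI)
      have lt: "i < j" if "A * 2 ^ (i * m) \<le> n" for i
      proof (rule ccontr)
        assume "\<not> i < j"
        then have "(2::nat) ^ (j * m) \<le> 2 ^ (i * m)" by (intro power_increasing mult_right_mono) auto
        then have "A * 2 ^ (j * m) \<le> A * 2 ^ (i * m)" by (rule mult_le_mono2)
        with j that show False by linarith
      qed
      have kj: "k0 < j" using lt n by (simp add: n0_def)
      then obtain k where k: "j = Suc k" by (cases j) auto
      have "\<not> n < A * 2 ^ (k * m)" using not_less_Least[of k "\<lambda>j. n < A * 2 ^ (j * m)"] k by (simp add: j_def)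
      then show ?thesis using j k kj by (intro exI[of _ k]) auto
    qed
    then obtain k where k: "k0 \<le> k" "A * 2 ^ (k * m) \<le> n" "n < A * 2 ^ (Suc k * m)" by blast
    note kk = k0[OF k(1)]
    have k1: "1 \<le> k" "V \<le> real k" "24 * D \<le> k" "2 * D + 17 + b \<le> k" "b \<le> k" using kk V0 by linarith+
    have y: "1 \<le> real k" using k1 by simp
    define N where "N = (2::real) ^ (k * m)"
    have N0: "0 < N" by (simp add: N_def)
    have nA: "real A * N \<le> real n" using k(2) unfolding N_def by (metis of_nat_le_iff of_nat_mult of_nat_numeral of_nat_power)
    have "real n \<le> real (A * 2 ^ (Suc k * m))" using k(3) by (simp only: of_nat_le_iff less_imp_le)
    then have nB: "real n \<le> B * N" by (simp add: B_def N_def power_add mult_ac)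
    have Nn: "N \<le> real n"
    proof -
      have "1 * N \<le> real A * N" using A1 N0 by (intro mult_right_mono) auto
      then show ?thesis using nA by linarith
    qed
    have n1: "0 < n" using Nn N0 by linarith
    obtain r where r: "real k ^ 5 \<le> 2 ^ r" "(2::real) ^ r \<le> 32 * real k ^ 5" using exists_log_scale[OF k1(1)] by blast
    have "(2::real) ^ r \<le> 2 ^ k" using r(2) kk by linarith
    then have rk: "r \<le> k" by simp
    \<comment> \<open>Half of k + b, rounded up: the lower bound serves \<open>gain_lower\<close>,
      the upper bound \<open>noise_total_le\<close>.\<close>
    define J where "J = (k + b + 1) div 2"
    have J: "k + b \<le> 2 * J" "2 * J \<le> k + b + 1" by (auto simp: J_def)
    define q where "q = r + D + 8"
    have Jq: "J + q \<le> 2 * k" using J rk k1 by (simp add: q_def)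
    have J2: "J + 1 \<le> 2 * k" using Jq by (simp add: q_def)
    define \<eta> where "\<eta> = cap_radius D k"
    define L where "L = 4 * real m * real k"
    define Smax where "Smax = k + s"
    define a where "a = 1 / real k ^ 26"
    define t2 where "t2 = (1 / 4) ^ k / real k ^ (26 + 8 * m)"
    define gg where "gg = N * (1 / 4) ^ k * \<tau> / (256 * (real D)\<^sup>2)"
    have y1: "1 \<le> real k ^ j" for j using y by (simp add: one_le_power)
    have tails: "(2 * (real (J + q) + 1) * (2 * real D * 3 ^ D) * (2 ^ (J + q)) ^ m) * ((2 * real n * (real Smax + 1) + 1) * exp (- L)) \<le> 1 / 16"
      "2 * real n * exp (- L) \<le> 1 / 16"
      using kk Jq nB unfolding L_def N_def Smax_def by blast+
    have "\<exists>K\<in>unit_convex_bodies. ennreal (t2 / 2) \<le> risk P n Khat K"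
    proof (rule risk_at_scale[OF d adm c Khat n1, where k = k and J = J and r = r and Smax = Smax and \<tau> = \<tau> and L = L and a = a and ?t2.0 = t2 and gg = gg,
        folded D_def, folded m_def \<kappa>_def q_def \<eta>_def, folded V_def])
      show "12 * real D \<le> 2 ^ J"
      proof -
        have "12 * D \<le> J" using J k1 by linarith
        also have "J < 2 ^ J" by simp
        finally have "real (12 * D) \<le> real (2 ^ J)" by (simp only: of_nat_le_iff less_imp_le)
        then show ?thesis by simp
      qed
      have "real n \<le> 2 ^ (s * m) * 2 ^ (k * m)" using nB s N0 unfolding N_def by (meson mult_right_mono order_trans zero_le_numeral zero_le_power)
      also have "\<dots> = real (2 ^ (Smax * m))" by (simp add: Smax_def add_mult_distrib power_add)
      finally show "n \<le> 2 ^ (Smax * m)" by (simp only: of_nat_le_iff)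
      show "0 < L" using k1 D6 by (simp add: L_def)
      show "0 < \<tau>" by (rule \<tau>0)
      show "0 < a" "a \<le> 1" using y1[of 26] y by (auto simp: a_def)
      show "0 \<le> t2" by (simp add: t2_def)
      show "2 * (exp (- (real n * (\<kappa> * (\<eta> ^ m / (2 * 8 ^ D))))) + 4 * \<tau> * real n / 2 ^ (k * m)) + 2 * real n * exp (- L) \<le> 1 / 8"
      proof -
        have "\<kappa> * (\<eta> ^ m / (2 * 8 ^ D)) = pp / N"
          by (simp add: \<eta>_def cap_radius_def pp_def N_def power_divide power_mult_distrib power_mult)
        moreover have "real A * pp \<le> real n * (pp / N)"
        proof -
          have "(real A * N) * (pp / N) \<le> real n * (pp / N)" using nA pp0 N0 by (intro mult_right_mono) auto
          then show ?thesis using N0 by simp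
        qed
        ultimately have "exp (- (real n * (\<kappa> * (\<eta> ^ m / (2 * 8 ^ D))))) \<le> 1 / 128"
          using eA by (simp only:) (meson exp_le_cancel_iff neg_le_iff_le order_trans)
        moreover have "4 * \<tau> * real n / 2 ^ (k * m) \<le> 1 / 128"
        proof -
          have "4 * \<tau> * real n / N \<le> 4 * \<tau> * (B * N) / N" using nB \<tau>0 N0 by (intro divide_right_mono mult_left_mono) auto
          also have "\<dots> = 1 / 128" using N0 B1 by (simp add: \<tau>_def)
          finally show ?thesis by (simp add: N_def)
        qed
        moreover have "2 * (u + v) + w \<le> 1 / 8" if "u \<le> 1 / 128" "v \<le> 1 / 128" "w \<le> 1 / 16" for u v w :: real
        proof -
          have "2 * (u + v) + w \<le> 2 * (1 / 128 + 1 / 128) + 1 / 16" by (intro add_mono mult_left_mono that) simp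
          also have "\<dots> \<le> 1 / 8" by simp
          finally show ?thesis .
        qed
        ultimately show ?thesis using tails(2) by blast
      qed
      show "(2 * (real (J + q) + 1) * (2 * real D * 3 ^ D) * (2 ^ (J + q)) ^ m) * ((2 * real n * (real Smax + 1) + 1) * exp (- L)) \<le> 1 / 16"
        by (rule tails)
      show "V * t2 \<le> 1"
      proof -
        have "t2 \<le> 1 / real k ^ 1"
          unfolding t2_def using y by (intro frac_le power_increasing) (auto simp: power_le_one)
        then have "V * t2 \<le> V * (1 / real k ^ 1)" using V0 by (intro mult_left_mono) auto
        also have "\<dots> \<le> 1" using k1 y by simp
        finally show ?thesis .
      qed
      have kc: "9 * sqrt (B * (4 * real m * real k)) \<le> 2 ^ k * \<delta>"
      proof -
        have "1 \<le> real m" using D6 by simp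
        then have "1 * 1 \<le> real m * real k" using y by (intro mult_mono) auto
        then have "1 \<le> 4 * real m * real k" by simp
        then have "1 * 1 \<le> B * (4 * real m * real k)" using B1 by (intro mult_mono[of 1 B 1]) simp_all
        moreover have "sqrt z \<le> z" if "1 \<le> z" for z :: real
          using that by (intro real_le_lsqrt) (auto simp: power2_eq_square mult_le_cancel_right1)
        ultimately have "sqrt (B * (4 * real m * real k)) \<le> B * (4 * real m * real k)" by (simp only: mult_1_right)
        moreover have "9 * (B * (4 * real m * real k)) \<le> 2 ^ k * \<delta>"
        proof -
          have "9 * (B * (4 * real m * real k)) / 2 ^ k \<le> \<delta>" using kk by (simp add: mult_ac)
          then show ?thesis by (simp add: pos_divide_le_eq mult.commute)
        qed
        ultimately show ?thesis by linarith
      qed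
      show "gg \<le> 2 ^ (k * m) * \<tau> * (2 * \<eta>\<^sup>2) / 4 - 3 * (2 * (1 / 2 ^ J)\<^sup>2 + 2 * \<eta>\<^sup>2) * sqrt (real n * L) - real n * (2 * (1 / 2 ^ J)\<^sup>2 + 2 * \<eta>\<^sup>2)\<^sup>2"
        using gain_lower[OF D6(1) k1(5) J(1), of n B \<tau>] nB B1 \<tau>0 b kc unfolding gg_def N_def \<delta>_def L_def \<eta>_def m_def by simp
      show "2 * (upper_const D * noise_const D Smax L *
       ((real J + 1) * ((V * t2 * 16 ^ J) powr (1 - expo D) * real n powr expo D)
         + (16 * real n * (2 * (near_const D)\<^sup>2 / 2 ^ r)) powr expo D
         + 4 ^ q * (V * t2 * 16 ^ J / a) powr (1 - expo D) * real n powr expo D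
         + 4 ^ q * sqrt a * real n powr expo D)) < gg" (is "?lhs < gg")
      proof -
        have \<Lambda>: "0 \<le> noise_const D Smax L" "noise_const D Smax L \<le> C\<Lambda> * (real k)\<^sup>2"
          using C\<Lambda>(2)[OF k1(1)] bron_const_nonneg[OF D6(2)] unfolding Smax_def L_def
          by (auto simp: noise_const_def intro!: add_nonneg_nonneg mult_nonneg_nonneg real_sqrt_ge_zero)
        have "?lhs \<le> T / real k * (N * (1 / 4) ^ k)"
          using noise_total_le[OF D6(1) k1(1) _ B1 J2 J(2) r U0 \<Lambda> less_imp_le[OF V0] p0, of n] nB
          unfolding T_def W_def C1_def Cq_def U_def p_def t2_def a_def q_def N_def m_def by simp
        also have "\<dots> < 2 * \<delta> * (N * (1 / 4) ^ k)" using kk N0 by (intro mult_strict_right_mono) auto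
        also have "\<dots> = gg" by (simp add: gg_def \<delta>_def)
        finally show ?thesis .
      qed
    qed
    then obtain K where K: "K \<in> unit_convex_bodies" "ennreal (t2 / 2) \<le> risk P n Khat K" by blast
    have "1 / 2 * real n powr (- 2 / (real D - 1)) * ln (real n) powr (- real (26 + 8 * m)) \<le> t2 / 2"
    proof -
      have be: "- 2 / (real D - 1) = - (1 - expo D)" by (simp add: expo_def)
      have b0: "0 < 1 - expo D" using expo_bounds[OF D6(1)] by simp
      have "real n powr (- (1 - expo D)) \<le> N powr (- (1 - expo D))"
        using Nn N0 b0 by (intro powr_mono2') auto
      also have "\<dots> = (1 / 4) ^ k"
        unfolding powr_minus N_def power_mult m_def pow_beta[OF D6(1)] by (simp add: inverse_eq_divide power_one_over)
      finally have 1: "real n powr (- 2 / (real D - 1)) \<le> (1 / 4) ^ k" unfolding be .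
      \<comment> \<open>Powers of \<open>k\<close> become powers of ln n, since \<open>k\<close> is
        at most the logarithm of 2^(k m).\<close>
      have "real k \<le> real (k * m) * ln 2"
      proof -
        have "1 \<le> real m * ln 2"
        proof -
          have "5 * (2 / 3) \<le> real m * ln 2" using D6 ln2_ge_two_thirds by (intro mult_mono) (auto simp: m_def)
          then show ?thesis by simp
        qed
        then have "real k * 1 \<le> real k * (real m * ln 2)" by (intro mult_left_mono) auto
        then show ?thesis by (simp add: mult_ac)
      qed
      also have "\<dots> = ln N" unfolding N_def by (simp add: ln_realpow)
      also have "\<dots> \<le> ln (real n)" using Nn N0 by simp
      finally have "real k \<le> ln (real n)" .
      then have "ln (real n) powr (- real (26 + 8 * m)) \<le> real k powr (- real (26 + 8 * m))"
        using y by (intro powr_mono2') auto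
      also have "\<dots> = 1 / real k ^ (26 + 8 * m)"
        unfolding powr_minus using y by (subst powr_realpow) (auto simp: inverse_eq_divide)
      finally have 2: "ln (real n) powr (- real (26 + 8 * m)) \<le> 1 / real k ^ (26 + 8 * m)" .
      have "real n powr (- 2 / (real D - 1)) * ln (real n) powr (- real (26 + 8 * m)) \<le> (1 / 4) ^ k * (1 / real k ^ (26 + 8 * m))"
        using 1 2 by (intro mult_mono) auto
      then show ?thesis by (simp add: t2_def)
    qed
    then show "\<exists>K\<in>unit_convex_bodies. ennreal (1 / 2 * real n powr (- 2 / (real CARD('d) - 1)) * ln (real n) powr (- real (26 + 8 * (CARD('d) - 1)))) \<le> risk P n Khat K"
      using K unfolding D_def m_def by (meson ennreal_leI order_trans)
  qed
qed

theorem corollary2: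
  fixes c\<^sub>1 :: real
  assumes "c\<^sub>1 > 0" and "CARD('d::finite) \<ge> 6"
  shows "\<exists>C>0. \<exists>\<gamma>>0. \<forall>(P :: (real^'d) measure) (n::nat) Khat.
           admissible_design c\<^sub>1 P \<longrightarrow> n \<ge> 2 \<longrightarrow> least_squares_estimator n Khat \<longrightarrow>
           (SUP K\<in>unit_convex_bodies. risk P n Khat K)
             \<ge> ennreal (C * real n powr (- 2 / (real CARD('d) - 1)) * ln (real n) powr (- \<gamma>))"
proof -
  define \<gamma> where "\<gamma> = real (26 + 8 * (CARD('d) - 1))"
  have \<gamma>0: "0 < \<gamma>" by (simp add: \<gamma>_def)
  obtain n0 where big: "\<And>(P :: (real ^ 'd) measure) n Khat. admissible_design c\<^sub>1 P \<Longrightarrow> n0 \<le> n \<Longrightarrow> least_squares_estimator n Khat \<Longrightarrow>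
    \<exists>K\<in>unit_convex_bodies. ennreal (1 / 2 * real n powr (- 2 / (real CARD('d) - 1)) * ln (real n) powr (- \<gamma>)) \<le> risk P n Khat K"
    using risk_large_sample[OF assms(2,1)] unfolding \<gamma>_def by blast
  obtain v where v: "0 < v" "\<And>(P :: (real ^ 'd) measure) n Khat. admissible_design c\<^sub>1 P \<Longrightarrow> 0 < n \<Longrightarrow> n < n0 \<Longrightarrow>
    least_squares_estimator n Khat \<Longrightarrow> ennreal v \<le> risk P n Khat {0}"
    using risk_small_sample[OF assms(1), of n0] by blast
  \<comment> \<open>Below \<open>n0\<close> the body {0} has risk at least \<open>v\<close>. There
    the power of \<open>n\<close> is at most 1, and \<open>ln n powr - \<gamma>\<close> is at most
    its value at 2, which the second argument of the minimum divides out.\<close>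
  define C where "C = min (1 / 2) (v / ln 2 powr (- \<gamma>))"
  have l2: "0 < ln (2::real) powr (- \<gamma>)" by simp
  have C0: "0 < C" using v l2 by (simp add: C_def)
  have Cle: "C \<le> 1 / 2" "C \<le> v / ln 2 powr (- \<gamma>)" by (simp_all only: C_def min.cobounded1 min.cobounded2)
  show ?thesis
  proof (rule exI[of _ C], rule conjI, rule C0, rule exI[of _ \<gamma>], intro conjI allI impI \<gamma>0)
    fix P :: "(real ^ 'd) measure" and n :: nat and Khat :: "(nat \<Rightarrow> (real ^ 'd) \<times> real) \<Rightarrow> (real ^ 'd) set"
    assume adm: "admissible_design c\<^sub>1 P" and n: "n \<ge> 2" and Khat: "least_squares_estimator n Khat"
    define x where "x = real n powr (- 2 / (real CARD('d) - 1))"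
    have x: "0 \<le> x" "x \<le> 1"
    proof -
      have "- 2 / (real CARD('d) - 1) \<le> 0" using assms(2) by simp
      then have "x \<le> real n powr 0" unfolding x_def using n by (intro powr_mono) auto
      then show "x \<le> 1" "0 \<le> x" using n by (auto simp: x_def)
    qed
    have "\<exists>K\<in>unit_convex_bodies. ennreal (C * x * ln (real n) powr (- \<gamma>)) \<le> risk P n Khat K"
    proof (cases "n0 \<le> n")
      case True
      have "C * x * ln (real n) powr (- \<gamma>) \<le> 1 / 2 * x * ln (real n) powr (- \<gamma>)"
        using x Cle by (intro mult_right_mono) auto
      then show ?thesis using big[OF adm True Khat] unfolding x_def by (meson ennreal_leI order_trans)
    next
      case False
      have "ln (real n) powr (- \<gamma>) \<le> ln 2 powr (- \<gamma>)" using n \<gamma>0 by (intro powr_mono2') auto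
      then have "C * x * ln (real n) powr (- \<gamma>) \<le> (v / ln 2 powr (- \<gamma>)) * 1 * ln 2 powr (- \<gamma>)"
        using x v l2 Cle by (intro mult_mono) auto
      also have "\<dots> = v" using l2 by simp
      finally have "ennreal (C * x * ln (real n) powr (- \<gamma>)) \<le> risk P n Khat {0}"
        using v(2)[OF adm _ _ Khat] n False by (meson ennreal_leI order_trans not_le order_less_le_trans zero_less_numeral)
      moreover have "{0 :: real ^ 'd} \<in> unit_convex_bodies" by (simp add: unit_convex_bodies_def convex_bodies_def)
      ultimately show ?thesis by blast
    qed
    then show "(SUP K\<in>unit_convex_bodies. risk P n Khat K) \<ge> ennreal (C * real n powr (- 2 / (real CARD('d) - 1)) * ln (real n) powr (- \<gamma>))"
      unfolding x_def by (meson SUP_upper2)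
  qed
qed

end
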